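(* Let $((\rho,\eta)\mathring H,(\rho,\eta)\mathring V)$ be a distinguished linear $(\rho,\eta)$-connection for the generalized tangent bundle $(\rho,\eta)TE$ and let $G=g_{\alpha\beta}\,d\tilde z^\alpha\otimes d\tilde z^\beta+g_{ab}\,\delta\tilde y^a\otimes\delta\tilde y^b$ be a (pseudo)metrical structure. Then the real local functions $$H^\alpha_{\beta\gamma}=\tfrac12\tilde g^{\alpha\varepsilon}\Big(\tilde\rho(\tilde\delta_\gamma)g_{\varepsilon\beta}+\tilde\rho(\tilde\delta_\beta)g_{\varepsilon\gamma}-\tilde\rho(\tilde\delta_\varepsilon)g_{\beta\gamma}+g_{\theta\varepsilon}\,L^\theta_{\gamma\beta}\circ h\circ\pi-g_{\beta\theta}\,L^\theta_{\gamma\varepsilon}\circ h\circ\pi-g_{\theta\gamma}\,L^\theta_{\beta\varepsilon}\circ h\circ\pi\Big),$$ $$H^a_{b\gamma}=\mathring H^a_{b\gamma}+\tfrac12\tilde g^{ac}g_{bc\overset{0}{|}\gamma},\qquad V^\alpha_{\beta c}=\mathring V^\alpha_{\beta c}+\tfrac12\tilde g^{\alpha\varepsilon}g_{\beta\varepsilon}\overset{0}{|}_c,$$ $$V^a_{bc}=\tfrac12\tilde g^{ae}\Big(\tilde\rho(\dot{\tilde\partial}_c)g_{eb}+\tilde\rho(\dot{\tilde\partial}_b)g_{ec}-\tilde\rho(\dot{\tilde\partial}_e)g_{bc}\Big)$$ are the components of a distinguished linear $(\rho,\eta)$-connection $D$ such that $(\rho,\eta)TE$ becomes $(\rho,\eta)$-(pseudo)metrizable,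 i.e. $D_XG=0$ for every section $X$ of $(\rho,\eta)TE$.
   Context: Everything is smooth; repeated indices are summed. Setting. $M,N$ are manifolds of dimension $m$, $h:M\to N$ and $\eta:N\to M$ are diffeomorphisms, $\nu:F\to N$ is a vector bundle of rank $p$, $\pi:E\to M$ a vector bundle of rank $r$. A generalized Lie algebroid structure $([\,,]_{F,h},(\rho,\eta))$ on $F$ consists of a vector bundle morphism $\rho:F\to TM$ covering $\eta$ and a Lie bracket $[\,,]_{F,h}$ on $\Gamma(F)$ with $[u,fv]_{F,h}=f[u,v]_{F,h}+(\mathcal A(u)f)\,v$ for $f\in C^\infty(N)$, where the map $\mathcal A=\Gamma(Th\circ\rho,h\circ\eta):\Gamma(F)\to\Gamma(TN)$ is a morphism of Lie algebras. Such a structure is fixed. In local coordinates $x^i$ on $M$ and a local frame $t_\alpha$ of $F$, $\mathcal A$ is described by local functions $\rho^i_\alpha$ on $N$ via $(\mathcal A(z^\alpha t_\alpha)f)\circ h=(\rho^i_\alpha\circ h)(z^\alpha\circ h)\,\partial(f\circ h)/\partial x^i$; thus $\mathcal A$ is $C^\infty(N)$-linear and the functions $\rho^i_\alpha\circ h$ are the components of a bundle map $h^*F\to TM$ over $\mathrm{Id}_M$. The structure functions are $[t_\alpha,t_\beta]_{F,h}=L^\gamma_{\alpha\beta}t_\gamma$. Generalized tangent bundle. Let $(x^i,y^a)$ be vector bundle coordinates on $E$ and $T_\alpha$ the frame of $\pi^*(h^*F)$ induced by $t_\alpha$. $(\rho,\eta)TE$ is the vector subbundle of $\pi^*(h^*F)\oplus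 TE\to E$ with local frame (natural base) $\tilde\partial_\alpha=T_\alpha\oplus(\rho^i_\alpha\circ h\circ\pi)\frac{\partial}{\partial x^i}$, $\dot{\tilde\partial}_a=0\oplus\frac{\partial}{\partial y^a}$. The anchor $\tilde\rho:(\rho,\eta)TE\to TE$ is $\tilde\rho(Z^\alpha\tilde\partial_\alpha+Y^a\dot{\tilde\partial}_a)=Z^\alpha(\rho^i_\alpha\circ h\circ\pi)\frac{\partial}{\partial x^i}+Y^a\frac{\partial}{\partial y^a}$; $\tilde\rho(X)f$ is the derivative of $f\in C^\infty(E)$ along the vector field $\tilde\rho(X)$. The vertical subbundle $V(\rho,\eta)TE$ is spanned by the $\dot{\tilde\partial}_a$. A $(\rho,\eta)$-connection $(\rho,\eta)\Gamma$ for $E$, fixed throughout, is a vector bundle map $(\rho,\eta)TE\to V(\rho,\eta)TE$ over $\mathrm{Id}_E$ which is the identity on $V(\rho,\eta)TE$; locally it maps $Z^\gamma\tilde\partial_\gamma+Y^a\dot{\tilde\partial}_a$ to $(Y^a+\Gamma^a_\gamma Z^\gamma)\dot{\tilde\partial}_a$, where $\Gamma^a_\gamma$ abbreviates $(\rho,\eta)\Gamma^a_\gamma$. Its kernel is the horizontal subbundle $H(\rho,\eta)TE$, with frame $\tilde\delta_\alpha=\tilde\partial_\alpha-\Gamma^a_\alpha\dot{\tilde\partial}_a$. The dual frame of $(\tilde\delta_\alpha,\dot{\tilde\partial}_a)$ is $(d\tilde z^\alpha,\delta\tilde y^a)$. Distinguished linear $(\rho,\eta)$-connection: a covariant derivative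 $D$ on the tensor algebra of $(\rho,\eta)TE$ ($C^\infty(E)$-linear in $X$, $D_Xf=\tilde\rho(X)f$, a derivation of tensor products commuting with contractions) preserving $H(\rho,\eta)TE$ and $V(\rho,\eta)TE$. Its components are given by $D_{\tilde\delta_\gamma}\tilde\delta_\beta=H^\alpha_{\beta\gamma}\tilde\delta_\alpha$, $D_{\tilde\delta_\gamma}\dot{\tilde\partial}_b=H^a_{b\gamma}\dot{\tilde\partial}_a$, $D_{\dot{\tilde\partial}_c}\tilde\delta_\beta=V^\alpha_{\beta c}\tilde\delta_\alpha$, $D_{\dot{\tilde\partial}_c}\dot{\tilde\partial}_b=V^a_{bc}\dot{\tilde\partial}_a$ (the prefix $(\rho,\eta)$ on components is dropped). Those of the given connection carry a ring: $\mathring H^\alpha_{\beta\gamma},\mathring H^a_{b\gamma},\mathring V^\alpha_{\beta c},\mathring V^a_{bc}$. A (pseudo)metrical structure is a tensor field $G=g_{\alpha\beta}d\tilde z^\alpha\otimes d\tilde z^\beta+g_{ab}\delta\tilde y^a\otimes\delta\tilde y^b$ with symmetric components such that the matrices $(g_{\alpha\beta})$, $(g_{ab})$ are nondegenerate at every point of $E$ (metrical if moreover both have constant signature); $\tilde g^{\alpha\beta}$, $\tilde g^{ab}$ are the inverse matrices. Covariant derivatives with respect to the ringed connection: $g_{bc\overset{0}{|}\gamma}=\tilde\rho(\tilde\delta_\gamma)g_{bc}-\mathring H^e_{b\gamma}g_{ec}-\mathring H^e_{c\gamma}g_{be}$ and $g_{\beta\varepsilon}\overset{0}{|}_c=\tilde\rho(\dot{\tilde\partial}_c)g_{\beta\varepsilon}-\mathring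 V^\theta_{\beta c}g_{\theta\varepsilon}-\mathring V^\theta_{\varepsilon c}g_{\beta\theta}$. *)

theory Defs
  imports "HOL-Analysis.Analysis" "HOL-Library.Function_Algebras"
begin

text \<open>Pointwise scaling makes the functionals on an algebra of functions a real vector space;
  tangent vectors are such functionals.\<close>

instantiation "fun" :: (type, real_vector) real_vector
begin

definition scaleR_fun_def: "c *\<^sub>R f = (\<lambda>x. c *\<^sub>R f x)"

instance
  by standard (auto simp: scaleR_fun_def fun_eq_iff scaleR_add_right scaleR_add_left)

end

definition lin_on :: "'v::real_vector set \<Rightarrow> ('v \<Rightarrow> 'w::real_vector) \<Rightarrow> bool" where
  "lin_on W T \<longleftrightarrow>
     (\<forall>x\<in>W. \<forall>y\<in>W. T (x + y) = T x + T y) \<and> (\<forall>c. \<forall>x\<in>W. T (c *\<^sub>R x) = c *\<^sub>R T x)"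

definition basis_of :: "'v::real_vector set \<Rightarrow> ('k \<Rightarrow> 'v) \<Rightarrow> bool" where
  "basis_of W b \<longleftrightarrow> inj b \<and> independent (range b) \<and> span (range b) = W"

definition coef :: "('k \<Rightarrow> 'v::real_vector) \<Rightarrow> 'v \<Rightarrow> 'k \<Rightarrow> real" where
  "coef b w k = representation (range b) w (b k)"


section \<open>Manifolds and vector bundles\<close>

primrec Ck_on :: "nat \<Rightarrow> 'a::real_normed_vector set \<Rightarrow> ('a \<Rightarrow> 'b::real_normed_vector) \<Rightarrow> bool" where
  "Ck_on 0 S f \<longleftrightarrow> continuous_on S f"
| "Ck_on (Suc k) S f \<longleftrightarrow> (\<forall>x\<in>S. f differentiable (at x)) \<and>
     (\<forall>v. Ck_on k S (\<lambda>x. frechet_derivative f (at x) v))"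

text \<open>Only used for open subsets of finite-dimensional spaces.\<close>

definition smooth_on :: "'a::real_normed_vector set \<Rightarrow> ('a \<Rightarrow> 'b::real_normed_vector) \<Rightarrow> bool" where
  "smooth_on S f \<longleftrightarrow> (\<forall>k. Ck_on k S f)"

type_synonym ('m, 'i) atlas = "('m set \<times> ('m \<Rightarrow> real ^ 'i)) set"

definition chart_on :: "'m::topological_space set \<Rightarrow> ('m \<Rightarrow> real ^ 'i::finite) \<Rightarrow> bool" where
  "chart_on U \<phi> \<longleftrightarrow> open U \<and> open (\<phi> ` U) \<and> homeomorphism U (\<phi> ` U) \<phi> (inv_into U \<phi>)"

definition smooth_compat ::
  "'m set \<Rightarrow> ('m \<Rightarrow> real ^ 'i::finite) \<Rightarrow> 'm set \<Rightarrow> ('m \<Rightarrow> real ^ 'i) \<Rightarrow> bool" where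
  "smooth_compat U \<phi> V \<psi> \<longleftrightarrow>
     smooth_on (\<phi> ` (U \<inter> V)) (\<psi> \<circ> inv_into U \<phi>) \<and> smooth_on (\<psi> ` (U \<inter> V)) (\<phi> \<circ> inv_into V \<psi>)"

text \<open>A manifold is a Hausdorff second countable type together with a smooth atlas; its dimension
  is the cardinality of the index type \<open>'i\<close>.\<close>

definition manifold ::
  "('m::{t2_space,second_countable_topology}, 'i::finite) atlas \<Rightarrow> bool" where
  "manifold A \<longleftrightarrow> (\<forall>(U, \<phi>)\<in>A. chart_on U \<phi>) \<and> (\<Union>(U, \<phi>)\<in>A. U) = UNIV \<and>
     (\<forall>(U, \<phi>)\<in>A. \<forall>(V, \<psi>)\<in>A. smooth_compat U \<phi> V \<psi>)"

text \<open>Charts of the maximal atlas.\<close>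

definition smooth_chart ::
  "('m::topological_space, 'i::finite) atlas \<Rightarrow> 'm set \<Rightarrow> ('m \<Rightarrow> real ^ 'i) \<Rightarrow> bool" where
  "smooth_chart A U \<phi> \<longleftrightarrow> chart_on U \<phi> \<and> (\<forall>(V, \<psi>)\<in>A. smooth_compat U \<phi> V \<psi>)"

definition smooth_fun ::
  "('m, 'i::finite) atlas \<Rightarrow> 'm set \<Rightarrow> ('m \<Rightarrow> real) \<Rightarrow> bool" where
  "smooth_fun A W f \<longleftrightarrow> (\<forall>(U, \<phi>)\<in>A. smooth_on (\<phi> ` (U \<inter> W)) (f \<circ> inv_into U \<phi>))"

definition smooth_map ::
  "('m::topological_space, 'i::finite) atlas \<Rightarrow> ('n::topological_space, 'j::finite) atlas
     \<Rightarrow> ('m \<Rightarrow> 'n) \<Rightarrow> bool" where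
  "smooth_map A B g \<longleftrightarrow> continuous_on UNIV g \<and>
     (\<forall>(U, \<phi>)\<in>A. \<forall>(V, \<psi>)\<in>B. smooth_on (\<phi> ` (U \<inter> g -` V)) (\<psi> \<circ> g \<circ> inv_into U \<phi>))"

definition diffeo ::
  "('m::topological_space, 'i::finite) atlas \<Rightarrow> ('n::topological_space, 'j::finite) atlas
     \<Rightarrow> ('m \<Rightarrow> 'n) \<Rightarrow> bool" where
  "diffeo A B g \<longleftrightarrow> bij g \<and> smooth_map A B g \<and> smooth_map B A (inv g)"

text \<open>Tangent vectors at \<open>p\<close>, as directional derivatives acting on smooth functions. All functionals
  representing tangent vectors vanish on non-smooth functions, so that equality of tangent vectors
  is equality of functionals.\<close>

definition tangent_space ::
  "('m, 'i::finite) atlas \<Rightarrow> 'm \<Rightarrow> (('m \<Rightarrow> real) \<Rightarrow> real) set" where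
  "tangent_space A p = {v. \<exists>(U, \<phi>)\<in>A. p \<in> U \<and> (\<exists>c. v = (\<lambda>f. if smooth_fun A UNIV f
     then frechet_derivative (f \<circ> inv_into U \<phi>) (at (\<phi> p)) c else 0))}"

text \<open>A vector bundle over the type \<open>'x\<close>, with rank the cardinality of \<open>'k\<close>: a family of subspaces
  of some real vector space, together with an atlas of frames over open sets. A frame is the same
  thing as a local trivialization. Distinct fibres may overlap in \<open>'v\<close>; the total space is the
  disjoint sum \<open>total_space\<close> below.\<close>

record ('x, 'v, 'k) vbundle =
  fibre :: "'x \<Rightarrow> 'v set"
  frames :: "('x set \<times> ('k \<Rightarrow> 'x \<Rightarrow> 'v)) set"

definition vector_bundle ::
  "('x::topological_space, 'i::finite) atlas \<Rightarrow> ('x, 'v::real_vector, 'k::finite) vbundle \<Rightarrow> bool" where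
  "vector_bundle A B \<longleftrightarrow>
     (\<forall>(U, t)\<in>frames B. open U \<and> (\<forall>x\<in>U. basis_of (fibre B x) (\<lambda>k. t k x))) \<and>
     (\<Union>(U, t)\<in>frames B. U) = UNIV \<and>
     (\<forall>(U, t)\<in>frames B. \<forall>(V, s)\<in>frames B. \<forall>k l.
        smooth_fun A (U \<inter> V) (\<lambda>x. coef (\<lambda>j. t j x) (s k x) l))"

definition local_section ::
  "('x, 'i::finite) atlas \<Rightarrow> ('x, 'v::real_vector, 'k::finite) vbundle \<Rightarrow> 'x set \<Rightarrow> ('x \<Rightarrow> 'v) \<Rightarrow> bool"
  where
  "local_section A B U u \<longleftrightarrow> (\<forall>x\<in>U. u x \<in> fibre B x) \<and>
     (\<forall>(V, t)\<in>frames B. \<forall>k. smooth_fun A (U \<inter> V) (\<lambda>x. coef (\<lambda>j. t j x) (u x) k))"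

definition local_frame ::
  "('x::topological_space, 'i::finite) atlas \<Rightarrow> ('x, 'v::real_vector, 'k::finite) vbundle \<Rightarrow> 'x set
     \<Rightarrow> ('k \<Rightarrow> 'x \<Rightarrow> 'v) \<Rightarrow> bool" where
  "local_frame A B U t \<longleftrightarrow> open U \<and> (\<forall>x\<in>U. basis_of (fibre B x) (\<lambda>k. t k x)) \<and>
     (\<forall>k. local_section A B U (t k))"

definition total_space :: "('x, 'v, 'k) vbundle \<Rightarrow> ('x \<times> 'v) set" where
  "total_space B = {(x, y). y \<in> fibre B x}"

text \<open>The inverse of the vector bundle coordinate system on the total space that is induced by a
  chart of the base and a frame.\<close>

definition bundle_param ::
  "'x set \<Rightarrow> ('x \<Rightarrow> real ^ 'i) \<Rightarrow> ('k::finite \<Rightarrow> 'x \<Rightarrow> 'v::real_vector)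
     \<Rightarrow> (real ^ 'i) \<times> (real ^ 'k) \<Rightarrow> 'x \<times> 'v" where
  "bundle_param U \<phi> s = (\<lambda>(a, y). (inv_into U \<phi> a, \<Sum>k\<in>UNIV. (y $ k) *\<^sub>R s k (inv_into U \<phi> a)))"

text \<open>Smoothness of a function on the part of the total space that lies over the open set \<open>U\<close>; values
  outside this part are irrelevant.\<close>

definition smooth_total ::
  "('x, 'i::finite) atlas \<Rightarrow> ('x, 'v::real_vector, 'k::finite) vbundle \<Rightarrow> 'x set \<Rightarrow> ('x \<times> 'v \<Rightarrow> real)
     \<Rightarrow> bool" where
  "smooth_total A B U f \<longleftrightarrow> (\<forall>(V, \<phi>)\<in>A. \<forall>(W, s)\<in>frames B.
     smooth_on (\<phi> ` (V \<inter> W \<inter> U) \<times> UNIV) (f \<circ> bundle_param V \<phi> s))"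


section \<open>Generalized Lie algebroids\<close>

text \<open>\<open>rho S q\<close> is the restriction to the fibre over \<open>q\<close> of the bundle morphism from \<open>F\<close> to \<open>TM\<close>.\<close>

record ('m, 'n, 'f, 'b, 'i, 'p, 'r) gla_data =
  atlasM :: "('m, 'i) atlas"
  atlasN :: "('n, 'i) atlas"
  hmap :: "'m \<Rightarrow> 'n"
  eta :: "'n \<Rightarrow> 'm"
  bundleF :: "('n, 'f, 'p) vbundle"
  rho :: "'n \<Rightarrow> 'f \<Rightarrow> ('m \<Rightarrow> real) \<Rightarrow> real"
  bracket :: "('n \<Rightarrow> 'f) \<Rightarrow> ('n \<Rightarrow> 'f) \<Rightarrow> 'n \<Rightarrow> 'f"
  bundleE :: "('m, 'b, 'r) vbundle"

definition bundle_morphism_TM ::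
  "('m, 'n, 'f::real_vector, 'b, 'i::finite, 'p::finite, 'r) gla_data \<Rightarrow> bool" where
  "bundle_morphism_TM S \<longleftrightarrow>
     (\<forall>q. lin_on (fibre (bundleF S) q) (rho S q) \<and>
          rho S q ` fibre (bundleF S) q \<subseteq> tangent_space (atlasM S) (eta S q)) \<and>
     (\<forall>(U, t)\<in>frames (bundleF S). \<forall>k. \<forall>f. smooth_fun (atlasM S) UNIV f \<longrightarrow>
          smooth_fun (atlasN S) U (\<lambda>q. rho S q (t k q) f))"

definition sectionsF ::
  "('m, 'n, 'f::real_vector, 'b, 'i::finite, 'p::finite, 'r) gla_data \<Rightarrow> ('n \<Rightarrow> 'f) set" where
  "sectionsF S = {u. local_section (atlasN S) (bundleF S) UNIV u}"

text \<open>\<open>\<Gamma>(Th \<circ> \<rho>, h \<circ> \<eta>)\<close>: a section \<open>u\<close> is sent to the vector field on \<open>N\<close>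
  whose value at \<open>h (\<eta> q)\<close> is \<open>Th (\<rho> (u q))\<close>; vector fields on \<open>N\<close> act as derivations.\<close>

definition anchorN ::
  "('m, 'n, 'f, 'b, 'i, 'p, 'r) gla_data \<Rightarrow> ('n \<Rightarrow> 'f) \<Rightarrow> ('n \<Rightarrow> real) \<Rightarrow> 'n \<Rightarrow> real" where
  "anchorN S u f = (\<lambda>q. let q' = inv (hmap S \<circ> eta S) q in rho S q' (u q') (f \<circ> hmap S))"

definition lie_bracket_on :: "'v::real_vector set \<Rightarrow> ('v \<Rightarrow> 'v \<Rightarrow> 'v) \<Rightarrow> bool" where
  "lie_bracket_on L br \<longleftrightarrow>
     (\<forall>u\<in>L. \<forall>v\<in>L. br u v \<in> L) \<and>
     (\<forall>u\<in>L. lin_on L (br u) \<and> lin_on L (\<lambda>v. br v u)) \<and>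
     (\<forall>u\<in>L. br u u = 0) \<and>
     (\<forall>u\<in>L. \<forall>v\<in>L. \<forall>w\<in>L. br u (br v w) + br v (br w u) + br w (br u v) = 0)"

definition generalized_Lie_algebroid ::
  "('m::{t2_space,second_countable_topology}, 'n::{t2_space,second_countable_topology},
    'f::real_vector, 'b, 'i::finite, 'p::finite, 'r) gla_data \<Rightarrow> bool" where
  "generalized_Lie_algebroid S \<longleftrightarrow>
     manifold (atlasM S) \<and> manifold (atlasN S) \<and>
     diffeo (atlasM S) (atlasN S) (hmap S) \<and> diffeo (atlasN S) (atlasM S) (eta S) \<and>
     vector_bundle (atlasN S) (bundleF S) \<and>
     bundle_morphism_TM S \<and>
     lie_bracket_on (sectionsF S) (bracket S) \<and>
     (\<forall>u\<in>sectionsF S. \<forall>v\<in>sectionsF S. \<forall>f. smooth_fun (atlasN S) UNIV f \<longrightarrow>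
        bracket S u (\<lambda>q. f q *\<^sub>R v q) =
          (\<lambda>q. f q *\<^sub>R bracket S u v q + anchorN S u f q *\<^sub>R v q)) \<and>
     (\<forall>u\<in>sectionsF S. \<forall>v\<in>sectionsF S. \<forall>f. smooth_fun (atlasN S) UNIV f \<longrightarrow>
        anchorN S (bracket S u v) f =
          (\<lambda>q. anchorN S u (anchorN S v f) q - anchorN S v (anchorN S u f) q))"


section \<open>Local coordinates\<close>

text \<open>A chart of \<open>M\<close> over an open set, a frame of \<open>E\<close> over the same set (equivalently, vector bundle
  coordinates \<open>(x, y)\<close> on \<open>E\<close>) and a frame of \<open>F\<close> over its image under \<open>h\<close>.\<close>

record ('m, 'n, 'f, 'b, 'i, 'p, 'r) coords =
  nbhd :: "'m set"
  xchart :: "'m \<Rightarrow> real ^ 'i"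
  tframe :: "'p \<Rightarrow> 'n \<Rightarrow> 'f"
  sframe :: "'r \<Rightarrow> 'm \<Rightarrow> 'b"

definition local_coords ::
  "('m::topological_space, 'n::topological_space, 'f::real_vector, 'b::real_vector,
    'i::finite, 'p::finite, 'r::finite) gla_data
     \<Rightarrow> ('m, 'n, 'f, 'b, 'i, 'p, 'r) coords \<Rightarrow> bool" where
  "local_coords S K \<longleftrightarrow> smooth_chart (atlasM S) (nbhd K) (xchart K) \<and>
     local_frame (atlasN S) (bundleF S) (hmap S ` nbhd K) (tframe K) \<and>
     local_frame (atlasM S) (bundleE S) (nbhd K) (sframe K)"

text \<open>The bracket acts on global sections, and frames are only local. Values on local
  frames at a point are therefore computed with global sections that coincide with the frame near
  that point.\<close>

text \<open>\<open>struct_fun S K \<gamma> \<alpha> \<beta> x\<close> is the value at \<open>h x\<close> of the structure function with upper index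
  \<open>\<gamma>\<close> and lower indices \<open>\<alpha> \<beta>\<close>.\<close>

definition struct_fun ::
  "('m, 'n::topological_space, 'f::real_vector, 'b, 'i::finite, 'p::finite, 'r) gla_data
     \<Rightarrow> ('m, 'n, 'f, 'b, 'i, 'p, 'r) coords \<Rightarrow> 'p \<Rightarrow> 'p \<Rightarrow> 'p \<Rightarrow> 'm \<Rightarrow> real" where
  "struct_fun S K \<gamma> \<alpha> \<beta> x = (THE c :: real ^ 'p. \<forall>u\<in>sectionsF S. \<forall>v\<in>sectionsF S. \<forall>V.
     open V \<and> hmap S x \<in> V \<and> (\<forall>q\<in>V. u q = tframe K \<alpha> q \<and> v q = tframe K \<beta> q) \<longrightarrow>
     bracket S u v (hmap S x) = (\<Sum>\<theta>\<in>UNIV. (c $ \<theta>) *\<^sub>R tframe K \<theta> (hmap S x))) $ \<gamma>"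

text \<open>\<open>anchor_coef S K \<alpha> x $ i\<close> is the value at \<open>h x\<close> of the anchor component with lower index \<open>\<alpha>\<close> and
  upper index \<open>i\<close>.\<close>

definition anchor_coef ::
  "('m, 'n::topological_space, 'f::real_vector, 'b, 'i::finite, 'p::finite, 'r) gla_data
     \<Rightarrow> ('m, 'n, 'f, 'b, 'i, 'p, 'r) coords \<Rightarrow> 'p \<Rightarrow> 'm \<Rightarrow> real ^ 'i" where
  "anchor_coef S K \<alpha> x = (THE c. \<forall>u\<in>sectionsF S. \<forall>V f.
     open V \<and> hmap S x \<in> V \<and> (\<forall>q\<in>V. u q = tframe K \<alpha> q) \<and> smooth_fun (atlasN S) UNIV f \<longrightarrow>
     anchorN S u f (hmap S x) =
       (\<Sum>i\<in>UNIV. c $ i * frechet_derivative (f \<circ> hmap S \<circ> inv_into (nbhd K) (xchart K))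
                            (at (xchart K x)) (axis i 1)))"

text \<open>Partial derivatives on the total space of \<open>E\<close> in the coordinates \<open>(x, y)\<close>.\<close>

definition partial_deriv ::
  "('m, 'n, 'f, 'b::real_vector, 'i::finite, 'p, 'r::finite) coords
     \<Rightarrow> (real ^ 'i) \<times> (real ^ 'r) \<Rightarrow> ('m \<times> 'b \<Rightarrow> real) \<Rightarrow> 'm \<times> 'b \<Rightarrow> real" where
  "partial_deriv K w f = (\<lambda>(x, y). frechet_derivative
     (f \<circ> bundle_param (nbhd K) (xchart K) (sframe K))
     (at (xchart K x, \<chi> k. coef (\<lambda>a. sframe K a x) y k)) w)"

abbreviation pdx where "pdx K i \<equiv> partial_deriv K (axis i 1, 0)"
abbreviation pdy where "pdy K a \<equiv> partial_deriv K (0, axis a 1)"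


section \<open>The generalized tangent bundle\<close>

text \<open>The fibre of the generalized tangent bundle at \<open>e = (x, y)\<close> consists of pairs of an element of the
  fibre of \<open>F\<close> over \<open>h x\<close> and a tangent vector of \<open>E\<close> at \<open>e\<close>; the anchor is \<open>snd\<close>.\<close>

type_synonym ('m, 'f, 'b) gvec = "'f \<times> (('m \<times> 'b \<Rightarrow> real) \<Rightarrow> real)"

abbreviation smoothE where "smoothE S \<equiv> smooth_total (atlasM S) (bundleE S)"
abbreviation totalE where "totalE S \<equiv> total_space (bundleE S)"

text \<open>The natural base; \<open>Inl \<alpha>\<close> indexes the vectors with Greek index, \<open>Inr a\<close> the vertical ones.\<close>

fun nat_frame ::
  "('m, 'n::topological_space, 'f::real_vector, 'b::real_vector, 'i::finite, 'p::finite, 'r::finite) gla_data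
     \<Rightarrow> ('m, 'n, 'f, 'b, 'i, 'p, 'r) coords \<Rightarrow> 'm \<times> 'b \<Rightarrow> 'p + 'r \<Rightarrow> ('m, 'f, 'b) gvec" where
  "nat_frame S K e (Inl \<alpha>) = (tframe K \<alpha> (hmap S (fst e)),
     \<lambda>f. if smoothE S UNIV f then \<Sum>i\<in>UNIV. anchor_coef S K \<alpha> (fst e) $ i * pdx K i f e else 0)"
| "nat_frame S K e (Inr a) = (0, \<lambda>f. if smoothE S UNIV f then pdy K a f e else 0)"

definition gtb ::
  "('m::topological_space, 'n::topological_space, 'f::real_vector, 'b::real_vector,
    'i::finite, 'p::finite, 'r::finite) gla_data \<Rightarrow> 'm \<times> 'b \<Rightarrow> ('m, 'f, 'b) gvec set" where
  "gtb S e = {w. \<exists>K. local_coords S K \<and> fst e \<in> nbhd K \<and> w \<in> span (range (nat_frame S K e))}"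

definition vertical ::
  "('m::topological_space, 'n::topological_space, 'f::real_vector, 'b::real_vector,
    'i::finite, 'p::finite, 'r::finite) gla_data \<Rightarrow> 'm \<times> 'b \<Rightarrow> ('m, 'f, 'b) gvec set" where
  "vertical S e = {w. \<exists>K. local_coords S K \<and> fst e \<in> nbhd K \<and>
     w \<in> span (range (\<lambda>a. nat_frame S K e (Inr a)))}"

text \<open>Global sections of the generalized tangent bundle. They are functions on the whole type \<open>'m \<times> 'b\<close>,
  required to vanish off the total space of \<open>E\<close>.\<close>

definition gsections ::
  "('m::topological_space, 'n::topological_space, 'f::real_vector, 'b::real_vector,
    'i::finite, 'p::finite, 'r::finite) gla_data \<Rightarrow> ('m \<times> 'b \<Rightarrow> ('m, 'f, 'b) gvec) set" where
  "gsections S = {X. (\<forall>e\<in>totalE S. X e \<in> gtb S e) \<and> (\<forall>e. e \<notin> totalE S \<longrightarrow> X e = 0) \<and>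
     (\<forall>K. local_coords S K \<longrightarrow> (\<forall>k. smoothE S (nbhd K) (\<lambda>e. coef (nat_frame S K e) (X e) k)))}"


section \<open>Connections and adapted frames\<close>

type_synonym ('m, 'f, 'b) gconn = "'m \<times> 'b \<Rightarrow> ('m, 'f, 'b) gvec \<Rightarrow> ('m, 'f, 'b) gvec"

text \<open>\<open>conn_coef S C K a \<gamma> e\<close> has upper index \<open>a\<close> and lower index \<open>\<gamma>\<close>.\<close>

definition conn_coef ::
  "('m, 'n::topological_space, 'f::real_vector, 'b::real_vector, 'i::finite, 'p::finite, 'r::finite) gla_data
     \<Rightarrow> ('m, 'f, 'b) gconn \<Rightarrow> ('m, 'n, 'f, 'b, 'i, 'p, 'r) coords \<Rightarrow> 'r \<Rightarrow> 'p \<Rightarrow> 'm \<times> 'b \<Rightarrow> real" where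
  "conn_coef S C K a \<gamma> e =
     coef (\<lambda>b. nat_frame S K e (Inr b)) (C e (nat_frame S K e (Inl \<gamma>))) a"

definition gconnection ::
  "('m::topological_space, 'n::topological_space, 'f::real_vector, 'b::real_vector,
    'i::finite, 'p::finite, 'r::finite) gla_data \<Rightarrow> ('m, 'f, 'b) gconn \<Rightarrow> bool" where
  "gconnection S C \<longleftrightarrow>
     (\<forall>e\<in>totalE S. lin_on (gtb S e) (C e) \<and> C e ` gtb S e \<subseteq> vertical S e \<and>
        (\<forall>w\<in>vertical S e. C e w = w)) \<and>
     (\<forall>K. local_coords S K \<longrightarrow> (\<forall>a \<gamma>. smoothE S (nbhd K) (conn_coef S C K a \<gamma>)))"

definition horizontal ::
  "('m::topological_space, 'n::topological_space, 'f::real_vector, 'b::real_vector,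
    'i::finite, 'p::finite, 'r::finite) gla_data \<Rightarrow> ('m, 'f, 'b) gconn \<Rightarrow> 'm \<times> 'b
     \<Rightarrow> ('m, 'f, 'b) gvec set" where
  "horizontal S C e = {w \<in> gtb S e. C e w = 0}"

fun adapted_frame ::
  "('m, 'n::topological_space, 'f::real_vector, 'b::real_vector, 'i::finite, 'p::finite, 'r::finite) gla_data
     \<Rightarrow> ('m, 'f, 'b) gconn \<Rightarrow> ('m, 'n, 'f, 'b, 'i, 'p, 'r) coords \<Rightarrow> 'm \<times> 'b \<Rightarrow> 'p + 'r
     \<Rightarrow> ('m, 'f, 'b) gvec" where
  "adapted_frame S C K e (Inl \<alpha>) = nat_frame S K e (Inl \<alpha>) -
     (\<Sum>a\<in>UNIV. conn_coef S C K a \<alpha> e *\<^sub>R nat_frame S K e (Inr a))"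
| "adapted_frame S C K e (Inr a) = nat_frame S K e (Inr a)"

text \<open>The derivative of a local function along the anchor images of the adapted frame. The functionals
  \<open>snd w\<close> only act on functions that are smooth on all of \<open>E\<close>, hence the explicit coordinate
  expression.\<close>

fun adapted_deriv ::
  "('m, 'n::topological_space, 'f::real_vector, 'b::real_vector, 'i::finite, 'p::finite, 'r::finite) gla_data
     \<Rightarrow> ('m, 'f, 'b) gconn \<Rightarrow> ('m, 'n, 'f, 'b, 'i, 'p, 'r) coords \<Rightarrow> 'p + 'r
     \<Rightarrow> ('m \<times> 'b \<Rightarrow> real) \<Rightarrow> 'm \<times> 'b \<Rightarrow> real" where
  "adapted_deriv S C K (Inl \<gamma>) f e =
     (\<Sum>i\<in>UNIV. anchor_coef S K \<gamma> (fst e) $ i * pdx K i f e) -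
     (\<Sum>a\<in>UNIV. conn_coef S C K a \<gamma> e * pdy K a f e)"
| "adapted_deriv S C K (Inr a) f e = pdy K a f e"


section \<open>The tensor algebra\<close>

text \<open>Covectors are extended by zero off the fibre, so that equality of covectors is equality of
  functions.\<close>

definition covectors ::
  "('m::topological_space, 'n::topological_space, 'f::real_vector, 'b::real_vector,
    'i::finite, 'p::finite, 'r::finite) gla_data \<Rightarrow> 'm \<times> 'b \<Rightarrow> (('m, 'f, 'b) gvec \<Rightarrow> real) set" where
  "covectors S e = {\<omega>. lin_on (gtb S e) \<omega> \<and> (\<forall>w. w \<notin> gtb S e \<longrightarrow> \<omega> w = 0)}"

definition dual_basis :: "'v::real_vector set \<Rightarrow> ('k \<Rightarrow> 'v) \<Rightarrow> 'k \<Rightarrow> 'v \<Rightarrow> real" where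
  "dual_basis W b k = (\<lambda>w. if w \<in> W then coef b w k else 0)"

text \<open>A tensor field of type \<open>(k, l)\<close> assigns to each point of \<open>E\<close> a function, multilinear on lists of
  \<open>k\<close> covectors and \<open>l\<close> vectors, and zero on all other arguments.\<close>

type_synonym ('m, 'f, 'b) tensor =
  "'m \<times> 'b \<Rightarrow> (('m, 'f, 'b) gvec \<Rightarrow> real) list \<Rightarrow> ('m, 'f, 'b) gvec list \<Rightarrow> real"

definition tensor_args ::
  "('m::topological_space, 'n::topological_space, 'f::real_vector, 'b::real_vector,
    'i::finite, 'p::finite, 'r::finite) gla_data \<Rightarrow> nat \<Rightarrow> nat \<Rightarrow> 'm \<times> 'b
     \<Rightarrow> ((('m, 'f, 'b) gvec \<Rightarrow> real) list \<times> ('m, 'f, 'b) gvec list) set" where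
  "tensor_args S k l e = {(\<omega>s, ws). length \<omega>s = k \<and> set \<omega>s \<subseteq> covectors S e \<and>
                                     length ws = l \<and> set ws \<subseteq> gtb S e}"

definition tensor_field ::
  "('m::topological_space, 'n::topological_space, 'f::real_vector, 'b::real_vector,
    'i::finite, 'p::finite, 'r::finite) gla_data \<Rightarrow> nat \<Rightarrow> nat \<Rightarrow> ('m, 'f, 'b) tensor \<Rightarrow> bool" where
  "tensor_field S k l T \<longleftrightarrow>
     (\<forall>e \<omega>s ws. T e \<omega>s ws \<noteq> 0 \<longrightarrow> e \<in> totalE S \<and> (\<omega>s, ws) \<in> tensor_args S k l e) \<and>
     (\<forall>e\<in>totalE S. \<forall>(\<omega>s, ws)\<in>tensor_args S k l e.
        (\<forall>i<k. lin_on (covectors S e) (\<lambda>\<omega>. T e (\<omega>s[i := \<omega>]) ws)) \<and>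
        (\<forall>j<l. lin_on (gtb S e) (\<lambda>w. T e \<omega>s (ws[j := w])))) \<and>
     (\<forall>K. local_coords S K \<longrightarrow> (\<forall>As Bs. length As = k \<and> length Bs = l \<longrightarrow>
        smoothE S (nbhd K) (\<lambda>e. T e (map (dual_basis (gtb S e) (nat_frame S K e)) As)
                                     (map (nat_frame S K e) Bs))))"

definition scalar_tensor ::
  "('m, 'n, 'f, 'b, 'i, 'p, 'r) gla_data \<Rightarrow> ('m \<times> 'b \<Rightarrow> real) \<Rightarrow> ('m, 'f, 'b) tensor" where
  "scalar_tensor S f = (\<lambda>e \<omega>s ws. if e \<in> totalE S \<and> \<omega>s = [] \<and> ws = [] then f e else 0)"

definition vector_tensor ::
  "('m::topological_space, 'n::topological_space, 'f::real_vector, 'b::real_vector,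
    'i::finite, 'p::finite, 'r::finite) gla_data \<Rightarrow> ('m \<times> 'b \<Rightarrow> ('m, 'f, 'b) gvec)
     \<Rightarrow> ('m, 'f, 'b) tensor" where
  "vector_tensor S Y = (\<lambda>e \<omega>s ws.
     if e \<in> totalE S \<and> (\<omega>s, ws) \<in> tensor_args S 1 0 e then hd \<omega>s (Y e) else 0)"

text \<open>The product of a tensor field of type \<open>(k, l)\<close> with a tensor field of arbitrary type.\<close>

definition tensor_prod ::
  "nat \<Rightarrow> nat \<Rightarrow> ('m, 'f, 'b) tensor \<Rightarrow> ('m, 'f, 'b) tensor \<Rightarrow> ('m, 'f, 'b) tensor" where
  "tensor_prod k l T T' =
     (\<lambda>e \<omega>s ws. T e (take k \<omega>s) (take l ws) * T' e (drop k \<omega>s) (drop l ws))"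

text \<open>Contraction of the covector slot \<open>i\<close> with the vector slot \<open>j\<close>, computed in an arbitrary basis of the
  fibre.\<close>

definition contraction ::
  "('m::topological_space, 'n::topological_space, 'f::real_vector, 'b::real_vector,
    'i::finite, 'p::finite, 'r::finite) gla_data \<Rightarrow> nat \<Rightarrow> nat \<Rightarrow> ('m, 'f, 'b) tensor
     \<Rightarrow> ('m, 'f, 'b) tensor" where
  "contraction S i j T = (\<lambda>e \<omega>s ws.
     let b = (SOME b :: 'p + 'r \<Rightarrow> ('m, 'f, 'b) gvec. basis_of (gtb S e) b) in
     \<Sum>k\<in>UNIV. T e (take i \<omega>s @ dual_basis (gtb S e) b k # drop i \<omega>s) (take j ws @ b k # drop j ws))"


section \<open>Distinguished linear connections\<close>

type_synonym ('m, 'f, 'b) cov_deriv =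
  "('m \<times> 'b \<Rightarrow> ('m, 'f, 'b) gvec) \<Rightarrow> ('m, 'f, 'b) tensor \<Rightarrow> ('m, 'f, 'b) tensor"

definition covariant_derivative ::
  "('m::topological_space, 'n::topological_space, 'f::real_vector, 'b::real_vector,
    'i::finite, 'p::finite, 'r::finite) gla_data \<Rightarrow> ('m, 'f, 'b) cov_deriv \<Rightarrow> bool" where
  "covariant_derivative S D \<longleftrightarrow>
     (\<forall>X\<in>gsections S. \<forall>k l T. tensor_field S k l T \<longrightarrow> tensor_field S k l (D X T)) \<and>
     (\<forall>X\<in>gsections S. \<forall>Y\<in>gsections S. \<forall>k l T. tensor_field S k l T \<longrightarrow>
        D (X + Y) T = D X T + D Y T) \<and>
     (\<forall>X\<in>gsections S. \<forall>f k l T. smoothE S UNIV f \<and> tensor_field S k l T \<longrightarrow>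
        D (\<lambda>e. f e *\<^sub>R X e) T = (\<lambda>e \<omega>s ws. f e * D X T e \<omega>s ws)) \<and>
     (\<forall>X\<in>gsections S. \<forall>k l T T'. tensor_field S k l T \<and> tensor_field S k l T' \<longrightarrow>
        D X (T + T') = D X T + D X T') \<and>
     (\<forall>X\<in>gsections S. \<forall>f. smoothE S UNIV f \<longrightarrow>
        D X (scalar_tensor S f) = scalar_tensor S (\<lambda>e. snd (X e) f)) \<and>
     (\<forall>X\<in>gsections S. \<forall>k l k' l' T T'. tensor_field S k l T \<and> tensor_field S k' l' T' \<longrightarrow>
        D X (tensor_prod k l T T') = tensor_prod k l (D X T) T' + tensor_prod k l T (D X T')) \<and>
     (\<forall>X\<in>gsections S. \<forall>k l T i j. tensor_field S (Suc k) (Suc l) T \<and> i \<le> k \<and> j \<le> l \<longrightarrow>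
        D X (contraction S i j T) = contraction S i j (D X T))"

definition preserves ::
  "('m::topological_space, 'n::topological_space, 'f::real_vector, 'b::real_vector,
    'i::finite, 'p::finite, 'r::finite) gla_data \<Rightarrow> ('m, 'f, 'b) cov_deriv
     \<Rightarrow> ('m \<times> 'b \<Rightarrow> ('m, 'f, 'b) gvec set) \<Rightarrow> bool" where
  "preserves S D P \<longleftrightarrow>
     (\<forall>X\<in>gsections S. \<forall>Y\<in>gsections S. (\<forall>e\<in>totalE S. Y e \<in> P e) \<longrightarrow>
        (\<exists>Z\<in>gsections S. (\<forall>e\<in>totalE S. Z e \<in> P e) \<and> D X (vector_tensor S Y) = vector_tensor S Z))"

definition distinguished_connection ::
  "('m::topological_space, 'n::topological_space, 'f::real_vector, 'b::real_vector,
    'i::finite, 'p::finite, 'r::finite) gla_data \<Rightarrow> ('m, 'f, 'b) gconn \<Rightarrow> ('m, 'f, 'b) cov_deriv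
     \<Rightarrow> bool" where
  "distinguished_connection S C D \<longleftrightarrow>
     covariant_derivative S D \<and> preserves S D (horizontal S C) \<and> preserves S D (vertical S)"

text \<open>The covariant derivative at \<open>e\<close> of the local section \<open>Y0\<close> along the local section \<open>X0\<close> equals \<open>w\<close>. As
  \<open>D\<close> acts on global sections, it is evaluated on global sections that coincide with the local ones
  over a neighbourhood of the base point.\<close>

definition local_cov ::
  "('m::topological_space, 'n::topological_space, 'f::real_vector, 'b::real_vector,
    'i::finite, 'p::finite, 'r::finite) gla_data \<Rightarrow> ('m, 'f, 'b) cov_deriv
     \<Rightarrow> ('m \<times> 'b \<Rightarrow> ('m, 'f, 'b) gvec) \<Rightarrow> ('m \<times> 'b \<Rightarrow> ('m, 'f, 'b) gvec) \<Rightarrow> 'm \<times> 'b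
     \<Rightarrow> ('m, 'f, 'b) gvec \<Rightarrow> bool" where
  "local_cov S D X0 Y0 e w \<longleftrightarrow>
     (\<forall>X\<in>gsections S. \<forall>Y\<in>gsections S. \<forall>V. open V \<and> fst e \<in> V \<and>
        (\<forall>e'\<in>totalE S. fst e' \<in> V \<longrightarrow> X e' = X0 e' \<and> Y e' = Y0 e') \<longrightarrow>
        (\<forall>\<omega>\<in>covectors S e. D X (vector_tensor S Y) e [\<omega>] [] = \<omega> w))"

text \<open>The four families of component functions; the first index is the upper one, the last index is that
  of the direction of differentiation.\<close>

definition components_in ::
  "('m::topological_space, 'n::topological_space, 'f::real_vector, 'b::real_vector,
    'i::finite, 'p::finite, 'r::finite) gla_data \<Rightarrow> ('m, 'f, 'b) gconn
     \<Rightarrow> ('m, 'n, 'f, 'b, 'i, 'p, 'r) coords \<Rightarrow> ('m, 'f, 'b) cov_deriv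
     \<Rightarrow> ('p \<Rightarrow> 'p \<Rightarrow> 'p \<Rightarrow> 'm \<times> 'b \<Rightarrow> real) \<Rightarrow> ('r \<Rightarrow> 'r \<Rightarrow> 'p \<Rightarrow> 'm \<times> 'b \<Rightarrow> real)
     \<Rightarrow> ('p \<Rightarrow> 'p \<Rightarrow> 'r \<Rightarrow> 'm \<times> 'b \<Rightarrow> real) \<Rightarrow> ('r \<Rightarrow> 'r \<Rightarrow> 'r \<Rightarrow> 'm \<times> 'b \<Rightarrow> real) \<Rightarrow> bool" where
  "components_in S C K D Hh Hv Vh Vv \<longleftrightarrow>
     (\<forall>e\<in>totalE S. fst e \<in> nbhd K \<longrightarrow>
        (let \<delta> = (\<lambda>\<alpha> e. adapted_frame S C K e (Inl \<alpha>)); d = (\<lambda>a e. adapted_frame S C K e (Inr a)) in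
        (\<forall>\<beta> \<gamma>. local_cov S D (\<delta> \<gamma>) (\<delta> \<beta>) e (\<Sum>\<alpha>\<in>UNIV. Hh \<alpha> \<beta> \<gamma> e *\<^sub>R \<delta> \<alpha> e)) \<and>
        (\<forall>b \<gamma>. local_cov S D (\<delta> \<gamma>) (d b) e (\<Sum>a\<in>UNIV. Hv a b \<gamma> e *\<^sub>R d a e)) \<and>
        (\<forall>\<beta> c. local_cov S D (d c) (\<delta> \<beta>) e (\<Sum>\<alpha>\<in>UNIV. Vh \<alpha> \<beta> c e *\<^sub>R \<delta> \<alpha> e)) \<and>
        (\<forall>b c. local_cov S D (d c) (d b) e (\<Sum>a\<in>UNIV. Vv a b c e *\<^sub>R d a e))))"


section \<open>Pseudometrical structures\<close>

definition g_hor ::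
  "('m, 'n::topological_space, 'f::real_vector, 'b::real_vector, 'i::finite, 'p::finite, 'r::finite) gla_data
     \<Rightarrow> ('m, 'f, 'b) gconn \<Rightarrow> ('m, 'n, 'f, 'b, 'i, 'p, 'r) coords \<Rightarrow> ('m, 'f, 'b) tensor
     \<Rightarrow> 'm \<times> 'b \<Rightarrow> real ^ 'p ^ 'p" where
  "g_hor S C K G e =
     (\<chi> \<alpha> \<beta>. G e [] [adapted_frame S C K e (Inl \<alpha>), adapted_frame S C K e (Inl \<beta>)])"

definition g_ver ::
  "('m, 'n::topological_space, 'f::real_vector, 'b::real_vector, 'i::finite, 'p::finite, 'r::finite) gla_data
     \<Rightarrow> ('m, 'f, 'b) gconn \<Rightarrow> ('m, 'n, 'f, 'b, 'i, 'p, 'r) coords \<Rightarrow> ('m, 'f, 'b) tensor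
     \<Rightarrow> 'm \<times> 'b \<Rightarrow> real ^ 'r ^ 'r" where
  "g_ver S C K G e =
     (\<chi> a b. G e [] [adapted_frame S C K e (Inr a), adapted_frame S C K e (Inr b)])"

definition pseudometrical ::
  "('m::topological_space, 'n::topological_space, 'f::real_vector, 'b::real_vector,
    'i::finite, 'p::finite, 'r::finite) gla_data \<Rightarrow> ('m, 'f, 'b) gconn \<Rightarrow> ('m, 'f, 'b) tensor
     \<Rightarrow> bool" where
  "pseudometrical S C G \<longleftrightarrow> tensor_field S 0 2 G \<and>
     (\<forall>K. local_coords S K \<longrightarrow> (\<forall>e\<in>totalE S. fst e \<in> nbhd K \<longrightarrow>
        (let \<theta> = dual_basis (gtb S e) (adapted_frame S C K e);
             gh = g_hor S C K G e; gv = g_ver S C K G e in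
        transpose gh = gh \<and> transpose gv = gv \<and> invertible gh \<and> invertible gv \<and>
        (\<forall>X\<in>gtb S e. \<forall>Y\<in>gtb S e. G e [] [X, Y] =
           (\<Sum>\<alpha>\<in>UNIV. \<Sum>\<beta>\<in>UNIV. gh $ \<alpha> $ \<beta> * \<theta> (Inl \<alpha>) X * \<theta> (Inl \<beta>) Y) +
           (\<Sum>a\<in>UNIV. \<Sum>b\<in>UNIV. gv $ a $ b * \<theta> (Inr a) X * \<theta> (Inr b) Y)))))"


section \<open>The components of the metrical connection\<close>

definition H_hor ::
  "('m, 'n::topological_space, 'f::real_vector, 'b::real_vector, 'i::finite, 'p::finite, 'r::finite) gla_data
     \<Rightarrow> ('m, 'f, 'b) gconn \<Rightarrow> ('m, 'n, 'f, 'b, 'i, 'p, 'r) coords \<Rightarrow> ('m, 'f, 'b) tensor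
     \<Rightarrow> 'p \<Rightarrow> 'p \<Rightarrow> 'p \<Rightarrow> 'm \<times> 'b \<Rightarrow> real" where
  "H_hor S C K G \<alpha> \<beta> \<gamma> e =
     (let g = (\<lambda>\<mu> \<nu> e. g_hor S C K G e $ \<mu> $ \<nu>);
          ginv = matrix_inv (g_hor S C K G e);
          D = (\<lambda>\<mu>. adapted_deriv S C K (Inl \<mu>));
          L = (\<lambda>\<theta> \<mu> \<nu>. struct_fun S K \<theta> \<mu> \<nu> (fst e))
      in 1/2 * (\<Sum>\<epsilon>\<in>UNIV. ginv $ \<alpha> $ \<epsilon> *
           (D \<gamma> (g \<epsilon> \<beta>) e + D \<beta> (g \<epsilon> \<gamma>) e - D \<epsilon> (g \<beta> \<gamma>) e
            + (\<Sum>\<theta>\<in>UNIV. g \<theta> \<epsilon> e * L \<theta> \<gamma> \<beta>)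
            - (\<Sum>\<theta>\<in>UNIV. g \<beta> \<theta> e * L \<theta> \<gamma> \<epsilon>)
            - (\<Sum>\<theta>\<in>UNIV. g \<theta> \<gamma> e * L \<theta> \<beta> \<epsilon>))))"

definition H_ver ::
  "('m, 'n::topological_space, 'f::real_vector, 'b::real_vector, 'i::finite, 'p::finite, 'r::finite) gla_data
     \<Rightarrow> ('m, 'f, 'b) gconn \<Rightarrow> ('m, 'n, 'f, 'b, 'i, 'p, 'r) coords \<Rightarrow> ('m, 'f, 'b) tensor
     \<Rightarrow> ('r \<Rightarrow> 'r \<Rightarrow> 'p \<Rightarrow> 'm \<times> 'b \<Rightarrow> real) \<Rightarrow> 'r \<Rightarrow> 'r \<Rightarrow> 'p \<Rightarrow> 'm \<times> 'b \<Rightarrow> real" where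
  "H_ver S C K G Hv0 a b \<gamma> e =
     (let g = (\<lambda>a b e. g_ver S C K G e $ a $ b);
          ginv = matrix_inv (g_ver S C K G e);
          Dg = (\<lambda>b c. adapted_deriv S C K (Inl \<gamma>) (g b c) e
                 - (\<Sum>d\<in>UNIV. Hv0 d b \<gamma> e * g d c e) - (\<Sum>d\<in>UNIV. Hv0 d c \<gamma> e * g b d e))
      in Hv0 a b \<gamma> e + 1/2 * (\<Sum>c\<in>UNIV. ginv $ a $ c * Dg b c))"

definition V_hor ::
  "('m, 'n::topological_space, 'f::real_vector, 'b::real_vector, 'i::finite, 'p::finite, 'r::finite) gla_data
     \<Rightarrow> ('m, 'f, 'b) gconn \<Rightarrow> ('m, 'n, 'f, 'b, 'i, 'p, 'r) coords \<Rightarrow> ('m, 'f, 'b) tensor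
     \<Rightarrow> ('p \<Rightarrow> 'p \<Rightarrow> 'r \<Rightarrow> 'm \<times> 'b \<Rightarrow> real) \<Rightarrow> 'p \<Rightarrow> 'p \<Rightarrow> 'r \<Rightarrow> 'm \<times> 'b \<Rightarrow> real" where
  "V_hor S C K G Vh0 \<alpha> \<beta> c e =
     (let g = (\<lambda>\<mu> \<nu> e. g_hor S C K G e $ \<mu> $ \<nu>);
          ginv = matrix_inv (g_hor S C K G e);
          Dg = (\<lambda>\<beta> \<epsilon>. adapted_deriv S C K (Inr c) (g \<beta> \<epsilon>) e
                 - (\<Sum>\<theta>\<in>UNIV. Vh0 \<theta> \<beta> c e * g \<theta> \<epsilon> e) - (\<Sum>\<theta>\<in>UNIV. Vh0 \<theta> \<epsilon> c e * g \<beta> \<theta> e))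
      in Vh0 \<alpha> \<beta> c e + 1/2 * (\<Sum>\<epsilon>\<in>UNIV. ginv $ \<alpha> $ \<epsilon> * Dg \<beta> \<epsilon>))"

definition V_ver ::
  "('m, 'n::topological_space, 'f::real_vector, 'b::real_vector, 'i::finite, 'p::finite, 'r::finite) gla_data
     \<Rightarrow> ('m, 'f, 'b) gconn \<Rightarrow> ('m, 'n, 'f, 'b, 'i, 'p, 'r) coords \<Rightarrow> ('m, 'f, 'b) tensor
     \<Rightarrow> 'r \<Rightarrow> 'r \<Rightarrow> 'r \<Rightarrow> 'm \<times> 'b \<Rightarrow> real" where
  "V_ver S C K G a b c e =
     (let g = (\<lambda>a b e. g_ver S C K G e $ a $ b);
          ginv = matrix_inv (g_ver S C K G e);
          D = (\<lambda>a. adapted_deriv S C K (Inr a))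
      in 1/2 * (\<Sum>d\<in>UNIV. ginv $ a $ d *
           (D c (g d b) e + D b (g d c) e - D d (g b c) e)))"

end

theory Submission
  imports Defs "HOL-Real_Asymp.Real_Asymp"
begin

text \<open>
  The difference of two covariant derivatives is a tensor, so the connection is sought in the form
  \<open>D\<^sub>X T = D0\<^sub>X T + \<Phi>\<^sub>X \<cdot> T\<close>, where \<open>\<Phi>\<^sub>X\<close> is a field of endomorphisms of the fibres, linear in \<open>X\<close>, and
  the dot is the derivation of the tensor algebra that it induces (\<open>act\<close>). Any such \<open>\<Phi>\<close> gives a
  covariant derivative (\<open>Dm_covariant\<close>); it is distinguished when \<open>\<Phi>\<^sub>X\<close> preserves the horizontal and the
  vertical subspaces, and \<open>D\<^sub>X G = 0\<close> says that \<open>G(\<Phi>\<^sub>X Y, Z) + G(Y, \<Phi>\<^sub>X Z) = Q(X, Y, Z)\<close> with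
  \<open>Q(X, Y, Z) = (D0\<^sub>X G)(Y, Z)\<close>.

  The local formulas of the theorem dictate \<open>\<Phi>\<close>. For \<open>X\<close> horizontal and \<open>Y\<close>, \<open>Z\<close> vertical, or the other way
  round, the coefficients are changed by half the metric derivative: \<open>2 G(\<Phi>\<^sub>X Y, Z) = Q(X, Y, Z)\<close>. For
  three horizontal or three vertical arguments the formulas are those of Levi-Civita and do not
  contain the given connection, so \<open>\<Phi>\<close> is the difference between the metrical connection without
  torsion and \<open>D0\<close>; by the usual cyclic argument, \<open>2 G(\<Phi>\<^sub>X Y, Z)\<close> is a Koszul expression in \<open>Q\<close> and the
  torsion of \<open>D0\<close>. The form \<open>diff_form\<close> collects the four blocks, and \<open>\<Phi>\<close> is obtained from it by
  nondegeneracy of \<open>G\<close>. Symmetrizing the form in its last two arguments gives \<open>2 Q\<close>, because the torsion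
  terms cancel and because \<open>Q\<close> has no mixed part: \<open>G\<close> is block diagonal and \<open>D0\<close> preserves the blocks. This
  is metrizability (\<open>Phi_metrical\<close>, \<open>Dm_metrical\<close>). As \<open>\<Phi>\<close> is defined on each fibre without coordinates,
  no compatibility of the local formulas on overlaps has to be verified; they are read off at the
  end by pairing \<open>D0 + \<Phi>\<close> with an adapted frame (\<open>H_hor_component\<close> and its companions).

  The torsion is defined without a bracket on sections of the generalized tangent bundle. For
  horizontal lifts \<open>u'\<close>, \<open>v'\<close> of sections of \<open>F\<close> it is the derivative of \<open>v'\<close> along \<open>u'\<close> minus that of \<open>u'\<close>
  along \<open>v'\<close> minus the lift of \<open>[u, v]\<close>, and for vertical lifts of sections of \<open>E\<close>, which
  commute, the bracket term is zero. Both expressions are linear over the functions on the base and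
  therefore descend to the fibres (\<open>descend_to_fibre\<close>). In the horizontal case this rests on a cancellation
  between the Leibniz rule of the bracket and the derivative along a horizontal lift, for which the
  anchor at a point must depend on the section at that same point. The map \<open>\<Gamma>(Th \<circ> \<rho>, h \<circ> \<eta>)\<close> reads the
  section at \<open>(h \<circ> \<eta>)\<^sup>-\<^sup>1 q\<close> instead; however, the Leibniz rule and antisymmetry force the anchor to
  vanish at \<open>q\<close> unless the two points are equal (\<open>anchorN_zero\<close>).

  Brackets and covariant derivatives act on global sections, whereas frames are local. Bump
  functions extend local frames to global sections, and the Leibniz rules show that the values at a
  point depend only on the sections near it (\<open>bracket_local\<close>, \<open>nab_local\<close>).
\<close>

section \<open>Smooth functions on open subsets of Euclidean spaces\<close>

lemma frechet_derivative_eqI: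
  "(f has_derivative f') (at x) \<Longrightarrow> frechet_derivative f (at x) = f'"
  using frechet_derivative_at by blast

lemma frechet_derivative_cong_open:
  assumes "open S" "x \<in> S" "\<And>y. y \<in> S \<Longrightarrow> f y = g y"
  shows "frechet_derivative f (at x) = frechet_derivative g (at x)"
proof -
  have "(f has_derivative d) (at x) \<longleftrightarrow> (g has_derivative d) (at x)" for d
    using assms by (metis has_derivative_transform_within_open)
  then show ?thesis by (simp add: frechet_derivative_def)
qed

lemma Ck_SucD:
  assumes "Ck_on (Suc k) S f" "x \<in> S"
  shows "(f has_derivative frechet_derivative f (at x)) (at x)"
  using assms frechet_derivative_works by auto

lemma Ck_on_cong:
  assumes "open S" "\<And>x. x \<in> S \<Longrightarrow> f x = g x" "Ck_on k S f"
  shows "Ck_on k S g"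
  using assms(2,3)
proof (induction k arbitrary: f g)
  case 0
  then show ?case by (simp cong: continuous_on_cong)
next
  case (Suc k)
  have fd: "frechet_derivative f (at x) = frechet_derivative g (at x)" if "x \<in> S" for x
    using frechet_derivative_cong_open[OF assms(1) that, of f g] Suc.prems by blast
  have "g differentiable (at x)" if "x \<in> S" for x
    using Ck_SucD[OF Suc.prems(2) that] has_derivative_transform_within_open[OF _ assms(1) that]
      Suc.prems(1) differentiableI by blast
  moreover have "Ck_on k S (\<lambda>x. frechet_derivative g (at x) v)" for v
    by (rule Suc.IH[of "\<lambda>x. frechet_derivative f (at x) v"]) (use fd Suc.prems(2) in auto)
  ultimately show ?case by simp
qed

lemma Ck_SucI:
  assumes "open S" "\<And>x. x \<in> S \<Longrightarrow> (f has_derivative f' x) (at x)"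
    and "\<And>v. Ck_on k S (\<lambda>x. f' x v)"
  shows "Ck_on (Suc k) S f"
proof -
  have "Ck_on k S (\<lambda>x. frechet_derivative f (at x) v)" for v
    by (rule Ck_on_cong[OF assms(1) _ assms(3)[of v]]) (use frechet_derivative_eqI[OF assms(2)] in auto)
  then show ?thesis using assms(2) by (auto intro: differentiableI)
qed

lemma Ck_on_subset: "Ck_on k S f \<Longrightarrow> T \<subseteq> S \<Longrightarrow> Ck_on k T f"
  by (induction k arbitrary: f) (auto intro: continuous_on_subset)

lemma Ck_on_locally:
  assumes "\<And>x. x \<in> S \<Longrightarrow> \<exists>T. open T \<and> x \<in> T \<and> Ck_on k T f"
  shows "Ck_on k S f"
  using assms
proof (induction k arbitrary: f)
  case 0
  then show ?case
    by (force simp: continuous_on_eq_continuous_at intro!: continuous_at_imp_continuous_on)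
next
  case (Suc k)
  then show ?case by (simp del: split_paired_Ex) metis
qed

lemma Ck_on_Suc_imp: "Ck_on (Suc k) S f \<Longrightarrow> Ck_on k S f"
proof (induction k arbitrary: f)
  case 0
  then show ?case
    by (auto intro!: continuous_at_imp_continuous_on differentiable_imp_continuous_within)
next
  case (Suc k)
  then show ?case by (metis Ck_on.simps(2))
qed

lemma Ck_on_const: "open S \<Longrightarrow> Ck_on k S (\<lambda>x. c)"
proof (induction k arbitrary: c)
  case (Suc k)
  show ?case by (rule Ck_SucI[where f'="\<lambda>_ _. 0"]) (use Suc in auto)
qed auto

lemma Ck_on_bounded_linear:
  assumes "open S" "bounded_linear h" shows "Ck_on k S h"
proof (cases k)
  case 0 then show ?thesis using assms by (simp add: linear_continuous_on)
next
  case (Suc j)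
  show ?thesis unfolding Suc
    by (rule Ck_SucI[where f'="\<lambda>_. h"])
      (use assms Ck_on_const in \<open>auto intro: bounded_linear_imp_has_derivative\<close>)
qed

lemma Ck_on_add:
  assumes "open S" "Ck_on k S f" "Ck_on k S g"
  shows "Ck_on k S (\<lambda>x. f x + g x)"
  using assms(2,3)
proof (induction k arbitrary: f g)
  case (Suc k)
  show ?case
    by (rule Ck_SucI[where f'="\<lambda>x v. frechet_derivative f (at x) v + frechet_derivative g (at x) v"])
      (use assms(1) Suc in \<open>auto intro!: has_derivative_add Ck_SucD\<close>)
qed (auto intro: continuous_on_add)

lemma (in bounded_bilinear) Ck_on_bilinear:
  assumes "open S" "Ck_on k S f" "Ck_on k S g"
  shows "Ck_on k S (\<lambda>x. prod (f x) (g x))"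
  using assms(2,3)
proof (induction k arbitrary: f g)
  case 0
  then show ?case by (auto intro: continuous_on)
next
  case (Suc k)
  show ?case
  proof (rule Ck_SucI[where f'="\<lambda>x v. prod (f x) (frechet_derivative g (at x) v)
        + prod (frechet_derivative f (at x) v) (g x)"])
    show "Ck_on k S (\<lambda>x. prod (f x) (frechet_derivative g (at x) v)
        + prod (frechet_derivative f (at x) v) (g x))" for v
      using Suc.prems Ck_on_Suc_imp[of k S f] Ck_on_Suc_imp[of k S g]
      by (auto intro!: Ck_on_add Suc.IH assms(1))
  qed (use assms(1) Suc.prems in \<open>auto intro!: FDERIV Ck_SucD\<close>)
qed

lemma Ck_on_sum:
  assumes "open S" "finite I" "\<And>i. i \<in> I \<Longrightarrow> Ck_on k S (f i)"
  shows "Ck_on k S (\<lambda>x. \<Sum>i\<in>I. f i x)"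
  using assms(2,3) by (induction I) (auto intro: Ck_on_const Ck_on_add assms(1))

text \<open>In the chain rule the derivative of the outer function is evaluated in a direction that varies;
  expanding that direction in the standard basis keeps the induction on the order of
  differentiability within functions of the same form.\<close>

lemma Ck_on_compose:
  fixes f :: "'a::real_normed_vector \<Rightarrow> 'b::euclidean_space"
  assumes "open S" "open T" "f ` S \<subseteq> T" "Ck_on k S f" "Ck_on k T g"
  shows "Ck_on k S (\<lambda>x. g (f x))"
  using assms(4,5)
proof (induction k arbitrary: g)
  case 0
  then show ?case using continuous_on_compose2[of T g S f] assms by auto
next
  case (Suc k)
  let ?h = "\<lambda>x v. \<Sum>b\<in>Basis. (frechet_derivative f (at x) v \<bullet> b) *\<^sub>R frechet_derivative g (at (f x)) b"
  show ?case
  proof (rule Ck_SucI[where f'="?h"])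
    fix x assume x: "x \<in> S"
    let ?G = "frechet_derivative g (at (f x))" and ?F = "frechet_derivative f (at x)"
    have G: "(g has_derivative ?G) (at (f x))" using Ck_SucD[OF Suc.prems(2)] x assms(3) by auto
    have F: "(f has_derivative ?F) (at x)" using Ck_SucD[OF Suc.prems(1)] x by auto
    interpret L: bounded_linear ?G using G by (rule has_derivative_bounded_linear)
    have "?G (?F v) = ?h x v" for v
    proof -
      have "?G (?F v) = ?G (\<Sum>b\<in>Basis. (?F v \<bullet> b) *\<^sub>R b)" by (simp add: euclidean_representation)
      then show ?thesis by (simp add: L.sum L.scaleR)
    qed
    then show "((\<lambda>x. g (f x)) has_derivative ?h x) (at x)"
      using has_derivative_compose[OF F G] by simp
  next
    fix v
    have f': "Ck_on k S (\<lambda>x. frechet_derivative f (at x) v)" using Suc.prems by auto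
    show "Ck_on k S (\<lambda>x. ?h x v)"
    proof (intro Ck_on_sum bounded_bilinear.Ck_on_bilinear[OF bounded_bilinear_scaleR] assms(1) finite_Basis)
      show "Ck_on k S (\<lambda>x. frechet_derivative f (at x) v \<bullet> b)" for b
        by (intro bounded_bilinear.Ck_on_bilinear[OF bounded_bilinear_inner] assms(1) f' Ck_on_const)
      show "Ck_on k S (\<lambda>x. frechet_derivative g (at (f x)) b)" for b
        by (rule Suc.IH) (use Suc.prems Ck_on_Suc_imp in auto)
    qed
  qed (rule assms(1))
qed

lemma Ck_on_inverse:
  fixes f :: "'a::real_normed_vector \<Rightarrow> real"
  assumes "open S" "\<And>x. x \<in> S \<Longrightarrow> f x \<noteq> 0" "Ck_on k S f"
  shows "Ck_on k S (\<lambda>x. inverse (f x))"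
  using assms(3)
proof (induction k)
  case 0
  then show ?case using assms by (auto intro: continuous_on_inverse)
next
  case (Suc k)
  have inv: "Ck_on k S (\<lambda>x. inverse (f x))" using Suc Ck_on_Suc_imp by blast
  show ?case
  proof (rule Ck_SucI[where f'="\<lambda>x v. (-1) * (inverse (f x) * frechet_derivative f (at x) v * inverse (f x))"])
    fix x assume x: "x \<in> S"
    show "((\<lambda>x. inverse (f x)) has_derivative
       (\<lambda>v. (-1) * (inverse (f x) * frechet_derivative f (at x) v * inverse (f x)))) (at x)"
      using Deriv.has_derivative_inverse[OF assms(2)[OF x] Ck_SucD[OF Suc.prems x]] by simp
  next
    fix v
    have "Ck_on k S (\<lambda>x. frechet_derivative f (at x) v)" using Suc.prems by auto
    then show "Ck_on k S (\<lambda>x. (-1) * (inverse (f x) * frechet_derivative f (at x) v * inverse (f x)))"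
      by (intro bounded_bilinear.Ck_on_bilinear[OF bounded_bilinear_mult] Ck_on_const assms(1) inv)
  qed (rule assms(1))
qed

lemma Ck_on_linear_image:
  assumes "open S" "bounded_linear h" "Ck_on k S u"
  shows "Ck_on k S (\<lambda>x. h (u x))"
  using assms(3)
proof (induction k arbitrary: u)
  case 0 then show ?case using assms(2) by (auto intro: bounded_linear.continuous_on)
next
  case (Suc k)
  show ?case
  proof (rule Ck_SucI[where f'="\<lambda>x v. h (frechet_derivative u (at x) v)"])
    show "((\<lambda>x. h (u x)) has_derivative (\<lambda>v. h (frechet_derivative u (at x) v))) (at x)" if "x \<in> S" for x
      by (rule bounded_linear.has_derivative[OF assms(2) Ck_SucD[OF Suc.prems that]])
    show "Ck_on k S (\<lambda>x. h (frechet_derivative u (at x) v))" for v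
      by (rule Suc.IH) (use Suc.prems in simp)
  qed (rule assms(1))
qed

lemma smooth_on_cong:
  "open S \<Longrightarrow> (\<And>x. x \<in> S \<Longrightarrow> f x = g x) \<Longrightarrow> smooth_on S f \<longleftrightarrow> smooth_on S g"
  unfolding smooth_on_def using Ck_on_cong[of S f g] Ck_on_cong[of S g f] by auto

lemma smooth_on_subset: "smooth_on S f \<Longrightarrow> T \<subseteq> S \<Longrightarrow> smooth_on T f"
  unfolding smooth_on_def using Ck_on_subset by blast

lemma smooth_on_locally:
  "(\<And>x. x \<in> S \<Longrightarrow> \<exists>T. open T \<and> x \<in> T \<and> smooth_on T f) \<Longrightarrow> smooth_on S f"
  unfolding smooth_on_def by (metis Ck_on_locally)

lemma smooth_on_const: "open S \<Longrightarrow> smooth_on S (\<lambda>x. c)"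
  by (simp add: smooth_on_def Ck_on_const)

lemma smooth_on_bounded_linear: "open S \<Longrightarrow> bounded_linear h \<Longrightarrow> smooth_on S h"
  by (simp add: smooth_on_def Ck_on_bounded_linear)

lemma smooth_on_add:
  "open S \<Longrightarrow> smooth_on S f \<Longrightarrow> smooth_on S g \<Longrightarrow> smooth_on S (\<lambda>x. f x + g x)"
  by (simp add: smooth_on_def Ck_on_add)

lemma smooth_on_scaleR:
  "open S \<Longrightarrow> smooth_on S f \<Longrightarrow> smooth_on S g \<Longrightarrow> smooth_on S (\<lambda>x. f x *\<^sub>R g x)"
  by (simp add: smooth_on_def bounded_bilinear.Ck_on_bilinear[OF bounded_bilinear_scaleR])

lemma smooth_on_mult:
  fixes f g :: "_ \<Rightarrow> real"
  shows "open S \<Longrightarrow> smooth_on S f \<Longrightarrow> smooth_on S g \<Longrightarrow> smooth_on S (\<lambda>x. f x * g x)"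
  using smooth_on_scaleR[of S f g] by simp

lemma smooth_on_sum:
  "open S \<Longrightarrow> finite I \<Longrightarrow> (\<And>i. i \<in> I \<Longrightarrow> smooth_on S (f i)) \<Longrightarrow> smooth_on S (\<lambda>x. \<Sum>i\<in>I. f i x)"
  by (simp add: smooth_on_def Ck_on_sum)

lemma smooth_on_inverse:
  fixes f :: "_ \<Rightarrow> real"
  shows "open S \<Longrightarrow> (\<And>x. x \<in> S \<Longrightarrow> f x \<noteq> 0) \<Longrightarrow> smooth_on S f \<Longrightarrow> smooth_on S (\<lambda>x. inverse (f x))"
  by (simp add: smooth_on_def Ck_on_inverse)

lemma smooth_on_compose:
  fixes f :: "'a::real_normed_vector \<Rightarrow> 'b::euclidean_space"
  shows "open S \<Longrightarrow> open T \<Longrightarrow> f ` S \<subseteq> T \<Longrightarrow> smooth_on S f \<Longrightarrow> smooth_on T g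
    \<Longrightarrow> smooth_on S (\<lambda>x. g (f x))"
  unfolding smooth_on_def using Ck_on_compose[of S T f _ g] by blast

lemma smooth_on_frechet:
  "smooth_on S f \<Longrightarrow> smooth_on S (\<lambda>x. frechet_derivative f (at x) v)"
  unfolding smooth_on_def by (metis Ck_on.simps(2))

lemma smooth_on_has_derivative:
  "smooth_on S f \<Longrightarrow> x \<in> S \<Longrightarrow> (f has_derivative frechet_derivative f (at x)) (at x)"
  unfolding smooth_on_def by (metis Ck_SucD)

lemma smooth_on_vec:
  fixes f :: "'k::finite \<Rightarrow> _ \<Rightarrow> real"
  assumes "open S" "\<And>k. smooth_on S (f k)"
  shows "smooth_on S (\<lambda>x. \<chi> k. f k x)"
proof -
  have "smooth_on S (\<lambda>x. \<Sum>k\<in>UNIV. f k x *\<^sub>R (axis k 1 :: real ^ 'k))"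
    using assms by (intro smooth_on_sum smooth_on_scaleR smooth_on_const) auto
  moreover have "(\<Sum>k\<in>UNIV. f k x *\<^sub>R (axis k 1 :: real ^ 'k)) = (\<chi> k. f k x)" for x
    by (simp add: vec_eq_iff axis_def if_distrib cong: if_cong)
  ultimately show ?thesis by simp
qed

lemma smooth_on_Pair:
  assumes "open S" "smooth_on S f" "smooth_on S g"
  shows "smooth_on S (\<lambda>x. (f x, g x))"
proof -
  have "Ck_on k S (\<lambda>x. (f x, 0) + (0, g x))" for k
  proof (rule Ck_on_add[OF assms(1)])
    show "Ck_on k S (\<lambda>x. (f x, 0))"
      using Ck_on_linear_image[OF assms(1), of "\<lambda>z. (z, 0)" k f] assms(2)
      by (simp add: smooth_on_def bounded_linear_Pair bounded_linear_ident bounded_linear_zero)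
    show "Ck_on k S (\<lambda>x. (0, g x))"
      using Ck_on_linear_image[OF assms(1), of "\<lambda>z. (0, z)" k g] assms(3)
      by (simp add: smooth_on_def bounded_linear_Pair bounded_linear_ident bounded_linear_zero)
  qed
  then show ?thesis by (simp add: smooth_on_def)
qed

subsection \<open>Bump functions\<close>

text \<open>The functions \<open>t\<^sup>-\<^sup>n exp (- 1 / t)\<close>, continued by zero to \<open>t \<le> 0\<close>, are closed under
  differentiation up to linear combinations; smoothness of all of them follows by one induction.\<close>

definition flat_exp :: "nat \<Rightarrow> real \<Rightarrow> real" where
  "flat_exp n t = (if t > 0 then inverse t ^ n * exp (- inverse t) else 0)"

lemma flat_exp_tendsto_0: "(flat_exp n \<longlongrightarrow> 0) (at 0)"
proof -
  have "((\<lambda>t::real. inverse t ^ n * exp (- inverse t)) \<longlongrightarrow> 0) (at_right 0)" by real_asymp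
  then have "(flat_exp n \<longlongrightarrow> 0) (at_right 0)"
    by (rule Lim_transform_eventually)
      (auto simp: flat_exp_def eventually_at_filter)
  moreover have "(flat_exp n \<longlongrightarrow> 0) (at_left 0)"
    by (rule Lim_transform_eventually[OF tendsto_const])
      (auto simp: flat_exp_def eventually_at_filter)
  ultimately show ?thesis by (simp add: filterlim_split_at)
qed

lemma flat_exp_has_derivative:
  "(flat_exp n has_real_derivative (flat_exp (n + 2) t - n * flat_exp (n + 1) t)) (at t)"
proof -
  consider "t > 0" | "t < 0" | "t = 0" by linarith
  then show ?thesis
  proof cases
    case 1
    let ?s = "inverse t"
    have "((\<lambda>t. inverse t ^ n * exp (- inverse t)) has_real_derivative
        real n * (- (?s * ?s)) * ?s ^ (n - 1) * exp (- ?s) + ?s ^ n * (exp (- ?s) * (?s * ?s))) (at t)"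
      by (rule derivative_eq_intros refl | use 1 in simp)+
    moreover have "real n * (- (?s * ?s)) * ?s ^ (n - 1) * exp (- ?s) + ?s ^ n * (exp (- ?s) * (?s * ?s))
        = flat_exp (n + 2) t - n * flat_exp (n + 1) t"
      using 1 by (cases n) (simp_all add: flat_exp_def algebra_simps)
    ultimately have "((\<lambda>t. inverse t ^ n * exp (- inverse t)) has_real_derivative
        (flat_exp (n + 2) t - n * flat_exp (n + 1) t)) (at t)" by simp
    then show ?thesis
      by (rule has_field_derivative_transform_within_open[where S="{0<..}"]) (use 1 in \<open>auto simp: flat_exp_def\<close>)
  next
    case 2
    have "((\<lambda>t. 0) has_real_derivative 0) (at t)" by simp
    then have "(flat_exp n has_real_derivative 0) (at t)"
      by (rule has_field_derivative_transform_within_open[where S="{..<0}"]) (use 2 in \<open>auto simp: flat_exp_def\<close>)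
    then show ?thesis using 2 by (simp add: flat_exp_def)
  next
    case 3
    have "((\<lambda>h. (flat_exp n (0 + h) - flat_exp n 0) / h) \<longlongrightarrow> 0) (at 0)"
      by (rule Lim_transform_eventually[OF flat_exp_tendsto_0[of "Suc n"]])
        (auto simp: flat_exp_def field_simps eventually_at_filter)
    then show ?thesis using 3 by (simp add: DERIV_def flat_exp_def)
  qed
qed

lemma smooth_on_flat_exp: "smooth_on UNIV (flat_exp n)"
proof -
  have "Ck_on k UNIV (flat_exp n)" for k
  proof (induction k arbitrary: n)
    case 0
    show ?case using DERIV_isCont[OF flat_exp_has_derivative]
      by (auto intro: continuous_at_imp_continuous_on)
  next
    case (Suc k)
    show ?case
    proof (rule Ck_SucI[where f'="\<lambda>t v. (flat_exp (n + 2) t + (- real n) * flat_exp (n + 1) t) * v"])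
      show "(flat_exp n has_derivative (\<lambda>v. (flat_exp (n + 2) t + (- real n) * flat_exp (n + 1) t) * v)) (at t)" for t
        using flat_exp_has_derivative[of n t] by (simp add: has_field_derivative_def)
      show "Ck_on k UNIV (\<lambda>t. (flat_exp (n + 2) t + (- real n) * flat_exp (n + 1) t) * v)" for v
        by (intro bounded_bilinear.Ck_on_bilinear[OF bounded_bilinear_mult] Ck_on_add Ck_on_const Suc) auto
    qed simp
  qed
  then show ?thesis by (simp add: smooth_on_def)
qed

text \<open>The quotient \<open>N / (N + P)\<close> of two flat functions of the squared distance:
  \<open>N\<close> is positive inside the ball of radius \<open>2 r\<close> and \<open>P\<close>
  outside the ball of radius \<open>r\<close>, so that the denominator has no zero.\<close>

lemma smooth_bump_ball:
  fixes a :: "'a::euclidean_space"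
  assumes "r > 0"
  obtains b :: "'a \<Rightarrow> real"
  where "smooth_on UNIV b" "\<And>z. dist a z < r \<Longrightarrow> b z = 1" "\<And>z. dist a z \<ge> 2 * r \<Longrightarrow> b z = 0"
proof -
  define q where "q z = (z - a) \<bullet> (z - a)" for z
  have q: "q z = (dist a z)\<^sup>2" for z by (simp add: q_def dist_norm norm_minus_commute[of a] power2_norm_eq_inner)
  define N where "N z = flat_exp 0 (4 * r\<^sup>2 + (-1) * q z)" for z
  define P where "P z = flat_exp 0 (q z + (- r\<^sup>2))" for z
  have sq: "smooth_on UNIV q" unfolding q_def smooth_on_def
    using Ck_on_add[OF open_UNIV Ck_on_bounded_linear[OF open_UNIV bounded_linear_ident] Ck_on_const[OF open_UNIV], of _ "-a"]
    by (auto intro!: bounded_bilinear.Ck_on_bilinear[OF bounded_bilinear_inner])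
  have sN: "smooth_on UNIV N" unfolding N_def
    by (intro smooth_on_compose[OF open_UNIV open_UNIV subset_UNIV _ smooth_on_flat_exp]
        smooth_on_add smooth_on_mult smooth_on_const sq open_UNIV)
  have sP: "smooth_on UNIV P" unfolding P_def
    by (intro smooth_on_compose[OF open_UNIV open_UNIV subset_UNIV _ smooth_on_flat_exp]
        smooth_on_add smooth_on_const sq open_UNIV)
  have nn: "flat_exp 0 t \<ge> 0" "flat_exp 0 t > 0 \<longleftrightarrow> t > 0" for t by (auto simp: flat_exp_def)
  have pos: "N z + P z > 0" for z
  proof (cases "q z < 4 * r\<^sup>2")
    case True then show ?thesis using nn by (simp add: N_def P_def add_pos_nonneg)
  next
    case False
    moreover have "r\<^sup>2 > 0" using assms by simp
    ultimately have "q z - r\<^sup>2 > 0" by linarith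
    then show ?thesis using nn by (simp add: N_def P_def add_nonneg_pos)
  qed
  show thesis
  proof (rule that[of "\<lambda>z. N z * inverse (N z + P z)"])
    show "smooth_on UNIV (\<lambda>z. N z * inverse (N z + P z))"
      using pos by (intro smooth_on_mult smooth_on_inverse smooth_on_add sN sP) (auto simp: less_imp_neq[symmetric] dest: less_imp_neq)
    show "N z * inverse (N z + P z) = 1" if "dist a z < r" for z
    proof -
      have "(dist a z)\<^sup>2 < r\<^sup>2" using that by (simp add: power_strict_mono)
      then have "P z = 0" by (simp add: P_def q flat_exp_def)
      then show ?thesis using pos[of z] by simp
    qed
    show "N z * inverse (N z + P z) = 0" if "dist a z \<ge> 2 * r" for z
    proof -
      have "(dist a z)\<^sup>2 \<ge> (2 * r)\<^sup>2" using that assms by (intro power_mono) auto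
      then show ?thesis by (simp add: N_def q flat_exp_def power_mult_distrib)
    qed
  qed
qed

section \<open>Functions on a manifold\<close>

lemma chart_on_inv: "chart_on U \<phi> \<Longrightarrow> x \<in> U \<Longrightarrow> inv_into U \<phi> (\<phi> x) = x"
  by (simp add: chart_on_def homeomorphism_def)

lemma chart_on_open: "chart_on U \<phi> \<Longrightarrow> open U"
  by (simp add: chart_on_def)

lemma chart_on_open_image:
  assumes "chart_on U \<phi>" "open W" shows "open (\<phi> ` (U \<inter> W))"
proof -
  have "open (\<phi> ` U \<inter> inv_into U \<phi> -` W)"
    using assms by (intro continuous_open_preimage) (auto simp: chart_on_def homeomorphism_def)
  moreover have "\<phi> ` U \<inter> inv_into U \<phi> -` W = \<phi> ` (U \<inter> W)"
    using chart_on_inv[OF assms(1)] by auto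
  ultimately show ?thesis by simp
qed

lemma chart_on_inv_restrict:
  assumes "chart_on U \<phi>" "W \<subseteq> U" "a \<in> \<phi> ` W" shows "inv_into W \<phi> a = inv_into U \<phi> a"
proof -
  obtain x where x: "x \<in> W" "a = \<phi> x" using assms(3) by auto
  have "inj_on \<phi> W" using chart_on_inv[OF assms(1)] assms(2) by (metis inj_on_inverseI subset_iff)
  then show ?thesis using x chart_on_inv[OF assms(1), of x] assms(2) by auto
qed

lemma chart_on_restrict:
  assumes "chart_on U \<phi>" "open W" "W \<subseteq> U" shows "chart_on W \<phi>"
proof -
  have inv: "inv_into W \<phi> a = inv_into U \<phi> a" if "a \<in> \<phi> ` W" for a
    using chart_on_inv_restrict[OF assms(1,3) that] .
  have op: "open (\<phi> ` W)" using chart_on_open_image[OF assms(1,2)] assms(3) by (simp add: Int_absorb1)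
  have "homeomorphism W (\<phi> ` W) \<phi> (inv_into U \<phi>)"
    using assms homeomorphism_of_subsets[of U "\<phi> ` U" \<phi> "inv_into U \<phi>" W "\<phi> ` W" "\<phi> ` W"]
    by (auto simp: chart_on_def)
  then have "homeomorphism W (\<phi> ` W) \<phi> (inv_into W \<phi>)"
    using inv by (simp add: homeomorphism_def cong: continuous_on_cong)
  then show ?thesis using op assms(2) by (simp add: chart_on_def)
qed

lemma smooth_on_chart_locally:
  assumes "chart_on U \<phi>" "\<And>x. x \<in> U \<inter> W \<Longrightarrow> \<exists>V. open V \<and> x \<in> V \<and> smooth_on (\<phi> ` (U \<inter> V)) f"
  shows "smooth_on (\<phi> ` (U \<inter> W)) f"
proof (rule smooth_on_locally)
  fix a assume "a \<in> \<phi> ` (U \<inter> W)"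
  then obtain x where x: "x \<in> U \<inter> W" "a = \<phi> x" by auto
  then obtain V where "open V" "x \<in> V" "smooth_on (\<phi> ` (U \<inter> V)) f" using assms(2) by blast
  then show "\<exists>T. open T \<and> a \<in> T \<and> smooth_on T f"
    using x chart_on_open_image[OF assms(1)] by (intro exI[of _ "\<phi> ` (U \<inter> V)"]) auto
qed

lemma smooth_on_chart_change:
  assumes "chart_on U \<phi>" "chart_on V \<psi>" "open W"
    and "smooth_on (\<phi> ` (U \<inter> V)) (\<psi> \<circ> inv_into U \<phi>)"
    and "smooth_on (\<psi> ` (V \<inter> W)) (g \<circ> inv_into V \<psi>)"
  shows "smooth_on (\<phi> ` (U \<inter> (V \<inter> W))) (g \<circ> inv_into U \<phi>)"
proof -
  have o: "open (\<phi> ` (U \<inter> (V \<inter> W)))" "open (\<psi> ` (V \<inter> W))"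
    using chart_on_open_image assms(1,2,3) chart_on_open open_Int by metis+
  have "smooth_on (\<phi> ` (U \<inter> (V \<inter> W))) (\<lambda>a. (g \<circ> inv_into V \<psi>) ((\<psi> \<circ> inv_into U \<phi>) a))"
    by (rule smooth_on_compose[OF o _ smooth_on_subset[OF assms(4)] assms(5)])
      (use chart_on_inv[OF assms(1)] in auto)
  then show ?thesis
    by (rule smooth_on_cong[THEN iffD1, rotated 2])
      (use o chart_on_inv[OF assms(1)] chart_on_inv[OF assms(2)] in auto)
qed

locale mfd =
  fixes A :: "('m::{t2_space,second_countable_topology}, 'i::finite) atlas"
  assumes mfd: "manifold A"
begin

lemma atlas_cover: obtains U \<phi> where "(U, \<phi>) \<in> A" "x \<in> U"
proof -
  have "x \<in> (\<Union>(U, \<phi>)\<in>A. U)" using mfd by (simp add: manifold_def)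
  then show thesis using that by auto
qed

lemma atlas_chart: "(U, \<phi>) \<in> A \<Longrightarrow> chart_on U \<phi>"
  using mfd by (auto simp: manifold_def)

lemma atlas_smooth_chart: "(U, \<phi>) \<in> A \<Longrightarrow> smooth_chart A U \<phi>"
  using mfd by (fastforce simp: manifold_def smooth_chart_def)

lemma smooth_chart_on: "smooth_chart A U \<phi> \<Longrightarrow> chart_on U \<phi>"
  by (simp add: smooth_chart_def)

lemma smooth_chart_atlas:
  "smooth_chart A U \<phi> \<Longrightarrow> (V, \<psi>) \<in> A \<Longrightarrow>
     smooth_on (\<phi> ` (U \<inter> V)) (\<psi> \<circ> inv_into U \<phi>) \<and> smooth_on (\<psi> ` (V \<inter> U)) (\<phi> \<circ> inv_into V \<psi>)"
  by (auto simp: smooth_chart_def smooth_compat_def Int_commute)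

lemma smooth_chart_change:
  assumes "smooth_chart A U \<phi>" "smooth_chart A V \<psi>"
  shows "smooth_on (\<phi> ` (U \<inter> V)) (\<psi> \<circ> inv_into U \<phi>)"
proof (rule smooth_on_chart_locally[OF smooth_chart_on[OF assms(1)]])
  fix x assume x: "x \<in> U \<inter> V"
  obtain W \<kappa> where W: "(W, \<kappa>) \<in> A" "x \<in> W" by (rule atlas_cover)
  have "smooth_on (\<phi> ` (U \<inter> (W \<inter> V))) (\<psi> \<circ> inv_into U \<phi>)"
    using smooth_chart_atlas[OF assms(1) W(1)] smooth_chart_atlas[OF assms(2) W(1)]
    by (intro smooth_on_chart_change[OF smooth_chart_on[OF assms(1)] atlas_chart[OF W(1)]])
       (use assms chart_on_open smooth_chart_on in auto)
  then show "\<exists>V'. open V' \<and> x \<in> V' \<and> smooth_on (\<phi> ` (U \<inter> V')) (\<psi> \<circ> inv_into U \<phi>)"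
    using W x chart_on_open[OF atlas_chart[OF W(1)]] chart_on_open[OF smooth_chart_on[OF assms(2)]]
    by (intro exI[of _ "W \<inter> V"]) auto
qed

lemma smooth_chart_restrict:
  assumes "smooth_chart A U \<phi>" "open W" "W \<subseteq> U" shows "smooth_chart A W \<phi>"
proof -
  have c: "chart_on U \<phi>" using assms(1) by (rule smooth_chart_on)
  have "smooth_compat W \<phi> V \<psi>" if V: "(V, \<psi>) \<in> A" for V \<psi>
  proof -
    have o: "open (\<phi> ` (W \<inter> V))" "open (\<psi> ` (W \<inter> V))"
      using chart_on_open_image[OF chart_on_restrict[OF c assms(2,3)] chart_on_open[OF atlas_chart[OF V]]]
        chart_on_open_image[OF atlas_chart[OF V] assms(2)] by (auto simp: Int_commute)
    have "smooth_on (\<phi> ` (W \<inter> V)) (\<psi> \<circ> inv_into U \<phi>)" "smooth_on (\<psi> ` (W \<inter> V)) (\<phi> \<circ> inv_into V \<psi>)"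
      using smooth_chart_atlas[OF assms(1) V] assms(3) by (auto elim!: smooth_on_subset)
    moreover have "smooth_on (\<phi> ` (W \<inter> V)) (\<psi> \<circ> inv_into W \<phi>)
        = smooth_on (\<phi> ` (W \<inter> V)) (\<psi> \<circ> inv_into U \<phi>)"
      by (rule smooth_on_cong[OF o(1)]) (use chart_on_inv_restrict[OF c assms(3)] in auto)
    ultimately show ?thesis by (simp add: smooth_compat_def)
  qed
  then show ?thesis using chart_on_restrict[OF c assms(2,3)] by (auto simp: smooth_chart_def)
qed

lemma open_chart_image: "smooth_chart A U \<phi> \<Longrightarrow> open W \<Longrightarrow> open (\<phi> ` (U \<inter> W))"
  using smooth_chart_on chart_on_open_image by blast

text \<open>Smoothness is defined by the charts of the atlas only. Since the transition maps are smooth, every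
  chart of the maximal atlas may be used, and for the introduction rule one such chart around each
  point suffices.\<close>

lemma smooth_fun_chart:
  assumes "smooth_chart A U \<phi>" "open W" "smooth_fun A W f"
  shows "smooth_on (\<phi> ` (U \<inter> W)) (f \<circ> inv_into U \<phi>)"
proof (rule smooth_on_chart_locally[OF smooth_chart_on[OF assms(1)]])
  fix x assume x: "x \<in> U \<inter> W"
  obtain V \<psi> where V: "(V, \<psi>) \<in> A" "x \<in> V" by (rule atlas_cover)
  have "smooth_on (\<phi> ` (U \<inter> (V \<inter> W))) (f \<circ> inv_into U \<phi>)"
    using smooth_chart_atlas[OF assms(1) V(1)] assms(2,3) V
    by (intro smooth_on_chart_change[OF smooth_chart_on[OF assms(1)] atlas_chart[OF V(1)]])
      (auto simp: smooth_fun_def)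
  then show "\<exists>V'. open V' \<and> x \<in> V' \<and> smooth_on (\<phi> ` (U \<inter> V')) (f \<circ> inv_into U \<phi>)"
    using V x chart_on_open[OF atlas_chart[OF V(1)]] assms(2)
    by (intro exI[of _ "V \<inter> W"]) auto
qed

lemma smooth_funI_chart:
  assumes "\<And>x. x \<in> W \<Longrightarrow> \<exists>U \<phi> V. smooth_chart A U \<phi> \<and> open V \<and> x \<in> V \<and> x \<in> U \<and>
      smooth_on (\<phi> ` (U \<inter> V)) (f \<circ> inv_into U \<phi>)"
  shows "smooth_fun A W f"
  unfolding smooth_fun_def
proof clarify
  fix V \<psi> assume V: "(V, \<psi>) \<in> A"
  show "smooth_on (\<psi> ` (V \<inter> W)) (f \<circ> inv_into V \<psi>)"
  proof (rule smooth_on_chart_locally[OF atlas_chart[OF V]])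
    fix x assume x: "x \<in> V \<inter> W"
    then obtain U \<phi> O' where U: "smooth_chart A U \<phi>" "open O'" "x \<in> O'" "x \<in> U"
      "smooth_on (\<phi> ` (U \<inter> O')) (f \<circ> inv_into U \<phi>)" using assms[of x] by auto
    have "smooth_on (\<psi> ` (V \<inter> (U \<inter> O'))) (f \<circ> inv_into V \<psi>)"
      using smooth_chart_atlas[OF U(1) V] U V
      by (intro smooth_on_chart_change[OF atlas_chart[OF V] smooth_chart_on[OF U(1)]]) auto
    then show "\<exists>V'. open V' \<and> x \<in> V' \<and> smooth_on (\<psi> ` (V \<inter> V')) (f \<circ> inv_into V \<psi>)"
      using U chart_on_open[OF smooth_chart_on[OF U(1)]] by (intro exI[of _ "U \<inter> O'"]) auto
  qed
qed

lemma smooth_fun_subset: "smooth_fun A W f \<Longrightarrow> V \<subseteq> W \<Longrightarrow> smooth_fun A V f"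
  unfolding smooth_fun_def by (fastforce elim!: smooth_on_subset)

lemma smooth_fun_locally:
  assumes "\<And>x. x \<in> W \<Longrightarrow> \<exists>V. open V \<and> x \<in> V \<and> smooth_fun A V f"
  shows "smooth_fun A W f"
proof (rule smooth_funI_chart)
  fix x assume "x \<in> W"
  then obtain V where V: "open V" "x \<in> V" "smooth_fun A V f" using assms by blast
  obtain U \<phi> where U: "(U, \<phi>) \<in> A" "x \<in> U" by (rule atlas_cover)
  then show "\<exists>U \<phi> V. smooth_chart A U \<phi> \<and> open V \<and> x \<in> V \<and> x \<in> U \<and>
      smooth_on (\<phi> ` (U \<inter> V)) (f \<circ> inv_into U \<phi>)"
    using V smooth_fun_chart[OF atlas_smooth_chart[OF U(1)] V(1,3)] atlas_smooth_chart[OF U(1)] by blast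
qed

lemma smooth_fun_cong:
  assumes "open W" "\<And>x. x \<in> W \<Longrightarrow> f x = g x" "smooth_fun A W f" shows "smooth_fun A W g"
  unfolding smooth_fun_def
proof clarify
  fix V \<psi> assume V: "(V, \<psi>) \<in> A"
  have "smooth_on (\<psi> ` (V \<inter> W)) (f \<circ> inv_into V \<psi>)" using assms(3) V by (auto simp: smooth_fun_def)
  then show "smooth_on (\<psi> ` (V \<inter> W)) (g \<circ> inv_into V \<psi>)"
    by (rule smooth_on_cong[THEN iffD1, rotated 2])
      (use chart_on_open_image[OF atlas_chart[OF V] assms(1)] chart_on_inv[OF atlas_chart[OF V]] assms(2) in auto)
qed

lemma smooth_fun_const: "open W \<Longrightarrow> smooth_fun A W (\<lambda>x. c)"
  unfolding smooth_fun_def o_def by (auto intro!: smooth_on_const chart_on_open_image dest: atlas_chart)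

lemma smooth_fun_add:
  "open W \<Longrightarrow> smooth_fun A W f \<Longrightarrow> smooth_fun A W g \<Longrightarrow> smooth_fun A W (\<lambda>x. f x + g x)"
  unfolding smooth_fun_def o_def
  by (fastforce intro!: smooth_on_add chart_on_open_image dest: atlas_chart)

lemma smooth_fun_mult:
  "open W \<Longrightarrow> smooth_fun A W f \<Longrightarrow> smooth_fun A W g \<Longrightarrow> smooth_fun A W (\<lambda>x. f x * g x)"
  unfolding smooth_fun_def o_def
  by (fastforce intro!: smooth_on_mult chart_on_open_image dest: atlas_chart)

lemma smooth_fun_sum:
  "open W \<Longrightarrow> finite I \<Longrightarrow> (\<And>i. i \<in> I \<Longrightarrow> smooth_fun A W (f i)) \<Longrightarrow> smooth_fun A W (\<lambda>x. \<Sum>i\<in>I. f i x)"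
  unfolding smooth_fun_def o_def
  by (fastforce intro!: smooth_on_sum chart_on_open_image dest: atlas_chart)

lemma smooth_fun_inverse:
  "open W \<Longrightarrow> smooth_fun A W f \<Longrightarrow> (\<And>x. x \<in> W \<Longrightarrow> f x \<noteq> 0) \<Longrightarrow> smooth_fun A W (\<lambda>x. inverse (f x))"
  unfolding smooth_fun_def o_def
  by (fastforce intro!: smooth_on_inverse chart_on_open_image dest: atlas_chart
      simp: chart_on_inv)

end

text \<open>Bump functions turn local data into global data. The closed set inside \<open>W\<close> carrying the support
  is what makes extension by zero smooth.\<close>

definition bump_at :: "('m::topological_space, 'i::finite) atlas \<Rightarrow> 'm set \<Rightarrow> 'm \<Rightarrow> ('m \<Rightarrow> real) \<Rightarrow> bool" where
  "bump_at A W x b \<longleftrightarrow> smooth_fun A UNIV b \<and>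
     (\<exists>C V. closed C \<and> C \<subseteq> W \<and> open V \<and> x \<in> V \<and> V \<subseteq> C \<and> (\<forall>y\<in>V. b y = 1) \<and> (\<forall>y. y \<notin> C \<longrightarrow> b y = 0))"

lemma bump_at_eq_1: "bump_at A W x b \<Longrightarrow> b x = 1"
  by (auto simp: bump_at_def)

lemma bump_at_eq_0: "bump_at A W x b \<Longrightarrow> y \<notin> W \<Longrightarrow> b y = 0"
  by (auto simp: bump_at_def)

lemma bump_at_smooth: "bump_at A W x b \<Longrightarrow> smooth_fun A UNIV b"
  by (auto simp: bump_at_def)

lemma bump_at_plateau:
  assumes "bump_at A W x b"
  obtains V where "open V" "x \<in> V" "V \<subseteq> W" "\<And>y. y \<in> V \<Longrightarrow> b y = 1"
proof -
  obtain C V where "C \<subseteq> W" "open V" "x \<in> V" "V \<subseteq> C" "\<forall>y\<in>V. b y = 1"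
    using assms unfolding bump_at_def by blast
  then show thesis by (intro that[of V]) auto
qed

lemma bump_at_off_support:
  assumes "bump_at A W x b" "y \<notin> W"
  obtains V where "open V" "y \<in> V" "\<And>z. z \<in> V \<Longrightarrow> b z = 0"
proof -
  obtain C where "closed C" "C \<subseteq> W" "\<forall>y. y \<notin> C \<longrightarrow> b y = 0" using assms(1) by (auto simp: bump_at_def)
  then show thesis using assms(2) by (intro that[of "- C"]) auto
qed

context mfd
begin

lemma ex_bump:
  assumes "open W" "x \<in> W" obtains b where "bump_at A W x b"
proof -
  obtain U \<phi> where U: "(U, \<phi>) \<in> A" "x \<in> U" by (rule atlas_cover)
  have c: "chart_on U \<phi>" by (rule atlas_chart[OF U(1)])
  define UW where "UW = U \<inter> W"
  have UW: "open UW" "x \<in> UW" "UW \<subseteq> U" "UW \<subseteq> W" and oi: "open (\<phi> ` UW)"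
    using U assms chart_on_open[OF c] chart_on_open_image[OF c assms(1)] by (auto simp: UW_def)
  obtain e where e: "e > 0" "ball (\<phi> x) e \<subseteq> \<phi> ` UW"
    using oi UW(2) openE by (metis imageI)
  define r where "r = e / 3"
  have r: "r > 0" "cball (\<phi> x) (2 * r) \<subseteq> \<phi> ` UW" using e by (auto simp: r_def subset_iff)
  obtain \<beta> :: "real ^ 'i \<Rightarrow> real" where \<beta>: "smooth_on UNIV \<beta>" "\<And>z. dist (\<phi> x) z < r \<Longrightarrow> \<beta> z = 1"
    "\<And>z. dist (\<phi> x) z \<ge> 2 * r \<Longrightarrow> \<beta> z = 0" by (rule smooth_bump_ball[OF r(1), of "\<phi> x"]) blast
  define b where "b y = (if y \<in> UW then \<beta> (\<phi> y) else 0)" for y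
  define C where "C = inv_into U \<phi> ` cball (\<phi> x) (2 * r)"
  define V where "V = inv_into U \<phi> ` ball (\<phi> x) r"
  have invUW: "inv_into U \<phi> a \<in> UW \<and> \<phi> (inv_into U \<phi> a) = a" if "a \<in> \<phi> ` UW" for a
    using that chart_on_inv[OF c] UW(3) by auto
  have "continuous_on (\<phi> ` U) (inv_into U \<phi>)" using c by (simp add: chart_on_def homeomorphism_def)
  then have "compact C" unfolding C_def using r(2) UW(3)
    by (intro compact_continuous_image) (auto elim!: continuous_on_subset)
  then have C: "closed C" by (rule compact_imp_closed)
  have CUW: "C \<subseteq> UW" using invUW r(2) by (auto simp: C_def)
  have V_eq: "V = U \<inter> \<phi> -` ball (\<phi> x) r"
  proof
    show "V \<subseteq> U \<inter> \<phi> -` ball (\<phi> x) r"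
    proof
      fix y assume "y \<in> V"
      then obtain a where a: "a \<in> ball (\<phi> x) r" "y = inv_into U \<phi> a" by (auto simp: V_def)
      then have "a \<in> \<phi> ` UW" using r by (auto simp: subset_iff)
      then show "y \<in> U \<inter> \<phi> -` ball (\<phi> x) r" using invUW a UW(3) by auto
    qed
    show "U \<inter> \<phi> -` ball (\<phi> x) r \<subseteq> V" using chart_on_inv[OF c] by (force simp: V_def)
  qed
  have "continuous_on U \<phi>" using c by (simp add: chart_on_def homeomorphism_def)
  then have V: "open V" unfolding V_eq using chart_on_open[OF c] by (intro continuous_open_preimage) auto
  have VC: "V \<subseteq> C" using r(1) by (auto simp: V_def C_def)
  have b0: "b y = 0" if "y \<notin> C" for y
  proof (cases "y \<in> UW")
    case True
    then have "\<phi> y \<notin> cball (\<phi> x) (2 * r)" using that chart_on_inv[OF c, of y] UW(3) by (force simp: C_def)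
    then show ?thesis using \<beta>(3) by (simp add: b_def)
  qed (simp add: b_def)
  have b1: "b y = 1" if "y \<in> V" for y
    using that VC CUW \<beta>(2) V_eq by (auto simp: b_def)
  have "smooth_fun A UNIV b"
  proof (rule smooth_fun_locally)
    fix y
    show "\<exists>V. open V \<and> y \<in> V \<and> smooth_fun A V b"
    proof (cases "y \<in> C")
      case True
      have "smooth_on (\<phi> ` UW) (b \<circ> inv_into U \<phi>)"
        by (rule smooth_on_cong[THEN iffD1, OF oi _ smooth_on_subset[OF \<beta>(1)]])
          (use invUW in \<open>auto simp: b_def\<close>)
      then have "smooth_fun A UW b"
        using UW U atlas_smooth_chart[OF U(1)]
        by (intro smooth_funI_chart exI[of _ U] exI[of _ \<phi>] exI[of _ UW]) (auto simp: Int_absorb1)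
      then show ?thesis using True CUW UW by blast
    next
      case False
      have "smooth_fun A (- C) b"
        by (rule smooth_fun_cong[OF _ _ smooth_fun_const[where c=0]]) (use C b0 in auto)
      then show ?thesis using False C by blast
    qed
  qed
  moreover have "x \<in> V" using V_eq U r(1) by auto
  moreover have "C \<subseteq> W" using CUW UW(4) by blast
  ultimately have "bump_at A W x b" unfolding bump_at_def using C V VC b0 b1
    by (intro conjI exI[of _ C] exI[of _ V]) auto
  then show thesis by (rule that)
qed

lemma smooth_fun_bump_mult:
  assumes "bump_at A W x b" "open W" "smooth_fun A W f"
  shows "smooth_fun A UNIV (\<lambda>y. b y * f y)"
proof (rule smooth_fun_locally)
  fix y
  show "\<exists>V. open V \<and> y \<in> V \<and> smooth_fun A V (\<lambda>y. b y * f y)"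
  proof (cases "y \<in> W")
    case True
    have "smooth_fun A W (\<lambda>y. b y * f y)"
      by (rule smooth_fun_mult[OF assms(2) smooth_fun_subset[OF bump_at_smooth[OF assms(1)] subset_UNIV] assms(3)])
    then show ?thesis using True assms(2) by blast
  next
    case False
    obtain V where V: "open V" "y \<in> V" "\<And>z. z \<in> V \<Longrightarrow> b z = 0"
      by (rule bump_at_off_support[OF assms(1) False]) blast
    have "smooth_fun A V (\<lambda>y. b y * f y)"
      by (rule smooth_fun_cong[OF _ _ smooth_fun_const[where c=0]]) (use V in auto)
    then show ?thesis using V by blast
  qed
qed

end

lemma smooth_fun_compose:
  fixes g :: "'m::{t2_space,second_countable_topology} \<Rightarrow> 'n::{t2_space,second_countable_topology}"
  assumes A: "manifold A" and B: "manifold B" and g: "smooth_map A B g" and W: "open W"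
    and f: "smooth_fun B W f"
  shows "smooth_fun A (g -` W) (f \<circ> g)"
proof -
  interpret A: mfd A by (standard, rule A)
  interpret B: mfd B by (standard, rule B)
  have cg: "open X \<Longrightarrow> open (g -` X)" for X using g by (auto simp: smooth_map_def intro: open_vimage)
  show ?thesis unfolding smooth_fun_def
  proof clarify
    fix U \<phi> assume U: "(U, \<phi>) \<in> A"
    have c: "chart_on U \<phi>" by (rule A.atlas_chart[OF U])
    show "smooth_on (\<phi> ` (U \<inter> g -` W)) (f \<circ> g \<circ> inv_into U \<phi>)"
    proof (rule smooth_on_chart_locally[OF c])
      fix x assume x: "x \<in> U \<inter> g -` W"
      obtain V \<psi> where V: "(V, \<psi>) \<in> B" "g x \<in> V" by (rule B.atlas_cover)
      have cV: "chart_on V \<psi>" by (rule B.atlas_chart[OF V(1)])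
      have o: "open (\<phi> ` (U \<inter> g -` (V \<inter> W)))" "open (\<psi> ` (V \<inter> W))"
        using chart_on_open_image[OF c cg[OF open_Int[OF chart_on_open[OF cV] W]]]
          chart_on_open_image[OF cV W] by auto
      have "smooth_on (\<phi> ` (U \<inter> g -` (V \<inter> W)))
          (\<lambda>a. (f \<circ> inv_into V \<psi>) ((\<psi> \<circ> g \<circ> inv_into U \<phi>) a))"
      proof (rule smooth_on_compose[OF o])
        show "smooth_on (\<phi> ` (U \<inter> g -` (V \<inter> W))) (\<psi> \<circ> g \<circ> inv_into U \<phi>)"
          using g U V by (fastforce simp: smooth_map_def elim!: smooth_on_subset)
        show "smooth_on (\<psi> ` (V \<inter> W)) (f \<circ> inv_into V \<psi>)"
          using f V by (auto simp: smooth_fun_def)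
      qed (use chart_on_inv[OF c] in auto)
      then have "smooth_on (\<phi> ` (U \<inter> g -` (V \<inter> W))) (f \<circ> g \<circ> inv_into U \<phi>)"
        by (rule smooth_on_cong[THEN iffD1, rotated 2])
          (use o chart_on_inv[OF c] chart_on_inv[OF cV] in auto)
      then show "\<exists>V. open V \<and> x \<in> V \<and> smooth_on (\<phi> ` (U \<inter> V)) (f \<circ> g \<circ> inv_into U \<phi>)"
        using V x chart_on_open[OF cV] W cg by (intro exI[of _ "g -` (V \<inter> W)"]) auto
    qed
  qed
qed

subsection \<open>Tangent vectors in a chart\<close>

context mfd
begin

definition chart_deriv :: "'m set \<Rightarrow> ('m \<Rightarrow> real ^ 'i) \<Rightarrow> 'm \<Rightarrow> real ^ 'i \<Rightarrow> ('m \<Rightarrow> real) \<Rightarrow> real" where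
  "chart_deriv U \<phi> p c f = frechet_derivative (f \<circ> inv_into U \<phi>) (at (\<phi> p)) c"

lemma chart_deriv_cong:
  assumes "smooth_chart A U \<phi>" "open V" "p \<in> V" "p \<in> U" "\<And>x. x \<in> V \<Longrightarrow> f x = g x"
  shows "chart_deriv U \<phi> p c f = chart_deriv U \<phi> p c g"
  unfolding chart_deriv_def
  by (rule fun_cong[OF frechet_derivative_cong_open[of "\<phi> ` (U \<inter> V)"]])
    (use assms open_chart_image chart_on_inv[OF smooth_chart_on[OF assms(1)]] in auto)

lemma chart_deriv_change:
  assumes U: "smooth_chart A U \<phi>" and V: "smooth_chart A V \<psi>" and p: "p \<in> U" "p \<in> V"
    and f: "smooth_fun A UNIV f"
  shows "chart_deriv V \<psi> p c f
       = chart_deriv U \<phi> p (frechet_derivative (\<phi> \<circ> inv_into V \<psi>) (at (\<psi> p)) c) f"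
proof -
  have cU: "chart_on U \<phi>" and cV: "chart_on V \<psi>" using U V smooth_chart_on by auto
  have pe: "(\<phi> \<circ> inv_into V \<psi>) (\<psi> p) = \<phi> p" using chart_on_inv[OF cV p(2)] by simp
  have "smooth_on (\<psi> ` (V \<inter> U)) (\<phi> \<circ> inv_into V \<psi>)" by (rule smooth_chart_change[OF V U])
  then have 1: "((\<phi> \<circ> inv_into V \<psi>) has_derivative frechet_derivative (\<phi> \<circ> inv_into V \<psi>) (at (\<psi> p))) (at (\<psi> p))"
    by (rule smooth_on_has_derivative) (use p in auto)
  have "smooth_on (\<phi> ` (U \<inter> UNIV)) (f \<circ> inv_into U \<phi>)" by (rule smooth_fun_chart[OF U open_UNIV f])
  then have 2: "((f \<circ> inv_into U \<phi>) has_derivative frechet_derivative (f \<circ> inv_into U \<phi>) (at (\<phi> p))) (at (\<phi> p))"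
    by (rule smooth_on_has_derivative) (use p in auto)
  have "((\<lambda>z. (f \<circ> inv_into U \<phi>) ((\<phi> \<circ> inv_into V \<psi>) z)) has_derivative
     (\<lambda>c. frechet_derivative (f \<circ> inv_into U \<phi>) (at (\<phi> p)) (frechet_derivative (\<phi> \<circ> inv_into V \<psi>) (at (\<psi> p)) c))) (at (\<psi> p))"
    by (rule has_derivative_compose[OF 1]) (use 2 in \<open>simp only: pe\<close>)
  then have "((f \<circ> inv_into V \<psi>) has_derivative
     (\<lambda>c. frechet_derivative (f \<circ> inv_into U \<phi>) (at (\<phi> p)) (frechet_derivative (\<phi> \<circ> inv_into V \<psi>) (at (\<psi> p)) c))) (at (\<psi> p))"
    by (rule has_derivative_transform_within_open[of _ _ _ _ "\<psi> ` (V \<inter> U)"])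
      (use open_chart_image[OF V chart_on_open[OF cU]] p chart_on_inv[OF cU] chart_on_inv[OF cV] in auto)
  then show ?thesis unfolding chart_deriv_def by (simp add: frechet_derivative_eqI)
qed

lemma tangent_space_chart:
  assumes "smooth_chart A U \<phi>" "p \<in> U" "v \<in> tangent_space A p"
  obtains c where "\<And>f. smooth_fun A UNIV f \<Longrightarrow> v f = chart_deriv U \<phi> p c f"
    "\<And>f. \<not> smooth_fun A UNIV f \<Longrightarrow> v f = 0"
proof -
  obtain V \<psi> c where V: "(V, \<psi>) \<in> A" "p \<in> V" "v = (\<lambda>f. if smooth_fun A UNIV f
     then frechet_derivative (f \<circ> inv_into V \<psi>) (at (\<psi> p)) c else 0)"
    using assms(3) by (auto simp: tangent_space_def)
  show thesis
    by (rule that[of "frechet_derivative (\<phi> \<circ> inv_into V \<psi>) (at (\<psi> p)) c"])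
      (use V chart_deriv_change[OF assms(1) atlas_smooth_chart[OF V(1)] assms(2) V(2)] in
        \<open>auto simp: chart_deriv_def[of V]\<close>)
qed

lemma tangent_local:
  assumes "v \<in> tangent_space A p" "smooth_fun A UNIV f" "smooth_fun A UNIV g"
    and "open V" "p \<in> V" "\<And>x. x \<in> V \<Longrightarrow> f x = g x"
  shows "v f = v g"
proof -
  obtain U \<phi> where U: "(U, \<phi>) \<in> A" "p \<in> U" by (rule atlas_cover)
  note sc = atlas_smooth_chart[OF U(1)]
  obtain c where "\<And>f. smooth_fun A UNIV f \<Longrightarrow> v f = chart_deriv U \<phi> p c f"
    by (rule tangent_space_chart[OF sc U(2) assms(1)]) blast
  then show ?thesis using chart_deriv_cong[OF sc assms(4,5) U(2) assms(6)] assms by simp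
qed

lemma tangent_zero: "v \<in> tangent_space A p \<Longrightarrow> v (\<lambda>x. 0) = 0"
  by (auto simp: tangent_space_def o_def)

lemma smooth_fun_coordinate:
  assumes "smooth_chart A U \<phi>" shows "smooth_fun A U (\<lambda>x. \<phi> x $ i)"
proof (rule smooth_funI_chart)
  fix x assume x: "x \<in> U"
  have o: "open (\<phi> ` (U \<inter> U))" using open_chart_image assms chart_on_open smooth_chart_on by blast
  have "smooth_on (\<phi> ` (U \<inter> U)) ((\<lambda>x. \<phi> x $ i) \<circ> inv_into U \<phi>)"
    by (rule smooth_on_cong[THEN iffD1, OF o _ smooth_on_bounded_linear[OF o bounded_linear_vec_nth[of i]]])
      (use chart_on_inv[OF smooth_chart_on[OF assms]] in auto)
  then show "\<exists>U \<phi>' V. smooth_chart A U \<phi>' \<and> open V \<and> x \<in> V \<and> x \<in> U \<and>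
      smooth_on (\<phi>' ` (U \<inter> V)) ((\<lambda>x. \<phi> x $ i) \<circ> inv_into U \<phi>')"
    using assms x chart_on_open[OF smooth_chart_on[OF assms]] by blast
qed

text \<open>Cut-off coordinates are global functions, and they recover the components of a tangent vector; this
  is what makes the components unique.\<close>

lemma chart_deriv_coordinate:
  assumes "smooth_chart A U \<phi>" "p \<in> U" "bump_at A U p b"
  shows "chart_deriv U \<phi> p c (\<lambda>x. b x * \<phi> x $ i) = c $ i"
proof -
  obtain V where V: "open V" "p \<in> V" "V \<subseteq> U" "\<And>y. y \<in> V \<Longrightarrow> b y = 1"
    by (rule bump_at_plateau[OF assms(3)]) blast
  have "chart_deriv U \<phi> p c (\<lambda>x. b x * \<phi> x $ i) = chart_deriv U \<phi> p c (\<lambda>x. \<phi> x $ i)"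
    by (rule chart_deriv_cong[OF assms(1) V(1,2) assms(2)]) (use V in auto)
  also have "\<dots> = frechet_derivative (\<lambda>a. a $ i) (at (\<phi> p)) c"
    unfolding chart_deriv_def
    by (rule fun_cong[OF frechet_derivative_cong_open[OF open_chart_image[OF assms(1) V(1)]]])
      (use V assms(2) chart_on_inv[OF smooth_chart_on[OF assms(1)]] in auto)
  also have "\<dots> = c $ i"
    by (subst frechet_derivative_eqI[OF bounded_linear_imp_has_derivative[OF bounded_linear_vec_nth]]) simp
  finally show ?thesis .
qed

end

section \<open>Bases, frames and sections\<close>

lemma basis_of_subspace: "basis_of W b \<Longrightarrow> subspace W"
  unfolding basis_of_def using subspace_span by blast

lemma basis_of_in: "basis_of W b \<Longrightarrow> b k \<in> W"
  unfolding basis_of_def using span_base[of "b k" "range b"] by auto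

lemma basis_of_sum_in:
  fixes b :: "'k::finite \<Rightarrow> 'v::real_vector"
  shows "basis_of W b \<Longrightarrow> (\<Sum>k\<in>UNIV. c k *\<^sub>R b k) \<in> W"
  by (intro subspace_sum subspace_scale) (auto intro: basis_of_subspace basis_of_in)

lemma basis_of_expand:
  fixes b :: "'k::finite \<Rightarrow> 'v::real_vector"
  assumes "basis_of W b" "w \<in> W"
  shows "(\<Sum>k\<in>UNIV. coef b w k *\<^sub>R b k) = w"
proof -
  have "(\<Sum>v\<in>range b. representation (range b) w v *\<^sub>R v) = w"
    using assms by (intro real_vector.sum_representation_eq) (auto simp: basis_of_def)
  moreover have "(\<Sum>v\<in>range b. representation (range b) w v *\<^sub>R v) = (\<Sum>k\<in>UNIV. coef b w k *\<^sub>R b k)"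
    using assms by (subst sum.reindex) (auto simp: basis_of_def coef_def)
  ultimately show ?thesis by simp
qed

lemma coef_sum:
  fixes b :: "'k::finite \<Rightarrow> 'v::real_vector"
  assumes "basis_of W b" shows "coef b (\<Sum>k\<in>UNIV. c k *\<^sub>R b k) j = c j"
proof -
  have ind: "independent (range b)" and inj: "inj b" using assms by (auto simp: basis_of_def)
  have sp: "b k \<in> span (range b)" for k by (simp add: span_base)
  have "representation (range b) (\<Sum>k\<in>UNIV. c k *\<^sub>R b k) (b j)
      = (\<Sum>k\<in>UNIV. representation (range b) (c k *\<^sub>R b k) (b j))"
    using sp by (subst real_vector.representation_sum[OF ind]) (auto intro: span_scale)
  also have "\<dots> = (\<Sum>k\<in>UNIV. c k * (if b j = b k then 1 else 0))"
    using sp by (simp add: real_vector.representation_scale[OF ind] real_vector.representation_basis[OF ind])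
  also have "\<dots> = (\<Sum>k\<in>UNIV. if k = j then c k else 0)"
    using inj by (intro sum.cong) (auto simp: inj_eq)
  finally show ?thesis by (simp add: coef_def)
qed

lemma coef_add:
  "basis_of W b \<Longrightarrow> v \<in> W \<Longrightarrow> w \<in> W \<Longrightarrow> coef b (v + w) k = coef b v k + coef b w k"
  unfolding coef_def basis_of_def by (auto simp: real_vector.representation_add)

lemma coef_scale: "basis_of W b \<Longrightarrow> w \<in> W \<Longrightarrow> coef b (c *\<^sub>R w) k = c * coef b w k"
  unfolding coef_def basis_of_def by (auto simp: real_vector.representation_scale)

lemma coef_zero: "coef b 0 k = 0"
  by (simp add: coef_def real_vector.representation_zero)

lemma coef_basis:
  "basis_of W b \<Longrightarrow> coef b (b j) k = (if k = j then 1 else 0)"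
  unfolding coef_def basis_of_def by (auto simp: real_vector.representation_basis inj_eq)

lemma basis_ofI:
  fixes b :: "'k::finite \<Rightarrow> 'v::real_vector"
  assumes "\<And>w. w \<in> W \<Longrightarrow> \<exists>c. w = (\<Sum>k\<in>UNIV. c k *\<^sub>R b k)"
    and "\<And>c. (\<Sum>k\<in>UNIV. c k *\<^sub>R b k) \<in> W"
    and ind: "\<And>c k. (\<Sum>k\<in>UNIV. c k *\<^sub>R b k) = 0 \<Longrightarrow> c k = 0"
  shows "basis_of W b"
proof -
  have inj: "inj b"
  proof (rule injI, rule ccontr)
    fix j k assume jk: "b j = b k" "j \<noteq> k"
    have "(\<Sum>i\<in>UNIV. ((if i = j then 1 else 0) - (if i = k then 1 else 0)) *\<^sub>R b i) = 0"
      using jk(1) by (simp add: scaleR_left_diff_distrib sum_subtractf if_distrib[of "\<lambda>c. c *\<^sub>R _"] cong: if_cong)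
    from ind[OF this, of j] jk(2) show False by simp
  qed
  have "independent (range b)"
    unfolding real_vector.independent_explicit_finite_subsets
  proof (intro allI impI ballI)
    fix T u v assume T: "T \<subseteq> range b" "finite T" "(\<Sum>v\<in>T. u v *\<^sub>R v) = 0" "v \<in> T"
    have "(\<Sum>k\<in>UNIV. (if b k \<in> T then u (b k) else 0) *\<^sub>R b k) = (\<Sum>v\<in>range b. (if v \<in> T then u v else 0) *\<^sub>R v)"
      by (subst sum.reindex[OF inj]) simp
    also have "\<dots> = (\<Sum>v\<in>T. u v *\<^sub>R v)"
      using T(1) by (intro sum.mono_neutral_cong_right) auto
    finally have z: "(\<Sum>k\<in>UNIV. (if b k \<in> T then u (b k) else 0) *\<^sub>R b k) = 0" using T(3) by simp
    obtain k where "v = b k" using T(1,4) by auto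
    then show "u v = 0" using ind[OF z, of k] T(4) by simp
  qed
  moreover have "span (range b) = W"
  proof
    show "span (range b) \<subseteq> W"
    proof
      fix w assume "w \<in> span (range b)"
      then obtain u where "w = (\<Sum>v\<in>range b. u v *\<^sub>R v)" using real_vector.span_finite[of "range b"] by auto
      then have "w = (\<Sum>k\<in>UNIV. u (b k) *\<^sub>R b k)" by (simp add: sum.reindex[OF inj])
      then show "w \<in> W" using assms(2)[of "u \<circ> b"] by simp
    qed
    show "W \<subseteq> span (range b)"
    proof
      fix w assume "w \<in> W"
      then obtain c where "w = (\<Sum>k\<in>UNIV. c k *\<^sub>R b k)" using assms(1) by blast
      then show "w \<in> span (range b)" by (simp add: span_sum span_scale span_base)
    qed
  qed
  ultimately show ?thesis using inj by (simp add: basis_of_def)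
qed

lemma lin_on_sum:
  assumes "lin_on W T" "subspace W" "finite I" "\<And>i. i \<in> I \<Longrightarrow> w i \<in> W"
  shows "T (\<Sum>i\<in>I. c i *\<^sub>R w i) = (\<Sum>i\<in>I. c i *\<^sub>R T (w i))"
  using assms(3,4)
proof (induction I rule: finite_induct)
  case empty
  have "T (0 *\<^sub>R 0) = 0 *\<^sub>R T 0" using assms(1) subspace_0[OF assms(2)] unfolding lin_on_def by blast
  then show ?case by simp
next
  case (insert i I)
  have "(\<Sum>i\<in>I. c i *\<^sub>R w i) \<in> W" "c i *\<^sub>R w i \<in> W"
    using insert assms(2) by (auto intro!: subspace_sum subspace_scale)
  then show ?case using insert assms(1) by (simp add: lin_on_def)
qed

lemma lin_on_zero: "lin_on W T \<Longrightarrow> 0 \<in> W \<Longrightarrow> T 0 = 0"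
  unfolding lin_on_def by (metis scale_zero_left)

lemma lin_on_diff: "lin_on W T \<Longrightarrow> subspace W \<Longrightarrow> v \<in> W \<Longrightarrow> w \<in> W \<Longrightarrow> T (v - w) = T v - T w"
  unfolding lin_on_def
  by (metis subspace_diff eq_diff_eq diff_add_cancel)

text \<open>By Cramer's rule the solution of a linear system lies in every algebra of functions that contains
  the coefficients and is closed under inversion.\<close>

lemma cramer_closed:
  fixes P :: "('x \<Rightarrow> real) \<Rightarrow> bool" and M :: "'x \<Rightarrow> real ^ 'k::finite ^ 'k"
  assumes const: "\<And>c. P (\<lambda>x. c)"
    and add: "\<And>f g. P f \<Longrightarrow> P g \<Longrightarrow> P (\<lambda>x. f x + g x)"
    and mult: "\<And>f g. P f \<Longrightarrow> P g \<Longrightarrow> P (\<lambda>x. f x * g x)"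
    and inv: "\<And>f. P f \<Longrightarrow> (\<And>x. x \<in> U \<Longrightarrow> f x \<noteq> 0) \<Longrightarrow> P (\<lambda>x. inverse (f x))"
    and cong: "\<And>f g. P f \<Longrightarrow> (\<And>x. x \<in> U \<Longrightarrow> f x = g x) \<Longrightarrow> P g"
    and M: "\<And>i j. P (\<lambda>x. M x $ i $ j)" and v: "\<And>i. P (\<lambda>x. v x $ i)"
    and sol: "\<And>x. x \<in> U \<Longrightarrow> invertible (M x) \<and> M x *v y x = v x"
  shows "P (\<lambda>x. y x $ k)"
proof -
  have sum: "finite I \<Longrightarrow> (\<And>i. i \<in> I \<Longrightarrow> P (f i)) \<Longrightarrow> P (\<lambda>x. \<Sum>i\<in>I. f i x)" for I :: "('k \<Rightarrow> 'k) set" and f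
    by (induction I rule: finite_induct) (auto intro: const add)
  have prod: "finite I \<Longrightarrow> (\<And>i. i \<in> I \<Longrightarrow> P (f i)) \<Longrightarrow> P (\<lambda>x. \<Prod>i\<in>I. f i x)" for I :: "'k set" and f
    by (induction I rule: finite_induct) (auto intro: const mult)
  have det: "P (\<lambda>x. det (N x))" if "\<And>i j. P (\<lambda>x. N x $ i $ j)" for N :: "'x \<Rightarrow> real ^ 'k ^ 'k"
    unfolding det_def by (intro sum mult const prod that) (auto simp: finite_permutations)
  define N where "N x = (\<chi> i j. if j = k then v x $ i else M x $ i $ j)" for x
  have "P (\<lambda>x. N x $ i $ j)" for i j using M v by (cases "j = k") (auto simp: N_def)
  then have "P (\<lambda>x. det (N x) * inverse (det (M x)))"
    using sol by (intro mult inv det M) (auto simp: invertible_det_nz)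
  then show ?thesis
  proof (rule cong)
    fix x assume x: "x \<in> U"
    then have "y x = (\<chi> k. det (\<chi> i j. if j = k then v x $ i else M x $ i $ j) / det (M x))"
      using sol[OF x] cramer[of "M x" "y x" "v x"] invertible_det_nz by blast
    then show "det (N x) * inverse (det (M x)) = y x $ k" by (simp add: N_def divide_inverse)
  qed
qed

text \<open>After multiplication with a function equal to one at \<open>p\<close>, a section that vanishes at \<open>p\<close> is a
  combination of global sections with coefficients vanishing at \<open>p\<close>; linearity over the functions takes
  these coefficients out.\<close>

lemma function_linear_vanishes:
  fixes \<tau> :: "('x \<Rightarrow> 'v::real_vector) \<Rightarrow> 'c::real_vector" and s :: "'k::finite \<Rightarrow> 'x \<Rightarrow> 'v"
  assumes addc: "\<And>u v. u \<in> \<Gamma> \<Longrightarrow> v \<in> \<Gamma> \<Longrightarrow> (\<lambda>x. u x + v x) \<in> \<Gamma>"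
    and scalec: "\<And>f u. f \<in> R \<Longrightarrow> u \<in> \<Gamma> \<Longrightarrow> (\<lambda>x. f x *\<^sub>R u x) \<in> \<Gamma>"
    and add: "\<And>u v. u \<in> \<Gamma> \<Longrightarrow> v \<in> \<Gamma> \<Longrightarrow> \<tau> (\<lambda>x. u x + v x) = \<tau> u + \<tau> v"
    and scale: "\<And>f u. f \<in> R \<Longrightarrow> u \<in> \<Gamma> \<Longrightarrow> \<tau> (\<lambda>x. f x *\<^sub>R u x) = f p *\<^sub>R \<tau> u"
    and zero: "(\<lambda>x. 0) \<in> R"
    and u: "u \<in> \<Gamma>" and \<beta>: "\<beta> \<in> R" "\<beta> p = 1"
    and s: "\<And>k. s k \<in> \<Gamma>" and a: "\<And>k. a k \<in> R" "\<And>k. a k p = 0"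
    and eq: "\<And>x. \<beta> x *\<^sub>R u x = (\<Sum>k\<in>UNIV. a k x *\<^sub>R s k x)"
  shows "\<tau> u = 0"
proof -
  have z: "(\<lambda>x. 0) \<in> \<Gamma>" "\<tau> (\<lambda>x. 0) = 0" using scalec[OF zero u] scale[OF zero u] by auto
  have "(\<lambda>x. \<Sum>k\<in>I. a k x *\<^sub>R s k x) \<in> \<Gamma> \<and> \<tau> (\<lambda>x. \<Sum>k\<in>I. a k x *\<^sub>R s k x) = 0" if "finite I" for I :: "'k set"
    using that
  proof (induction I)
    case empty then show ?case using z by simp
  next
    case (insert k I)
    then show ?case
      using addc[OF scalec[OF a(1)[of k] s[of k]]] add[OF scalec[OF a(1)[of k] s[of k]]] scale[OF a(1)[of k] s[of k]] a(2)
      by simp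
  qed
  then have "\<tau> (\<lambda>x. \<beta> x *\<^sub>R u x) = 0" using eq by simp
  then show ?thesis using scale[OF \<beta>(1) u] \<beta>(2) by simp
qed

text \<open>Two sections with the same value at the point differ by one on which \<open>\<tau>\<close> vanishes, so the choice of the
  extension is immaterial; linearity follows because sums of extensions are extensions.\<close>

lemma descend_to_fibre:
  fixes ev :: "'s \<Rightarrow> 'v::real_vector" and \<tau> :: "'s \<Rightarrow> 'c::real_vector"
  assumes sur: "\<And>w. w \<in> W \<Longrightarrow> \<exists>s\<in>\<Gamma>. ev s = w" and W: "\<And>s. s \<in> \<Gamma> \<Longrightarrow> ev s \<in> W"
    and comb: "\<And>s t c. s \<in> \<Gamma> \<Longrightarrow> t \<in> \<Gamma> \<Longrightarrow> \<exists>r\<in>\<Gamma>. ev r = ev s + c *\<^sub>R ev t \<and> \<tau> r = \<tau> s + c *\<^sub>R \<tau> t"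
    and vanish: "\<And>s. s \<in> \<Gamma> \<Longrightarrow> ev s = 0 \<Longrightarrow> \<tau> s = 0"
  shows "s \<in> \<Gamma> \<Longrightarrow> \<tau> (SOME t. t \<in> \<Gamma> \<and> ev t = ev s) = \<tau> s"
    and "lin_on W (\<lambda>w. \<tau> (SOME t. t \<in> \<Gamma> \<and> ev t = w))"
proof -
  have same: "\<tau> s = \<tau> t" if st: "s \<in> \<Gamma>" "t \<in> \<Gamma>" "ev s = ev t" for s t
  proof -
    obtain r where "r \<in> \<Gamma>" "ev r = ev s + (-1) *\<^sub>R ev t" "\<tau> r = \<tau> s + (-1) *\<^sub>R \<tau> t" using comb[OF st(1,2), of "-1"] by blast
    then show ?thesis using vanish[of r] st(3) by simp
  qed
  show A: "\<tau> (SOME t. t \<in> \<Gamma> \<and> ev t = ev s) = \<tau> s" if "s \<in> \<Gamma>" for s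
    using someI[of "\<lambda>t. t \<in> \<Gamma> \<and> ev t = ev s" s] that same by blast
  define h where "h = (\<lambda>w. \<tau> (SOME t. t \<in> \<Gamma> \<and> ev t = w))"
  have h: "h (ev s) = \<tau> s" if "s \<in> \<Gamma>" for s using A[OF that] by (simp add: h_def)
  have comb': "h (v + c *\<^sub>R w) = h v + c *\<^sub>R h w" if vw: "v \<in> W" "w \<in> W" for v w c
  proof -
    obtain s where s: "s \<in> \<Gamma>" "ev s = v" using sur[OF vw(1)] by auto
    obtain t where t: "t \<in> \<Gamma>" "ev t = w" using sur[OF vw(2)] by auto
    note st = s t
    obtain r where "r \<in> \<Gamma>" "ev r = ev s + c *\<^sub>R ev t" "\<tau> r = \<tau> s + c *\<^sub>R \<tau> t" using comb[OF st(1,3), of c] by blast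
    then show ?thesis using h[of r] h[of s] h[of t] st by simp
  qed
  have h0: "h w = 0" if w: "w = 0" "w \<in> W" for w
  proof -
    obtain s where s: "s \<in> \<Gamma>" "ev s = w" using sur[OF w(2)] by auto
    then show ?thesis using h[of s] vanish[of s] w(1) by simp
  qed
  have W0: "0 \<in> W" if "w \<in> W" for w
  proof -
    obtain s where s: "s \<in> \<Gamma>" "ev s = w" using sur \<open>w \<in> W\<close> by blast
    obtain r where "r \<in> \<Gamma>" "ev r = ev s + (-1) *\<^sub>R ev s" using comb[OF s(1) s(1), of "-1"] by blast
    then show ?thesis using W by force
  qed
  show "lin_on W (\<lambda>w. \<tau> (SOME t. t \<in> \<Gamma> \<and> ev t = w))" unfolding h_def[symmetric] lin_on_def
  proof (intro conjI ballI allI)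
    show "h (x + y) = h x + h y" if "x \<in> W" "y \<in> W" for x y using comb'[OF that, of 1] by simp
    show "h (c *\<^sub>R x) = c *\<^sub>R h x" if "x \<in> W" for c x
      using comb'[OF W0[OF that] that, of c] h0[OF refl W0[OF that]] by simp
  qed
qed

locale vb = mfd A for A :: "('m::{t2_space,second_countable_topology}, 'i::finite) atlas" +
  fixes B :: "('m, 'v::real_vector, 'k::finite) vbundle"
  assumes vb: "vector_bundle A B"
begin

lemma frame_cover: obtains V t where "(V, t) \<in> frames B" "x \<in> V"
proof -
  have "x \<in> (\<Union>(U, t)\<in>frames B. U)" using vb by (simp add: vector_bundle_def)
  then show thesis using that by auto
qed

lemma frame_open: "(V, t) \<in> frames B \<Longrightarrow> open V"
  using vb by (auto simp: vector_bundle_def)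

lemma frame_basis: "(V, t) \<in> frames B \<Longrightarrow> x \<in> V \<Longrightarrow> basis_of (fibre B x) (\<lambda>k. t k x)"
  using vb by (auto simp: vector_bundle_def)

lemma fibre_subspace: "subspace (fibre B x)"
  by (rule frame_cover[of x]) (auto dest!: frame_basis basis_of_subspace)

lemma frame_change:
  assumes a: "(U, t) \<in> frames B" and b: "(V, s) \<in> frames B"
  shows "smooth_fun A (U \<inter> V) (\<lambda>x. coef (\<lambda>j. t j x) (s k x) l)"
proof -
  note c = conjunct2[OF conjunct2[OF vb[unfolded vector_bundle_def]]]
  from bspec[OF c a]
  have "\<forall>(V, s)\<in>frames B. \<forall>k l. smooth_fun A (U \<inter> V) (\<lambda>x. coef (\<lambda>j. t j x) (s k x) l)" by simp
  from bspec[OF this b] show ?thesis by simp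
qed

lemma frame_local_frame: "(V, t) \<in> frames B \<Longrightarrow> local_frame A B V t"
  unfolding local_frame_def local_section_def
proof (intro conjI ballI allI; clarify?)
  fix W s k l assume "(V, t) \<in> frames B" "(W, s) \<in> frames B"
  then show "smooth_fun A (V \<inter> W) (\<lambda>x. coef (\<lambda>j. s j x) (t k x) l)"
    using frame_change[of W s V t] by (simp add: Int_commute)
qed (simp_all add: frame_open frame_basis basis_of_in[OF frame_basis])

lemma local_section_in: "local_section A B U u \<Longrightarrow> x \<in> U \<Longrightarrow> u x \<in> fibre B x"
  by (auto simp: local_section_def)

lemma local_section_smooth:
  "local_section A B U u \<Longrightarrow> (V, t) \<in> frames B \<Longrightarrow> smooth_fun A (U \<inter> V) (\<lambda>x. coef (\<lambda>j. t j x) (u x) k)"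
  by (auto simp: local_section_def)

lemma local_section_subset:
  assumes "local_section A B U u" "V \<subseteq> U" shows "local_section A B V u"
  unfolding local_section_def
proof (intro conjI ballI allI; clarify?)
  fix x assume "x \<in> V"
  then show "u x \<in> fibre B x" using assms local_section_in by blast
next
  fix W t k assume "(W, t) \<in> frames B"
  then show "smooth_fun A (V \<inter> W) (\<lambda>x. coef (\<lambda>j. t j x) (u x) k)"
    by (rule smooth_fun_subset[OF local_section_smooth[OF assms(1)]]) (use assms(2) in auto)
qed

lemma local_section_add:
  assumes "open U" "local_section A B U u" "local_section A B U v"
  shows "local_section A B U (\<lambda>x. u x + v x)"
  unfolding local_section_def
proof (intro conjI ballI allI; clarify?)
  fix x assume "x \<in> U"
  then show "u x + v x \<in> fibre B x" using assms local_section_in fibre_subspace by (auto intro: subspace_add)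
next
  fix V t k assume V: "(V, t) \<in> frames B"
  have o: "open (U \<inter> V)" using assms(1) frame_open[OF V] by auto
  show "smooth_fun A (U \<inter> V) (\<lambda>x. coef (\<lambda>j. t j x) (u x + v x) k)"
    by (rule smooth_fun_cong[OF o _ smooth_fun_add[OF o local_section_smooth[OF assms(2) V, of k] local_section_smooth[OF assms(3) V, of k]]])
      (use frame_basis[OF V] assms(2,3) local_section_in in \<open>auto intro!: coef_add[symmetric]\<close>)
qed

lemma local_section_scale:
  assumes "open U" "smooth_fun A U f" "local_section A B U u"
  shows "local_section A B U (\<lambda>x. f x *\<^sub>R u x)"
  unfolding local_section_def
proof (intro conjI ballI allI; clarify?)
  fix x assume "x \<in> U"
  then show "f x *\<^sub>R u x \<in> fibre B x" using assms local_section_in fibre_subspace by (auto intro: subspace_scale)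
next
  fix V t k assume V: "(V, t) \<in> frames B"
  have o: "open (U \<inter> V)" using assms(1) frame_open[OF V] by auto
  have f: "smooth_fun A (U \<inter> V) f" using assms(2) smooth_fun_subset by blast
  show "smooth_fun A (U \<inter> V) (\<lambda>x. coef (\<lambda>j. t j x) (f x *\<^sub>R u x) k)"
    by (rule smooth_fun_cong[OF o _ smooth_fun_mult[OF o f local_section_smooth[OF assms(3) V, of k]]])
      (use frame_basis[OF V] assms(3) local_section_in in \<open>auto intro!: coef_scale[symmetric]\<close>)
qed

lemma local_section_cong:
  assumes "open U" "\<And>x. x \<in> U \<Longrightarrow> u x = v x" "local_section A B U u"
  shows "local_section A B U v"
  unfolding local_section_def
proof (intro conjI ballI allI; clarify?)
  fix x assume "x \<in> U"
  then show "v x \<in> fibre B x" using assms local_section_in by metis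
next
  fix V t k assume V: "(V, t) \<in> frames B"
  have o: "open (U \<inter> V)" using assms(1) frame_open[OF V] by auto
  show "smooth_fun A (U \<inter> V) (\<lambda>x. coef (\<lambda>j. t j x) (v x) k)"
    by (rule smooth_fun_cong[OF o _ local_section_smooth[OF assms(3) V, of k]]) (use assms(2) in auto)
qed

lemma local_section_zero:
  assumes "open U" shows "local_section A B U (\<lambda>x. 0)"
  unfolding local_section_def
  using fibre_subspace subspace_0 assms frame_open
  by (auto simp: coef_zero intro!: smooth_fun_const)

lemma local_section_sum:
  "finite I \<Longrightarrow> open U \<Longrightarrow> (\<And>i. i \<in> I \<Longrightarrow> local_section A B U (u i)) \<Longrightarrow> local_section A B U (\<lambda>x. \<Sum>i\<in>I. u i x)"
  by (induction I rule: finite_induct) (auto intro: local_section_zero local_section_add)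

lemma local_section_locally:
  assumes "\<And>x. x \<in> U \<Longrightarrow> \<exists>V. open V \<and> x \<in> V \<and> local_section A B V u"
  shows "local_section A B U u"
  unfolding local_section_def
proof (intro conjI ballI allI; clarify?)
  fix x assume "x \<in> U"
  then show "u x \<in> fibre B x" using assms local_section_in by metis
next
  fix V t k assume V: "(V, t) \<in> frames B"
  show "smooth_fun A (U \<inter> V) (\<lambda>x. coef (\<lambda>j. t j x) (u x) k)"
  proof (rule smooth_fun_locally)
    fix x assume x: "x \<in> U \<inter> V"
    then obtain W where "open W" "x \<in> W" "local_section A B W u" using assms by blast
    then show "\<exists>W. open W \<and> x \<in> W \<and> smooth_fun A W (\<lambda>x. coef (\<lambda>j. t j x) (u x) k)"
      using local_section_smooth[OF _ V] frame_open[OF V] x by (intro exI[of _ "W \<inter> V"]) auto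
  qed
qed

lemma local_section_bump:
  assumes "bump_at A W x b" "open W" "local_section A B W u"
  shows "local_section A B UNIV (\<lambda>y. b y *\<^sub>R u y)"
proof (rule local_section_locally)
  fix y
  show "\<exists>V. open V \<and> y \<in> V \<and> local_section A B V (\<lambda>y. b y *\<^sub>R u y)"
  proof (cases "y \<in> W")
    case True
    have "local_section A B W (\<lambda>y. b y *\<^sub>R u y)"
      by (rule local_section_scale[OF assms(2) smooth_fun_subset[OF bump_at_smooth[OF assms(1)] subset_UNIV] assms(3)])
    then show ?thesis using True assms(2) by blast
  next
    case False
    obtain V where V: "open V" "y \<in> V" "\<And>z. z \<in> V \<Longrightarrow> b z = 0"
      by (rule bump_at_off_support[OF assms(1) False]) blast
    have "local_section A B V (\<lambda>y. b y *\<^sub>R u y)"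
      by (rule local_section_cong[OF _ _ local_section_zero]) (use V in auto)
    then show ?thesis using V by blast
  qed
qed

lemma local_frame_open: "local_frame A B U t \<Longrightarrow> open U"
  and local_frame_basis: "local_frame A B U t \<Longrightarrow> x \<in> U \<Longrightarrow> basis_of (fibre B x) (\<lambda>k. t k x)"
  and local_frame_section: "local_frame A B U t \<Longrightarrow> local_section A B U (t k)"
  by (auto simp: local_frame_def)

lemma local_frame_subset: "local_frame A B U t \<Longrightarrow> open V \<Longrightarrow> V \<subseteq> U \<Longrightarrow> local_frame A B V t"
  unfolding local_frame_def using local_section_subset by blast

text \<open>By definition the coefficients of a section are smooth in the frames of the bundle atlas. In any
  other local frame they solve the linear system given by the change of frame.\<close>

lemma local_section_coef:
  assumes t: "local_frame A B U t" and W: "open W" and u: "local_section A B W u"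
  shows "smooth_fun A (U \<inter> W) (\<lambda>x. coef (\<lambda>j. t j x) (u x) k)"
proof (rule smooth_fun_locally)
  fix x0 assume x0: "x0 \<in> U \<inter> W"
  obtain V s where V: "(V, s) \<in> frames B" "x0 \<in> V" by (rule frame_cover)
  define X where "X = U \<inter> W \<inter> V"
  have X: "open X" "X \<subseteq> U" "X \<subseteq> W" "X \<subseteq> V" "x0 \<in> X"
    using local_frame_open[OF t] W frame_open[OF V(1)] x0 V by (auto simp: X_def)
  define M :: "'m \<Rightarrow> real ^ 'k ^ 'k" where "M x = (\<chi> l j. coef (\<lambda>j. s j x) (t j x) l)" for x
  define v :: "'m \<Rightarrow> real ^ 'k" where "v x = (\<chi> l. coef (\<lambda>j. s j x) (u x) l)" for x
  define y :: "'m \<Rightarrow> real ^ 'k" where "y x = (\<chi> j. coef (\<lambda>j. t j x) (u x) j)" for x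
  have bt: "basis_of (fibre B x) (\<lambda>j. t j x)" and bs: "basis_of (fibre B x) (\<lambda>j. s j x)"
    and ux: "u x \<in> fibre B x" if "x \<in> X" for x
    using that X local_frame_basis[OF t] frame_basis[OF V(1)] local_section_in[OF u] by auto
  have comb: "M x *v z = (\<chi> l. coef (\<lambda>j. s j x) (\<Sum>j\<in>UNIV. z $ j *\<^sub>R t j x) l)" if x: "x \<in> X" for x z
  proof -
    have "(\<Sum>j\<in>UNIV. z $ j *\<^sub>R t j x) = (\<Sum>j\<in>UNIV. z $ j *\<^sub>R (\<Sum>l\<in>UNIV. coef (\<lambda>j. s j x) (t j x) l *\<^sub>R s l x))"
      using basis_of_expand[OF bs[OF x]] basis_of_in[OF bt[OF x]] by simp
    also have "\<dots> = (\<Sum>l\<in>UNIV. (\<Sum>j\<in>UNIV. z $ j * coef (\<lambda>j. s j x) (t j x) l) *\<^sub>R s l x)"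
      by (simp add: scaleR_sum_right scaleR_sum_left) (rule sum.swap)
    finally show ?thesis
      by (simp add: coef_sum[OF bs[OF x]] M_def matrix_vector_mult_def vec_eq_iff mult.commute)
  qed
  have "smooth_fun A X (\<lambda>x. y x $ k)"
  proof (rule cramer_closed[where U=X and M=M and v=v and P="smooth_fun A X"])
    show "smooth_fun A X (\<lambda>x. M x $ i $ j)" for i j
      using smooth_fun_subset[OF local_section_smooth[OF local_frame_section[OF t] V(1)]] X by (simp add: M_def)
    show "smooth_fun A X (\<lambda>x. v x $ i)" for i
      using smooth_fun_subset[OF local_section_smooth[OF u V(1)]] X by (simp add: v_def)
    show "invertible (M x) \<and> M x *v y x = v x" if x: "x \<in> X" for x
    proof
      show "M x *v y x = v x" using comb[OF x, of "y x"] basis_of_expand[OF bt[OF x] ux[OF x]] by (simp add: y_def v_def)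
      have "z = 0" if z: "M x *v z = 0" for z
      proof -
        have "coef (\<lambda>j. s j x) (\<Sum>j\<in>UNIV. z $ j *\<^sub>R t j x) l = 0" for l
          using z comb[OF x, of z] by (simp add: vec_eq_iff)
        then have "(\<Sum>j\<in>UNIV. z $ j *\<^sub>R t j x) = 0"
          using basis_of_expand[OF bs[OF x] basis_of_sum_in[OF bt[OF x]], of "\<lambda>j. z $ j"] by simp
        then have "z $ j = 0" for j using coef_sum[OF bt[OF x], of "\<lambda>j. z $ j" j] by (simp add: coef_zero)
        then show "z = 0" by (simp add: vec_eq_iff)
      qed
      then show "invertible (M x)" using invertible_left_inverse matrix_left_invertible_ker by metis
    qed
  qed (use X in \<open>auto intro: smooth_fun_const smooth_fun_add smooth_fun_mult smooth_fun_inverse smooth_fun_cong\<close>)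
  then show "\<exists>V. open V \<and> x0 \<in> V \<and> smooth_fun A V (\<lambda>x. coef (\<lambda>j. t j x) (u x) k)"
    using X by (auto simp: y_def)
qed

lemma section_extends:
  assumes "w \<in> fibre B x" obtains u where "local_section A B UNIV u" "u x = w"
proof -
  obtain V t where V: "(V, t) \<in> frames B" "x \<in> V" by (rule frame_cover)
  obtain b where b: "bump_at A V x b" by (rule ex_bump[OF frame_open[OF V(1)] V(2)])
  define u where "u = (\<lambda>y. \<Sum>k\<in>UNIV. coef (\<lambda>k. t k x) w k *\<^sub>R (b y *\<^sub>R t k y))"
  have "local_section A B UNIV u" unfolding u_def
    by (intro local_section_sum local_section_scale smooth_fun_const
        local_section_bump[OF b frame_open[OF V(1)]] local_frame_section[OF frame_local_frame[OF V(1)]]) auto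
  moreover have "u x = w" using bump_at_eq_1[OF b] basis_of_expand[OF frame_basis[OF V] assms] by (simp add: u_def)
  ultimately show thesis by (rule that)
qed

lemma section_function_linear_vanishes:
  fixes \<tau> :: "('m \<Rightarrow> 'v) \<Rightarrow> 'c::real_vector"
  assumes add: "\<And>u v. local_section A B UNIV u \<Longrightarrow> local_section A B UNIV v \<Longrightarrow> \<tau> (\<lambda>x. u x + v x) = \<tau> u + \<tau> v"
    and scale: "\<And>f u. smooth_fun A UNIV f \<Longrightarrow> local_section A B UNIV u \<Longrightarrow> \<tau> (\<lambda>x. f x *\<^sub>R u x) = f p *\<^sub>R \<tau> u"
    and u: "local_section A B UNIV u" "u p = 0"
  shows "\<tau> u = 0"
proof -
  obtain V t where V: "(V, t) \<in> frames B" "p \<in> V" by (rule frame_cover)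
  note oV = frame_open[OF V(1)]
  note lf = frame_local_frame[OF V(1)]
  obtain b where b: "bump_at A V p b" by (rule ex_bump[OF oV V(2)])
  \<comment> \<open>one factor \<open>b\<close> makes the coefficients global, the other one the frame\<close>
  show ?thesis
  proof (rule function_linear_vanishes[where \<Gamma>="{u. local_section A B UNIV u}" and R="{f. smooth_fun A UNIV f}"
        and \<beta>="\<lambda>x. b x * b x" and s="\<lambda>k x. b x *\<^sub>R t k x" and a="\<lambda>k x. b x * coef (\<lambda>j. t j x) (u x) k" and p=p and u=u])
    show "(\<lambda>x. b x *\<^sub>R t k x) \<in> {u. local_section A B UNIV u}" for k
      using local_section_bump[OF b oV local_frame_section[OF lf]] by simp
    show "(\<lambda>x. b x * coef (\<lambda>j. t j x) (u x) k) \<in> {f. smooth_fun A UNIV f}" for k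
      using smooth_fun_bump_mult[OF b oV] local_section_coef[OF lf open_UNIV u(1), of k] by simp
    show "(\<lambda>x. b x * b x) \<in> {f. smooth_fun A UNIV f}"
      using bump_at_smooth[OF b] by (simp add: smooth_fun_mult)
    show "(b x * b x) *\<^sub>R u x = (\<Sum>k\<in>UNIV. (b x * coef (\<lambda>j. t j x) (u x) k) *\<^sub>R b x *\<^sub>R t k x)" for x
    proof (cases "x \<in> V")
      case True
      have "(\<Sum>k\<in>UNIV. (b x * coef (\<lambda>j. t j x) (u x) k) *\<^sub>R b x *\<^sub>R t k x)
          = (b x * b x) *\<^sub>R (\<Sum>k\<in>UNIV. coef (\<lambda>j. t j x) (u x) k *\<^sub>R t k x)"
        by (simp add: scaleR_sum_right mult_ac)
      then show ?thesis
        using basis_of_expand[OF frame_basis[OF V(1) True] local_section_in[OF u(1) UNIV_I]] by simp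
    qed (simp add: bump_at_eq_0[OF b])
  qed (use add scale u bump_at_eq_1[OF b] in
      \<open>auto intro: local_section_add local_section_scale smooth_fun_const simp: coef_zero\<close>)
qed

end

section \<open>Functions on the total space of a vector bundle\<close>

lemma smooth_on_compose_fst:
  fixes g :: "'a::euclidean_space \<Rightarrow> 'c::real_normed_vector"
  assumes "open S" "smooth_on S g"
  shows "smooth_on (S \<times> (UNIV :: 'b::real_normed_vector set)) (\<lambda>z. g (fst z))"
  by (rule smooth_on_compose[OF _ assms(1) _ smooth_on_bounded_linear[OF _ bounded_linear_fst] assms(2)])
    (auto intro: open_Times assms(1))

definition bundle_coord ::
  "('x \<Rightarrow> real ^ 'i) \<Rightarrow> ('k::finite \<Rightarrow> 'x \<Rightarrow> 'v::real_vector) \<Rightarrow> 'x \<times> 'v \<Rightarrow> (real ^ 'i) \<times> (real ^ 'k)" where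
  "bundle_coord \<phi> s e = (\<phi> (fst e), \<chi> k. coef (\<lambda>a. s a (fst e)) (snd e) k)"

context vb
begin

definition bundle_chart :: "'m set \<Rightarrow> ('m \<Rightarrow> real ^ 'i) \<Rightarrow> ('k \<Rightarrow> 'm \<Rightarrow> 'v) \<Rightarrow> bool" where
  "bundle_chart U \<phi> s \<longleftrightarrow> smooth_chart A U \<phi> \<and> local_frame A B U s"

lemma bundle_chart_chart: "bundle_chart U \<phi> s \<Longrightarrow> smooth_chart A U \<phi>"
  and bundle_chart_frame: "bundle_chart U \<phi> s \<Longrightarrow> local_frame A B U s"
  by (auto simp: bundle_chart_def)

lemma bundle_chart_open: "bundle_chart U \<phi> s \<Longrightarrow> open U"
  using local_frame_open bundle_chart_frame by blast

lemma bundle_chart_inv: "bundle_chart U \<phi> s \<Longrightarrow> x \<in> U \<Longrightarrow> inv_into U \<phi> (\<phi> x) = x"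
  using chart_on_inv smooth_chart_on bundle_chart_chart by blast

lemma bundle_chart_open_image: "bundle_chart U \<phi> s \<Longrightarrow> open W \<Longrightarrow> open (\<phi> ` (U \<inter> W) \<times> UNIV)"
  using open_chart_image bundle_chart_chart by (auto intro!: open_Times)

lemma bundle_chart_basis: "bundle_chart U \<phi> s \<Longrightarrow> x \<in> U \<Longrightarrow> basis_of (fibre B x) (\<lambda>k. s k x)"
  using local_frame_basis bundle_chart_frame by blast

lemma bundle_chart_restrict:
  "bundle_chart U \<phi> s \<Longrightarrow> open V \<Longrightarrow> V \<subseteq> U \<Longrightarrow> bundle_chart V \<phi> s"
  using smooth_chart_restrict local_frame_subset by (auto simp: bundle_chart_def)

lemma atlas_bundle_chart:
  "(V, \<phi>) \<in> A \<Longrightarrow> (W, s) \<in> frames B \<Longrightarrow> bundle_chart (V \<inter> W) \<phi> s"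
  unfolding bundle_chart_def
  using smooth_chart_restrict[OF atlas_smooth_chart, of V \<phi> "V \<inter> W"] local_frame_subset[OF frame_local_frame, of W s "V \<inter> W"]
    chart_on_open[OF atlas_chart, of V \<phi>] frame_open[of W s] by auto

lemma bundle_param_in_total:
  assumes "bundle_chart U \<phi> s" "a \<in> \<phi> ` U"
  shows "bundle_param U \<phi> s (a, y) \<in> total_space B" "fst (bundle_param U \<phi> s (a, y)) = inv_into U \<phi> a"
    "inv_into U \<phi> a \<in> U"
  using basis_of_sum_in[OF bundle_chart_basis[OF assms(1) inv_into_into[OF assms(2)]]] inv_into_into[OF assms(2)]
  by (simp_all add: bundle_param_def total_space_def)

lemma bundle_param_coord:
  assumes "bundle_chart U \<phi> s" "e \<in> total_space B" "fst e \<in> U"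
  shows "bundle_param U \<phi> s (bundle_coord \<phi> s e) = e"
  using assms basis_of_expand[OF bundle_chart_basis[OF assms(1,3)], of "snd e"]
  by (auto simp: bundle_param_def bundle_coord_def bundle_chart_inv[OF assms(1)] total_space_def)

lemma bundle_coord_param:
  assumes "bundle_chart U \<phi> s" "a \<in> \<phi> ` U"
  shows "bundle_coord \<phi> s (bundle_param U \<phi> s (a, y)) = (a, y)"
  using coef_sum[OF bundle_chart_basis[OF assms(1) inv_into_into[OF assms(2)]], of "\<lambda>k. y $ k"] f_inv_into_f[OF assms(2)]
  by (simp add: bundle_param_def bundle_coord_def vec_eq_iff)

lemma coef_bundle_param:
  assumes "bundle_chart U \<phi> s" "a \<in> \<phi> ` U"
  shows "coef (\<lambda>b. s b (fst (bundle_param U \<phi> s (a, y)))) (snd (bundle_param U \<phi> s (a, y))) k = y $ k"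
  using bundle_coord_param[OF assms, of y] by (simp add: bundle_coord_def vec_eq_iff)

lemma bundle_coord_in: "fst e \<in> U \<Longrightarrow> bundle_coord \<phi> s e \<in> \<phi> ` U \<times> UNIV"
  by (simp add: bundle_coord_def)

text \<open>The transition map acts on the base by a change of charts and on the fibre variable linearly, by the
  change of frame at the base point.\<close>

lemma bundle_transition_smooth:
  assumes U: "bundle_chart U \<phi> s" and V: "bundle_chart V \<psi> t"
  shows "smooth_on (\<phi> ` (U \<inter> V) \<times> UNIV) (bundle_coord \<psi> t \<circ> bundle_param U \<phi> s)"
proof -
  have o: "open (\<phi> ` (U \<inter> V))" and oV: "open V" and oE: "open (\<phi> ` (U \<inter> V) \<times> (UNIV :: (real ^ 'k) set))"
    using open_chart_image[OF bundle_chart_chart[OF U]] bundle_chart_open[OF V] by (auto intro!: open_Times)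
  let ?c = "\<lambda>l k x. coef (\<lambda>j. t j x) (s l x) k"
  have c: "smooth_on (\<phi> ` (U \<inter> V)) (?c l k \<circ> inv_into U \<phi>)" for l k
  proof -
    have "smooth_fun A (V \<inter> U) (?c l k)"
      by (rule local_section_coef[OF bundle_chart_frame[OF V] bundle_chart_open[OF U] local_frame_section[OF bundle_chart_frame[OF U]]])
    from smooth_fun_chart[OF bundle_chart_chart[OF U] _ this] oV bundle_chart_open[OF U]
    show ?thesis by (simp add: Int_assoc Int_commute[of V] Int_left_absorb open_Int)
  qed
  have "smooth_on (\<phi> ` (U \<inter> V) \<times> UNIV)
      (\<lambda>z. ((\<psi> \<circ> inv_into U \<phi>) (fst z), \<chi> k. \<Sum>l\<in>UNIV. snd z $ l * (?c l k \<circ> inv_into U \<phi>) (fst z)))"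
  proof (intro smooth_on_Pair smooth_on_vec smooth_on_sum smooth_on_mult oE smooth_on_compose_fst[OF o])
    show "smooth_on (\<phi> ` (U \<inter> V)) (\<psi> \<circ> inv_into U \<phi>)"
      by (rule smooth_chart_change[OF bundle_chart_chart[OF U] bundle_chart_chart[OF V]])
    show "smooth_on (\<phi> ` (U \<inter> V) \<times> UNIV) (\<lambda>z::(real ^ 'i) \<times> (real ^ 'k). snd z $ l)" for l
      using bounded_linear_compose[OF bounded_linear_vec_nth bounded_linear_snd] by (intro smooth_on_bounded_linear oE)
  qed (use c in \<open>auto simp: o_def\<close>)
  then show ?thesis
  proof (rule smooth_on_cong[THEN iffD1, OF oE, rotated])
    fix z assume "z \<in> \<phi> ` (U \<inter> V) \<times> (UNIV :: (real ^ 'k) set)"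
    then obtain x y where z: "z = (\<phi> x, y)" "x \<in> U" "x \<in> V" by auto
    have bs: "basis_of (fibre B x) (\<lambda>k. s k x)" and bt: "basis_of (fibre B x) (\<lambda>k. t k x)"
      using z bundle_chart_basis U V by auto
    have "coef (\<lambda>j. t j x) (\<Sum>l\<in>UNIV. y $ l *\<^sub>R s l x) k = (\<Sum>l\<in>UNIV. y $ l * ?c l k x)" for k
    proof -
      have "lin_on (fibre B x) (\<lambda>w. coef (\<lambda>j. t j x) w k)"
        unfolding lin_on_def using coef_add[OF bt] coef_scale[OF bt] by simp
      then show ?thesis
        using lin_on_sum[OF _ fibre_subspace, of x "\<lambda>w. coef (\<lambda>j. t j x) w k" UNIV "\<lambda>l. s l x" "\<lambda>l. y $ l"]
          basis_of_in[OF bs] by simp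
    qed
    then show "((\<psi> \<circ> inv_into U \<phi>) (fst z), \<chi> k. \<Sum>l\<in>UNIV. snd z $ l * (?c l k \<circ> inv_into U \<phi>) (fst z))
        = (bundle_coord \<psi> t \<circ> bundle_param U \<phi> s) z"
      using z bundle_chart_inv[OF U] by (simp add: bundle_coord_def bundle_param_def)
  qed
qed

lemma smooth_on_bundle_change:
  assumes U: "bundle_chart U \<phi> s" and V: "bundle_chart V \<psi> t" and W: "open W"
    and f: "smooth_on (\<psi> ` (V \<inter> W) \<times> UNIV) (f \<circ> bundle_param V \<psi> t)"
  shows "smooth_on (\<phi> ` (U \<inter> (V \<inter> W)) \<times> UNIV) (f \<circ> bundle_param U \<phi> s)"
proof -
  have o: "open (\<phi> ` (U \<inter> (V \<inter> W)) \<times> (UNIV :: (real ^ 'k) set))" "open (\<psi> ` (V \<inter> W) \<times> (UNIV :: (real ^ 'k) set))"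
    using bundle_chart_open_image[OF U open_Int[OF bundle_chart_open[OF V] W]] bundle_chart_open_image[OF V W] by auto
  have e: "bundle_param U \<phi> s z \<in> total_space B \<and> fst (bundle_param U \<phi> s z) \<in> V \<inter> W"
    if "z \<in> \<phi> ` (U \<inter> (V \<inter> W)) \<times> UNIV" for z
    using that bundle_param_in_total[OF U] bundle_chart_inv[OF U] by (cases z) auto
  have "smooth_on (\<phi> ` (U \<inter> (V \<inter> W)) \<times> UNIV)
      (\<lambda>z. (f \<circ> bundle_param V \<psi> t) ((bundle_coord \<psi> t \<circ> bundle_param U \<phi> s) z))"
  proof (rule smooth_on_compose[OF o _ _ f])
    show "smooth_on (\<phi> ` (U \<inter> (V \<inter> W)) \<times> UNIV) (bundle_coord \<psi> t \<circ> bundle_param U \<phi> s)"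
      by (rule smooth_on_subset[OF bundle_transition_smooth[OF U V]]) auto
    show "(bundle_coord \<psi> t \<circ> bundle_param U \<phi> s) ` (\<phi> ` (U \<inter> (V \<inter> W)) \<times> UNIV) \<subseteq> \<psi> ` (V \<inter> W) \<times> UNIV"
    proof
      fix w assume "w \<in> (bundle_coord \<psi> t \<circ> bundle_param U \<phi> s) ` (\<phi> ` (U \<inter> (V \<inter> W)) \<times> UNIV)"
      then obtain z where "z \<in> \<phi> ` (U \<inter> (V \<inter> W)) \<times> UNIV" "w = bundle_coord \<psi> t (bundle_param U \<phi> s z)" by auto
      then show "w \<in> \<psi> ` (V \<inter> W) \<times> UNIV" using bundle_coord_in[of "bundle_param U \<phi> s z" "V \<inter> W"] e by blast
    qed
  qed
  then show ?thesis
    by (rule smooth_on_cong[THEN iffD1, OF o(1), rotated]) (use e bundle_param_coord[OF V] in auto)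
qed

lemma smooth_on_bundle_locally:
  fixes f :: "(real ^ 'i) \<times> (real ^ 'k) \<Rightarrow> 'c::real_normed_vector"
  assumes "bundle_chart U \<phi> s"
    and "\<And>x. x \<in> U \<inter> W \<Longrightarrow> \<exists>V. open V \<and> x \<in> V \<and> smooth_on (\<phi> ` (U \<inter> V) \<times> UNIV) f"
  shows "smooth_on (\<phi> ` (U \<inter> W) \<times> UNIV) f"
proof (rule smooth_on_locally)
  fix z assume "z \<in> \<phi> ` (U \<inter> W) \<times> (UNIV :: (real ^ 'k) set)"
  then obtain x y where x: "x \<in> U \<inter> W" "z = (\<phi> x, y)" by auto
  then obtain V where "open V" "x \<in> V" "smooth_on (\<phi> ` (U \<inter> V) \<times> UNIV) f" using assms(2) by blast
  then show "\<exists>T. open T \<and> z \<in> T \<and> smooth_on T f"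
    using x bundle_chart_open_image[OF assms(1)] by (intro exI[of _ "\<phi> ` (U \<inter> V) \<times> UNIV"]) auto
qed

lemma smooth_total_atlas:
  "smooth_total A B W f \<Longrightarrow> (V, \<phi>) \<in> A \<Longrightarrow> (X, s) \<in> frames B
     \<Longrightarrow> smooth_on (\<phi> ` (V \<inter> X \<inter> W) \<times> UNIV) (f \<circ> bundle_param V \<phi> s)"
  by (auto simp: smooth_total_def)

lemma smooth_total_chart:
  assumes U: "bundle_chart U \<phi> s" and W: "open W" and f: "smooth_total A B W f"
  shows "smooth_on (\<phi> ` (U \<inter> W) \<times> UNIV) (f \<circ> bundle_param U \<phi> s)"
proof (rule smooth_on_bundle_locally[OF U])
  fix x assume x: "x \<in> U \<inter> W"
  obtain V \<psi> where V: "(V, \<psi>) \<in> A" "x \<in> V" by (rule atlas_cover)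
  obtain X t where X: "(X, t) \<in> frames B" "x \<in> X" by (rule frame_cover)
  have bc: "bundle_chart (V \<inter> X) \<psi> t" by (rule atlas_bundle_chart[OF V(1) X(1)])
  have "smooth_on (\<psi> ` (V \<inter> X \<inter> W) \<times> UNIV) (f \<circ> bundle_param (V \<inter> X) \<psi> t)"
    by (rule smooth_on_cong[THEN iffD1, OF bundle_chart_open_image[OF bc W] _ smooth_total_atlas[OF f V(1) X(1)]])
      (use chart_on_inv_restrict[OF atlas_chart[OF V(1)], of "V \<inter> X"] in \<open>auto simp: bundle_param_def\<close>)
  then have "smooth_on (\<phi> ` (U \<inter> ((V \<inter> X) \<inter> W)) \<times> UNIV) (f \<circ> bundle_param U \<phi> s)"
    by (rule smooth_on_bundle_change[OF U bc W])
  then show "\<exists>V. open V \<and> x \<in> V \<and> smooth_on (\<phi> ` (U \<inter> V) \<times> UNIV) (f \<circ> bundle_param U \<phi> s)"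
    using x V X bundle_chart_open[OF bc] W by (intro exI[of _ "V \<inter> X \<inter> W"]) auto
qed

lemma smooth_totalI_chart:
  assumes "\<And>x. x \<in> W \<Longrightarrow> \<exists>U \<phi> s V. bundle_chart U \<phi> s \<and> open V \<and> x \<in> V \<and> x \<in> U \<and>
      smooth_on (\<phi> ` (U \<inter> V) \<times> UNIV) (f \<circ> bundle_param U \<phi> s)"
  shows "smooth_total A B W f"
  unfolding smooth_total_def
proof clarify
  fix V \<psi> X t assume V: "(V, \<psi>) \<in> A" and X: "(X, t) \<in> frames B"
  have bc: "bundle_chart (V \<inter> X) \<psi> t" by (rule atlas_bundle_chart[OF V X])
  show "smooth_on (\<psi> ` (V \<inter> X \<inter> W) \<times> UNIV) (f \<circ> bundle_param V \<psi> t)"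
  proof (rule smooth_on_bundle_locally[OF bc])
    fix x assume x: "x \<in> V \<inter> X \<inter> W"
    then obtain U \<phi> s O' where U: "bundle_chart U \<phi> s" "open O'" "x \<in> O'" "x \<in> U"
      "smooth_on (\<phi> ` (U \<inter> O') \<times> UNIV) (f \<circ> bundle_param U \<phi> s)" using assms[of x] by auto
    have o: "open (\<psi> ` (V \<inter> X \<inter> (U \<inter> O')) \<times> (UNIV :: (real ^ 'k) set))"
      using bundle_chart_open_image[OF bc] U bundle_chart_open[OF U(1)] by auto
    have "smooth_on (\<psi> ` (V \<inter> X \<inter> (U \<inter> O')) \<times> UNIV) (f \<circ> bundle_param V \<psi> t)"
      by (rule smooth_on_cong[THEN iffD1, OF o _ smooth_on_bundle_change[OF bc U(1,2,5)]])
        (use chart_on_inv_restrict[OF atlas_chart[OF V], of "V \<inter> X"] in \<open>auto simp: bundle_param_def\<close>)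
    then show "\<exists>W. open W \<and> x \<in> W \<and> smooth_on (\<psi> ` (V \<inter> X \<inter> W) \<times> UNIV) (f \<circ> bundle_param V \<psi> t)"
      using U bundle_chart_open[OF U(1)] by (intro exI[of _ "U \<inter> O'"]) auto
  qed
qed

lemma ex_bundle_chart: obtains U \<phi> s where "bundle_chart U \<phi> s" "x \<in> U"
  using atlas_cover[of x] frame_cover[of x] atlas_bundle_chart by (metis IntI)

lemma smooth_total_subset: "smooth_total A B W f \<Longrightarrow> V \<subseteq> W \<Longrightarrow> smooth_total A B V f"
  unfolding smooth_total_def by (fastforce elim!: smooth_on_subset)

lemma smooth_total_locally:
  assumes "\<And>x. x \<in> W \<Longrightarrow> \<exists>V. open V \<and> x \<in> V \<and> smooth_total A B V f"
  shows "smooth_total A B W f"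
proof (rule smooth_totalI_chart)
  fix x assume "x \<in> W"
  then obtain V where V: "open V" "x \<in> V" "smooth_total A B V f" using assms by blast
  obtain U \<phi> s where U: "bundle_chart U \<phi> s" "x \<in> U" by (rule ex_bundle_chart)
  then show "\<exists>U \<phi> s V. bundle_chart U \<phi> s \<and> open V \<and> x \<in> V \<and> x \<in> U \<and>
      smooth_on (\<phi> ` (U \<inter> V) \<times> UNIV) (f \<circ> bundle_param U \<phi> s)"
    using V smooth_total_chart[OF U(1) V(1,3)] by blast
qed

lemma open_atlas_image: "(V, \<phi>) \<in> A \<Longrightarrow> (X, s) \<in> frames B \<Longrightarrow> open W
    \<Longrightarrow> open (\<phi> ` (V \<inter> X \<inter> W) \<times> (UNIV :: (real ^ 'k) set))"
  using bundle_chart_open_image[OF atlas_bundle_chart] by blast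

lemma atlas_param_in_total:
  assumes "(V, \<phi>) \<in> A" "(X, s) \<in> frames B" "z \<in> \<phi> ` (V \<inter> X \<inter> W) \<times> UNIV"
  shows "bundle_param V \<phi> s z \<in> total_space B \<and> fst (bundle_param V \<phi> s z) \<in> V \<inter> X \<inter> W"
proof -
  obtain x y where z: "z = (\<phi> x, y)" "x \<in> V \<inter> X \<inter> W" using assms(3) by auto
  then show ?thesis using chart_on_inv[OF atlas_chart[OF assms(1)], of x] basis_of_sum_in[OF frame_basis[OF assms(2), of x]]
    by (simp add: bundle_param_def total_space_def)
qed

lemma smooth_total_cong:
  assumes "open W" "\<And>e. e \<in> total_space B \<Longrightarrow> fst e \<in> W \<Longrightarrow> f e = g e" "smooth_total A B W f"
  shows "smooth_total A B W g"
  unfolding smooth_total_def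
proof clarify
  fix V \<phi> X s assume V: "(V, \<phi>) \<in> A" and X: "(X, s) \<in> frames B"
  show "smooth_on (\<phi> ` (V \<inter> X \<inter> W) \<times> UNIV) (g \<circ> bundle_param V \<phi> s)"
    by (rule smooth_on_cong[THEN iffD1, OF open_atlas_image[OF V X assms(1)] _ smooth_total_atlas[OF assms(3) V X]])
      (use assms(2) atlas_param_in_total[OF V X] in auto)
qed

lemma smooth_total_const: "open W \<Longrightarrow> smooth_total A B W (\<lambda>e. c)"
  unfolding smooth_total_def o_def by (auto intro!: smooth_on_const open_atlas_image)

lemma smooth_total_add:
  assumes "open W" "smooth_total A B W f" "smooth_total A B W g"
  shows "smooth_total A B W (\<lambda>e. f e + g e)"
  unfolding smooth_total_def
proof clarify
  fix V \<phi> X s assume V: "(V, \<phi>) \<in> A" and X: "(X, s) \<in> frames B"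
  show "smooth_on (\<phi> ` (V \<inter> X \<inter> W) \<times> UNIV) ((\<lambda>e. f e + g e) \<circ> bundle_param V \<phi> s)"
    using smooth_on_add[OF open_atlas_image[OF V X assms(1)] smooth_total_atlas[OF assms(2) V X] smooth_total_atlas[OF assms(3) V X]]
    by (simp add: o_def)
qed

lemma smooth_total_mult:
  assumes "open W" "smooth_total A B W f" "smooth_total A B W g"
  shows "smooth_total A B W (\<lambda>e. f e * g e)"
  unfolding smooth_total_def
proof clarify
  fix V \<phi> X s assume V: "(V, \<phi>) \<in> A" and X: "(X, s) \<in> frames B"
  show "smooth_on (\<phi> ` (V \<inter> X \<inter> W) \<times> UNIV) ((\<lambda>e. f e * g e) \<circ> bundle_param V \<phi> s)"
    using smooth_on_mult[OF open_atlas_image[OF V X assms(1)] smooth_total_atlas[OF assms(2) V X] smooth_total_atlas[OF assms(3) V X]]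
    by (simp add: o_def)
qed

lemma smooth_total_inverse:
  assumes "open W" "smooth_total A B W f" "\<And>e. e \<in> total_space B \<Longrightarrow> fst e \<in> W \<Longrightarrow> f e \<noteq> 0"
  shows "smooth_total A B W (\<lambda>e. inverse (f e))"
  unfolding smooth_total_def
proof clarify
  fix V \<phi> X s assume V: "(V, \<phi>) \<in> A" and X: "(X, s) \<in> frames B"
  show "smooth_on (\<phi> ` (V \<inter> X \<inter> W) \<times> UNIV) ((\<lambda>e. inverse (f e)) \<circ> bundle_param V \<phi> s)"
    using smooth_on_inverse[OF open_atlas_image[OF V X assms(1)] _ smooth_total_atlas[OF assms(2) V X]]
      assms(3) atlas_param_in_total[OF V X] by (simp add: o_def)
qed

lemma smooth_total_sum:
  "finite I \<Longrightarrow> open W \<Longrightarrow> (\<And>i. i \<in> I \<Longrightarrow> smooth_total A B W (f i)) \<Longrightarrow> smooth_total A B W (\<lambda>e. \<Sum>i\<in>I. f i e)"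
  by (induction I rule: finite_induct) (auto intro: smooth_total_const smooth_total_add)

lemma smooth_total_minus: "open W \<Longrightarrow> smooth_total A B W f \<Longrightarrow> smooth_total A B W (\<lambda>e. - f e)"
  using smooth_total_mult[OF _ smooth_total_const[of W "-1"], of f] by simp

lemma smooth_total_diff:
  "open W \<Longrightarrow> smooth_total A B W f \<Longrightarrow> smooth_total A B W g \<Longrightarrow> smooth_total A B W (\<lambda>e. f e - g e)"
  using smooth_total_add[OF _ _ smooth_total_minus, of W f g] by simp

lemma smooth_total_pullback:
  assumes "open W" "smooth_fun A W g" shows "smooth_total A B W (\<lambda>e. g (fst e))"
  unfolding smooth_total_def
proof clarify
  fix V \<phi> X s assume V: "(V, \<phi>) \<in> A" and X: "(X, s) \<in> frames B"
  have o: "open (\<phi> ` (V \<inter> X \<inter> W))"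
    using open_chart_image[OF atlas_smooth_chart[OF V] open_Int[OF frame_open[OF X] assms(1)]] by (simp add: Int_assoc)
  have "smooth_on (\<phi> ` (V \<inter> X \<inter> W)) (g \<circ> inv_into V \<phi>)"
    using assms(2) V by (fastforce simp: smooth_fun_def elim!: smooth_on_subset)
  from smooth_on_compose_fst[OF o this]
  show "smooth_on (\<phi> ` (V \<inter> X \<inter> W) \<times> UNIV) ((\<lambda>e. g (fst e)) \<circ> bundle_param V \<phi> s)"
    by (simp add: o_def bundle_param_def split_beta)
qed

lemma smooth_total_bump_mult:
  assumes "bump_at A W x b" "open W" "smooth_total A B W f"
  shows "smooth_total A B UNIV (\<lambda>e. b (fst e) * f e)"
proof (rule smooth_total_locally)
  fix y
  show "\<exists>V. open V \<and> y \<in> V \<and> smooth_total A B V (\<lambda>e. b (fst e) * f e)"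
  proof (cases "y \<in> W")
    case True
    have "smooth_total A B W (\<lambda>e. b (fst e) * f e)"
      by (intro smooth_total_mult assms smooth_total_pullback smooth_fun_subset[OF bump_at_smooth[OF assms(1)] subset_UNIV])
    then show ?thesis using True assms(2) by blast
  next
    case False
    obtain V where V: "open V" "y \<in> V" "\<And>z. z \<in> V \<Longrightarrow> b z = 0"
      by (rule bump_at_off_support[OF assms(1) False]) blast
    have "smooth_total A B V (\<lambda>e. b (fst e) * f e)"
      by (rule smooth_total_cong[OF _ _ smooth_total_const[where c=0]]) (use V in auto)
    then show ?thesis using V by blast
  qed
qed

subsection \<open>Derivatives in bundle charts\<close>

definition bundle_deriv ::
  "'m set \<Rightarrow> ('m \<Rightarrow> real ^ 'i) \<Rightarrow> ('k \<Rightarrow> 'm \<Rightarrow> 'v) \<Rightarrow> (real ^ 'i) \<times> (real ^ 'k) \<Rightarrow> ('m \<times> 'v \<Rightarrow> real) \<Rightarrow> 'm \<times> 'v \<Rightarrow> real"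
  where "bundle_deriv U \<phi> s w f e = frechet_derivative (f \<circ> bundle_param U \<phi> s) (at (bundle_coord \<phi> s e)) w"

lemma bundle_deriv_cong:
  assumes U: "bundle_chart U \<phi> s" and V: "open V" and e: "fst e \<in> V" "fst e \<in> U"
    and eq: "\<And>e'. e' \<in> total_space B \<Longrightarrow> fst e' \<in> V \<Longrightarrow> f e' = g e'"
  shows "bundle_deriv U \<phi> s w f e = bundle_deriv U \<phi> s w g e"
  unfolding bundle_deriv_def
proof (rule fun_cong[OF frechet_derivative_cong_open[OF bundle_chart_open_image[OF U V]]])
  show "bundle_coord \<phi> s e \<in> \<phi> ` (U \<inter> V) \<times> UNIV" by (rule bundle_coord_in) (use e in simp)
  show "(f \<circ> bundle_param U \<phi> s) z = (g \<circ> bundle_param U \<phi> s) z" if z: "z \<in> \<phi> ` (U \<inter> V) \<times> UNIV" for z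
  proof -
    obtain x y where "z = (\<phi> x, y)" "x \<in> U" "x \<in> V" using z by auto
    then show ?thesis using eq[of "bundle_param U \<phi> s z"] bundle_param_in_total(1,2)[OF U, of "\<phi> x" y] bundle_chart_inv[OF U, of x]
      by simp
  qed
qed

lemma bundle_has_derivative:
  assumes "bundle_chart U \<phi> s" "open W" "fst e \<in> U \<inter> W" "smooth_total A B W f"
  shows "((f \<circ> bundle_param U \<phi> s) has_derivative (\<lambda>w. bundle_deriv U \<phi> s w f e)) (at (bundle_coord \<phi> s e))"
  unfolding bundle_deriv_def
  by (rule smooth_on_has_derivative[OF smooth_total_chart[OF assms(1,2,4)] bundle_coord_in[OF assms(3)]])

lemma bundle_deriv_linear:
  assumes "bundle_chart U \<phi> s" "open W" "fst e \<in> U \<inter> W" "smooth_total A B W f"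
  shows "linear (\<lambda>w. bundle_deriv U \<phi> s w f e)"
  using bundle_has_derivative[OF assms] has_derivative_bounded_linear bounded_linear.linear by blast

lemma bundle_deriv_smooth:
  assumes U: "bundle_chart U \<phi> s" and W: "open W" "W \<subseteq> U" and f: "smooth_total A B W f"
  shows "smooth_total A B W (bundle_deriv U \<phi> s w f)"
proof (rule smooth_totalI_chart)
  fix x assume x: "x \<in> W"
  have "smooth_on (\<phi> ` (U \<inter> W) \<times> UNIV) (bundle_deriv U \<phi> s w f \<circ> bundle_param U \<phi> s)"
    by (rule smooth_on_cong[THEN iffD1, OF bundle_chart_open_image[OF U W(1)] _
          smooth_on_frechet[OF smooth_total_chart[OF U W(1) f], of w]])
      (auto simp: bundle_deriv_def bundle_coord_param[OF U])
  then show "\<exists>U' \<phi>' s' V. bundle_chart U' \<phi>' s' \<and> open V \<and> x \<in> V \<and> x \<in> U' \<and>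
      smooth_on (\<phi>' ` (U' \<inter> V) \<times> UNIV) (bundle_deriv U \<phi> s w f \<circ> bundle_param U' \<phi>' s')"
    using U W x by blast
qed

text \<open>Chain rule: the new direction is the image of the old one under the derivative of the transition
  map, hence the same for all functions.\<close>

lemma bundle_deriv_change:
  assumes U: "bundle_chart U \<phi> s" and V: "bundle_chart V \<psi> t"
    and e: "e \<in> total_space B" "fst e \<in> U" "fst e \<in> V"
  obtains w' where "\<And>f. smooth_total A B UNIV f \<Longrightarrow> bundle_deriv U \<phi> s w f e = bundle_deriv V \<psi> t w' f e"
proof
  fix f assume f: "smooth_total A B UNIV f"
  let ?\<Theta> = "bundle_coord \<psi> t \<circ> bundle_param U \<phi> s"
  let ?z = "bundle_coord \<phi> s e"
  have z: "?z \<in> \<phi> ` (U \<inter> V) \<times> UNIV" by (rule bundle_coord_in) (use e in simp)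
  have 1: "(?\<Theta> has_derivative frechet_derivative ?\<Theta> (at ?z)) (at ?z)"
    by (rule smooth_on_has_derivative[OF bundle_transition_smooth[OF U V] z])
  have "?\<Theta> ?z = bundle_coord \<psi> t e" using bundle_param_coord[OF U e(1,2)] by simp
  then have 2: "((f \<circ> bundle_param V \<psi> t) has_derivative (\<lambda>w. bundle_deriv V \<psi> t w f e)) (at (?\<Theta> ?z))"
    using bundle_has_derivative[OF V open_UNIV _ f, of e] e(3) by simp
  have "((f \<circ> bundle_param U \<phi> s) has_derivative
      (\<lambda>w. bundle_deriv V \<psi> t (frechet_derivative ?\<Theta> (at ?z) w) f e)) (at ?z)"
  proof (rule has_derivative_transform_within_open[OF has_derivative_compose[OF 1 2] bundle_chart_open_image[OF U bundle_chart_open[OF V]] z])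
    fix a assume "a \<in> \<phi> ` (U \<inter> V) \<times> (UNIV :: (real ^ 'k) set)"
    then obtain x y where a: "a = (\<phi> x, y)" "x \<in> U" "x \<in> V" by auto
    then show "(f \<circ> bundle_param V \<psi> t) (?\<Theta> a) = (f \<circ> bundle_param U \<phi> s) a"
      using bundle_param_coord[OF V, of "bundle_param U \<phi> s a"] bundle_param_in_total(1,2)[OF U, of "\<phi> x" y] bundle_chart_inv[OF U, of x]
      by simp
  qed
  then show "bundle_deriv U \<phi> s w f e = bundle_deriv V \<psi> t (frechet_derivative ?\<Theta> (at ?z) w) f e"
    unfolding bundle_deriv_def[of U] by (simp add: frechet_derivative_eqI)
qed

lemma bundle_deriv_pullback:
  assumes U: "bundle_chart U \<phi> s" and e: "fst e \<in> U" and g: "smooth_fun A UNIV g"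
  shows "bundle_deriv U \<phi> s (c, y) (\<lambda>e. g (fst e)) e = chart_deriv U \<phi> (fst e) c g"
proof -
  have "((g \<circ> inv_into U \<phi>) has_derivative frechet_derivative (g \<circ> inv_into U \<phi>) (at (\<phi> (fst e)))) (at (\<phi> (fst e)))"
    by (rule smooth_on_has_derivative[OF smooth_fun_chart[OF bundle_chart_chart[OF U] open_UNIV g]]) (use e in auto)
  then have 2: "((g \<circ> inv_into U \<phi>) has_derivative frechet_derivative (g \<circ> inv_into U \<phi>) (at (\<phi> (fst e)))) (at (fst (bundle_coord \<phi> s e)))"
    by (simp add: bundle_coord_def)
  have 1: "(fst has_derivative fst) (at (bundle_coord \<phi> s e))"
    by (rule bounded_linear_imp_has_derivative[OF bounded_linear_fst])
  have "((\<lambda>z. (g \<circ> inv_into U \<phi>) (fst z)) has_derivative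
      (\<lambda>w. frechet_derivative (g \<circ> inv_into U \<phi>) (at (\<phi> (fst e))) (fst w))) (at (bundle_coord \<phi> s e))"
    by (rule has_derivative_compose[OF 1 2])
  moreover have "(\<lambda>e. g (fst e)) \<circ> bundle_param U \<phi> s = (\<lambda>z. (g \<circ> inv_into U \<phi>) (fst z))"
    by (auto simp: bundle_param_def)
  ultimately show ?thesis
    by (simp add: bundle_deriv_def chart_deriv_def frechet_derivative_eqI)
qed

lemma smooth_total_fibre_coord:
  assumes U: "bundle_chart U \<phi> s"
  shows "smooth_total A B U (\<lambda>e. coef (\<lambda>a. s a (fst e)) (snd e) k)"
proof (rule smooth_totalI_chart)
  fix x assume x: "x \<in> U"
  have o: "open (\<phi> ` (U \<inter> U) \<times> (UNIV :: (real ^ 'k) set))" by (rule bundle_chart_open_image[OF U bundle_chart_open[OF U]])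
  have "smooth_on (\<phi> ` (U \<inter> U) \<times> UNIV) ((\<lambda>e. coef (\<lambda>a. s a (fst e)) (snd e) k) \<circ> bundle_param U \<phi> s)"
    by (rule smooth_on_cong[THEN iffD1, OF o _ smooth_on_bounded_linear[OF o
            bounded_linear_compose[OF bounded_linear_vec_nth[of k] bounded_linear_snd]]])
      (auto simp: coef_bundle_param[OF U])
  then show "\<exists>U' \<phi>' s' V. bundle_chart U' \<phi>' s' \<and> open V \<and> x \<in> V \<and> x \<in> U' \<and>
      smooth_on (\<phi>' ` (U' \<inter> V) \<times> UNIV) ((\<lambda>e. coef (\<lambda>a. s a (fst e)) (snd e) k) \<circ> bundle_param U' \<phi>' s')"
    using U x bundle_chart_open[OF U] by blast
qed

lemma bundle_deriv_fibre_coord: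
  assumes U: "bundle_chart U \<phi> s" and e: "fst e \<in> U"
  shows "bundle_deriv U \<phi> s (c, y) (\<lambda>e. coef (\<lambda>a. s a (fst e)) (snd e) k) e = y $ k"
proof -
  have "bundle_deriv U \<phi> s (c, y) (\<lambda>e. coef (\<lambda>a. s a (fst e)) (snd e) k) e
      = frechet_derivative (\<lambda>z. snd z $ k) (at (bundle_coord \<phi> s e)) (c, y)"
    unfolding bundle_deriv_def
    by (rule fun_cong[OF frechet_derivative_cong_open[OF bundle_chart_open_image[OF U bundle_chart_open[OF U]]
            bundle_coord_in[of e "U \<inter> U"]]])
      (use e in \<open>auto simp: coef_bundle_param[OF U]\<close>)
  also have "\<dots> = y $ k"
    by (subst frechet_derivative_eqI[OF bounded_linear_imp_has_derivative[OF
            bounded_linear_compose[OF bounded_linear_vec_nth[of k] bounded_linear_snd]]]) simp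
  finally show ?thesis .
qed

end

section \<open>The anchor of a generalized Lie algebroid\<close>

lemma bump_at_center: "bump_at A W x b \<Longrightarrow> \<exists>V. open V \<and> x \<in> V \<and> V \<subseteq> W \<and> (\<forall>y\<in>V. b y = 1 \<and> bump_at A W y b)"
  unfolding bump_at_def by (elim conjE exE) (rule_tac x=V in exI, auto)

lemma linear_combination:
  fixes h :: "'v::real_vector \<Rightarrow> real"
  assumes "linear h" shows "h (\<Sum>i\<in>I. c i *\<^sub>R w i) = (\<Sum>i\<in>I. c i * h (w i))"
  using assms by (simp add: linear_sum linear_scale)

lemma sum_apply: "(\<Sum>i\<in>I. f i) x = (\<Sum>i\<in>I. f i x)"
  by (induction I rule: infinite_finite_induct) auto

lemma sum_UNIV_Plus:
  "(\<Sum>k\<in>(UNIV :: ('x::finite + 'y::finite) set). g k) = (\<Sum>x\<in>UNIV. g (Inl x)) + (\<Sum>y\<in>UNIV. g (Inr y))"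
  using sum.Plus[of "UNIV :: 'x set" "UNIV :: 'y set" g] by simp

locale gla =
  fixes S :: "('m::{t2_space,second_countable_topology}, 'n::{t2_space,second_countable_topology},
               'f::real_vector, 'b::real_vector, 'i::finite, 'p::finite, 'r::finite) gla_data"
  assumes gla: "generalized_Lie_algebroid S" and vbE: "vector_bundle (atlasM S) (bundleE S)"
begin

lemma manifolds: "manifold (atlasM S)" "manifold (atlasN S)"
  and diffeos: "diffeo (atlasM S) (atlasN S) (hmap S)" "diffeo (atlasN S) (atlasM S) (eta S)"
  and vbF: "vector_bundle (atlasN S) (bundleF S)"
  and morphism: "bundle_morphism_TM S"
  and lie: "lie_bracket_on (sectionsF S) (bracket S)"
  using gla unfolding generalized_Lie_algebroid_def by blast+

sublocale E: vb "atlasM S" "bundleE S"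
  by unfold_locales (rule manifolds vbE)+

sublocale F: vb "atlasN S" "bundleF S"
  by unfold_locales (rule manifolds vbF)+

lemma bij_h: "bij (hmap S)" and bij_eta: "bij (eta S)"
  and smooth_h: "smooth_map (atlasM S) (atlasN S) (hmap S)"
  and smooth_inv_h: "smooth_map (atlasN S) (atlasM S) (inv (hmap S))"
  and smooth_inv_eta: "smooth_map (atlasM S) (atlasN S) (inv (eta S))"
  using diffeos by (auto simp: diffeo_def)

lemma inv_h [simp]: "inv (hmap S) (hmap S x) = x" "hmap S (inv (hmap S) q) = q"
  using bij_h by (simp_all add: bij_is_inj bij_is_surj surj_f_inv_f)

lemma inv_eta [simp]: "inv (eta S) (eta S q) = q" "eta S (inv (eta S) x) = x"
  using bij_eta by (simp_all add: bij_is_inj bij_is_surj surj_f_inv_f)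

lemma h_eq_iff [simp]: "hmap S x = hmap S y \<longleftrightarrow> x = y"
  using bij_h by (meson bij_is_inj inj_eq)

lemma continuous_h: "open W \<Longrightarrow> open (hmap S -` W)" "open U \<Longrightarrow> open (hmap S ` U)"
proof -
  have "hmap S ` U = inv (hmap S) -` U" using bij_h by (simp add: bij_vimage_eq_inv_image bij_imp_bij_inv inv_inv_eq)
  then show "open U \<Longrightarrow> open (hmap S ` U)" "open W \<Longrightarrow> open (hmap S -` W)"
    using smooth_h smooth_inv_h by (auto simp: smooth_map_def intro: open_vimage)
qed

lemma smooth_fun_h: "open W \<Longrightarrow> smooth_fun (atlasN S) W f \<Longrightarrow> smooth_fun (atlasM S) (hmap S -` W) (\<lambda>x. f (hmap S x))"
  using smooth_fun_compose[OF manifolds smooth_h] by (simp add: o_def)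

lemma smooth_fun_h_UNIV: "smooth_fun (atlasN S) UNIV f \<Longrightarrow> smooth_fun (atlasM S) UNIV (f \<circ> hmap S)"
  using smooth_fun_h[of UNIV f] by (simp add: o_def)

lemma smooth_fun_inv_h: "smooth_fun (atlasM S) UNIV g \<Longrightarrow> smooth_fun (atlasN S) UNIV (g \<circ> inv (hmap S))"
  using smooth_fun_compose[OF manifolds(2,1) smooth_inv_h open_UNIV] by (simp add: o_def)

lemma sectionsF_iff: "u \<in> sectionsF S \<longleftrightarrow> local_section (atlasN S) (bundleF S) UNIV u"
  by (simp add: sectionsF_def)

lemma sectionsF_in: "u \<in> sectionsF S \<Longrightarrow> u q \<in> fibre (bundleF S) q"
  using F.local_section_in by (auto simp: sectionsF_iff)

lemma sectionsF_add: "u \<in> sectionsF S \<Longrightarrow> v \<in> sectionsF S \<Longrightarrow> (\<lambda>q. u q + v q) \<in> sectionsF S"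
  by (simp add: sectionsF_iff F.local_section_add)

lemma sectionsF_scale:
  "smooth_fun (atlasN S) UNIV f \<Longrightarrow> u \<in> sectionsF S \<Longrightarrow> (\<lambda>q. f q *\<^sub>R u q) \<in> sectionsF S"
  by (simp add: sectionsF_iff F.local_section_scale)

lemma bracket_in: "u \<in> sectionsF S \<Longrightarrow> v \<in> sectionsF S \<Longrightarrow> bracket S u v \<in> sectionsF S"
  using lie by (simp add: lie_bracket_on_def)

lemma bracket_self: "u \<in> sectionsF S \<Longrightarrow> bracket S u u q = 0"
  using lie by (simp add: lie_bracket_on_def)

lemma bracket_add:
  assumes "u \<in> sectionsF S" "v \<in> sectionsF S" "w \<in> sectionsF S"
  shows "bracket S u (\<lambda>q. v q + w q) q = bracket S u v q + bracket S u w q"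
    and "bracket S (\<lambda>q. v q + w q) u q = bracket S v u q + bracket S w u q"
proof -
  have "lin_on (sectionsF S) (bracket S u)" "lin_on (sectionsF S) (\<lambda>v. bracket S v u)"
    using lie assms(1) by (auto simp: lie_bracket_on_def)
  then have "bracket S u (v + w) = bracket S u v + bracket S u w" "bracket S (v + w) u = bracket S v u + bracket S w u"
    using assms by (simp_all add: lin_on_def)
  then show "bracket S u (\<lambda>q. v q + w q) q = bracket S u v q + bracket S u w q"
    "bracket S (\<lambda>q. v q + w q) u q = bracket S v u q + bracket S w u q"
    by (simp_all add: plus_fun_def)
qed

lemma bracket_antisym:
  assumes "u \<in> sectionsF S" "v \<in> sectionsF S" shows "bracket S v u q = - bracket S u v q"
proof -
  have "0 = bracket S (\<lambda>q. u q + v q) (\<lambda>q. u q + v q) q"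
    using bracket_self[OF sectionsF_add[OF assms]] by simp
  also have "\<dots> = bracket S u v q + bracket S v u q"
    using bracket_add(1)[OF sectionsF_add[OF assms] assms] bracket_add(2)[OF _ assms] assms bracket_self by simp
  finally show ?thesis by (simp add: eq_neg_iff_add_eq_0 add.commute)
qed

lemma bracket_scale_right:
  assumes "u \<in> sectionsF S" "v \<in> sectionsF S" "smooth_fun (atlasN S) UNIV f"
  shows "bracket S u (\<lambda>q. f q *\<^sub>R v q) q = f q *\<^sub>R bracket S u v q + anchorN S u f q *\<^sub>R v q"
proof -
  have "bracket S u (\<lambda>q. f q *\<^sub>R v q) = (\<lambda>q. f q *\<^sub>R bracket S u v q + anchorN S u f q *\<^sub>R v q)"
    using gla assms unfolding generalized_Lie_algebroid_def by simp
  then show ?thesis by simp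
qed

lemma bracket_scale_left:
  assumes "u \<in> sectionsF S" "v \<in> sectionsF S" "smooth_fun (atlasN S) UNIV f"
  shows "bracket S (\<lambda>q. f q *\<^sub>R u q) v q = f q *\<^sub>R bracket S u v q - anchorN S v f q *\<^sub>R u q"
  using bracket_antisym[OF assms(2) sectionsF_scale[OF assms(3,1)], of q] bracket_scale_right[OF assms(2,1,3), of q]
    bracket_antisym[OF assms(2,1), of q] by simp

lemma rho_lin: "lin_on (fibre (bundleF S) q) (rho S q)"
  and rho_tangent: "a \<in> fibre (bundleF S) q \<Longrightarrow> rho S q a \<in> tangent_space (atlasM S) (eta S q)"
  using morphism by (auto simp: bundle_morphism_TM_def)

lemma rho_add:
  "a \<in> fibre (bundleF S) q \<Longrightarrow> b \<in> fibre (bundleF S) q \<Longrightarrow> rho S q (a + b) f = rho S q a f + rho S q b f"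
  using rho_lin[of q] by (simp add: lin_on_def)

lemma rho_scale: "a \<in> fibre (bundleF S) q \<Longrightarrow> rho S q (c *\<^sub>R a) f = c * rho S q a f"
  using rho_lin[of q] by (simp add: lin_on_def scaleR_fun_def)

definition source_pt :: "'n \<Rightarrow> 'n" where "source_pt q = inv (hmap S \<circ> eta S) q"

lemma source_pt_eq: "source_pt q = inv (eta S) (inv (hmap S) q)"
  using bij_h bij_eta by (simp add: source_pt_def o_inv_distrib)

lemma eta_source_pt [simp]: "eta S (source_pt q) = inv (hmap S) q"
  by (simp add: source_pt_eq)

lemma anchorN_eq_rho: "anchorN S u f q = rho S (source_pt q) (u (source_pt q)) (f \<circ> hmap S)"
  by (simp add: anchorN_def source_pt_def Let_def)

lemma anchorN_scale:
  "u \<in> sectionsF S \<Longrightarrow> anchorN S (\<lambda>q. f q *\<^sub>R u q) g q = f (source_pt q) * anchorN S u g q"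
  by (simp add: anchorN_eq_rho rho_scale sectionsF_in)

lemma anchorN_add:
  "u \<in> sectionsF S \<Longrightarrow> v \<in> sectionsF S \<Longrightarrow> anchorN S (\<lambda>q. u q + v q) g q = anchorN S u g q + anchorN S v g q"
  by (simp add: anchorN_eq_rho rho_add sectionsF_in)

text \<open>At \<open>q\<close> the anchor of \<open>u\<close> is computed from the value of \<open>u\<close> at the possibly different point
  \<open>source_pt q\<close>, while the Leibniz rule makes the bracket local. Expanding the bracket of \<open>b u\<close> and \<open>g u\<close> with the
  Leibniz rule in either argument, for a function \<open>b\<close> with \<open>b = 1\<close> at \<open>source_pt q\<close> and \<open>b = 0\<close> near \<open>q\<close>, shows
  that the anchor is zero wherever these points differ. This is the reason why the anchor is linear
  over the functions.\<close>

lemma anchorN_zero: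
  assumes u: "u \<in> sectionsF S" and g: "smooth_fun (atlasN S) UNIV g" and q: "source_pt q \<noteq> q"
  shows "anchorN S u g q = 0"
proof -
  obtain X Y where XY: "open X" "open Y" "source_pt q \<in> X" "q \<in> Y" "X \<inter> Y = {}"
    using hausdorff[OF q] by blast
  obtain b where b: "bump_at (atlasN S) X (source_pt q) b" by (rule F.ex_bump[OF XY(1,3)])
  note bs = bump_at_smooth[OF b]
  have b1: "b (source_pt q) = 1" by (rule bump_at_eq_1[OF b])
  have bY: "b y = 0" if "y \<in> Y" for y using bump_at_eq_0[OF b] that XY by blast
  \<comment> \<open>\<open>h\<close> maps the point of differentiation \<open>\<eta> (source_pt q)\<close> to \<open>q\<close>, and \<open>b\<close> is zero near \<open>q\<close>\<close>
  have loc: "anchorN S v b q = 0" if v: "v \<in> sectionsF S" for v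
  proof -
    note t = rho_tangent[OF sectionsF_in[OF v, of "source_pt q"]]
    have "rho S (source_pt q) (v (source_pt q)) (b \<circ> hmap S) = rho S (source_pt q) (v (source_pt q)) (\<lambda>x. 0)"
      by (rule E.tangent_local[OF t smooth_fun_h_UNIV[OF bs] E.smooth_fun_const[OF open_UNIV] continuous_h(1)[OF XY(2)]])
        (use XY bY in auto)
    then show ?thesis using E.tangent_zero[OF t] by (simp add: anchorN_eq_rho)
  qed
  have nz: "anchorN S v g q = 0" if v: "v \<in> sectionsF S" "v q \<noteq> 0" for v
  proof -
    have bv: "(\<lambda>q. b q *\<^sub>R v q) \<in> sectionsF S" and gv: "(\<lambda>q. g q *\<^sub>R v q) \<in> sectionsF S"
      using sectionsF_scale bs g v by auto
    have "bracket S (\<lambda>q. b q *\<^sub>R v q) (\<lambda>q. g q *\<^sub>R v q) q = anchorN S v g q *\<^sub>R v q"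
      using bracket_scale_right[OF bv v(1) g, of q] bracket_scale_left[OF v(1) v(1) bs, of q] loc[OF v(1)]
        bracket_self[OF v(1)] anchorN_scale[OF v(1), of b g q] b1 by simp
    moreover have "bracket S (\<lambda>q. g q *\<^sub>R v q) (\<lambda>q. b q *\<^sub>R v q) q = 0"
      using bracket_scale_right[OF gv v(1) bs, of q] loc[OF gv] bY[OF XY(4)] by simp
    ultimately show ?thesis using bracket_antisym[OF gv bv, of q] v(2) by simp
  qed
  show ?thesis
  proof (cases "u q = 0")
    case True
    \<comment> \<open>both \<open>v\<close> and \<open>u + v\<close> are nonzero at \<open>q\<close> for any section \<open>v\<close> that is\<close>
    obtain V t where V: "(V, t) \<in> frames (bundleF S)" "q \<in> V" by (rule F.frame_cover)
    let ?k = "undefined :: 'p"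
    have bt: "basis_of (fibre (bundleF S) q) (\<lambda>k. t k q)" by (rule F.frame_basis[OF V])
    have "t ?k q \<noteq> 0" using coef_basis[OF bt, of ?k ?k] coef_zero[of "\<lambda>k. t k q" ?k] by auto
    moreover obtain v where "v \<in> sectionsF S" "v q = t ?k q"
      using F.section_extends[OF basis_of_in[OF bt, of ?k]] by (auto simp: sectionsF_iff)
    ultimately show ?thesis
      using nz[OF sectionsF_add[OF u, of v]] nz[of v] anchorN_add[OF u, of v g q] True by simp
  qed (rule nz[OF u])
qed

text \<open>The anchor over \<open>x\<close> as a map on the fibre of \<open>F\<close> at \<open>h x\<close>. The vectors \<open>rho S (hmap S x) a\<close> are tangent at
  \<open>\<eta> (h x)\<close>; where this is not \<open>x\<close>, the anchor vanishes by \<open>anchorN_zero\<close>.\<close>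

definition anch :: "'m \<Rightarrow> 'f \<Rightarrow> ('m \<Rightarrow> real) \<Rightarrow> real" where
  "anch x a g = (if eta S (hmap S x) = x then rho S (hmap S x) a g else 0)"

lemma source_pt_h: "source_pt (hmap S x) = inv (eta S) x"
  by (simp add: source_pt_eq)

lemma anchorN_eq_anch:
  assumes "u \<in> sectionsF S" "smooth_fun (atlasN S) UNIV f"
  shows "anchorN S u f (hmap S x) = anch x (u (hmap S x)) (f \<circ> hmap S)"
proof (cases "eta S (hmap S x) = x")
  case True
  then have "source_pt (hmap S x) = hmap S x" using inv_eta(1)[of "hmap S x"] by (simp add: source_pt_h)
  then show ?thesis using True by (simp add: anch_def anchorN_eq_rho)
next
  case False
  then have "source_pt (hmap S x) \<noteq> hmap S x" by (metis inv_eta(2) source_pt_h)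
  then show ?thesis using False anchorN_zero[OF assms] by (simp add: anch_def)
qed

lemma anch_lin: "lin_on (fibre (bundleF S) (hmap S x)) (\<lambda>a. anch x a g)"
  using rho_add rho_scale by (simp add: lin_on_def anch_def)

lemma anch_sum:
  fixes t :: "'p \<Rightarrow> 'f"
  assumes "basis_of (fibre (bundleF S) (hmap S x)) t"
  shows "anch x (\<Sum>k\<in>UNIV. c k *\<^sub>R t k) g = (\<Sum>k\<in>UNIV. c k * anch x (t k) g)"
  using lin_on_sum[OF anch_lin F.fibre_subspace, of UNIV t _ c] basis_of_in[OF assms] by simp

lemma chart_deriv_linear:
  assumes "smooth_chart (atlasM S) U \<phi>" "x \<in> U" "smooth_fun (atlasM S) UNIV g"
  shows "linear (\<lambda>c. E.chart_deriv U \<phi> x c g)"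
  unfolding E.chart_deriv_def
  by (rule bounded_linear.linear[OF has_derivative_bounded_linear[OF
          smooth_on_has_derivative[OF E.smooth_fun_chart[OF assms(1) open_UNIV assms(3)]]]])
    (use assms(2) in auto)

lemma anch_chart:
  assumes "smooth_chart (atlasM S) U \<phi>" "x \<in> U" "a \<in> fibre (bundleF S) (hmap S x)"
  obtains c where "\<And>g. smooth_fun (atlasM S) UNIV g \<Longrightarrow> anch x a g = E.chart_deriv U \<phi> x c g"
proof (cases "eta S (hmap S x) = x")
  case True
  have "rho S (hmap S x) a \<in> tangent_space (atlasM S) x" using rho_tangent[OF assms(3)] True by simp
  from E.tangent_space_chart[OF assms(1,2) this]
  obtain c where "\<And>g. smooth_fun (atlasM S) UNIV g \<Longrightarrow> rho S (hmap S x) a g = E.chart_deriv U \<phi> x c g" by metis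
  then show thesis using True by (intro that[of c]) (simp add: anch_def)
next
  case False
  show thesis
    by (rule that[of 0]) (use False linear_0[OF chart_deriv_linear[OF assms(1,2)]] in \<open>auto simp: anch_def\<close>)
qed

lemma chart_deriv_unique:
  assumes "smooth_chart (atlasM S) U \<phi>" "x \<in> U"
    and "\<And>g. smooth_fun (atlasM S) UNIV g \<Longrightarrow> E.chart_deriv U \<phi> x c g = E.chart_deriv U \<phi> x d g"
  shows "c = d"
proof -
  obtain b where b: "bump_at (atlasM S) U x b"
    using E.ex_bump[OF chart_on_open[OF E.smooth_chart_on[OF assms(1)]] assms(2)] by blast
  have "c $ i = d $ i" for i
  proof -
    have "smooth_fun (atlasM S) UNIV (\<lambda>x. b x * \<phi> x $ i)"
      by (rule E.smooth_fun_bump_mult[OF b chart_on_open[OF E.smooth_chart_on[OF assms(1)]] E.smooth_fun_coordinate[OF assms(1)]])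
    from assms(3)[OF this] show ?thesis using E.chart_deriv_coordinate[OF assms(1,2) b] by simp
  qed
  then show ?thesis by (simp add: vec_eq_iff)
qed

lemma rho_smooth:
  assumes u: "u \<in> sectionsF S" and g: "smooth_fun (atlasM S) UNIV g"
  shows "smooth_fun (atlasN S) UNIV (\<lambda>q. rho S q (u q) g)"
proof (rule F.smooth_fun_locally)
  fix q
  obtain V t where V: "(V, t) \<in> frames (bundleF S)" "q \<in> V" by (rule F.frame_cover)
  have "smooth_fun (atlasN S) V (\<lambda>q. rho S q (t k q) g)" for k
    using morphism V(1) g by (fastforce simp: bundle_morphism_TM_def)
  moreover have "smooth_fun (atlasN S) V (\<lambda>q. coef (\<lambda>j. t j q) (u q) k)" for k
    using F.local_section_smooth[OF _ V(1), of UNIV u k] u by (simp add: sectionsF_iff)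
  ultimately have "smooth_fun (atlasN S) V (\<lambda>q. \<Sum>k\<in>UNIV. coef (\<lambda>j. t j q) (u q) k * rho S q (t k q) g)"
    by (intro F.smooth_fun_sum F.smooth_fun_mult F.frame_open[OF V(1)]) auto
  then have "smooth_fun (atlasN S) V (\<lambda>q. rho S q (u q) g)"
  proof (rule F.smooth_fun_cong[OF F.frame_open[OF V(1)], rotated])
    fix y assume y: "y \<in> V"
    note bt = F.frame_basis[OF V(1) y]
    have "rho S y (\<Sum>k\<in>UNIV. coef (\<lambda>j. t j y) (u y) k *\<^sub>R t k y)
        = (\<Sum>k\<in>UNIV. coef (\<lambda>j. t j y) (u y) k *\<^sub>R rho S y (t k y))"
      by (rule lin_on_sum[OF rho_lin F.fibre_subspace]) (auto intro: basis_of_in[OF bt])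
    then have "rho S y (u y) = (\<Sum>k\<in>UNIV. coef (\<lambda>j. t j y) (u y) k *\<^sub>R rho S y (t k y))"
      using basis_of_expand[OF bt sectionsF_in[OF u]] by simp
    then show "(\<Sum>k\<in>UNIV. coef (\<lambda>j. t j y) (u y) k * rho S y (t k y) g) = rho S y (u y) g"
      by (simp add: scaleR_fun_def sum_apply)
  qed
  then show "\<exists>V. open V \<and> q \<in> V \<and> smooth_fun (atlasN S) V (\<lambda>q. rho S q (u q) g)"
    using V F.frame_open[OF V(1)] by blast
qed

text \<open>The case distinction in \<open>anch\<close> disappears when the section is evaluated at
  \<open>\<eta>\<^sup>-\<^sup>1 x\<close> instead of \<open>h x\<close>.\<close>

lemma anch_smooth:
  assumes u: "u \<in> sectionsF S" and g: "smooth_fun (atlasM S) UNIV g"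
  shows "smooth_fun (atlasM S) UNIV (\<lambda>x. anch x (u (hmap S x)) g)"
proof -
  have "anch x (u (hmap S x)) g = rho S (inv (eta S) x) (u (inv (eta S) x)) g" for x
  proof -
    have "(g \<circ> inv (hmap S)) \<circ> hmap S = g" by auto
    then show ?thesis
      using anchorN_eq_anch[OF u smooth_fun_inv_h[OF g], of x] by (simp add: anchorN_eq_rho source_pt_h)
  qed
  then show ?thesis
    using smooth_fun_compose[OF manifolds smooth_inv_eta open_UNIV rho_smooth[OF u g]] by (simp add: o_def)
qed

section \<open>The natural base\<close>

lemma local_coords_bundle_chart: "local_coords S K \<Longrightarrow> E.bundle_chart (nbhd K) (xchart K) (sframe K)"
  by (simp add: local_coords_def E.bundle_chart_def)

lemma local_coords_chart: "local_coords S K \<Longrightarrow> smooth_chart (atlasM S) (nbhd K) (xchart K)"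
  and local_coords_frameF: "local_coords S K \<Longrightarrow> local_frame (atlasN S) (bundleF S) (hmap S ` nbhd K) (tframe K)"
  and local_coords_open: "local_coords S K \<Longrightarrow> open (nbhd K)"
  using E.bundle_chart_open[OF local_coords_bundle_chart] by (auto simp: local_coords_def)

lemma basisF: "local_coords S K \<Longrightarrow> x \<in> nbhd K \<Longrightarrow> basis_of (fibre (bundleF S) (hmap S x)) (\<lambda>\<alpha>. tframe K \<alpha> (hmap S x))"
  using F.local_frame_basis[OF local_coords_frameF] by blast

lemma ex_local_coords: obtains K where "local_coords S K" "x \<in> nbhd K"
proof -
  obtain U \<phi> s where U: "E.bundle_chart U \<phi> s" "x \<in> U" by (rule E.ex_bundle_chart)
  obtain V t where V: "(V, t) \<in> frames (bundleF S)" "hmap S x \<in> V" by (rule F.frame_cover)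
  define W where "W = U \<inter> hmap S -` V"
  have W: "open W" "W \<subseteq> U" "x \<in> W" "hmap S ` W \<subseteq> V"
    using E.bundle_chart_open[OF U(1)] continuous_h(1)[OF F.frame_open[OF V(1)]] U V by (auto simp: W_def)
  have "E.bundle_chart W \<phi> s" by (rule E.bundle_chart_restrict[OF U(1) W(1,2)])
  moreover have "local_frame (atlasN S) (bundleF S) (hmap S ` W) t"
    by (rule F.local_frame_subset[OF F.frame_local_frame[OF V(1)] continuous_h(2)[OF W(1)] W(4)])
  ultimately have "local_coords S \<lparr>nbhd = W, xchart = \<phi>, tframe = t, sframe = s\<rparr>"
    by (simp add: local_coords_def E.bundle_chart_def)
  then show thesis using W(3) by (intro that) auto
qed

lemma partial_deriv_eq: "partial_deriv K w f e = E.bundle_deriv (nbhd K) (xchart K) (sframe K) w f e"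
  by (cases e) (simp add: partial_deriv_def E.bundle_deriv_def bundle_coord_def)

text \<open>The global section obtained from a frame field of \<open>F\<close> with a bump function; \<open>N\<close> and \<open>M\<close> are
  identified by \<open>h\<close>, so the bump function is a function on \<open>M\<close>.\<close>

definition bumpF :: "('m, 'n, 'f, 'b, 'i, 'p, 'r) coords \<Rightarrow> ('m \<Rightarrow> real) \<Rightarrow> 'p \<Rightarrow> 'n \<Rightarrow> 'f" where
  "bumpF K b \<alpha> q = b (inv (hmap S) q) *\<^sub>R tframe K \<alpha> q"

lemma bump_at_inv_h:
  assumes "bump_at (atlasM S) W x b"
  shows "bump_at (atlasN S) (hmap S ` W) (hmap S x) (b \<circ> inv (hmap S))"
proof -
  obtain C V where CV: "closed C" "C \<subseteq> W" "open V" "x \<in> V" "V \<subseteq> C" "\<forall>y\<in>V. b y = 1" "\<forall>y. y \<notin> C \<longrightarrow> b y = 0"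
    using assms by (auto simp: bump_at_def)
  have "- (hmap S ` C) = hmap S ` (- C)" using bij_h by (simp add: bij_image_Compl_eq)
  then have "closed (hmap S ` C)" using continuous_h(2)[of "- C"] CV(1) by (simp add: closed_def)
  moreover have "\<forall>q. q \<notin> hmap S ` C \<longrightarrow> (b \<circ> inv (hmap S)) q = 0"
    using CV(7) inv_h(2) by (metis comp_apply imageI)
  ultimately show ?thesis
    unfolding bump_at_def using smooth_fun_inv_h[OF bump_at_smooth[OF assms]] CV continuous_h(2)
    by (intro conjI exI[of _ "hmap S ` C"] exI[of _ "hmap S ` V"]) auto
qed

lemma bumpF_section:
  assumes "local_coords S K" "bump_at (atlasM S) (nbhd K) x b"
  shows "bumpF K b \<alpha> \<in> sectionsF S"
  using F.local_section_bump[OF bump_at_inv_h[OF assms(2)] continuous_h(2)[OF local_coords_open[OF assms(1)]]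
      F.local_frame_section[OF local_coords_frameF[OF assms(1)]], of \<alpha>]
  by (simp add: sectionsF_iff bumpF_def[abs_def])

lemma bumpF_eq: "bumpF K b \<alpha> (hmap S x) = b x *\<^sub>R tframe K \<alpha> (hmap S x)"
  by (simp add: bumpF_def)

lemma coords_bump:
  assumes "local_coords S K" "x \<in> nbhd K"
  obtains b V where "bump_at (atlasM S) (nbhd K) x b" "open V" "x \<in> V" "V \<subseteq> nbhd K"
    "\<And>y. y \<in> V \<Longrightarrow> b y = 1" "\<And>y. y \<in> V \<Longrightarrow> bump_at (atlasM S) (nbhd K) y b"
proof -
  obtain b where b: "bump_at (atlasM S) (nbhd K) x b" by (rule E.ex_bump[OF local_coords_open[OF assms(1)] assms(2)])
  from bump_at_center[OF b] that[OF b] show thesis by blast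
qed

lemma chart_deriv_axis_sum:
  assumes "smooth_chart (atlasM S) U \<phi>" "x \<in> U" "smooth_fun (atlasM S) UNIV g"
  shows "(\<Sum>i\<in>UNIV. c $ i * frechet_derivative (g \<circ> inv_into U \<phi>) (at (\<phi> x)) (axis i 1)) = E.chart_deriv U \<phi> x c g"
proof -
  have "E.chart_deriv U \<phi> x (\<Sum>i\<in>UNIV. c $ i *\<^sub>R axis i 1) g
      = (\<Sum>i\<in>UNIV. c $ i *\<^sub>R E.chart_deriv U \<phi> x (axis i 1) g)"
    using linear_combination[OF chart_deriv_linear[OF assms], of "\<lambda>i. c $ i" "\<lambda>i. axis i 1" UNIV] by simp
  then show ?thesis using basis_expansion[of c] by (simp add: E.chart_deriv_def scalar_mult_eq_scaleR)
qed

text \<open>The definite description behind \<open>anchor_coef\<close> is met by the components of the anchor in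
  the chart, because \<open>anch\<close> depends on the value of the section only. It is met by
  nothing else because the frame extends to global sections.\<close>

lemma anchor_coef_anch:
  assumes K: "local_coords S K" and x: "x \<in> nbhd K" and g: "smooth_fun (atlasM S) UNIV g"
  shows "anch x (tframe K \<alpha> (hmap S x)) g = E.chart_deriv (nbhd K) (xchart K) x (anchor_coef S K \<alpha> x) g"
proof -
  note sc = local_coords_chart[OF K]
  have aF: "tframe K \<alpha> (hmap S x) \<in> fibre (bundleF S) (hmap S x)" using basis_of_in[OF basisF[OF K x]] .
  obtain c0 where c0: "\<And>g. smooth_fun (atlasM S) UNIV g \<Longrightarrow>
      anch x (tframe K \<alpha> (hmap S x)) g = E.chart_deriv (nbhd K) (xchart K) x c0 g"
    using anch_chart[OF sc x aF] by blast
  obtain b V where b: "bump_at (atlasM S) (nbhd K) x b" "open V" "x \<in> V" "\<And>y. y \<in> V \<Longrightarrow> b y = 1"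
    using coords_bump[OF K x] by metis
  define P where "P c \<longleftrightarrow> (\<forall>u\<in>sectionsF S. \<forall>V f. open V \<and> hmap S x \<in> V \<and> (\<forall>q\<in>V. u q = tframe K \<alpha> q) \<and>
     smooth_fun (atlasN S) UNIV f \<longrightarrow> anchorN S u f (hmap S x) =
       (\<Sum>i\<in>UNIV. c $ i * frechet_derivative (f \<circ> hmap S \<circ> inv_into (nbhd K) (xchart K))
                            (at (xchart K x)) (axis i 1)))" for c
  have "P c0" unfolding P_def
    using anchorN_eq_anch chart_deriv_axis_sum[OF sc x smooth_fun_h_UNIV] c0 smooth_fun_h_UNIV by auto
  moreover have "c = c0" if "P c" for c
  proof (rule chart_deriv_unique[OF sc x])
    fix g :: "'m \<Rightarrow> real" assume g: "smooth_fun (atlasM S) UNIV g"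
    let ?f = "g \<circ> inv (hmap S)"
    have f: "smooth_fun (atlasN S) UNIV ?f" "?f \<circ> hmap S = g" using smooth_fun_inv_h[OF g] by auto
    have "anchorN S (bumpF K b \<alpha>) ?f (hmap S x) =
       (\<Sum>i\<in>UNIV. c $ i * frechet_derivative (?f \<circ> hmap S \<circ> inv_into (nbhd K) (xchart K)) (at (xchart K x)) (axis i 1))"
      using that[unfolded P_def, rule_format, OF bumpF_section[OF K b(1), of \<alpha>], of "hmap S ` V" ?f] b continuous_h(2)[OF b(2)] f(1)
      by (auto simp: bumpF_eq)
    then show "E.chart_deriv (nbhd K) (xchart K) x c g = E.chart_deriv (nbhd K) (xchart K) x c0 g"
      using anchorN_eq_anch[OF bumpF_section[OF K b(1), of \<alpha>] f(1), of x] chart_deriv_axis_sum[OF sc x g, of c] c0[OF g] f(2)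
        bump_at_eq_1[OF b(1)] by (simp add: bumpF_eq)
  qed
  ultimately have "(THE c. P c) = c0" by (rule the_equality)
  then have "anchor_coef S K \<alpha> x = c0" by (simp add: anchor_coef_def P_def)
  then show ?thesis using c0[OF g] by simp
qed

lemma anchor_coef_smooth:
  assumes K: "local_coords S K"
  shows "smooth_fun (atlasM S) (nbhd K) (\<lambda>x. anchor_coef S K \<alpha> x $ i)"
proof (rule E.smooth_fun_locally)
  fix x assume x: "x \<in> nbhd K"
  obtain b V where b: "bump_at (atlasM S) (nbhd K) x b" "open V" "x \<in> V" "V \<subseteq> nbhd K" "\<And>y. y \<in> V \<Longrightarrow> b y = 1"
    "\<And>y. y \<in> V \<Longrightarrow> bump_at (atlasM S) (nbhd K) y b"
    using coords_bump[OF K x] by metis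
  let ?g = "\<lambda>x. b x * xchart K x $ i"
  have g: "smooth_fun (atlasM S) UNIV ?g"
    by (rule E.smooth_fun_bump_mult[OF b(1) local_coords_open[OF K] E.smooth_fun_coordinate[OF local_coords_chart[OF K]]])
  have "smooth_fun (atlasM S) V (\<lambda>x. anchor_coef S K \<alpha> x $ i)"
  proof (rule E.smooth_fun_cong[OF b(2) _ E.smooth_fun_subset[OF anch_smooth[OF bumpF_section[OF K b(1), of \<alpha>] g]]])
    fix y assume y: "y \<in> V"
    then have yK: "y \<in> nbhd K" using b(4) by auto
    show "anch y (bumpF K b \<alpha> (hmap S y)) ?g = anchor_coef S K \<alpha> y $ i"
      using anchor_coef_anch[OF K yK g] E.chart_deriv_coordinate[OF local_coords_chart[OF K] yK b(6)[OF y]] b(5)[OF y]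
      by (simp add: bumpF_eq)
  qed simp
  then show "\<exists>V. open V \<and> x \<in> V \<and> smooth_fun (atlasM S) V (\<lambda>x. anchor_coef S K \<alpha> x $ i)" using b by blast
qed

definition tanE :: "('m, 'n, 'f, 'b, 'i, 'p, 'r) coords \<Rightarrow> (real ^ 'i) \<times> (real ^ 'r) \<Rightarrow> 'm \<times> 'b \<Rightarrow> ('m \<times> 'b \<Rightarrow> real) \<Rightarrow> real" where
  "tanE K w e f = (if smoothE S UNIV f then partial_deriv K w f e else 0)"

lemma tanE_linear:
  assumes "local_coords S K" "fst e \<in> nbhd K" shows "linear (\<lambda>w. tanE K w e f)"
proof (cases "smoothE S UNIV f")
  case True
  then show ?thesis
    using E.bundle_deriv_linear[OF local_coords_bundle_chart[OF assms(1)] open_UNIV _ True, of e] assms(2)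
    by (simp add: tanE_def partial_deriv_eq)
qed (simp add: tanE_def linear_zero)

lemma tanE_pullback:
  assumes "local_coords S K" "fst e \<in> nbhd K" "smooth_fun (atlasM S) UNIV g"
  shows "tanE K (c, y) e (\<lambda>e. g (fst e)) = E.chart_deriv (nbhd K) (xchart K) (fst e) c g"
  using E.bundle_deriv_pullback[OF local_coords_bundle_chart[OF assms(1)] assms(2,3)]
    E.smooth_total_pullback[OF open_UNIV assms(3)] by (simp add: tanE_def partial_deriv_eq)

text \<open>Fibre coordinates are defined on whole fibres, so that a cut-off in the base makes them global
  functions on \<open>E\<close>. They detect the vertical components of tangent vectors.\<close>

definition fibre_coord :: "('m, 'n, 'f, 'b, 'i, 'p, 'r) coords \<Rightarrow> ('m \<Rightarrow> real) \<Rightarrow> 'r \<Rightarrow> 'm \<times> 'b \<Rightarrow> real" where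
  "fibre_coord K b a e = b (fst e) * coef (\<lambda>k. sframe K k (fst e)) (snd e) a"

lemma fibre_coord_smooth:
  "local_coords S K \<Longrightarrow> bump_at (atlasM S) (nbhd K) x b \<Longrightarrow> smoothE S UNIV (fibre_coord K b a)"
  unfolding fibre_coord_def
  using E.smooth_total_bump_mult local_coords_open E.smooth_total_fibre_coord local_coords_bundle_chart by blast

lemma tanE_fibre_coord:
  assumes K: "local_coords S K" and b: "bump_at (atlasM S) (nbhd K) (fst e) b" and e: "fst e \<in> nbhd K"
  shows "tanE K (c, y) e (fibre_coord K b a) = y $ a"
proof -
  obtain V where V: "open V" "fst e \<in> V" "V \<subseteq> nbhd K" "\<And>y. y \<in> V \<Longrightarrow> b y = 1"
    by (rule bump_at_plateau[OF b]) blast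
  have "E.bundle_deriv (nbhd K) (xchart K) (sframe K) (c, y) (fibre_coord K b a) e
     = E.bundle_deriv (nbhd K) (xchart K) (sframe K) (c, y) (\<lambda>e. coef (\<lambda>k. sframe K k (fst e)) (snd e) a) e"
    by (rule E.bundle_deriv_cong[OF local_coords_bundle_chart[OF K] V(1,2) e]) (use V in \<open>auto simp: fibre_coord_def\<close>)
  then show ?thesis
    using E.bundle_deriv_fibre_coord[OF local_coords_bundle_chart[OF K] e] fibre_coord_smooth[OF K b]
    by (simp add: tanE_def partial_deriv_eq)
qed

lemma nat_frame_Inl:
  assumes "local_coords S K" "fst e \<in> nbhd K"
  shows "nat_frame S K e (Inl \<alpha>) = (tframe K \<alpha> (hmap S (fst e)), tanE K (anchor_coef S K \<alpha> (fst e), 0) e)"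
proof -
  have "(\<Sum>i\<in>UNIV. anchor_coef S K \<alpha> (fst e) $ i * pdx K i f e)
      = tanE K (anchor_coef S K \<alpha> (fst e), 0) e f" if "smoothE S UNIV f" for f
  proof -
    let ?c = "anchor_coef S K \<alpha> (fst e)"
    have "(?c, 0) = (\<Sum>i\<in>UNIV. ?c $ i *\<^sub>R (axis i 1, 0 :: real ^ 'r))"
      using basis_expansion[of ?c] by (simp add: prod_eq_iff fst_sum snd_sum scalar_mult_eq_scaleR)
    then have "tanE K (?c, 0) e f = (\<Sum>i\<in>UNIV. ?c $ i * tanE K (axis i 1, 0) e f)"
      using linear_combination[OF tanE_linear[OF assms, of f], of "\<lambda>i. ?c $ i" "\<lambda>i. (axis i 1, 0)" UNIV] by simp
    then show ?thesis using that by (simp add: tanE_def)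
  qed
  then show ?thesis by (auto simp: tanE_def fun_eq_iff)
qed

lemma nat_frame_Inr: "nat_frame S K e (Inr a) = (0, tanE K (0, axis a 1) e)"
  by (auto simp: tanE_def fun_eq_iff)

lemma nat_frame_sum:
  assumes "local_coords S K" "fst e \<in> nbhd K"
  shows "(\<Sum>k\<in>UNIV. z k *\<^sub>R nat_frame S K e k) = (\<Sum>\<alpha>\<in>UNIV. z (Inl \<alpha>) *\<^sub>R tframe K \<alpha> (hmap S (fst e)),
     tanE K (\<Sum>\<alpha>\<in>UNIV. z (Inl \<alpha>) *\<^sub>R anchor_coef S K \<alpha> (fst e), \<chi> a. z (Inr a)) e)"
proof (rule prod_eqI)
  show "fst (\<Sum>k\<in>UNIV. z k *\<^sub>R nat_frame S K e k) = fst (\<Sum>\<alpha>\<in>UNIV. z (Inl \<alpha>) *\<^sub>R tframe K \<alpha> (hmap S (fst e)),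
     tanE K (\<Sum>\<alpha>\<in>UNIV. z (Inl \<alpha>) *\<^sub>R anchor_coef S K \<alpha> (fst e), \<chi> a. z (Inr a)) e)"
    by (simp add: fst_sum sum_UNIV_Plus)
  show "snd (\<Sum>k\<in>UNIV. z k *\<^sub>R nat_frame S K e k) = snd (\<Sum>\<alpha>\<in>UNIV. z (Inl \<alpha>) *\<^sub>R tframe K \<alpha> (hmap S (fst e)),
     tanE K (\<Sum>\<alpha>\<in>UNIV. z (Inl \<alpha>) *\<^sub>R anchor_coef S K \<alpha> (fst e), \<chi> a. z (Inr a)) e)"
  proof
    fix f
    let ?w = "(\<Sum>\<alpha>\<in>UNIV. z (Inl \<alpha>) *\<^sub>R anchor_coef S K \<alpha> (fst e), \<chi> a. z (Inr a))"
    have "?w = (\<Sum>\<alpha>\<in>UNIV. z (Inl \<alpha>) *\<^sub>R (anchor_coef S K \<alpha> (fst e), 0)) + (\<Sum>a\<in>UNIV. z (Inr a) *\<^sub>R (0, axis a 1))"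
      using basis_expansion[of "\<chi> a. z (Inr a)"] by (simp add: prod_eq_iff fst_sum snd_sum scalar_mult_eq_scaleR)
    then have "tanE K ?w e f = (\<Sum>\<alpha>\<in>UNIV. z (Inl \<alpha>) * tanE K (anchor_coef S K \<alpha> (fst e), 0) e f)
        + (\<Sum>a\<in>UNIV. z (Inr a) * tanE K (0, axis a 1) e f)"
      using linear_add[OF tanE_linear[OF assms, of f]]
        linear_combination[OF tanE_linear[OF assms, of f], of "\<lambda>\<alpha>. z (Inl \<alpha>)" "\<lambda>\<alpha>. (anchor_coef S K \<alpha> (fst e), 0)" UNIV]
        linear_combination[OF tanE_linear[OF assms, of f], of "\<lambda>a. z (Inr a)" "\<lambda>a. (0, axis a 1)" UNIV]
      by (simp only:)
    then show "snd (\<Sum>k\<in>UNIV. z k *\<^sub>R nat_frame S K e k) f = snd (\<Sum>\<alpha>\<in>UNIV. z (Inl \<alpha>) *\<^sub>R tframe K \<alpha> (hmap S (fst e)), tanE K ?w e) f"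
      by (simp add: snd_sum sum_UNIV_Plus nat_frame_Inl[OF assms] nat_frame_Inr scaleR_fun_def sum_apply del: nat_frame.simps)
  qed
qed

text \<open>A description of the fibre that mentions no frame: pairs of an element of \<open>F\<close> and a tangent vector
  of \<open>E\<close> whose projection to \<open>M\<close> is the anchor image of the first entry. Hence all natural bases at a
  point span the same space.\<close>

definition gtv :: "'m \<times> 'b \<Rightarrow> ('m, 'f, 'b) gvec set" where
  "gtv e = {w. fst w \<in> fibre (bundleF S) (hmap S (fst e)) \<and>
     (\<exists>K z. local_coords S K \<and> fst e \<in> nbhd K \<and> snd w = tanE K z e) \<and>
     (\<forall>g. smooth_fun (atlasM S) UNIV g \<longrightarrow> snd w (\<lambda>e. g (fst e)) = anch (fst e) (fst w) g)}"

lemma tanE_change: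
  assumes "local_coords S K" "fst e \<in> nbhd K" "local_coords S K'" "fst e \<in> nbhd K'" "e \<in> totalE S"
  obtains z' where "tanE K z e = tanE K' z' e"
proof -
  obtain z' where "\<And>f. smoothE S UNIV f \<Longrightarrow> E.bundle_deriv (nbhd K) (xchart K) (sframe K) z f e
      = E.bundle_deriv (nbhd K') (xchart K') (sframe K') z' f e"
    using E.bundle_deriv_change[OF local_coords_bundle_chart[OF assms(1)] local_coords_bundle_chart[OF assms(3)] assms(5,2,4)]
    by blast
  then have "tanE K z e = tanE K' z' e" by (auto simp: tanE_def partial_deriv_eq fun_eq_iff)
  then show thesis by (rule that)
qed

lemma nat_frame_basis_gtv:
  assumes K: "local_coords S K" and e: "e \<in> totalE S" "fst e \<in> nbhd K"
  shows "basis_of (gtv e) (nat_frame S K e)"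
proof (rule basis_ofI)
  let ?t = "\<lambda>\<alpha>. tframe K \<alpha> (hmap S (fst e))" and ?c = "\<lambda>\<alpha>. anchor_coef S K \<alpha> (fst e)"
  note bF = basisF[OF K e(2)] and sc = local_coords_chart[OF K]
  have an: "anch (fst e) (\<Sum>\<alpha>\<in>UNIV. z \<alpha> *\<^sub>R ?t \<alpha>) g = E.chart_deriv (nbhd K) (xchart K) (fst e) (\<Sum>\<alpha>\<in>UNIV. z \<alpha> *\<^sub>R ?c \<alpha>) g"
    if g: "smooth_fun (atlasM S) UNIV g" for z g
  proof -
    have "E.chart_deriv (nbhd K) (xchart K) (fst e) (\<Sum>\<alpha>\<in>UNIV. z \<alpha> *\<^sub>R ?c \<alpha>) g
        = (\<Sum>\<alpha>\<in>UNIV. z \<alpha> * E.chart_deriv (nbhd K) (xchart K) (fst e) (?c \<alpha>) g)"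
      by (rule linear_combination[OF chart_deriv_linear[OF sc e(2) g]])
    then show ?thesis using anch_sum[OF bF] anchor_coef_anch[OF K e(2) g] by simp
  qed
  show "(\<Sum>k\<in>UNIV. z k *\<^sub>R nat_frame S K e k) \<in> gtv e" for z
    unfolding gtv_def nat_frame_sum[OF K e(2)]
    using basis_of_sum_in[OF bF] an tanE_pullback[OF K e(2)] K e(2) by auto
  show "\<exists>z. w = (\<Sum>k\<in>UNIV. z k *\<^sub>R nat_frame S K e k)" if w: "w \<in> gtv e" for w
  proof -
    obtain K' z' where K': "local_coords S K'" "fst e \<in> nbhd K'" "snd w = tanE K' z' e" using w by (auto simp: gtv_def)
    obtain z where "tanE K' z' e = tanE K z e" using tanE_change[OF K'(1,2) K e(2,1)] by blast
    then obtain c y where cy: "snd w = tanE K (c, y) e" using K' by (cases z) auto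
    let ?a = "\<lambda>\<alpha>. coef ?t (fst w) \<alpha>"
    have fw: "(\<Sum>\<alpha>\<in>UNIV. ?a \<alpha> *\<^sub>R ?t \<alpha>) = fst w" using w by (intro basis_of_expand[OF bF]) (simp add: gtv_def)
    have "c = (\<Sum>\<alpha>\<in>UNIV. ?a \<alpha> *\<^sub>R ?c \<alpha>)"
    proof (rule chart_deriv_unique[OF sc e(2)])
      fix g :: "'m \<Rightarrow> real" assume g: "smooth_fun (atlasM S) UNIV g"
      have "E.chart_deriv (nbhd K) (xchart K) (fst e) c g = anch (fst e) (fst w) g"
        using tanE_pullback[OF K e(2) g, of c y] cy w g by (simp add: gtv_def)
      then show "E.chart_deriv (nbhd K) (xchart K) (fst e) c g = E.chart_deriv (nbhd K) (xchart K) (fst e) (\<Sum>\<alpha>\<in>UNIV. ?a \<alpha> *\<^sub>R ?c \<alpha>) g"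
        using an[OF g, of ?a] fw by simp
    qed
    then have "w = (\<Sum>k\<in>UNIV. case_sum ?a (\<lambda>a. y $ a) k *\<^sub>R nat_frame S K e k)"
      unfolding nat_frame_sum[OF K e(2)] using fw cy by (simp add: prod_eq_iff)
    then show ?thesis by blast
  qed
  show "z k = 0" if z: "(\<Sum>k\<in>UNIV. z k *\<^sub>R nat_frame S K e k) = 0" for z k
  proof -
    have z1: "(\<Sum>\<alpha>\<in>UNIV. z (Inl \<alpha>) *\<^sub>R ?t \<alpha>) = 0"
      and z2: "tanE K (\<Sum>\<alpha>\<in>UNIV. z (Inl \<alpha>) *\<^sub>R ?c \<alpha>, \<chi> a. z (Inr a)) e = 0"
      using z unfolding nat_frame_sum[OF K e(2)] by (simp_all add: prod_eq_iff)
    have "z (Inl \<alpha>) = 0" for \<alpha> using coef_sum[OF bF, of "\<lambda>\<alpha>. z (Inl \<alpha>)" \<alpha>] z1 by (simp add: coef_zero)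
    moreover have "z (Inr a) = 0" for a
    proof -
      obtain b V where b: "bump_at (atlasM S) (nbhd K) (fst e) b" using coords_bump[OF K e(2)] by metis
      show ?thesis using tanE_fibre_coord[OF K b e(2)] fun_cong[OF z2, of "fibre_coord K b a"] by simp
    qed
    ultimately show ?thesis by (cases k) auto
  qed
qed

lemma gtb_eq_gtv:
  assumes "e \<in> totalE S" shows "gtb S e = gtv e"
proof -
  have "span (range (nat_frame S K e)) = gtv e" if "local_coords S K" "fst e \<in> nbhd K" for K
    using nat_frame_basis_gtv[OF that(1) assms that(2)] by (simp add: basis_of_def)
  moreover obtain K where "local_coords S K" "fst e \<in> nbhd K" by (rule ex_local_coords)
  ultimately show ?thesis unfolding gtb_def by blast
qed

lemma nat_frame_basis:
  "local_coords S K \<Longrightarrow> e \<in> totalE S \<Longrightarrow> fst e \<in> nbhd K \<Longrightarrow> basis_of (gtb S e) (nat_frame S K e)"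
  using nat_frame_basis_gtv gtb_eq_gtv by metis

lemma gtb_subspace: "e \<in> totalE S \<Longrightarrow> subspace (gtb S e)"
  using ex_local_coords[of "fst e"] nat_frame_basis basis_of_subspace by metis

lemma gtb_fst: "e \<in> totalE S \<Longrightarrow> w \<in> gtb S e \<Longrightarrow> fst w \<in> fibre (bundleF S) (hmap S (fst e))"
  by (simp add: gtb_eq_gtv gtv_def)

lemma gtb_snd_pullback:
  "e \<in> totalE S \<Longrightarrow> w \<in> gtb S e \<Longrightarrow> smooth_fun (atlasM S) UNIV g \<Longrightarrow>
     snd w (\<lambda>e. g (fst e)) = anch (fst e) (fst w) g"
  by (simp add: gtb_eq_gtv gtv_def)

lemma coef_Inl:
  assumes "local_coords S K" "e \<in> totalE S" "fst e \<in> nbhd K" "w \<in> gtb S e"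
  shows "coef (nat_frame S K e) w (Inl \<alpha>) = coef (\<lambda>\<alpha>. tframe K \<alpha> (hmap S (fst e))) (fst w) \<alpha>"
proof -
  have "fst w = fst (\<Sum>k\<in>UNIV. coef (nat_frame S K e) w k *\<^sub>R nat_frame S K e k)"
    using basis_of_expand[OF nat_frame_basis[OF assms(1-3)] assms(4)] by simp
  then show ?thesis unfolding nat_frame_sum[OF assms(1,3)] using coef_sum[OF basisF[OF assms(1,3)]] by simp
qed

lemma coef_Inr:
  assumes "local_coords S K" "e \<in> totalE S" "fst e \<in> nbhd K" "w \<in> gtb S e" "bump_at (atlasM S) (nbhd K) (fst e) b"
  shows "coef (nat_frame S K e) w (Inr a) = snd w (fibre_coord K b a)"
proof -
  have "snd w = snd (\<Sum>k\<in>UNIV. coef (nat_frame S K e) w k *\<^sub>R nat_frame S K e k)"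
    using basis_of_expand[OF nat_frame_basis[OF assms(1-3)] assms(4)] by simp
  then show ?thesis unfolding nat_frame_sum[OF assms(1,3)] using tanE_fibre_coord[OF assms(1,5,3)] by simp
qed

lemma vertical_eq:
  assumes e: "e \<in> totalE S"
  shows "vertical S e = {w \<in> gtb S e. fst w = 0}"
    and "local_coords S K \<Longrightarrow> fst e \<in> nbhd K \<Longrightarrow> basis_of (vertical S e) (\<lambda>a. nat_frame S K e (Inr a))"
proof -
  have B: "basis_of {w \<in> gtb S e. fst w = 0} (\<lambda>a. nat_frame S K e (Inr a))"
    if K: "local_coords S K" "fst e \<in> nbhd K" for K
  proof (rule basis_ofI)
    note nb = nat_frame_basis[OF K(1) e K(2)]
    have ext: "(\<Sum>a\<in>UNIV. c a *\<^sub>R nat_frame S K e (Inr a)) = (\<Sum>k\<in>UNIV. case_sum (\<lambda>_. 0) c k *\<^sub>R nat_frame S K e k)" for c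
      by (simp add: sum_UNIV_Plus del: nat_frame.simps)
    show "(\<Sum>a\<in>UNIV. c a *\<^sub>R nat_frame S K e (Inr a)) \<in> {w \<in> gtb S e. fst w = 0}" for c
      using basis_of_sum_in[OF nb, of "case_sum (\<lambda>_. 0) c"] unfolding ext[symmetric] by (simp add: fst_sum)
    show "\<exists>c. w = (\<Sum>a\<in>UNIV. c a *\<^sub>R nat_frame S K e (Inr a))" if "w \<in> {w \<in> gtb S e. fst w = 0}" for w
    proof
      have "coef (nat_frame S K e) w (Inl \<alpha>) = 0" for \<alpha>
        using coef_Inl[OF K(1) e K(2)] that by (simp add: coef_zero)
      then show "w = (\<Sum>a\<in>UNIV. coef (nat_frame S K e) w (Inr a) *\<^sub>R nat_frame S K e (Inr a))"
        using basis_of_expand[OF nb, of w] that by (simp add: sum_UNIV_Plus del: nat_frame.simps)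
    qed
    show "c k = 0" if "(\<Sum>a\<in>UNIV. c a *\<^sub>R nat_frame S K e (Inr a)) = 0" for c k
      using coef_sum[OF nb, of "case_sum (\<lambda>_. 0) c" "Inr k"] that unfolding ext by (simp add: coef_zero)
  qed
  then have sp: "span (range (\<lambda>a. nat_frame S K e (Inr a))) = {w \<in> gtb S e. fst w = 0}"
    if "local_coords S K" "fst e \<in> nbhd K" for K using that by (simp add: basis_of_def)
  show 1: "vertical S e = {w \<in> gtb S e. fst w = 0}"
  proof -
    obtain K where "local_coords S K" "fst e \<in> nbhd K" by (rule ex_local_coords)
    then show ?thesis unfolding vertical_def using sp by blast
  qed
  show "local_coords S K \<Longrightarrow> fst e \<in> nbhd K \<Longrightarrow> basis_of (vertical S e) (\<lambda>a. nat_frame S K e (Inr a))"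
    unfolding 1 by (rule B)
qed

lemma vertical_subset: "e \<in> totalE S \<Longrightarrow> vertical S e \<subseteq> gtb S e"
  by (auto simp: vertical_eq)

end

section \<open>Sections of the generalized tangent bundle\<close>

declare nat_frame.simps [simp del] adapted_frame.simps [simp del]

context gla
begin

lemma gsec_in: "X \<in> gsections S \<Longrightarrow> e \<in> totalE S \<Longrightarrow> X e \<in> gtb S e"
  and gsec_off: "X \<in> gsections S \<Longrightarrow> e \<notin> totalE S \<Longrightarrow> X e = 0"
  and gsec_coef: "X \<in> gsections S \<Longrightarrow> local_coords S K \<Longrightarrow> smoothE S (nbhd K) (\<lambda>e. coef (nat_frame S K e) (X e) k)"
  unfolding gsections_def mem_Collect_eq by blast+

lemma gsec_expand:
  assumes "X \<in> gsections S" "local_coords S K" "e \<in> totalE S" "fst e \<in> nbhd K"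
  shows "X e = (\<Sum>k\<in>UNIV. coef (nat_frame S K e) (X e) k *\<^sub>R nat_frame S K e k)"
  using basis_of_expand[OF nat_frame_basis[OF assms(2-4)] gsec_in[OF assms(1,3)]] by simp

lemma snd_nat_smooth:
  assumes K: "local_coords S K" and f: "smoothE S UNIV f"
  shows "smoothE S (nbhd K) (\<lambda>e. snd (nat_frame S K e k) f)"
proof -
  note oK = local_coords_open[OF K]
  have pd: "smoothE S (nbhd K) (partial_deriv K w f)" for w
  proof -
    have "smoothE S (nbhd K) (E.bundle_deriv (nbhd K) (xchart K) (sframe K) w f)"
      by (rule E.bundle_deriv_smooth[OF local_coords_bundle_chart[OF K] oK order_refl E.smooth_total_subset[OF f]]) simp
    then show ?thesis by (rule E.smooth_total_cong[OF oK, rotated]) (simp add: partial_deriv_eq)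
  qed
  show ?thesis
  proof (cases k)
    case (Inl \<alpha>)
    have "smoothE S (nbhd K) (\<lambda>e. \<Sum>i\<in>UNIV. anchor_coef S K \<alpha> (fst e) $ i * pdx K i f e)"
      by (intro E.smooth_total_sum E.smooth_total_mult oK pd E.smooth_total_pullback anchor_coef_smooth[OF K]) simp
    then show ?thesis using f Inl by (simp add: nat_frame.simps)
  next
    case (Inr a)
    then show ?thesis using f pd by (simp add: nat_frame.simps)
  qed
qed

lemma snd_expand:
  assumes "local_coords S K" "e \<in> totalE S" "fst e \<in> nbhd K" "w \<in> gtb S e"
  shows "snd w f = (\<Sum>k\<in>UNIV. coef (nat_frame S K e) w k * snd (nat_frame S K e k) f)"
proof -
  have "snd w = snd (\<Sum>k\<in>UNIV. coef (nat_frame S K e) w k *\<^sub>R nat_frame S K e k)"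
    using basis_of_expand[OF nat_frame_basis[OF assms(1-3)] assms(4)] by simp
  then show ?thesis by (simp add: snd_sum sum_apply scaleR_fun_def)
qed

lemma smooth_derivative_coefs:
  assumes K: "local_coords S K" and V: "open V" "V \<subseteq> nbhd K"
    and X: "\<And>e. e \<in> totalE S \<Longrightarrow> fst e \<in> V \<Longrightarrow> X e \<in> gtb S e"
    and c: "\<And>k. smoothE S V (\<lambda>e. coef (nat_frame S K e) (X e) k)" and f: "smoothE S UNIV f"
  shows "smoothE S V (\<lambda>e. snd (X e) f)"
proof -
  have "smoothE S V (\<lambda>e. \<Sum>k\<in>UNIV. coef (nat_frame S K e) (X e) k * snd (nat_frame S K e k) f)"
    using E.smooth_total_subset[OF snd_nat_smooth[OF K f] V(2)]
    by (intro E.smooth_total_sum E.smooth_total_mult V(1) c) auto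
  then show ?thesis
  proof (rule E.smooth_total_cong[OF V(1), rotated])
    fix e assume "e \<in> totalE S" "fst e \<in> V"
    then show "(\<Sum>k\<in>UNIV. coef (nat_frame S K e) (X e) k * snd (nat_frame S K e k) f) = snd (X e) f"
      using snd_expand[OF K, of e "X e" f] V(2) X[of e] by auto
  qed
qed

lemma gsec_derivative_smooth:
  assumes "X \<in> gsections S" "smoothE S UNIV f" shows "smoothE S UNIV (\<lambda>e. snd (X e) f)"
proof (rule E.smooth_total_locally)
  fix x
  obtain K where K: "local_coords S K" "x \<in> nbhd K" by (rule ex_local_coords)
  have "smoothE S (nbhd K) (\<lambda>e. snd (X e) f)"
    by (rule smooth_derivative_coefs[OF K(1) local_coords_open[OF K(1)] order_refl gsec_in[OF assms(1)] gsec_coef[OF assms(1) K(1)] assms(2)])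
  then show "\<exists>V. open V \<and> x \<in> V \<and> smoothE S V (\<lambda>e. snd (X e) f)" using K local_coords_open by blast
qed

text \<open>Smooth coefficients in one natural base around each point suffice: the coefficients with
  index \<open>Inl \<alpha>\<close> change by a change of frame of \<open>F\<close>, and the vertical ones are the derivatives of cut-off fibre coordinates,
  so no transformation rule for the natural bases is used.\<close>

lemma gsectionI:
  assumes X: "\<And>e. e \<in> totalE S \<Longrightarrow> X e \<in> gtb S e" and off: "\<And>e. e \<notin> totalE S \<Longrightarrow> X e = 0"
    and loc: "\<And>x. \<exists>K V. local_coords S K \<and> open V \<and> x \<in> V \<and> V \<subseteq> nbhd K \<and>
      (\<forall>k. smoothE S V (\<lambda>e. coef (nat_frame S K e) (X e) k))"
  shows "X \<in> gsections S"
  unfolding gsections_def mem_Collect_eq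
proof (intro conjI ballI allI impI)
  fix K' :: "('m, 'n, 'f, 'b, 'i, 'p, 'r) coords" and k assume K': "local_coords S K'"
  show "smoothE S (nbhd K') (\<lambda>e. coef (nat_frame S K' e) (X e) k)"
  proof (rule E.smooth_total_locally)
    fix x assume x: "x \<in> nbhd K'"
    obtain K V where K: "local_coords S K" "open V" "x \<in> V" "V \<subseteq> nbhd K"
      "\<And>k. smoothE S V (\<lambda>e. coef (nat_frame S K e) (X e) k)" using loc[of x] by blast
    obtain b W where b: "bump_at (atlasM S) (nbhd K') x b" "open W" "x \<in> W" "W \<subseteq> nbhd K'"
      "\<And>y. y \<in> W \<Longrightarrow> bump_at (atlasM S) (nbhd K') y b" using coords_bump[OF K' x] by metis
    define O' where "O' = V \<inter> W"
    have O': "open O'" "x \<in> O'" "O' \<subseteq> V" "O' \<subseteq> W" "O' \<subseteq> nbhd K" "O' \<subseteq> nbhd K'" using K b by (auto simp: O'_def)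
    have "smoothE S O' (\<lambda>e. coef (nat_frame S K' e) (X e) k)"
    proof (cases k)
      case (Inr a)
      have "smoothE S O' (\<lambda>e. snd (X e) (fibre_coord K' b a))"
        by (rule E.smooth_total_subset[OF smooth_derivative_coefs[OF K(1,2,4) X K(5) fibre_coord_smooth[OF K' b(1)]] O'(3)])
      then show ?thesis
      proof (rule E.smooth_total_cong[OF O'(1), rotated])
        fix e assume e: "e \<in> totalE S" "fst e \<in> O'"
        then have "fst e \<in> nbhd K'" "fst e \<in> W" using O' by auto
        then show "snd (X e) (fibre_coord K' b a) = coef (nat_frame S K' e) (X e) k"
          using coef_Inr[OF K' e(1) _ X[OF e(1)] b(5)] Inr by simp
      qed
    next
      case (Inl \<alpha>)
      let ?A = "\<lambda>\<beta> x. coef (\<lambda>\<alpha>. tframe K' \<alpha> (hmap S x)) (tframe K \<beta> (hmap S x)) \<alpha>"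
      have A: "smoothE S O' (\<lambda>e. ?A \<beta> (fst e))" for \<beta>
      proof (rule E.smooth_total_pullback[OF O'(1)])
        have "smooth_fun (atlasN S) (hmap S ` nbhd K' \<inter> hmap S ` nbhd K)
            (\<lambda>q. coef (\<lambda>\<alpha>. tframe K' \<alpha> q) (tframe K \<beta> q) \<alpha>)"
          by (rule F.local_section_coef[OF local_coords_frameF[OF K'] continuous_h(2)[OF local_coords_open[OF K(1)]]
                F.local_frame_section[OF local_coords_frameF[OF K(1)]]])
        from smooth_fun_h[OF _ this]
        have "smooth_fun (atlasM S) (hmap S -` (hmap S ` nbhd K' \<inter> hmap S ` nbhd K)) (?A \<beta>)"
          using continuous_h(2) local_coords_open K' K by (simp add: open_Int)
        then show "smooth_fun (atlasM S) O' (?A \<beta>)"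
          by (rule E.smooth_fun_subset) (use O' in auto)
      qed
      have "smoothE S O' (\<lambda>e. \<Sum>\<beta>\<in>UNIV. coef (nat_frame S K e) (X e) (Inl \<beta>) * ?A \<beta> (fst e))"
        using E.smooth_total_subset[OF K(5) O'(3)] by (intro E.smooth_total_sum E.smooth_total_mult O'(1) A) auto
      then show ?thesis
      proof (rule E.smooth_total_cong[OF O'(1), rotated])
        fix e assume e: "e \<in> totalE S" "fst e \<in> O'"
        then have eK: "fst e \<in> nbhd K" "fst e \<in> nbhd K'" using O' by auto
        let ?t = "\<lambda>\<beta>. tframe K \<beta> (hmap S (fst e))" and ?t' = "\<lambda>\<beta>. tframe K' \<beta> (hmap S (fst e))"
        note bt = basisF[OF K(1) eK(1)] and bt' = basisF[OF K' eK(2)]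
        have "lin_on (fibre (bundleF S) (hmap S (fst e))) (\<lambda>a. coef ?t' a \<alpha>)"
          using coef_add[OF bt'] coef_scale[OF bt'] by (simp add: lin_on_def)
        then have "coef ?t' (\<Sum>\<beta>\<in>UNIV. coef ?t (fst (X e)) \<beta> *\<^sub>R ?t \<beta>) \<alpha> = (\<Sum>\<beta>\<in>UNIV. coef ?t (fst (X e)) \<beta> *\<^sub>R coef ?t' (?t \<beta>) \<alpha>)"
          by (rule lin_on_sum[OF _ F.fibre_subspace]) (auto intro: basis_of_in[OF bt])
        then show "(\<Sum>\<beta>\<in>UNIV. coef (nat_frame S K e) (X e) (Inl \<beta>) * ?A \<beta> (fst e)) = coef (nat_frame S K' e) (X e) k"
          using coef_Inl[OF K(1) e(1) eK(1) X[OF e(1)]] coef_Inl[OF K' e(1) eK(2) X[OF e(1)]] Inl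
            basis_of_expand[OF bt gtb_fst[OF e(1) X[OF e(1)]]] by simp
      qed
    qed
    then show "\<exists>V. open V \<and> x \<in> V \<and> smoothE S V (\<lambda>e. coef (nat_frame S K' e) (X e) k)" using O' by blast
  qed
qed (use X off in auto)

lemma gsectionI_coords:
  assumes "\<And>e. e \<in> totalE S \<Longrightarrow> X e \<in> gtb S e" "\<And>e. e \<notin> totalE S \<Longrightarrow> X e = 0"
    and "\<And>K k. local_coords S K \<Longrightarrow> smoothE S (nbhd K) (\<lambda>e. coef (nat_frame S K e) (X e) k)"
  shows "X \<in> gsections S"
  using assms by (simp add: gsections_def)

lemma gsec_add:
  assumes "X \<in> gsections S" "Y \<in> gsections S" shows "(\<lambda>e. X e + Y e) \<in> gsections S"
proof (rule gsectionI_coords)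
  fix K :: "('m, 'n, 'f, 'b, 'i, 'p, 'r) coords" and k assume K: "local_coords S K"
  show "smoothE S (nbhd K) (\<lambda>e. coef (nat_frame S K e) (X e + Y e) k)"
    by (rule E.smooth_total_cong[OF local_coords_open[OF K] _ E.smooth_total_add[OF local_coords_open[OF K] gsec_coef[OF assms(1) K, of k] gsec_coef[OF assms(2) K, of k]]])
      (simp add: coef_add[OF nat_frame_basis[OF K]] gsec_in assms)
qed (simp_all add: assms gsec_in gsec_off gtb_subspace subspace_add)

lemma gsec_scale:
  assumes "smoothE S UNIV f" "X \<in> gsections S" shows "(\<lambda>e. f e *\<^sub>R X e) \<in> gsections S"
proof (rule gsectionI_coords)
  fix K :: "('m, 'n, 'f, 'b, 'i, 'p, 'r) coords" and k assume K: "local_coords S K"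
  show "smoothE S (nbhd K) (\<lambda>e. coef (nat_frame S K e) (f e *\<^sub>R X e) k)"
    by (rule E.smooth_total_cong[OF local_coords_open[OF K] _ E.smooth_total_mult[OF local_coords_open[OF K] E.smooth_total_subset[OF assms(1) subset_UNIV] gsec_coef[OF assms(2) K, of k]]])
      (simp add: coef_scale[OF nat_frame_basis[OF K]] gsec_in assms)
qed (simp_all add: assms gsec_in gsec_off gtb_subspace subspace_scale)

lemma gsec_diff:
  assumes "X \<in> gsections S" "Y \<in> gsections S" shows "(\<lambda>e. X e - Y e) \<in> gsections S"
  using gsec_add[OF assms(1) gsec_scale[OF E.smooth_total_const[OF open_UNIV] assms(2)], of "-1"] by simp

lemma gsec_zero: "(\<lambda>e. 0) \<in> gsections S"
  by (rule gsectionI_coords)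
    (auto simp: coef_zero intro!: subspace_0 gtb_subspace E.smooth_total_const local_coords_open)

lemma gsec_sum:
  "finite I \<Longrightarrow> (\<And>i. i \<in> I \<Longrightarrow> X i \<in> gsections S) \<Longrightarrow> (\<lambda>e. \<Sum>i\<in>I. X i e) \<in> gsections S"
  by (induction I rule: finite_induct) (auto intro: gsec_zero gsec_add)

definition bumpE :: "('m, 'n, 'f, 'b, 'i, 'p, 'r) coords \<Rightarrow> ('m \<Rightarrow> real) \<Rightarrow> 'p + 'r \<Rightarrow> 'm \<times> 'b \<Rightarrow> ('m, 'f, 'b) gvec" where
  "bumpE K b k e = (if e \<in> totalE S then b (fst e) *\<^sub>R nat_frame S K e k else 0)"

lemma bumpE_section:
  assumes K: "local_coords S K" and b: "bump_at (atlasM S) (nbhd K) x b"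
  shows "bumpE K b k \<in> gsections S"
proof (rule gsectionI)
  show "bumpE K b k e \<in> gtb S e" if e: "e \<in> totalE S" for e
  proof (cases "fst e \<in> nbhd K")
    case True
    then show ?thesis using e basis_of_in[OF nat_frame_basis[OF K e]] gtb_subspace[OF e]
      by (simp add: bumpE_def subspace_scale)
  next
    case False
    then show ?thesis using e gtb_subspace[OF e] bump_at_eq_0[OF b] by (simp add: bumpE_def subspace_0)
  qed
  fix y
  show "\<exists>K' V. local_coords S K' \<and> open V \<and> y \<in> V \<and> V \<subseteq> nbhd K' \<and>
      (\<forall>k'. smoothE S V (\<lambda>e. coef (nat_frame S K' e) (bumpE K b k e) k'))"
  proof (cases "y \<in> nbhd K")
    case True
    have "smoothE S (nbhd K) (\<lambda>e. coef (nat_frame S K e) (bumpE K b k e) k')" for k'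
    proof (rule E.smooth_total_cong[OF local_coords_open[OF K]])
      show "smoothE S (nbhd K) (\<lambda>e. b (fst e) * (if k' = k then 1 else 0))"
        by (intro E.smooth_total_mult local_coords_open[OF K] E.smooth_total_const E.smooth_total_pullback
            E.smooth_fun_subset[OF bump_at_smooth[OF b]]) simp
      show "b (fst e) * (if k' = k then 1 else 0) = coef (nat_frame S K e) (bumpE K b k e) k'"
        if "e \<in> totalE S" "fst e \<in> nbhd K" for e
        using coef_scale[OF nat_frame_basis[OF K that] basis_of_in[OF nat_frame_basis[OF K that]]]
          coef_basis[OF nat_frame_basis[OF K that]] that by (simp add: bumpE_def)
    qed
    then show ?thesis using True K local_coords_open by blast
  next
    case False
    obtain V where V: "open V" "y \<in> V" "\<And>z. z \<in> V \<Longrightarrow> b z = 0" by (rule bump_at_off_support[OF b False]) blast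
    obtain K' where K': "local_coords S K'" "y \<in> nbhd K'" by (rule ex_local_coords)
    have o: "open (V \<inter> nbhd K')" using V local_coords_open[OF K'(1)] by auto
    have "smoothE S (V \<inter> nbhd K') (\<lambda>e. coef (nat_frame S K' e) (bumpE K b k e) k')" for k'
      by (rule E.smooth_total_cong[OF o _ E.smooth_total_const[OF o, of 0]]) (use V in \<open>auto simp: bumpE_def coef_zero\<close>)
    then show ?thesis using K' V o by blast
  qed
qed (simp add: bumpE_def)

lemma gsec_extends:
  assumes "e \<in> totalE S" "w \<in> gtb S e" obtains X where "X \<in> gsections S" "X e = w"
proof -
  obtain K where K: "local_coords S K" "fst e \<in> nbhd K" by (rule ex_local_coords)
  obtain b where b: "bump_at (atlasM S) (nbhd K) (fst e) b" using coords_bump[OF K] by metis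
  define X where "X = (\<lambda>e'. \<Sum>k\<in>UNIV. coef (nat_frame S K e) w k *\<^sub>R bumpE K b k e')"
  have "X \<in> gsections S" unfolding X_def
    by (intro gsec_sum gsec_scale bumpE_section[OF K(1) b] E.smooth_total_const) auto
  moreover have "X e = w"
    using basis_of_expand[OF nat_frame_basis[OF K(1) assms(1) K(2)] assms(2)] bump_at_eq_1[OF b] assms(1)
    by (simp add: X_def bumpE_def)
  ultimately show thesis by (rule that)
qed

lemma gsec_function_linear_vanishes:
  fixes \<tau> :: "('m \<times> 'b \<Rightarrow> ('m, 'f, 'b) gvec) \<Rightarrow> 'c::real_vector"
  assumes add: "\<And>X Y. X \<in> gsections S \<Longrightarrow> Y \<in> gsections S \<Longrightarrow> \<tau> (\<lambda>e. X e + Y e) = \<tau> X + \<tau> Y"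
    and scale: "\<And>f X. smoothE S UNIV f \<Longrightarrow> X \<in> gsections S \<Longrightarrow> \<tau> (\<lambda>e. f e *\<^sub>R X e) = f p *\<^sub>R \<tau> X"
    and X: "X \<in> gsections S" "X p = 0"
  shows "\<tau> X = 0"
proof -
  obtain K where K: "local_coords S K" "fst p \<in> nbhd K" by (rule ex_local_coords)
  obtain b where b: "bump_at (atlasM S) (nbhd K) (fst p) b" using coords_bump[OF K] by metis
  have bE: "smoothE S UNIV (\<lambda>e. b (fst e))" by (rule E.smooth_total_pullback[OF open_UNIV bump_at_smooth[OF b]])
  \<comment> \<open>one factor \<open>b\<close> makes the coefficients global, the other one the natural base\<close>
  show ?thesis
  proof (rule function_linear_vanishes[where \<Gamma>="gsections S" and R="{f. smoothE S UNIV f}" and u=X and p=p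
        and \<beta>="\<lambda>e. b (fst e) * b (fst e)" and s="bumpE K b" and a="\<lambda>k e. b (fst e) * coef (nat_frame S K e) (X e) k"])
    show "(\<lambda>e. b (fst e) * coef (nat_frame S K e) (X e) k) \<in> {f. smoothE S UNIV f}" for k
      using E.smooth_total_bump_mult[OF b local_coords_open[OF K(1)] gsec_coef[OF X(1) K(1)]] by simp
    show "(b (fst e) * b (fst e)) *\<^sub>R X e = (\<Sum>k\<in>UNIV. (b (fst e) * coef (nat_frame S K e) (X e) k) *\<^sub>R bumpE K b k e)" for e
    proof (cases "e \<in> totalE S \<and> fst e \<in> nbhd K")
      case True
      have "(\<Sum>k\<in>UNIV. (b (fst e) * coef (nat_frame S K e) (X e) k) *\<^sub>R bumpE K b k e)
          = (b (fst e) * b (fst e)) *\<^sub>R (\<Sum>k\<in>UNIV. coef (nat_frame S K e) (X e) k *\<^sub>R nat_frame S K e k)"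
        using True by (simp add: bumpE_def scaleR_sum_right mult_ac)
      then show ?thesis using gsec_expand[OF X(1) K(1), of e] True by simp
    next
      case False
      then show ?thesis using gsec_off[OF X(1)] bump_at_eq_0[OF b, of "fst e"] by (cases "e \<in> totalE S") (auto simp: bumpE_def)
    qed
  qed (use add scale X bump_at_eq_1[OF b] bumpE_section[OF K(1) b] gsec_add gsec_scale in
      \<open>auto simp: coef_zero intro: E.smooth_total_const E.smooth_total_mult bE\<close>)
qed

section \<open>Vertical lifts\<close>

text \<open>The derivative along the line \<open>e + t y\<close> in the fibre of \<open>E\<close>; without
  coordinates, vertical lifts are global from the start.\<close>

definition vvec :: "'m \<times> 'b \<Rightarrow> 'b \<Rightarrow> ('m, 'f, 'b) gvec" where
  "vvec e y = (0, \<lambda>f. if smoothE S UNIV f then frechet_derivative (\<lambda>t::real. f (fst e, snd e + t *\<^sub>R y)) (at 0) 1 else 0)"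

lemma vvec_eq:
  assumes K: "local_coords S K" and e: "e \<in> totalE S" "fst e \<in> nbhd K" and y: "y \<in> fibre (bundleE S) (fst e)"
  shows "vvec e y = (\<Sum>a\<in>UNIV. coef (\<lambda>a. sframe K a (fst e)) y a *\<^sub>R nat_frame S K e (Inr a))"
proof -
  note U = local_coords_bundle_chart[OF K]
  let ?c = "\<chi> a. coef (\<lambda>a. sframe K a (fst e)) y a"
  note bs = E.bundle_chart_basis[OF U e(2)]
  have eF: "snd e \<in> fibre (bundleE S) (fst e)" using e(1) by (cases e) (simp add: total_space_def)
  have path: "bundle_coord (xchart K) (sframe K) (fst e, snd e + t *\<^sub>R y) = bundle_coord (xchart K) (sframe K) e + t *\<^sub>R (0, ?c)" for t
    using coef_add[OF bs eF] coef_scale[OF bs y] subspace_scale[OF E.fibre_subspace y] y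
    by (simp add: bundle_coord_def vec_eq_iff)
  have pt: "(fst e, snd e + t *\<^sub>R y) \<in> totalE S" for t
    using subspace_add[OF E.fibre_subspace eF subspace_scale[OF E.fibre_subspace y]] by (simp add: total_space_def)
  have "frechet_derivative (\<lambda>t::real. f (fst e, snd e + t *\<^sub>R y)) (at 0) 1 = partial_deriv K (0, ?c) f e"
    if f: "smoothE S UNIV f" for f
  proof -
    let ?P = "bundle_param (nbhd K) (xchart K) (sframe K)" and ?z = "bundle_coord (xchart K) (sframe K) e"
    have fe: "f (fst e, snd e + t *\<^sub>R y) = (f \<circ> ?P) (?z + t *\<^sub>R (0, ?c))" for t
      using E.bundle_param_coord[OF U pt, of t] e(2) by (simp only: o_def path[symmetric] fst_conv)
    have 1: "((\<lambda>t::real. ?z + t *\<^sub>R (0, ?c)) has_derivative (\<lambda>t. t *\<^sub>R (0, ?c))) (at 0)"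
      by (auto intro!: derivative_eq_intros)
    have 2: "((f \<circ> ?P) has_derivative (\<lambda>w. partial_deriv K w f e)) (at (?z + 0 *\<^sub>R (0, ?c)))"
      using E.bundle_has_derivative[OF U open_UNIV _ f, of e] e(2) by (simp add: partial_deriv_eq flip: zero_prod_def)
    have "((\<lambda>t. (f \<circ> ?P) (?z + t *\<^sub>R (0, ?c))) has_derivative (\<lambda>t. partial_deriv K (t *\<^sub>R (0, ?c)) f e)) (at 0)"
      by (rule has_derivative_compose[OF 1 2])
    then show ?thesis using frechet_derivative_eqI fe by (metis (no_types, lifting) ext scale_one)
  qed
  then have "vvec e y = (0, tanE K (0, ?c) e)" by (auto simp: vvec_def tanE_def fun_eq_iff)
  also have "\<dots> = (\<Sum>k\<in>UNIV. case_sum (\<lambda>_::'p. 0) (\<lambda>a. coef (\<lambda>a. sframe K a (fst e)) y a) k *\<^sub>R nat_frame S K e k)"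
    unfolding nat_frame_sum[OF K e(2)] by simp
  finally show ?thesis by (simp add: sum_UNIV_Plus)
qed

abbreviation sectionsE :: "('m \<Rightarrow> 'b) set" where
  "sectionsE \<equiv> {s. local_section (atlasM S) (bundleE S) UNIV s}"

definition vlift :: "('m \<Rightarrow> 'b) \<Rightarrow> 'm \<times> 'b \<Rightarrow> ('m, 'f, 'b) gvec" where
  "vlift s e = (if e \<in> totalE S then vvec e (s (fst e)) else 0)"

lemma vvec_vertical:
  assumes e: "e \<in> totalE S" and y: "y \<in> fibre (bundleE S) (fst e)" shows "vvec e y \<in> vertical S e"
proof -
  obtain K where K: "local_coords S K" "fst e \<in> nbhd K" by (rule ex_local_coords)
  show ?thesis unfolding vvec_eq[OF K(1) e K(2) y] by (rule basis_of_sum_in[OF vertical_eq(2)[OF e K]])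
qed

lemma vlift_vertical: "s \<in> sectionsE \<Longrightarrow> e \<in> totalE S \<Longrightarrow> vlift s e \<in> vertical S e"
  using vvec_vertical E.local_section_in by (auto simp: vlift_def)

lemma coef_vertical:
  assumes "local_coords S K" "e \<in> totalE S" "fst e \<in> nbhd K"
  shows "coef (nat_frame S K e) (\<Sum>a\<in>UNIV. c a *\<^sub>R nat_frame S K e (Inr a)) k = case_sum (\<lambda>_::'p. 0) c k"
proof -
  have "(\<Sum>a\<in>UNIV. c a *\<^sub>R nat_frame S K e (Inr a)) = (\<Sum>k\<in>UNIV. case_sum (\<lambda>_::'p. 0) c k *\<^sub>R nat_frame S K e k)"
    by (simp add: sum_UNIV_Plus)
  then show ?thesis using coef_sum[OF nat_frame_basis[OF assms]] by simp
qed

lemma vlift_section: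
  assumes s: "s \<in> sectionsE" shows "vlift s \<in> gsections S"
proof (rule gsectionI_coords)
  fix K :: "('m, 'n, 'f, 'b, 'i, 'p, 'r) coords" and k assume K: "local_coords S K"
  note U = local_coords_bundle_chart[OF K] and oK = local_coords_open[OF K]
  have c: "smoothE S (nbhd K) (\<lambda>e. coef (\<lambda>a. sframe K a (fst e)) (s (fst e)) a)" for a
    using E.local_section_coef[OF E.bundle_chart_frame[OF U] open_UNIV, of s a] s
    by (intro E.smooth_total_pullback oK) simp
  have "smoothE S (nbhd K) (\<lambda>e. case_sum (\<lambda>_::'p. 0) (\<lambda>a. coef (\<lambda>a. sframe K a (fst e)) (s (fst e)) a) k)"
    using c oK by (cases k) (auto intro: E.smooth_total_const)
  then show "smoothE S (nbhd K) (\<lambda>e. coef (nat_frame S K e) (vlift s e) k)"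
  proof (rule E.smooth_total_cong[OF oK, rotated])
    fix e assume e: "e \<in> totalE S" "fst e \<in> nbhd K"
    show "case_sum (\<lambda>_::'p. 0) (\<lambda>a. coef (\<lambda>a. sframe K a (fst e)) (s (fst e)) a) k = coef (nat_frame S K e) (vlift s e) k"
      using vvec_eq[OF K e, of "s (fst e)"] coef_vertical[OF K e] e s E.local_section_in[of UNIV s "fst e"]
      by (simp add: vlift_def)
  qed
qed (use vlift_vertical[OF s] vertical_subset in \<open>blast, simp add: vlift_def\<close>)

lemma vvec_linear:
  assumes e: "e \<in> totalE S" shows "lin_on (fibre (bundleE S) (fst e)) (vvec e)"
proof -
  obtain K where K: "local_coords S K" "fst e \<in> nbhd K" by (rule ex_local_coords)
  note bs = E.bundle_chart_basis[OF local_coords_bundle_chart[OF K(1)] K(2)]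
  have sp: "subspace (fibre (bundleE S) (fst e))" by (rule E.fibre_subspace)
  show ?thesis unfolding lin_on_def
    using vvec_eq[OF K(1) e K(2)] coef_add[OF bs] coef_scale[OF bs] subspace_add[OF sp] subspace_scale[OF sp]
    by (simp add: scaleR_add_left sum.distrib scaleR_sum_right)
qed

lemma vlift_add:
  assumes "s \<in> sectionsE" "t \<in> sectionsE" shows "vlift (\<lambda>x. s x + t x) = (\<lambda>e. vlift s e + vlift t e)"
  using vvec_linear assms E.local_section_in[of UNIV] by (auto simp: vlift_def lin_on_def fun_eq_iff)

lemma vlift_scale:
  assumes "s \<in> sectionsE" shows "vlift (\<lambda>x. f x *\<^sub>R s x) = (\<lambda>e. f (fst e) *\<^sub>R vlift s e)"
  using vvec_linear assms E.local_section_in[of UNIV] by (auto simp: vlift_def lin_on_def fun_eq_iff)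

lemma vlift_surj:
  assumes e: "e \<in> totalE S" and w: "w \<in> vertical S e" obtains s where "s \<in> sectionsE" "vlift s e = w"
proof -
  obtain K where K: "local_coords S K" "fst e \<in> nbhd K" by (rule ex_local_coords)
  note bs = E.bundle_chart_basis[OF local_coords_bundle_chart[OF K(1)] K(2)]
  note bv = vertical_eq(2)[OF e K]
  let ?c = "coef (\<lambda>a. nat_frame S K e (Inr a)) w"
  define y where "y = (\<Sum>a\<in>UNIV. ?c a *\<^sub>R sframe K a (fst e))"
  have y: "y \<in> fibre (bundleE S) (fst e)" unfolding y_def by (rule basis_of_sum_in[OF bs])
  obtain s where s: "local_section (atlasM S) (bundleE S) UNIV s" "s (fst e) = y" by (rule E.section_extends[OF y])
  have "vlift s e = w"
    using vvec_eq[OF K(1) e K(2) y] coef_sum[OF bs, of ?c] basis_of_expand[OF bv w] e s(2)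
    by (simp add: vlift_def y_def)
  then show thesis using s(1) by (intro that) auto
qed

lemma snd_vertical_pullback:
  assumes "e \<in> totalE S" "w \<in> vertical S e" "smooth_fun (atlasM S) UNIV g" shows "snd w (\<lambda>e. g (fst e)) = 0"
proof -
  have w: "w \<in> gtb S e" "fst w = 0" using assms by (auto simp: vertical_eq)
  have "anch (fst e) 0 g = 0" using lin_on_zero[OF anch_lin subspace_0[OF F.fibre_subspace]] .
  then show ?thesis using gtb_snd_pullback[OF assms(1) w(1) assms(3)] w(2) by simp
qed

end

section \<open>Horizontal lifts\<close>

locale gcon = gla S
  for S :: "('m::{t2_space,second_countable_topology}, 'n::{t2_space,second_countable_topology},
               'f::real_vector, 'b::real_vector, 'i::finite, 'p::finite, 'r::finite) gla_data" +
  fixes C :: "('m, 'f, 'b) gconn"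
  assumes gcon: "gconnection S C"
begin

lemma C_lin: "e \<in> totalE S \<Longrightarrow> lin_on (gtb S e) (C e)"
  and C_vertical: "e \<in> totalE S \<Longrightarrow> w \<in> gtb S e \<Longrightarrow> C e w \<in> vertical S e"
  and C_id: "e \<in> totalE S \<Longrightarrow> w \<in> vertical S e \<Longrightarrow> C e w = w"
  and conn_coef_smooth: "local_coords S K \<Longrightarrow> smoothE S (nbhd K) (conn_coef S C K a \<gamma>)"
  using gcon by (auto simp: gconnection_def image_subset_iff)

lemma C_in: "e \<in> totalE S \<Longrightarrow> w \<in> gtb S e \<Longrightarrow> C e w \<in> gtb S e"
  using C_vertical vertical_subset by blast

text \<open>The difference of the two vectors is vertical, so \<open>C\<close> fixes it, and horizontal, so
  \<open>C\<close> annihilates it.\<close>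

lemma horizontal_eqI:
  assumes e: "e \<in> totalE S" and v: "v \<in> horizontal S C e" and w: "w \<in> horizontal S C e" and eq: "fst v = fst w"
  shows "v = w"
proof -
  have vw: "v \<in> gtb S e" "w \<in> gtb S e" "C e v = 0" "C e w = 0" using v w by (auto simp: horizontal_def)
  then have "v - w \<in> vertical S e" using eq subspace_diff[OF gtb_subspace[OF e]] by (simp add: vertical_eq[OF e])
  then have "C e (v - w) = v - w" by (rule C_id[OF e])
  then show ?thesis using lin_on_diff[OF C_lin[OF e] gtb_subspace[OF e] vw(1,2)] vw by simp
qed

lemma horizontal_subspace: assumes e: "e \<in> totalE S" shows "subspace (horizontal S C e)"
  using gtb_subspace[OF e] C_lin[OF e] lin_on_zero[OF C_lin[OF e]]
  unfolding subspace_def horizontal_def lin_on_def by auto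

lemma horizontal_in: "w \<in> horizontal S C e \<Longrightarrow> w \<in> gtb S e"
  by (simp add: horizontal_def)

lemma vertical_subspace: "e \<in> totalE S \<Longrightarrow> subspace (vertical S e)"
  using ex_local_coords[of "fst e"] vertical_eq(2)[of e] basis_of_subspace by metis

definition hproj :: "'m \<times> 'b \<Rightarrow> ('m, 'f, 'b) gvec \<Rightarrow> ('m, 'f, 'b) gvec" where
  "hproj e w = w - C e w"

lemma hproj_horizontal: assumes "e \<in> totalE S" "w \<in> gtb S e" shows "hproj e w \<in> horizontal S C e"
  using lin_on_diff[OF C_lin[OF assms(1)] gtb_subspace[OF assms(1)] assms(2) C_in[OF assms]] C_id[OF assms(1) C_vertical[OF assms]]
    subspace_diff[OF gtb_subspace[OF assms(1)] assms(2) C_in[OF assms]] by (simp add: horizontal_def hproj_def)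

lemma hproj_in: "e \<in> totalE S \<Longrightarrow> w \<in> gtb S e \<Longrightarrow> hproj e w \<in> gtb S e"
  using hproj_horizontal horizontal_in by blast

lemma hproj_id: "w \<in> horizontal S C e \<Longrightarrow> hproj e w = w"
  by (simp add: horizontal_def hproj_def)

lemma hproj_vertical: "e \<in> totalE S \<Longrightarrow> w \<in> vertical S e \<Longrightarrow> hproj e w = 0"
  using C_id by (simp add: hproj_def)

lemma C_horizontal: "w \<in> horizontal S C e \<Longrightarrow> C e w = 0"
  by (simp add: horizontal_def)

lemma hproj_lin: assumes e: "e \<in> totalE S" shows "lin_on (gtb S e) (hproj e)"
  using C_lin[OF e] by (simp add: lin_on_def hproj_def scaleR_diff_right)

lemma fst_hproj: "e \<in> totalE S \<Longrightarrow> w \<in> gtb S e \<Longrightarrow> fst (hproj e w) = fst w"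
  using C_vertical[of e w] by (simp add: hproj_def vertical_eq)

lemma adapted_Inl:
  assumes K: "local_coords S K" and e: "e \<in> totalE S" "fst e \<in> nbhd K"
  shows "adapted_frame S C K e (Inl \<alpha>) = hproj e (nat_frame S K e (Inl \<alpha>))"
  using basis_of_expand[OF vertical_eq(2)[OF e(1) K e(2)] C_vertical[OF e(1) basis_of_in[OF nat_frame_basis[OF K e]]]]
  by (simp add: hproj_def conn_coef_def adapted_frame.simps)

lemma adapted_Inl_horizontal:
  assumes K: "local_coords S K" and e: "e \<in> totalE S" "fst e \<in> nbhd K"
  shows "adapted_frame S C K e (Inl \<alpha>) \<in> horizontal S C e"
    and "fst (adapted_frame S C K e (Inl \<alpha>)) = tframe K \<alpha> (hmap S (fst e))"
proof -
  have n: "nat_frame S K e (Inl \<alpha>) \<in> gtb S e" by (rule basis_of_in[OF nat_frame_basis[OF K e]])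
  show "adapted_frame S C K e (Inl \<alpha>) \<in> horizontal S C e"
    unfolding adapted_Inl[OF assms] by (rule hproj_horizontal[OF e(1) n])
  show "fst (adapted_frame S C K e (Inl \<alpha>)) = tframe K \<alpha> (hmap S (fst e))"
    unfolding adapted_Inl[OF assms] fst_hproj[OF e(1) n] by (simp add: nat_frame_Inl[OF K e(2)])
qed

lemma adapted_Inr_vertical:
  assumes K: "local_coords S K" and e: "e \<in> totalE S" "fst e \<in> nbhd K"
  shows "adapted_frame S C K e (Inr a) \<in> vertical S e"
  using basis_of_in[OF vertical_eq(2)[OF e(1) K e(2)], of a] by (simp add: adapted_frame.simps)

lemma adapted_basis:
  assumes K: "local_coords S K" and e: "e \<in> totalE S" "fst e \<in> nbhd K"
  shows "basis_of (gtb S e) (adapted_frame S C K e)"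
proof (rule basis_ofI)
  note nb = nat_frame_basis[OF K e] and bv = vertical_eq(2)[OF e(1) K e(2)]
  have in_gtb: "adapted_frame S C K e k \<in> gtb S e" for k
    using horizontal_in[OF adapted_Inl_horizontal(1)[OF K e]] adapted_Inr_vertical[OF K e] vertical_subset[OF e(1)]
    by (cases k) blast+
  show "(\<Sum>k\<in>UNIV. z k *\<^sub>R adapted_frame S C K e k) \<in> gtb S e" for z
    using in_gtb by (intro subspace_sum subspace_scale gtb_subspace[OF e(1)])
  show "\<exists>z. w = (\<Sum>k\<in>UNIV. z k *\<^sub>R adapted_frame S C K e k)" if w: "w \<in> gtb S e" for w
  proof
    let ?n = "coef (nat_frame S K e) w" and ?c = "coef (\<lambda>a. nat_frame S K e (Inr a)) (C e w)"
    have "hproj e (\<Sum>k\<in>UNIV. ?n k *\<^sub>R nat_frame S K e k) = (\<Sum>k\<in>UNIV. ?n k *\<^sub>R hproj e (nat_frame S K e k))"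
      by (rule lin_on_sum[OF hproj_lin[OF e(1)] gtb_subspace[OF e(1)]]) (auto intro: basis_of_in[OF nb])
    moreover have "hproj e (nat_frame S K e (Inr a)) = 0" for a
      by (rule hproj_vertical[OF e(1) basis_of_in[OF bv]])
    ultimately have h: "hproj e w = (\<Sum>\<alpha>\<in>UNIV. ?n (Inl \<alpha>) *\<^sub>R adapted_frame S C K e (Inl \<alpha>))"
      using basis_of_expand[OF nb w] adapted_Inl[OF K e] by (simp add: sum_UNIV_Plus)
    have c: "C e w = (\<Sum>a\<in>UNIV. ?c a *\<^sub>R adapted_frame S C K e (Inr a))"
      using basis_of_expand[OF bv C_vertical[OF e(1) w]] by (simp add: adapted_frame.simps)
    have "(\<Sum>k\<in>UNIV. case_sum (\<lambda>\<alpha>. ?n (Inl \<alpha>)) ?c k *\<^sub>R adapted_frame S C K e k) = hproj e w + C e w"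
      by (simp only: sum_UNIV_Plus sum.case h[symmetric] c[symmetric])
    then show "w = (\<Sum>k\<in>UNIV. case_sum (\<lambda>\<alpha>. ?n (Inl \<alpha>)) ?c k *\<^sub>R adapted_frame S C K e k)"
      by (simp add: hproj_def)
  qed
  show "z k = 0" if z: "(\<Sum>k\<in>UNIV. z k *\<^sub>R adapted_frame S C K e k) = 0" for z k
  proof -
    let ?t = "\<lambda>\<alpha>. tframe K \<alpha> (hmap S (fst e))"
    have "fst (\<Sum>k\<in>UNIV. z k *\<^sub>R adapted_frame S C K e k) = (\<Sum>\<alpha>\<in>UNIV. z (Inl \<alpha>) *\<^sub>R ?t \<alpha>)"
      using adapted_Inl_horizontal(2)[OF K e] by (simp add: sum_UNIV_Plus fst_sum adapted_frame.simps(2) nat_frame_Inr)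
    then have l: "z (Inl \<alpha>) = 0" for \<alpha>
      using coef_sum[OF basisF[OF K e(2)], of "\<lambda>\<alpha>. z (Inl \<alpha>)" \<alpha>] z by (simp add: coef_zero)
    then have "(\<Sum>a\<in>UNIV. z (Inr a) *\<^sub>R nat_frame S K e (Inr a)) = 0" using z by (simp add: sum_UNIV_Plus adapted_frame.simps(2))
    then have "z (Inr a) = 0" for a using coef_sum[OF bv, of "\<lambda>a. z (Inr a)" a] by (simp add: coef_zero)
    then show ?thesis using l by (cases k) auto
  qed
qed

definition hlift :: "('n \<Rightarrow> 'f) \<Rightarrow> 'm \<times> 'b \<Rightarrow> ('m, 'f, 'b) gvec" where
  "hlift u e = (if e \<in> totalE S then THE w. w \<in> horizontal S C e \<and> fst w = u (hmap S (fst e)) else 0)"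

lemma hlift_expand:
  assumes u: "u \<in> sectionsF S" and K: "local_coords S K" and e: "e \<in> totalE S" "fst e \<in> nbhd K"
  shows "hlift u e = (\<Sum>\<alpha>\<in>UNIV. coef (\<lambda>\<alpha>. tframe K \<alpha> (hmap S (fst e))) (u (hmap S (fst e))) \<alpha> *\<^sub>R adapted_frame S C K e (Inl \<alpha>))" (is "_ = ?s")
proof -
  have "?s \<in> horizontal S C e"
    by (intro subspace_sum subspace_scale horizontal_subspace[OF e(1)] adapted_Inl_horizontal[OF K e])
  moreover have "fst ?s = u (hmap S (fst e))"
    using basis_of_expand[OF basisF[OF K e(2)] sectionsF_in[OF u]] adapted_Inl_horizontal(2)[OF K e]
    by (simp add: fst_sum)
  ultimately have "(THE w. w \<in> horizontal S C e \<and> fst w = u (hmap S (fst e))) = ?s"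
    by (intro the_equality) (use horizontal_eqI[OF e(1)] in auto)
  then show ?thesis using e by (simp add: hlift_def)
qed

lemma hlift_horizontal: assumes "u \<in> sectionsF S" "e \<in> totalE S" shows "hlift u e \<in> horizontal S C e"
  and "fst (hlift u e) = u (hmap S (fst e))"
proof -
  obtain K where K: "local_coords S K" "fst e \<in> nbhd K" by (rule ex_local_coords)
  show "hlift u e \<in> horizontal S C e" unfolding hlift_expand[OF assms(1) K(1) assms(2) K(2)]
    by (intro subspace_sum subspace_scale horizontal_subspace[OF assms(2)] adapted_Inl_horizontal[OF K(1) assms(2) K(2)])
  show "fst (hlift u e) = u (hmap S (fst e))" unfolding hlift_expand[OF assms(1) K(1) assms(2) K(2)]
    using basis_of_expand[OF basisF[OF K] sectionsF_in[OF assms(1)]] adapted_Inl_horizontal(2)[OF K(1) assms(2) K(2)]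
    by (simp add: fst_sum)
qed

text \<open>Near a point the lift is a combination of the adapted frame whose coefficients are those of the
  section of \<open>F\<close>; its coefficients in the natural base involve in addition the
  coefficients of the connection.\<close>

lemma hlift_section:
  assumes u: "u \<in> sectionsF S" shows "hlift u \<in> gsections S"
proof (rule gsectionI_coords)
  fix K :: "('m, 'n, 'f, 'b, 'i, 'p, 'r) coords" and k assume K: "local_coords S K"
  note oK = local_coords_open[OF K]
  let ?u = "\<lambda>\<alpha> x. coef (\<lambda>\<alpha>. tframe K \<alpha> (hmap S x)) (u (hmap S x)) \<alpha>"
  have "smooth_fun (atlasN S) (hmap S ` nbhd K) (\<lambda>q. coef (\<lambda>\<alpha>. tframe K \<alpha> q) (u q) \<alpha>)" for \<alpha>
    using F.local_section_coef[OF local_coords_frameF[OF K] open_UNIV, of u \<alpha>] u by (simp add: sectionsF_iff)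
  from smooth_fun_h[OF continuous_h(2)[OF oK] this]
  have "smooth_fun (atlasM S) (nbhd K) (?u \<alpha>)" for \<alpha>
    by (rule E.smooth_fun_subset) auto
  then have c: "smoothE S (nbhd K) (\<lambda>e. ?u \<alpha> (fst e))" for \<alpha>
    by (intro E.smooth_total_pullback oK)
  have "smoothE S (nbhd K) (\<lambda>e. case_sum (\<lambda>\<alpha>. ?u \<alpha> (fst e)) (\<lambda>a. - (\<Sum>\<alpha>\<in>UNIV. ?u \<alpha> (fst e) * conn_coef S C K a \<alpha> e)) k)"
    using c oK conn_coef_smooth[OF K]
    by (cases k) (auto intro!: E.smooth_total_minus E.smooth_total_sum E.smooth_total_mult)
  then show "smoothE S (nbhd K) (\<lambda>e. coef (nat_frame S K e) (hlift u e) k)"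
  proof (rule E.smooth_total_cong[OF oK, rotated])
    fix e assume e: "e \<in> totalE S" "fst e \<in> nbhd K"
    let ?z = "case_sum (\<lambda>\<alpha>. ?u \<alpha> (fst e)) (\<lambda>a. - (\<Sum>\<alpha>\<in>UNIV. ?u \<alpha> (fst e) * conn_coef S C K a \<alpha> e))"
    have "hlift u e = (\<Sum>k\<in>UNIV. ?z k *\<^sub>R nat_frame S K e k)"
      unfolding hlift_expand[OF u K e] sum_UNIV_Plus
      by (simp add: adapted_frame.simps scaleR_diff_right sum_subtractf scaleR_sum_right scaleR_sum_left sum_negf)
        (rule sum.swap)
    then show "?z k = coef (nat_frame S K e) (hlift u e) k"
      using coef_sum[OF nat_frame_basis[OF K e], of ?z k] by simp
  qed
qed (use hlift_horizontal(1)[OF u] horizontal_in in \<open>blast, simp add: hlift_def\<close>)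

lemma hlift_add:
  assumes "u \<in> sectionsF S" "v \<in> sectionsF S"
  shows "hlift (\<lambda>q. u q + v q) = (\<lambda>e. hlift u e + hlift v e)"
proof
  fix e show "hlift (\<lambda>q. u q + v q) e = hlift u e + hlift v e"
  proof (cases "e \<in> totalE S")
    case True
    show ?thesis
      by (rule horizontal_eqI[OF True hlift_horizontal(1)[OF sectionsF_add[OF assms] True]])
        (use hlift_horizontal[OF _ True] sectionsF_add[OF assms] assms horizontal_subspace[OF True] in \<open>auto intro: subspace_add\<close>)
  qed (simp add: hlift_def)
qed

lemma hlift_scale:
  assumes "smooth_fun (atlasN S) UNIV f" "u \<in> sectionsF S"
  shows "hlift (\<lambda>q. f q *\<^sub>R u q) = (\<lambda>e. f (hmap S (fst e)) *\<^sub>R hlift u e)"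
proof
  fix e show "hlift (\<lambda>q. f q *\<^sub>R u q) e = f (hmap S (fst e)) *\<^sub>R hlift u e"
  proof (cases "e \<in> totalE S")
    case True
    show ?thesis
      by (rule horizontal_eqI[OF True hlift_horizontal(1)[OF sectionsF_scale[OF assms] True]])
        (use hlift_horizontal[OF _ True] sectionsF_scale[OF assms] assms horizontal_subspace[OF True] in \<open>auto intro: subspace_scale\<close>)
  qed (simp add: hlift_def)
qed

lemma hlift_surj:
  assumes e: "e \<in> totalE S" and w: "w \<in> horizontal S C e" obtains u where "u \<in> sectionsF S" "hlift u e = w"
proof -
  have "fst w \<in> fibre (bundleF S) (hmap S (fst e))" using gtb_fst[OF e horizontal_in[OF w]] .
  then obtain u where u: "u \<in> sectionsF S" "u (hmap S (fst e)) = fst w" using F.section_extends by (auto simp: sectionsF_iff)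
  then have "hlift u e = w"
    using horizontal_eqI[OF e hlift_horizontal(1)[OF _ e] w] hlift_horizontal(2)[OF _ e] by simp
  with u(1) show thesis by (rule that)
qed

lemma snd_hlift_pullback:
  assumes "u \<in> sectionsF S" "e \<in> totalE S" "smooth_fun (atlasN S) UNIV f"
  shows "snd (hlift u e) (\<lambda>e. f (hmap S (fst e))) = anchorN S u f (hmap S (fst e))"
  using gtb_snd_pullback[OF assms(2) horizontal_in[OF hlift_horizontal(1)[OF assms(1,2)]] smooth_fun_h_UNIV[OF assms(3)]]
    anchorN_eq_anch[OF assms(1,3), of "fst e"] hlift_horizontal(2)[OF assms(1,2)] by (simp add: o_def)

lemma hlift_bumpF:
  assumes "local_coords S K" "bump_at (atlasM S) (nbhd K) x b" "e \<in> totalE S" "fst e \<in> nbhd K" "b (fst e) = 1"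
  shows "hlift (bumpF K b \<alpha>) e = adapted_frame S C K e (Inl \<alpha>)"
  by (rule horizontal_eqI[OF assms(3) hlift_horizontal(1)[OF bumpF_section[OF assms(1,2)] assms(3)] adapted_Inl_horizontal(1)[OF assms(1,3,4)]])
    (use hlift_horizontal(2)[OF bumpF_section[OF assms(1,2)] assms(3)] adapted_Inl_horizontal(2)[OF assms(1,3,4)] assms(5) in
      \<open>simp add: bumpF_eq\<close>)

definition bumpS :: "('m, 'n, 'f, 'b, 'i, 'p, 'r) coords \<Rightarrow> ('m \<Rightarrow> real) \<Rightarrow> 'r \<Rightarrow> 'm \<Rightarrow> 'b" where
  "bumpS K b a x = b x *\<^sub>R sframe K a x"

lemma bumpS_section: "local_coords S K \<Longrightarrow> bump_at (atlasM S) (nbhd K) x b \<Longrightarrow> bumpS K b a \<in> sectionsE"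
  using E.local_section_bump[OF _ local_coords_open E.local_frame_section[OF E.bundle_chart_frame[OF local_coords_bundle_chart]]]
  by (simp add: bumpS_def[abs_def])

lemma vlift_bumpS:
  assumes "local_coords S K" "bump_at (atlasM S) (nbhd K) x b" "e \<in> totalE S" "fst e \<in> nbhd K" "b (fst e) = 1"
  shows "vlift (bumpS K b a) e = adapted_frame S C K e (Inr a)"
proof -
  note bs = E.bundle_chart_basis[OF local_coords_bundle_chart[OF assms(1)] assms(4)]
  have "(\<Sum>c\<in>UNIV. (if c = a then 1 else 0) *\<^sub>R nat_frame S K e (Inr c)) = nat_frame S K e (Inr a)"
    by (simp add: if_distrib[of "\<lambda>c. c *\<^sub>R _"] cong: if_cong)
  then show ?thesis
    using vvec_eq[OF assms(1,3,4) basis_of_in[OF bs, of a]] coef_basis[OF bs] assms(3,5)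
    by (simp add: vlift_def bumpS_def adapted_frame.simps)
qed

end

section \<open>Tensor fields\<close>

context gla
begin

lemma covectors_lin: "\<omega> \<in> covectors S e \<Longrightarrow> lin_on (gtb S e) \<omega>"
  by (simp add: covectors_def)

lemma covectors_subspace: "subspace (covectors S e)"
  unfolding subspace_def covectors_def lin_on_def
  by (auto simp: scaleR_fun_def algebra_simps)

lemma dual_basis_covector:
  assumes "basis_of (gtb S e) b" shows "dual_basis (gtb S e) b k \<in> covectors S e"
  unfolding covectors_def lin_on_def mem_Collect_eq
proof (intro conjI ballI allI impI)
  fix v w assume v: "v \<in> gtb S e" and w: "w \<in> gtb S e"
  have "v + w \<in> gtb S e" by (rule subspace_add[OF basis_of_subspace[OF assms] v w])
  then show "dual_basis (gtb S e) b k (v + w) = dual_basis (gtb S e) b k v + dual_basis (gtb S e) b k w"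
    using v w coef_add[OF assms v w] by (simp only: dual_basis_def if_True)
next
  fix c v assume v: "v \<in> gtb S e"
  have "c *\<^sub>R v \<in> gtb S e" by (rule subspace_scale[OF basis_of_subspace[OF assms] v])
  then show "dual_basis (gtb S e) b k (c *\<^sub>R v) = c *\<^sub>R dual_basis (gtb S e) b k v"
    using v coef_scale[OF assms v] by (simp only: dual_basis_def if_True real_scaleR_def)
qed (simp add: dual_basis_def)

lemma covectors_separate:
  assumes "e \<in> totalE S" "v \<in> gtb S e" "w \<in> gtb S e" "\<And>\<omega>. \<omega> \<in> covectors S e \<Longrightarrow> \<omega> v = \<omega> w"
  shows "v = w"
proof -
  obtain K where K: "local_coords S K" "fst e \<in> nbhd K" by (rule ex_local_coords)
  note nb = nat_frame_basis[OF K(1) assms(1) K(2)]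
  have "coef (nat_frame S K e) v k = coef (nat_frame S K e) w k" for k
    using assms(4)[OF dual_basis_covector[OF nb, of k]] assms(2,3) by (simp add: dual_basis_def)
  then have "(\<Sum>k\<in>UNIV. coef (nat_frame S K e) v k *\<^sub>R nat_frame S K e k)
      = (\<Sum>k\<in>UNIV. coef (nat_frame S K e) w k *\<^sub>R nat_frame S K e k)" by (simp only:)
  then show ?thesis unfolding basis_of_expand[OF nb assms(2)] basis_of_expand[OF nb assms(3)] .
qed

lemma covector_expand:
  fixes b :: "'k::finite \<Rightarrow> ('m, 'f, 'b) gvec"
  assumes b: "basis_of (gtb S e) b" and \<omega>: "\<omega> \<in> covectors S e"
  shows "\<omega> = (\<Sum>k\<in>UNIV. \<omega> (b k) *\<^sub>R dual_basis (gtb S e) b k)"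
proof
  fix w
  show "\<omega> w = (\<Sum>k\<in>UNIV. \<omega> (b k) *\<^sub>R dual_basis (gtb S e) b k) w"
  proof (cases "w \<in> gtb S e")
    case True
    have "\<omega> (\<Sum>k\<in>UNIV. coef b w k *\<^sub>R b k) = (\<Sum>k\<in>UNIV. coef b w k *\<^sub>R \<omega> (b k))"
      by (rule lin_on_sum[OF covectors_lin[OF \<omega>] basis_of_subspace[OF b]]) (auto intro: basis_of_in[OF b])
    then show ?thesis using basis_of_expand[OF b True] True
      by (simp add: sum_apply scaleR_fun_def dual_basis_def mult.commute)
  next
    case False
    then have "\<omega> w = 0" using \<omega> unfolding covectors_def by blast
    then show ?thesis using False by (simp add: sum_apply scaleR_fun_def dual_basis_def)
  qed
qed

lemma tensor_args_iff:
  "(\<omega>s, ws) \<in> tensor_args S k l e \<longleftrightarrow>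
     length \<omega>s = k \<and> set \<omega>s \<subseteq> covectors S e \<and> length ws = l \<and> set ws \<subseteq> gtb S e"
  by (simp add: tensor_args_def)

lemma tf_zero:
  assumes "tensor_field S k l T" "\<not> (e \<in> totalE S \<and> (\<omega>s, ws) \<in> tensor_args S k l e)" shows "T e \<omega>s ws = 0"
  using assms unfolding tensor_field_def by blast

lemma tf_lin_cov:
  assumes T: "tensor_field S k l T" and a: "e \<in> totalE S" "(\<omega>s, ws) \<in> tensor_args S k l e" "i < k"
  shows "lin_on (covectors S e) (\<lambda>\<omega>. T e (\<omega>s[i := \<omega>]) ws)"
proof -
  have "\<forall>e\<in>totalE S. \<forall>(\<omega>s, ws)\<in>tensor_args S k l e.
        (\<forall>i<k. lin_on (covectors S e) (\<lambda>\<omega>. T e (\<omega>s[i := \<omega>]) ws)) \<and>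
        (\<forall>j<l. lin_on (gtb S e) (\<lambda>w. T e \<omega>s (ws[j := w])))"
    using T unfolding tensor_field_def by blast
  from bspec[OF bspec[OF this a(1)] a(2)] a(3) show ?thesis by simp
qed

lemma tf_lin_vec:
  assumes T: "tensor_field S k l T" and a: "e \<in> totalE S" "(\<omega>s, ws) \<in> tensor_args S k l e" "j < l"
  shows "lin_on (gtb S e) (\<lambda>w. T e \<omega>s (ws[j := w]))"
proof -
  have "\<forall>e\<in>totalE S. \<forall>(\<omega>s, ws)\<in>tensor_args S k l e.
        (\<forall>i<k. lin_on (covectors S e) (\<lambda>\<omega>. T e (\<omega>s[i := \<omega>]) ws)) \<and>
        (\<forall>j<l. lin_on (gtb S e) (\<lambda>w. T e \<omega>s (ws[j := w])))"
    using T unfolding tensor_field_def by blast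
  from bspec[OF bspec[OF this a(1)] a(2)] a(3) show ?thesis by simp
qed

lemma tf_smooth:
  assumes "tensor_field S k l T" "local_coords S K" "length As = k" "length Bs = l"
  shows "smoothE S (nbhd K) (\<lambda>e. T e (map (dual_basis (gtb S e) (nat_frame S K e)) As) (map (nat_frame S K e) Bs))"
  using assms unfolding tensor_field_def by blast

lemma tensor_fieldI:
  assumes "\<And>e \<omega>s ws. \<not> (e \<in> totalE S \<and> (\<omega>s, ws) \<in> tensor_args S k l e) \<Longrightarrow> T e \<omega>s ws = 0"
    and "\<And>e \<omega>s ws i. e \<in> totalE S \<Longrightarrow> (\<omega>s, ws) \<in> tensor_args S k l e \<Longrightarrow> i < k \<Longrightarrow>
      lin_on (covectors S e) (\<lambda>\<omega>. T e (\<omega>s[i := \<omega>]) ws)"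
    and "\<And>e \<omega>s ws j. e \<in> totalE S \<Longrightarrow> (\<omega>s, ws) \<in> tensor_args S k l e \<Longrightarrow> j < l \<Longrightarrow>
      lin_on (gtb S e) (\<lambda>w. T e \<omega>s (ws[j := w]))"
    and "\<And>K As Bs. local_coords S K \<Longrightarrow> length As = k \<Longrightarrow> length Bs = l \<Longrightarrow>
      smoothE S (nbhd K) (\<lambda>e. T e (map (dual_basis (gtb S e) (nat_frame S K e)) As) (map (nat_frame S K e) Bs))"
  shows "tensor_field S k l T"
  unfolding tensor_field_def
proof (intro conjI)
  show "\<forall>e \<omega>s ws. T e \<omega>s ws \<noteq> 0 \<longrightarrow> e \<in> totalE S \<and> (\<omega>s, ws) \<in> tensor_args S k l e" using assms(1) by blast
  show "\<forall>e\<in>totalE S. \<forall>(\<omega>s, ws)\<in>tensor_args S k l e.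
        (\<forall>i<k. lin_on (covectors S e) (\<lambda>\<omega>. T e (\<omega>s[i := \<omega>]) ws)) \<and>
        (\<forall>j<l. lin_on (gtb S e) (\<lambda>w. T e \<omega>s (ws[j := w])))" using assms(2,3) by blast
  show "\<forall>K. local_coords S K \<longrightarrow> (\<forall>As Bs. length As = k \<and> length Bs = l \<longrightarrow>
        smoothE S (nbhd K) (\<lambda>e. T e (map (dual_basis (gtb S e) (nat_frame S K e)) As)
                                     (map (nat_frame S K e) Bs)))" using assms(4) by blast
qed

lemma lin_on_mult_left: "lin_on W f \<Longrightarrow> lin_on W (\<lambda>w. c * (f w :: real))"
  and lin_on_mult_right: "lin_on W f \<Longrightarrow> lin_on W (\<lambda>w. (f w :: real) * c)"
  by (auto simp: lin_on_def algebra_simps)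

lemma tensor_prod_field:
  assumes T: "tensor_field S k l T" and T': "tensor_field S k' l' T'"
  shows "tensor_field S (k + k') (l + l') (tensor_prod k l T T')"
proof (rule tensor_fieldI)
  have args: "(take k \<omega>s, take l ws) \<in> tensor_args S k l e" "(drop k \<omega>s, drop l ws) \<in> tensor_args S k' l' e"
    if "(\<omega>s, ws) \<in> tensor_args S (k + k') (l + l') e" for e \<omega>s ws
    using that by (auto simp: tensor_args_iff dest: in_set_takeD in_set_dropD)
  show "tensor_prod k l T T' e \<omega>s ws = 0" if n: "\<not> (e \<in> totalE S \<and> (\<omega>s, ws) \<in> tensor_args S (k + k') (l + l') e)" for e \<omega>s ws
  proof (rule ccontr)
    assume "tensor_prod k l T T' e \<omega>s ws \<noteq> 0"
    then have "T e (take k \<omega>s) (take l ws) \<noteq> 0" "T' e (drop k \<omega>s) (drop l ws) \<noteq> 0" by (auto simp: tensor_prod_def)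
    then have a: "e \<in> totalE S" "(take k \<omega>s, take l ws) \<in> tensor_args S k l e" "(drop k \<omega>s, drop l ws) \<in> tensor_args S k' l' e"
      using tf_zero[OF T] tf_zero[OF T'] by blast+
    have sets: "set \<omega>s = set (take k \<omega>s) \<union> set (drop k \<omega>s)" "set ws = set (take l ws) \<union> set (drop l ws)"
      by (simp_all only: set_append[symmetric] append_take_drop_id)
    have lengths: "length \<omega>s = length (take k \<omega>s) + length (drop k \<omega>s)" "length ws = length (take l ws) + length (drop l ws)"
      by simp_all
    have "length \<omega>s = k + k'" "length ws = l + l'" "set \<omega>s \<subseteq> covectors S e" "set ws \<subseteq> gtb S e"
      using a(2,3) unfolding tensor_args_iff by (simp_all only: lengths sets Un_subset_iff)
    then show False using n a(1) by (simp add: tensor_args_iff)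
  qed
  show "lin_on (covectors S e) (\<lambda>\<omega>. tensor_prod k l T T' e (\<omega>s[i := \<omega>]) ws)"
    if a: "e \<in> totalE S" "(\<omega>s, ws) \<in> tensor_args S (k + k') (l + l') e" "i < k + k'" for e \<omega>s ws i
  proof (cases "i < k")
    case True
    then show ?thesis using lin_on_mult_right[OF tf_lin_cov[OF T a(1) args(1)[OF a(2)] True]]
      by (simp add: tensor_prod_def take_update_swap drop_update_cancel)
  next
    case False
    then have "i - k < k'" using a(3) by simp
    then show ?thesis using False lin_on_mult_left[OF tf_lin_cov[OF T' a(1) args(2)[OF a(2)], of "i - k"]]
      by (simp add: tensor_prod_def drop_update_swap take_update_cancel)
  qed
  show "lin_on (gtb S e) (\<lambda>w. tensor_prod k l T T' e \<omega>s (ws[j := w]))"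
    if a: "e \<in> totalE S" "(\<omega>s, ws) \<in> tensor_args S (k + k') (l + l') e" "j < l + l'" for e \<omega>s ws j
  proof (cases "j < l")
    case True
    then show ?thesis using lin_on_mult_right[OF tf_lin_vec[OF T a(1) args(1)[OF a(2)] True]]
      by (simp add: tensor_prod_def take_update_swap drop_update_cancel)
  next
    case False
    then have "j - l < l'" using a(3) by simp
    then show ?thesis using False lin_on_mult_left[OF tf_lin_vec[OF T' a(1) args(2)[OF a(2)], of "j - l"]]
      by (simp add: tensor_prod_def drop_update_swap take_update_cancel)
  qed
  fix K :: "('m, 'n, 'f, 'b, 'i, 'p, 'r) coords" and As Bs :: "('p + 'r) list"
  assume K: "local_coords S K" and l: "length As = k + k'" "length Bs = l + l'"
  show "smoothE S (nbhd K) (\<lambda>e. tensor_prod k l T T' e (map (dual_basis (gtb S e) (nat_frame S K e)) As) (map (nat_frame S K e) Bs))"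
    using E.smooth_total_mult[OF local_coords_open[OF K] tf_smooth[OF T K, of "take k As" "take l Bs"] tf_smooth[OF T' K, of "drop k As" "drop l Bs"]] l
    by (simp add: tensor_prod_def take_map drop_map)
qed

lemma scalar_tensor_field:
  assumes f: "smoothE S UNIV f" shows "tensor_field S 0 0 (scalar_tensor S f)"
proof (rule tensor_fieldI)
  fix K :: "('m, 'n, 'f, 'b, 'i, 'p, 'r) coords" and As :: "('p + 'r) list" and Bs :: "('p + 'r) list"
  assume K: "local_coords S K" and l: "length As = 0" "length Bs = 0"
  show "smoothE S (nbhd K) (\<lambda>e. scalar_tensor S f e (map (dual_basis (gtb S e) (nat_frame S K e)) As) (map (nat_frame S K e) Bs))"
    by (rule E.smooth_total_cong[OF local_coords_open[OF K] _ E.smooth_total_subset[OF f subset_UNIV]])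
      (use l in \<open>simp add: scalar_tensor_def\<close>)
qed (auto simp: scalar_tensor_def tensor_args_iff)

lemma vt_apply: "e \<in> totalE S \<Longrightarrow> \<omega> \<in> covectors S e \<Longrightarrow> vector_tensor S Y e [\<omega>] [] = \<omega> (Y e)"
  by (simp add: vector_tensor_def tensor_args_iff)

lemma vt_zero: "\<not> (e \<in> totalE S \<and> (\<exists>\<omega>\<in>covectors S e. \<omega>s = [\<omega>]) \<and> ws = []) \<Longrightarrow> vector_tensor S Y e \<omega>s ws = 0"
  by (auto simp: vector_tensor_def tensor_args_iff length_Suc_conv)

lemma vector_tensor_field:
  assumes Y: "Y \<in> gsections S" shows "tensor_field S 1 0 (vector_tensor S Y)"
proof (rule tensor_fieldI)
  show "vector_tensor S Y e \<omega>s ws = 0" if "\<not> (e \<in> totalE S \<and> (\<omega>s, ws) \<in> tensor_args S 1 0 e)" for e \<omega>s ws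
    using that by (auto simp: vector_tensor_def)
  show "lin_on (covectors S e) (\<lambda>\<omega>. vector_tensor S Y e (\<omega>s[i := \<omega>]) ws)"
    if a: "e \<in> totalE S" "(\<omega>s, ws) \<in> tensor_args S 1 0 e" "i < 1" for e \<omega>s ws i
  proof -
    obtain \<omega>0 where "\<omega>s = [\<omega>0]" "ws = []" using a(2) by (auto simp: tensor_args_iff length_Suc_conv)
    moreover have "vector_tensor S Y e [c *\<^sub>R \<omega>] [] = c * \<omega> (Y e)" if "\<omega> \<in> covectors S e" for c \<omega>
      using vt_apply[OF a(1) subspace_scale[OF covectors_subspace that], of Y c] by (simp add: scaleR_fun_def)
    moreover have "vector_tensor S Y e [\<omega> + \<omega>'] [] = \<omega> (Y e) + \<omega>' (Y e)"
      if "\<omega> \<in> covectors S e" "\<omega>' \<in> covectors S e" for \<omega> \<omega>'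
      using vt_apply[OF a(1) subspace_add[OF covectors_subspace that], of Y] by simp
    ultimately show ?thesis using a(3) vt_apply[OF a(1)] by (simp add: lin_on_def)
  qed
  fix K :: "('m, 'n, 'f, 'b, 'i, 'p, 'r) coords" and As Bs :: "('p + 'r) list"
  assume K: "local_coords S K" and l: "length As = 1" "length Bs = 0"
  then obtain A where A: "As = [A]" "Bs = []" by (auto simp: length_Suc_conv)
  show "smoothE S (nbhd K) (\<lambda>e. vector_tensor S Y e (map (dual_basis (gtb S e) (nat_frame S K e)) As) (map (nat_frame S K e) Bs))"
    by (rule E.smooth_total_cong[OF local_coords_open[OF K] _ gsec_coef[OF Y K, of A]])
      (simp add: A vt_apply dual_basis_covector[OF nat_frame_basis[OF K]], simp add: dual_basis_def gsec_in[OF Y])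
qed simp

lemma vt_inject:
  assumes "Y \<in> gsections S" "Z \<in> gsections S" "vector_tensor S Y = vector_tensor S Z" shows "Y = Z"
proof
  fix e show "Y e = Z e"
  proof (cases "e \<in> totalE S")
    case True
    have "\<omega> (Y e) = \<omega> (Z e)" if "\<omega> \<in> covectors S e" for \<omega>
      using vt_apply[OF True that, of Y] vt_apply[OF True that, of Z] assms(3) by simp
    then show ?thesis using covectors_separate[OF True gsec_in[OF assms(1) True] gsec_in[OF assms(2) True]] by blast
  qed (simp add: gsec_off assms)
qed

lemma vt_eqI:
  assumes "tensor_field S 1 0 T" "\<And>e \<omega>. e \<in> totalE S \<Longrightarrow> \<omega> \<in> covectors S e \<Longrightarrow> T e [\<omega>] [] = \<omega> (Y e)"
  shows "T = vector_tensor S Y"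
proof (intro ext)
  fix e \<omega>s ws show "T e \<omega>s ws = vector_tensor S Y e \<omega>s ws"
  proof (cases "e \<in> totalE S \<and> (\<exists>\<omega>\<in>covectors S e. \<omega>s = [\<omega>]) \<and> ws = []")
    case True
    then obtain \<omega> where w: "e \<in> totalE S" "\<omega> \<in> covectors S e" "\<omega>s = [\<omega>]" "ws = []" by blast
    then show ?thesis using assms(2)[OF w(1,2)] vt_apply[OF w(1,2), of Y] by simp
  next
    case False
    then have "\<not> (e \<in> totalE S \<and> (\<omega>s, ws) \<in> tensor_args S 1 0 e)" by (auto simp: tensor_args_iff length_Suc_conv)
    then show ?thesis using False tf_zero[OF assms(1)] vt_zero[of e \<omega>s ws Y] by simp
  qed
qed

text \<open>The fibres are finite-dimensional, hence reflexive; at each point the vector is assembled in one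
  natural base and its coefficients in any other are values of the tensor on a dual basis.\<close>

lemma tensor_field_1_0_section:
  assumes T: "tensor_field S 1 0 T" obtains Z where "Z \<in> gsections S" "T = vector_tensor S Z"
proof -
  define Kc where "Kc x = (SOME K. local_coords S K \<and> x \<in> nbhd K)" for x
  have Kc: "local_coords S (Kc x) \<and> x \<in> nbhd (Kc x)" for x
    unfolding Kc_def by (rule someI_ex) (use ex_local_coords[of x] in blast)
  define Z where "Z e = (if e \<in> totalE S then \<Sum>k\<in>UNIV. T e [dual_basis (gtb S e) (nat_frame S (Kc (fst e)) e) k] [] *\<^sub>R nat_frame S (Kc (fst e)) e k else 0)" for e
  have Zg: "Z e \<in> gtb S e" and Z: "\<And>\<omega>. \<omega> \<in> covectors S e \<Longrightarrow> T e [\<omega>] [] = \<omega> (Z e)" if e: "e \<in> totalE S" for e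
  proof -
    let ?b = "nat_frame S (Kc (fst e)) e"
    note nb = nat_frame_basis[OF conjunct1[OF Kc] e conjunct2[OF Kc]]
    show "Z e \<in> gtb S e" using e basis_of_sum_in[OF nb] by (simp add: Z_def)
    fix \<omega> assume \<omega>: "\<omega> \<in> covectors S e"
    have "lin_on (covectors S e) (\<lambda>\<omega>'. T e ([\<omega>][0 := \<omega>']) [])"
      by (rule tf_lin_cov[OF T e]) (use \<omega> in \<open>auto simp: tensor_args_iff\<close>)
    then have l: "lin_on (covectors S e) (\<lambda>\<omega>. T e [\<omega>] [])" by simp
    have "T e [\<Sum>k\<in>UNIV. \<omega> (?b k) *\<^sub>R dual_basis (gtb S e) ?b k] [] = (\<Sum>k\<in>UNIV. \<omega> (?b k) *\<^sub>R T e [dual_basis (gtb S e) ?b k] [])"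
      by (rule lin_on_sum[OF l covectors_subspace]) (auto intro: dual_basis_covector[OF nb])
    moreover have "\<omega> (\<Sum>k\<in>UNIV. T e [dual_basis (gtb S e) ?b k] [] *\<^sub>R ?b k) = (\<Sum>k\<in>UNIV. T e [dual_basis (gtb S e) ?b k] [] *\<^sub>R \<omega> (?b k))"
      by (rule lin_on_sum[OF covectors_lin[OF \<omega>] gtb_subspace[OF e]]) (auto intro: basis_of_in[OF nb])
    ultimately show "T e [\<omega>] [] = \<omega> (Z e)" using covector_expand[OF nb \<omega>] e by (simp add: Z_def mult.commute)
  qed
  have "Z \<in> gsections S"
  proof (rule gsectionI_coords)
    fix K :: "('m, 'n, 'f, 'b, 'i, 'p, 'r) coords" and k assume K: "local_coords S K"
    have "smoothE S (nbhd K) (\<lambda>e. T e [dual_basis (gtb S e) (nat_frame S K e) k] [])"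
      using tf_smooth[OF T K, of "[k]" "[]"] by simp
    then show "smoothE S (nbhd K) (\<lambda>e. coef (nat_frame S K e) (Z e) k)"
    proof (rule E.smooth_total_cong[OF local_coords_open[OF K], rotated])
      fix e assume e: "e \<in> totalE S" "fst e \<in> nbhd K"
      show "T e [dual_basis (gtb S e) (nat_frame S K e) k] [] = coef (nat_frame S K e) (Z e) k"
        using Z[OF e(1) dual_basis_covector[OF nat_frame_basis[OF K e], of k]] Zg[OF e(1)] by (simp add: dual_basis_def)
    qed
  qed (use Zg in \<open>blast, simp add: Z_def\<close>)
  moreover have "T = vector_tensor S Z" by (rule vt_eqI[OF T Z])
  ultimately show thesis by (rule that)
qed

definition insert_section :: "('m, 'f, 'b) tensor \<Rightarrow> ('m \<times> 'b \<Rightarrow> ('m, 'f, 'b) gvec) \<Rightarrow> ('m, 'f, 'b) tensor" where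
  "insert_section T Y = (\<lambda>e \<omega>s ws. if \<omega>s = [] then T e [] (Y e # ws) else 0)"

lemma tf_Cons_lin:
  assumes "tensor_field S 0 (Suc l) T" "e \<in> totalE S" "length ws = l" "set ws \<subseteq> gtb S e"
  shows "lin_on (gtb S e) (\<lambda>w. T e [] (w # ws))"
proof -
  have "0 \<in> gtb S e" using subspace_0[OF gtb_subspace[OF assms(2)]] .
  then show ?thesis using tf_lin_vec[OF assms(1,2), of "[]" "0 # ws" 0] assms(3,4) by (simp add: tensor_args_iff)
qed

lemma insert_section_field:
  assumes T: "tensor_field S 0 (Suc l) T" and Y: "Y \<in> gsections S"
  shows "tensor_field S 0 l (insert_section T Y)"
proof (rule tensor_fieldI)
  show "insert_section T Y e \<omega>s ws = 0" if "\<not> (e \<in> totalE S \<and> (\<omega>s, ws) \<in> tensor_args S 0 l e)" for e \<omega>s ws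
    using that tf_zero[OF T, of e "[]" "Y e # ws"] by (auto simp: insert_section_def tensor_args_iff)
  show "lin_on (gtb S e) (\<lambda>w. insert_section T Y e \<omega>s (ws[j := w]))"
    if a: "e \<in> totalE S" "(\<omega>s, ws) \<in> tensor_args S 0 l e" "j < l" for e \<omega>s ws j
    using tf_lin_vec[OF T a(1), of "[]" "Y e # ws" "Suc j"] a gsec_in[OF Y a(1)]
    by (simp add: insert_section_def tensor_args_iff)
  fix K :: "('m, 'n, 'f, 'b, 'i, 'p, 'r) coords" and As Bs :: "('p + 'r) list"
  assume K: "local_coords S K" and l: "length As = 0" "length Bs = l"
  have "smoothE S (nbhd K) (\<lambda>e. \<Sum>A\<in>UNIV. coef (nat_frame S K e) (Y e) A * T e [] (map (nat_frame S K e) (A # Bs)))"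
    using tf_smooth[OF T K, of "[]" "_ # Bs"] l gsec_coef[OF Y K]
    by (intro E.smooth_total_sum E.smooth_total_mult local_coords_open[OF K]) auto
  then show "smoothE S (nbhd K) (\<lambda>e. insert_section T Y e (map (dual_basis (gtb S e) (nat_frame S K e)) As) (map (nat_frame S K e) Bs))"
  proof (rule E.smooth_total_cong[OF local_coords_open[OF K], rotated])
    fix e assume e: "e \<in> totalE S" "fst e \<in> nbhd K"
    note nb = nat_frame_basis[OF K e]
    have "T e [] ((\<Sum>A\<in>UNIV. coef (nat_frame S K e) (Y e) A *\<^sub>R nat_frame S K e A) # map (nat_frame S K e) Bs)
        = (\<Sum>A\<in>UNIV. coef (nat_frame S K e) (Y e) A *\<^sub>R T e [] (nat_frame S K e A # map (nat_frame S K e) Bs))"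
      by (rule lin_on_sum[OF tf_Cons_lin[OF T e(1)] gtb_subspace[OF e(1)]]) (use l basis_of_in[OF nb] in auto)
    then show "(\<Sum>A\<in>UNIV. coef (nat_frame S K e) (Y e) A * T e [] (map (nat_frame S K e) (A # Bs)))
        = insert_section T Y e (map (dual_basis (gtb S e) (nat_frame S K e)) As) (map (nat_frame S K e) Bs)"
      using l gsec_expand[OF Y K e] by (simp add: insert_section_def)
  qed
qed auto

lemma contraction_basis:
  assumes e: "e \<in> totalE S"
  obtains b :: "'p + 'r \<Rightarrow> ('m, 'f, 'b) gvec" where "basis_of (gtb S e) b"
    "\<And>i j T \<omega>s ws. contraction S i j T e \<omega>s ws
       = (\<Sum>k\<in>UNIV. T e (take i \<omega>s @ dual_basis (gtb S e) b k # drop i \<omega>s) (take j ws @ b k # drop j ws))"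
proof -
  obtain K where K: "local_coords S K" "fst e \<in> nbhd K" by (rule ex_local_coords)
  have "basis_of (gtb S e) (SOME b :: 'p + 'r \<Rightarrow> ('m, 'f, 'b) gvec. basis_of (gtb S e) b)"
    by (rule someI[of "basis_of (gtb S e)", OF nat_frame_basis[OF K(1) e K(2)]])
  then show thesis by (rule that) (simp add: contraction_def Let_def)
qed

lemma contraction_off: "e \<notin> totalE S \<Longrightarrow> tensor_field S k l T \<Longrightarrow> contraction S i j T e \<omega>s ws = 0"
  using tf_zero[of k l T e] by (simp add: contraction_def Let_def)

text \<open>Insertion of a section is a tensor product followed by a contraction, two operations with which a
  covariant derivative is compatible.\<close>

lemma contraction_insert:
  assumes T: "tensor_field S 0 (Suc l) T" and Y: "Y \<in> gsections S"
  shows "contraction S 0 0 (tensor_prod 0 (Suc l) T (vector_tensor S Y)) = insert_section T Y"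
proof (intro ext)
  fix e \<omega>s ws
  show "contraction S 0 0 (tensor_prod 0 (Suc l) T (vector_tensor S Y)) e \<omega>s ws = insert_section T Y e \<omega>s ws"
  proof (cases "e \<in> totalE S \<and> (\<omega>s, ws) \<in> tensor_args S 0 l e")
    case True
    then have e: "e \<in> totalE S" and a: "\<omega>s = []" "length ws = l" "set ws \<subseteq> gtb S e" by (auto simp: tensor_args_iff)
    obtain b :: "'p + 'r \<Rightarrow> ('m, 'f, 'b) gvec" where b: "basis_of (gtb S e) b"
      "\<And>i j T \<omega>s ws. contraction S i j T e \<omega>s ws
       = (\<Sum>k\<in>UNIV. T e (take i \<omega>s @ dual_basis (gtb S e) b k # drop i \<omega>s) (take j ws @ b k # drop j ws))"
      by (rule contraction_basis[OF e]) blast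
    have "T e [] ((\<Sum>k\<in>UNIV. coef b (Y e) k *\<^sub>R b k) # ws) = (\<Sum>k\<in>UNIV. coef b (Y e) k *\<^sub>R T e [] (b k # ws))"
      by (rule lin_on_sum[OF tf_Cons_lin[OF T e a(2,3)] gtb_subspace[OF e]]) (auto intro: basis_of_in[OF b(1)])
    then have "T e [] (Y e # ws) = (\<Sum>k\<in>UNIV. T e [] (b k # ws) * dual_basis (gtb S e) b k (Y e))"
      using gsec_in[OF Y e] unfolding basis_of_expand[OF b(1) gsec_in[OF Y e]] by (simp add: dual_basis_def mult.commute)
    then show ?thesis
      using a by (simp add: b(2) tensor_prod_def vt_apply[OF e dual_basis_covector[OF b(1)]] insert_section_def)
  next
    case False
    have i0: "insert_section T Y e \<omega>s ws = 0" by (rule tf_zero[OF insert_section_field[OF assms] False])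
    show ?thesis
    proof (cases "e \<in> totalE S")
      case e: True
      obtain b :: "'p + 'r \<Rightarrow> ('m, 'f, 'b) gvec" where b: "basis_of (gtb S e) b"
        "\<And>i j T \<omega>s ws. contraction S i j T e \<omega>s ws
         = (\<Sum>k\<in>UNIV. T e (take i \<omega>s @ dual_basis (gtb S e) b k # drop i \<omega>s) (take j ws @ b k # drop j ws))"
        by (rule contraction_basis[OF e]) blast
      have "T e [] (b k # take l ws) * vector_tensor S Y e (dual_basis (gtb S e) b k # \<omega>s) (drop l ws) = 0" for k
      proof (rule ccontr)
        assume "\<not> ?thesis"
        then have 1: "T e [] (b k # take l ws) \<noteq> 0" and 2: "vector_tensor S Y e (dual_basis (gtb S e) b k # \<omega>s) (drop l ws) \<noteq> 0" by auto
        have "([], b k # take l ws) \<in> tensor_args S 0 (Suc l) e" using tf_zero[OF T, of e] 1 by blast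
        moreover have "\<omega>s = []" "drop l ws = []" using vt_zero[of e _ _ Y] 2 by blast+
        ultimately have "(\<omega>s, ws) \<in> tensor_args S 0 l e" by (auto simp: tensor_args_iff)
        then show False using False e by simp
      qed
      then have "(\<Sum>k\<in>UNIV. T e [] (b k # take l ws) * vector_tensor S Y e (dual_basis (gtb S e) b k # \<omega>s) (drop l ws)) = 0"
        by (intro sum.neutral ballI)
      then show ?thesis using i0 by (simp add: b(2) tensor_prod_def)
    next
      case False
      then show ?thesis using i0 contraction_off[OF False tensor_prod_field[OF T vector_tensor_field[OF Y]]] by simp
    qed
  qed
qed

lemma contraction_add: "contraction S i j (T + T') = contraction S i j T + contraction S i j T'"
  by (simp add: contraction_def Let_def fun_eq_iff sum.distrib)

lemma tf_add:
  assumes "tensor_field S k l T" "tensor_field S k l T'" shows "tensor_field S k l (T + T')"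
proof (rule tensor_fieldI)
  fix K :: "('m, 'n, 'f, 'b, 'i, 'p, 'r) coords" and As Bs :: "('p + 'r) list"
  assume K: "local_coords S K" and l: "length As = k" "length Bs = l"
  show "smoothE S (nbhd K) (\<lambda>e. (T + T') e (map (dual_basis (gtb S e) (nat_frame S K e)) As) (map (nat_frame S K e) Bs))"
    using E.smooth_total_add[OF local_coords_open[OF K] tf_smooth[OF assms(1) K l] tf_smooth[OF assms(2) K l]] by simp
next
  fix e \<omega>s ws i assume a: "e \<in> totalE S" "(\<omega>s, ws) \<in> tensor_args S k l e" "i < k"
  show "lin_on (covectors S e) (\<lambda>\<omega>. (T + T') e (\<omega>s[i := \<omega>]) ws)"
    using tf_lin_cov[OF assms(1) a] tf_lin_cov[OF assms(2) a] by (simp add: lin_on_def algebra_simps)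
next
  fix e \<omega>s ws j assume a: "e \<in> totalE S" "(\<omega>s, ws) \<in> tensor_args S k l e" "j < l"
  show "lin_on (gtb S e) (\<lambda>w. (T + T') e \<omega>s (ws[j := w]))"
    using tf_lin_vec[OF assms(1) a] tf_lin_vec[OF assms(2) a] by (simp add: lin_on_def algebra_simps)
qed (use tf_zero[OF assms(1)] tf_zero[OF assms(2)] in auto)

lemma tf_eval_smooth:
  assumes T: "tensor_field S 0 2 T" and X: "X \<in> gsections S" and Y: "Y \<in> gsections S"
  shows "smoothE S UNIV (\<lambda>e. T e [] [X e, Y e])"
proof -
  have T2: "tensor_field S 0 (Suc (Suc 0)) T" using T by (simp add: numeral_2_eq_2)
  have i: "tensor_field S 0 0 (insert_section (insert_section T X) Y)"
    by (intro insert_section_field T2 X Y)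
  show ?thesis
  proof (rule E.smooth_total_locally)
    fix x
    obtain K where K: "local_coords S K" "x \<in> nbhd K" by (rule ex_local_coords)
    then show "\<exists>V. open V \<and> x \<in> V \<and> smoothE S V (\<lambda>e. T e [] [X e, Y e])"
      using tf_smooth[OF i K(1), of "[]" "[]"] local_coords_open[OF K(1)] by (auto simp: insert_section_def)
  qed
qed

end

section \<open>Covariant derivatives of sections and of the metric\<close>

locale metr = gcon S C
  for S :: "('m::{t2_space,second_countable_topology}, 'n::{t2_space,second_countable_topology},
               'f::real_vector, 'b::real_vector, 'i::finite, 'p::finite, 'r::finite) gla_data"
    and C :: "('m, 'f, 'b) gconn" +
  fixes D0 :: "('m, 'f, 'b) cov_deriv" and G :: "('m, 'f, 'b) tensor"
  assumes dist: "distinguished_connection S C D0" and metric: "pseudometrical S C G"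
begin

lemma cd: "covariant_derivative S D0"
  using dist by (simp add: distinguished_connection_def)

lemmas cd_1 = cd[unfolded covariant_derivative_def]
lemmas cd_2 = conjunct2[OF cd_1]
lemmas cd_3 = conjunct2[OF cd_2]
lemmas cd_4 = conjunct2[OF cd_3]
lemmas cd_5 = conjunct2[OF cd_4]
lemmas cd_6 = conjunct2[OF cd_5]

lemma cd_field: "X \<in> gsections S \<Longrightarrow> tensor_field S k l T \<Longrightarrow> tensor_field S k l (D0 X T)"
  by (rule conjunct1[OF cd_1, rule_format])

lemma cd_add_left:
  assumes "X \<in> gsections S" "Y \<in> gsections S" "tensor_field S k l T"
  shows "D0 (\<lambda>e. X e + Y e) T = D0 X T + D0 Y T"
  using conjunct1[OF cd_2, rule_format, OF assms] by (simp add: plus_fun_def)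

lemma cd_scale_left:
  assumes "X \<in> gsections S" "smoothE S UNIV f" "tensor_field S k l T"
  shows "D0 (\<lambda>e. f e *\<^sub>R X e) T = (\<lambda>e \<omega>s ws. f e * D0 X T e \<omega>s ws)"
  by (rule conjunct1[OF cd_3, rule_format, OF assms(1) conjI[OF assms(2,3)]])

lemma cd_add:
  assumes "X \<in> gsections S" "tensor_field S k l T" "tensor_field S k l T'"
  shows "D0 X (T + T') = D0 X T + D0 X T'"
  by (rule conjunct1[OF cd_4, rule_format, OF assms(1) conjI[OF assms(2,3)]])

lemma cd_scalar: "X \<in> gsections S \<Longrightarrow> smoothE S UNIV f \<Longrightarrow> D0 X (scalar_tensor S f) = scalar_tensor S (\<lambda>e. snd (X e) f)"
  by (rule conjunct1[OF cd_5, rule_format])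

lemma cd_prod:
  assumes "X \<in> gsections S" "tensor_field S k l T" "tensor_field S k' l' T'"
  shows "D0 X (tensor_prod k l T T') = tensor_prod k l (D0 X T) T' + tensor_prod k l T (D0 X T')"
  by (rule conjunct1[OF cd_6, rule_format, OF assms(1) conjI[OF assms(2,3)]])

lemma cd_contraction:
  assumes "X \<in> gsections S" "tensor_field S (Suc k) (Suc l) T" "i \<le> k" "j \<le> l"
  shows "D0 X (contraction S i j T) = contraction S i j (D0 X T)"
  by (rule conjunct2[OF cd_6, rule_format, OF assms(1) conjI[OF assms(2) conjI[OF assms(3,4)]]])

text \<open>The section that represents \<open>D0 X Y\<close>; it exists since every tensor field of type
  \<open>(1, 0)\<close> is a vector field.\<close>

definition nab :: "('m \<times> 'b \<Rightarrow> ('m, 'f, 'b) gvec) \<Rightarrow> ('m \<times> 'b \<Rightarrow> ('m, 'f, 'b) gvec) \<Rightarrow> 'm \<times> 'b \<Rightarrow> ('m, 'f, 'b) gvec" where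
  "nab X Y = (SOME Z. Z \<in> gsections S \<and> D0 X (vector_tensor S Y) = vector_tensor S Z)"

lemma nab:
  assumes "X \<in> gsections S" "Y \<in> gsections S"
  shows "nab X Y \<in> gsections S \<and> D0 X (vector_tensor S Y) = vector_tensor S (nab X Y)"
proof -
  obtain Z where "Z \<in> gsections S" "D0 X (vector_tensor S Y) = vector_tensor S Z"
    by (rule tensor_field_1_0_section[OF cd_field[OF assms(1) vector_tensor_field[OF assms(2)]]])
  then show ?thesis unfolding nab_def
    using someI[of "\<lambda>Z. Z \<in> gsections S \<and> D0 X (vector_tensor S Y) = vector_tensor S Z" Z] by blast
qed

lemma nab_in: "X \<in> gsections S \<Longrightarrow> Y \<in> gsections S \<Longrightarrow> nab X Y \<in> gsections S"
  and nab_vt: "X \<in> gsections S \<Longrightarrow> Y \<in> gsections S \<Longrightarrow> D0 X (vector_tensor S Y) = vector_tensor S (nab X Y)"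
  using nab by blast+

lemma nab_eqI:
  assumes "X \<in> gsections S" "Y \<in> gsections S" "Z \<in> gsections S"
    and "\<And>e \<omega>. e \<in> totalE S \<Longrightarrow> \<omega> \<in> covectors S e \<Longrightarrow> D0 X (vector_tensor S Y) e [\<omega>] [] = \<omega> (Z e)"
  shows "nab X Y = Z"
  by (rule vt_inject[OF nab_in[OF assms(1,2)] assms(3)])
    (use vt_eqI[OF cd_field[OF assms(1) vector_tensor_field[OF assms(2)]] assms(4)] nab_vt[OF assms(1,2)] in simp)

lemma nab_apply:
  "X \<in> gsections S \<Longrightarrow> Y \<in> gsections S \<Longrightarrow> e \<in> totalE S \<Longrightarrow> \<omega> \<in> covectors S e \<Longrightarrow>
     D0 X (vector_tensor S Y) e [\<omega>] [] = \<omega> (nab X Y e)"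
  by (simp add: nab_vt vt_apply)

lemma covector_add: "e \<in> totalE S \<Longrightarrow> \<omega> \<in> covectors S e \<Longrightarrow> v \<in> gtb S e \<Longrightarrow> w \<in> gtb S e \<Longrightarrow> \<omega> (v + w) = \<omega> v + \<omega> w"
  and covector_scale: "e \<in> totalE S \<Longrightarrow> \<omega> \<in> covectors S e \<Longrightarrow> v \<in> gtb S e \<Longrightarrow> \<omega> (c *\<^sub>R v) = c * \<omega> v"
  by (auto simp: covectors_def lin_on_def)

lemma nab_add_left:
  assumes "X \<in> gsections S" "X' \<in> gsections S" "Y \<in> gsections S"
  shows "nab (\<lambda>e. X e + X' e) Y = (\<lambda>e. nab X Y e + nab X' Y e)"
  by (rule nab_eqI)
    (simp_all add: assms gsec_add nab_in cd_add_left[OF _ _ vector_tensor_field] nab_apply covector_add gsec_in)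

lemma nab_scale_left:
  assumes "smoothE S UNIV f" "X \<in> gsections S" "Y \<in> gsections S"
  shows "nab (\<lambda>e. f e *\<^sub>R X e) Y = (\<lambda>e. f e *\<^sub>R nab X Y e)"
  by (rule nab_eqI)
    (simp_all add: assms gsec_scale nab_in cd_scale_left[OF _ _ vector_tensor_field] nab_apply covector_scale gsec_in)

lemma nab_add_right:
  assumes X: "X \<in> gsections S" and Y: "Y \<in> gsections S" "Y' \<in> gsections S"
  shows "nab X (\<lambda>e. Y e + Y' e) = (\<lambda>e. nab X Y e + nab X Y' e)"
proof (rule nab_eqI)
  have "vector_tensor S (\<lambda>e. Y e + Y' e) = vector_tensor S Y + vector_tensor S Y'"
    by (rule vt_eqI[symmetric, OF tf_add[OF vector_tensor_field[OF Y(1)] vector_tensor_field[OF Y(2)]]])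
      (simp add: Y vt_apply covector_add gsec_in)
  then show "D0 X (vector_tensor S (\<lambda>e. Y e + Y' e)) e [\<omega>] [] = \<omega> (nab X Y e + nab X Y' e)"
    if "e \<in> totalE S" "\<omega> \<in> covectors S e" for e \<omega>
    using that by (simp add: cd_add[OF X vector_tensor_field vector_tensor_field] X Y nab_apply covector_add gsec_in nab_in)
qed (simp_all add: assms gsec_add nab_in)

lemma nab_scale_right:
  assumes f: "smoothE S UNIV f" and X: "X \<in> gsections S" and Y: "Y \<in> gsections S"
  shows "nab X (\<lambda>e. f e *\<^sub>R Y e) = (\<lambda>e. snd (X e) f *\<^sub>R Y e + f e *\<^sub>R nab X Y e)"
proof (rule nab_eqI)
  have tf: "tensor_field S 1 0 (tensor_prod 0 0 (scalar_tensor S f) (vector_tensor S Y))"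
    using tensor_prod_field[OF scalar_tensor_field[OF f] vector_tensor_field[OF Y]] by simp
  have eq: "vector_tensor S (\<lambda>e. f e *\<^sub>R Y e) = tensor_prod 0 0 (scalar_tensor S f) (vector_tensor S Y)"
    by (rule vt_eqI[symmetric, OF tf]) (simp add: tensor_prod_def scalar_tensor_def vt_apply covector_scale gsec_in Y)
  show "D0 X (vector_tensor S (\<lambda>e. f e *\<^sub>R Y e)) e [\<omega>] [] = \<omega> (snd (X e) f *\<^sub>R Y e + f e *\<^sub>R nab X Y e)"
    if e: "e \<in> totalE S" and \<omega>: "\<omega> \<in> covectors S e" for e \<omega>
  proof -
    have "D0 X (vector_tensor S (\<lambda>e. f e *\<^sub>R Y e)) e [\<omega>] [] = snd (X e) f * \<omega> (Y e) + f e * \<omega> (nab X Y e)"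
      unfolding eq cd_prod[OF X scalar_tensor_field[OF f] vector_tensor_field[OF Y]] cd_scalar[OF X f]
      using e \<omega> by (simp add: tensor_prod_def scalar_tensor_def vt_apply nab_apply X Y)
    then show ?thesis
      using covector_add[OF e \<omega>, of "snd (X e) f *\<^sub>R Y e" "f e *\<^sub>R nab X Y e"] covector_scale[OF e \<omega>]
        gsec_in[OF Y e] gsec_in[OF nab_in[OF X Y] e] subspace_scale[OF gtb_subspace[OF e]] by simp
  qed
qed (use assms gsec_scale[OF gsec_derivative_smooth] in \<open>simp_all add: gsec_add gsec_scale nab_in\<close>)

lemma nab_horizontal:
  assumes X: "X \<in> gsections S" and Y: "Y \<in> gsections S" "\<And>e. e \<in> totalE S \<Longrightarrow> Y e \<in> horizontal S C e" and e: "e \<in> totalE S"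
  shows "nab X Y e \<in> horizontal S C e"
proof -
  have "preserves S D0 (horizontal S C)" using dist by (simp add: distinguished_connection_def)
  then have "\<exists>Z\<in>gsections S. (\<forall>e\<in>totalE S. Z e \<in> horizontal S C e) \<and> D0 X (vector_tensor S Y) = vector_tensor S Z"
    using X Y unfolding preserves_def by blast
  then obtain Z where Z: "Z \<in> gsections S" "\<forall>e\<in>totalE S. Z e \<in> horizontal S C e" "vector_tensor S (nab X Y) = vector_tensor S Z"
    using nab_vt[OF X Y(1)] by auto
  then have "nab X Y = Z" using vt_inject[OF nab_in[OF X Y(1)]] by blast
  then show ?thesis using Z e by blast
qed

lemma nab_vertical:
  assumes X: "X \<in> gsections S" and Y: "Y \<in> gsections S" "\<And>e. e \<in> totalE S \<Longrightarrow> Y e \<in> vertical S e" and e: "e \<in> totalE S"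
  shows "nab X Y e \<in> vertical S e"
proof -
  have "preserves S D0 (vertical S)" using dist by (simp add: distinguished_connection_def)
  then have "\<exists>Z\<in>gsections S. (\<forall>e\<in>totalE S. Z e \<in> vertical S e) \<and> D0 X (vector_tensor S Y) = vector_tensor S Z"
    using X Y unfolding preserves_def by blast
  then obtain Z where Z: "Z \<in> gsections S" "\<forall>e\<in>totalE S. Z e \<in> vertical S e" "vector_tensor S (nab X Y) = vector_tensor S Z"
    using nab_vt[OF X Y(1)] by auto
  then have "nab X Y = Z" using vt_inject[OF nab_in[OF X Y(1)]] by blast
  then show ?thesis using Z e by blast
qed

lemma nab_cong_point:
  assumes X: "X \<in> gsections S" "X' \<in> gsections S" and Y: "Y \<in> gsections S" and e: "X e = X' e"
  shows "nab X Y e = nab X' Y e"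
proof -
  have "(\<lambda>X. nab X Y e) (\<lambda>e. X e - X' e) = 0"
    by (rule gsec_function_linear_vanishes[where \<tau>="\<lambda>X. nab X Y e" and p=e])
      (use X Y e in \<open>simp_all add: nab_add_left nab_scale_left gsec_diff\<close>)
  moreover have "nab X Y = (\<lambda>e. nab (\<lambda>e. X e - X' e) Y e + nab X' Y e)"
    using nab_add_left[OF gsec_diff[OF X] X(2) Y] by simp
  ultimately show ?thesis by simp
qed

lemma snd_const:
  assumes "e \<in> totalE S" "w \<in> gtb S e" shows "snd w (\<lambda>e. c) = 0"
  using assms by (auto simp: gtb_eq_gtv gtv_def tanE_def partial_deriv_eq E.bundle_deriv_def o_def)

text \<open>A section vanishing over an open set of the base is its own product with a function vanishing at the
  point, so the Leibniz rule annihilates its derivative there.\<close>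

lemma nab_local:
  assumes X: "X \<in> gsections S" and Y: "Y \<in> gsections S" "Y' \<in> gsections S"
    and V: "open V" "fst e \<in> V" "\<And>e'. e' \<in> totalE S \<Longrightarrow> fst e' \<in> V \<Longrightarrow> Y e' = Y' e'" and e: "e \<in> totalE S"
  shows "nab X Y e = nab X Y' e"
proof -
  obtain b where b: "bump_at (atlasM S) V (fst e) b" by (rule E.ex_bump[OF V(1,2)])
  \<comment> \<open>equal to one off \<open>V\<close> and to zero at \<open>e\<close>\<close>
  define f where "f e' = 1 + (-1) * b (fst e')" for e' :: "'m \<times> 'b"
  have f: "smoothE S UNIV f" unfolding f_def
    by (intro E.smooth_total_add E.smooth_total_mult E.smooth_total_const E.smooth_total_pullback bump_at_smooth[OF b] open_UNIV)
  define Z where "Z e' = Y e' - Y' e'" for e'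
  have Z: "Z \<in> gsections S" unfolding Z_def by (rule gsec_diff[OF Y])
  have "Z = (\<lambda>e'. f e' *\<^sub>R Z e')"
  proof
    fix e'
    show "Z e' = f e' *\<^sub>R Z e'"
    proof (cases "e' \<in> totalE S \<and> fst e' \<in> V")
      case True then show ?thesis using V(3) by (simp add: Z_def)
    next
      case False then show ?thesis using bump_at_eq_0[OF b, of "fst e'"] gsec_off[OF Z, of e'] by (auto simp: f_def)
    qed
  qed
  then have "nab X Z = (\<lambda>e. snd (X e) f *\<^sub>R Z e + f e *\<^sub>R nab X Z e)"
    using nab_scale_right[OF f X Z] by simp
  then have "nab X Z e = snd (X e) f *\<^sub>R Z e + f e *\<^sub>R nab X Z e" by (rule fun_cong)
  then have "nab X Z e = 0" using V(2,3) e bump_at_eq_1[OF b] by (simp add: Z_def f_def)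
  moreover have "nab X Y = (\<lambda>e. nab X Z e + nab X Y' e)"
    using nab_add_right[OF X Z Y(2)] by (simp add: Z_def)
  ultimately show ?thesis by simp
qed

lemma cd_insert:
  assumes X: "X \<in> gsections S" and T: "tensor_field S 0 (Suc l) T" and Y: "Y \<in> gsections S"
  shows "D0 X (insert_section T Y) = insert_section (D0 X T) Y + insert_section T (nab X Y)"
proof -
  have tf: "tensor_field S (Suc 0) (Suc l) (tensor_prod 0 (Suc l) T (vector_tensor S Y))"
    using tensor_prod_field[OF T vector_tensor_field[OF Y]] by simp
  show ?thesis
    unfolding contraction_insert[OF T Y, symmetric] cd_contraction[OF X tf le0 le0] cd_prod[OF X T vector_tensor_field[OF Y]]
      contraction_add nab_vt[OF X Y]
    by (simp add: contraction_insert cd_field[OF X T] T Y nab_in[OF X Y])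
qed

abbreviation g :: "'m \<times> 'b \<Rightarrow> ('m, 'f, 'b) gvec \<Rightarrow> ('m, 'f, 'b) gvec \<Rightarrow> real" where
  "g e v w \<equiv> G e [] [v, w]"

lemma G_field: "tensor_field S 0 2 G"
  using metric by (simp add: pseudometrical_def)

text \<open>The function \<open>G(Y, Z)\<close> arises from \<open>G\<close> by two insertions, each of which
  obeys the Leibniz rule.\<close>

lemma cd_metric:
  assumes X: "X \<in> gsections S" and Y: "Y \<in> gsections S" and Z: "Z \<in> gsections S" and e: "e \<in> totalE S"
  shows "D0 X G e [] [Y e, Z e] = snd (X e) (\<lambda>e. g e (Y e) (Z e)) - g e (nab X Y e) (Z e) - g e (Y e) (nab X Z e)"
proof -
  have G2: "tensor_field S 0 (Suc (Suc 0)) G" using G_field by (simp add: numeral_2_eq_2)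
  note i1 = insert_section_field[OF G2 Y] and f = tf_eval_smooth[OF G_field Y Z]
  have s: "insert_section (insert_section G Y) Z = scalar_tensor S (\<lambda>e. g e (Y e) (Z e))"
    by (auto simp: insert_section_def scalar_tensor_def fun_eq_iff intro!: tf_zero[OF G_field]) (simp add: tensor_args_iff)
  have "D0 X (insert_section (insert_section G Y) Z) e [] []
      = D0 X G e [] [Y e, Z e] + g e (nab X Y e) (Z e) + g e (Y e) (nab X Z e)"
    unfolding cd_insert[OF X i1 Z] cd_insert[OF X G2 Y] by (simp add: insert_section_def)
  then show ?thesis unfolding s cd_scalar[OF X f] using e by (simp add: scalar_tensor_def)
qed

end

section \<open>The metric on a fibre\<close>

lemma lin_on_plus: "lin_on W f \<Longrightarrow> lin_on W f' \<Longrightarrow> lin_on W (\<lambda>w. f w + f' w)"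
  and lin_on_minus: "lin_on W f \<Longrightarrow> lin_on W f' \<Longrightarrow> lin_on W (\<lambda>w. f w - f' w)"
  by (auto simp: lin_on_def algebra_simps)

lemma lin_on_compose: "lin_on W f \<Longrightarrow> lin_on W' h \<Longrightarrow> (\<And>w. w \<in> W' \<Longrightarrow> h w \<in> W) \<Longrightarrow> lin_on W' (\<lambda>w. f (h w))"
  unfolding lin_on_def by simp

lemma lin_on_combination: "lin_on W f \<Longrightarrow> subspace W \<Longrightarrow> v \<in> W \<Longrightarrow> w \<in> W \<Longrightarrow> f (v + c *\<^sub>R w) = f v + c *\<^sub>R f w"
  by (simp add: lin_on_def subspace_scale)

lemma lin_on_neg: "lin_on W f \<Longrightarrow> lin_on W (\<lambda>w. - f w)"
  by (auto simp: lin_on_def)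

lemma lin_on_congI: "lin_on W f \<Longrightarrow> subspace W \<Longrightarrow> (\<And>w. w \<in> W \<Longrightarrow> f w = f' w) \<Longrightarrow> lin_on W f'"
  by (simp add: lin_on_def subspace_add subspace_scale)

context metr
begin

lemma adapted_in: "local_coords S K \<Longrightarrow> e \<in> totalE S \<Longrightarrow> fst e \<in> nbhd K \<Longrightarrow> adapted_frame S C K e k \<in> gtb S e"
  using basis_of_in[OF adapted_basis] .

lemma horizontal_expand:
  assumes K: "local_coords S K" and e: "e \<in> totalE S" "fst e \<in> nbhd K" and w: "w \<in> horizontal S C e"
  obtains c where "w = (\<Sum>\<alpha>\<in>UNIV. c \<alpha> *\<^sub>R adapted_frame S C K e (Inl \<alpha>))"
proof -
  obtain u where u: "u \<in> sectionsF S" "hlift u e = w" by (rule hlift_surj[OF e(1) w])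
  show thesis by (rule that) (use hlift_expand[OF u(1) K e] u(2) in simp)
qed

lemma vertical_expand:
  assumes K: "local_coords S K" and e: "e \<in> totalE S" "fst e \<in> nbhd K" and w: "w \<in> vertical S e"
  obtains c where "w = (\<Sum>a\<in>UNIV. c a *\<^sub>R adapted_frame S C K e (Inr a))"
  by (rule that[of "coef (\<lambda>a. nat_frame S K e (Inr a)) w"])
    (simp add: adapted_frame.simps basis_of_expand[OF vertical_eq(2)[OF e(1) K e(2)] w])

lemma coef_horizontal_Inr:
  assumes K: "local_coords S K" and e: "e \<in> totalE S" "fst e \<in> nbhd K" and w: "w \<in> horizontal S C e"
  shows "coef (adapted_frame S C K e) w (Inr a) = 0"
proof -
  obtain c where "w = (\<Sum>\<alpha>\<in>UNIV. c \<alpha> *\<^sub>R adapted_frame S C K e (Inl \<alpha>))" by (rule horizontal_expand[OF assms])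
  then have "w = (\<Sum>k\<in>UNIV. case_sum c (\<lambda>_. 0) k *\<^sub>R adapted_frame S C K e k)" by (simp add: sum_UNIV_Plus)
  then show ?thesis using coef_sum[OF adapted_basis[OF K e]] by simp
qed

lemma coef_vertical_Inl:
  assumes K: "local_coords S K" and e: "e \<in> totalE S" "fst e \<in> nbhd K" and w: "w \<in> vertical S e"
  shows "coef (adapted_frame S C K e) w (Inl \<alpha>) = 0"
proof -
  obtain c where "w = (\<Sum>a\<in>UNIV. c a *\<^sub>R adapted_frame S C K e (Inr a))" by (rule vertical_expand[OF assms])
  then have "w = (\<Sum>k\<in>UNIV. case_sum (\<lambda>_. 0) c k *\<^sub>R adapted_frame S C K e k)" by (simp add: sum_UNIV_Plus)
  then show ?thesis using coef_sum[OF adapted_basis[OF K e]] by simp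
qed

lemma metric_coords:
  assumes K: "local_coords S K" and e: "e \<in> totalE S" "fst e \<in> nbhd K"
  shows "g_hor S C K G e $ \<alpha> $ \<beta> = g_hor S C K G e $ \<beta> $ \<alpha>" "g_ver S C K G e $ a $ b = g_ver S C K G e $ b $ a"
    "invertible (g_hor S C K G e)" "invertible (g_ver S C K G e)"
    "v \<in> gtb S e \<Longrightarrow> w \<in> gtb S e \<Longrightarrow> g e v w =
       (\<Sum>\<alpha>\<in>UNIV. \<Sum>\<beta>\<in>UNIV. g_hor S C K G e $ \<alpha> $ \<beta> * coef (adapted_frame S C K e) v (Inl \<alpha>) * coef (adapted_frame S C K e) w (Inl \<beta>)) +
       (\<Sum>a\<in>UNIV. \<Sum>b\<in>UNIV. g_ver S C K G e $ a $ b * coef (adapted_frame S C K e) v (Inr a) * coef (adapted_frame S C K e) w (Inr b))"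
proof -
  have m: "transpose (g_hor S C K G e) = g_hor S C K G e \<and> transpose (g_ver S C K G e) = g_ver S C K G e \<and>
    invertible (g_hor S C K G e) \<and> invertible (g_ver S C K G e) \<and>
    (\<forall>X\<in>gtb S e. \<forall>Y\<in>gtb S e. G e [] [X, Y] =
           (\<Sum>\<alpha>\<in>UNIV. \<Sum>\<beta>\<in>UNIV. g_hor S C K G e $ \<alpha> $ \<beta> * dual_basis (gtb S e) (adapted_frame S C K e) (Inl \<alpha>) X * dual_basis (gtb S e) (adapted_frame S C K e) (Inl \<beta>) Y) +
           (\<Sum>a\<in>UNIV. \<Sum>b\<in>UNIV. g_ver S C K G e $ a $ b * dual_basis (gtb S e) (adapted_frame S C K e) (Inr a) X * dual_basis (gtb S e) (adapted_frame S C K e) (Inr b) Y))"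
    using conjunct2[OF metric[unfolded pseudometrical_def], rule_format, OF K e] unfolding Let_def .
  show "g_hor S C K G e $ \<alpha> $ \<beta> = g_hor S C K G e $ \<beta> $ \<alpha>"
    using arg_cong[OF conjunct1[OF m], of "\<lambda>A. A $ \<beta> $ \<alpha>"] by (simp add: transpose_def)
  show "g_ver S C K G e $ a $ b = g_ver S C K G e $ b $ a"
    using arg_cong[OF conjunct1[OF conjunct2[OF m]], of "\<lambda>A. A $ b $ a"] by (simp add: transpose_def)
  show "invertible (g_hor S C K G e)" "invertible (g_ver S C K G e)" using m by blast+
  note f = conjunct2[OF conjunct2[OF conjunct2[OF conjunct2[OF m]]]]
  assume v: "v \<in> gtb S e" and w: "w \<in> gtb S e"
  show "g e v w =
       (\<Sum>\<alpha>\<in>UNIV. \<Sum>\<beta>\<in>UNIV. g_hor S C K G e $ \<alpha> $ \<beta> * coef (adapted_frame S C K e) v (Inl \<alpha>) * coef (adapted_frame S C K e) w (Inl \<beta>)) +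
       (\<Sum>a\<in>UNIV. \<Sum>b\<in>UNIV. g_ver S C K G e $ a $ b * coef (adapted_frame S C K e) v (Inr a) * coef (adapted_frame S C K e) w (Inr b))"
    using bspec[OF bspec[OF f v] w] v w by (simp add: dual_basis_def)
qed

lemma g_sym:
  assumes e: "e \<in> totalE S" and v: "v \<in> gtb S e" and w: "w \<in> gtb S e" shows "g e v w = g e w v"
proof -
  obtain K where K: "local_coords S K" "fst e \<in> nbhd K" by (rule ex_local_coords)
  note m = metric_coords[OF K(1) e K(2)]
  let ?c = "coef (adapted_frame S C K e)"
  have "(\<Sum>\<alpha>\<in>UNIV. \<Sum>\<beta>\<in>UNIV. g_hor S C K G e $ \<alpha> $ \<beta> * ?c v (Inl \<alpha>) * ?c w (Inl \<beta>))
      = (\<Sum>\<beta>\<in>UNIV. \<Sum>\<alpha>\<in>UNIV. g_hor S C K G e $ \<beta> $ \<alpha> * ?c w (Inl \<beta>) * ?c v (Inl \<alpha>))"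
    by (subst sum.swap) (simp only: m(1) mult_ac)
  moreover have "(\<Sum>a\<in>UNIV. \<Sum>b\<in>UNIV. g_ver S C K G e $ a $ b * ?c v (Inr a) * ?c w (Inr b))
      = (\<Sum>b\<in>UNIV. \<Sum>a\<in>UNIV. g_ver S C K G e $ b $ a * ?c w (Inr b) * ?c v (Inr a))"
    by (subst sum.swap) (simp only: m(2) mult_ac)
  ultimately show ?thesis unfolding m(5)[OF v w] m(5)[OF w v] by simp
qed

lemma g_horizontal_vertical:
  assumes e: "e \<in> totalE S" and v: "v \<in> horizontal S C e" and w: "w \<in> vertical S e"
  shows "g e v w = 0" "g e w v = 0"
proof -
  obtain K where K: "local_coords S K" "fst e \<in> nbhd K" by (rule ex_local_coords)
  note vw = horizontal_in[OF v] subsetD[OF vertical_subset[OF e] w]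
  show "g e v w = 0" unfolding metric_coords(5)[OF K(1) e K(2) vw]
    using coef_horizontal_Inr[OF K(1) e K(2) v] coef_vertical_Inl[OF K(1) e K(2) w] by simp
  then show "g e w v = 0" using g_sym[OF e vw] by simp
qed

lemma g_lin: assumes "e \<in> totalE S" "v \<in> gtb S e"
  shows "lin_on (gtb S e) (\<lambda>w. g e w v)" "lin_on (gtb S e) (\<lambda>w. g e v w)"
proof -
  have G2: "tensor_field S 0 (Suc 1) G" using G_field by (simp add: numeral_2_eq_2)
  show "lin_on (gtb S e) (\<lambda>w. g e w v)" using tf_Cons_lin[OF G2 assms(1), of "[v]"] assms(2) by simp
  show "lin_on (gtb S e) (\<lambda>w. g e v w)"
    using tf_lin_vec[OF G_field assms(1), of "[]" "[v, v]" 1] assms(2) by (simp add: tensor_args_iff)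
qed

lemma lin_on_basis_zero:
  fixes b :: "'k::finite \<Rightarrow> 'v::real_vector"
  assumes "basis_of W b" "lin_on W f" "\<And>k. f (b k) = (0 :: real)" "w \<in> W" shows "f w = 0"
proof -
  have "f (\<Sum>k\<in>UNIV. coef b w k *\<^sub>R b k) = (\<Sum>k\<in>UNIV. coef b w k *\<^sub>R f (b k))"
    by (rule lin_on_sum[OF assms(2) basis_of_subspace[OF assms(1)]]) (auto intro: basis_of_in[OF assms(1)])
  then show ?thesis using basis_of_expand[OF assms(1,4)] assms(3) by simp
qed

lemma g_nondegenerate:
  assumes e: "e \<in> totalE S" and z: "z \<in> gtb S e" and zero: "\<And>v. v \<in> gtb S e \<Longrightarrow> g e z v = 0"
  shows "z = 0"
proof -
  obtain K where K: "local_coords S K" "fst e \<in> nbhd K" by (rule ex_local_coords)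
  note m = metric_coords[OF K(1) e K(2)] and ab = adapted_basis[OF K(1) e K(2)]
  let ?c = "coef (adapted_frame S C K e)"
  have "g_hor S C K G e *v (\<chi> \<alpha>. ?c z (Inl \<alpha>)) = 0"
  proof (simp add: vec_eq_iff matrix_vector_mult_def, intro allI)
    fix \<beta>
    have "0 = g e z (adapted_frame S C K e (Inl \<beta>))" using zero[OF basis_of_in[OF ab]] by simp
    also have "\<dots> = (\<Sum>\<alpha>\<in>UNIV. g_hor S C K G e $ \<alpha> $ \<beta> * ?c z (Inl \<alpha>))"
      unfolding m(5)[OF z basis_of_in[OF ab]] by (simp add: coef_basis[OF ab] if_distrib cong: if_cong)
    finally show "(\<Sum>\<alpha>\<in>UNIV. g_hor S C K G e $ \<beta> $ \<alpha> * ?c z (Inl \<alpha>)) = 0" by (simp add: m(1)[of \<beta>])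
  qed
  then have "(\<chi> \<alpha>. ?c z (Inl \<alpha>)) = 0" using m(3) invertible_left_inverse matrix_left_invertible_ker by metis
  then have 1: "?c z (Inl \<alpha>) = 0" for \<alpha> by (simp add: vec_eq_iff)
  have "g_ver S C K G e *v (\<chi> a. ?c z (Inr a)) = 0"
  proof (simp add: vec_eq_iff matrix_vector_mult_def, intro allI)
    fix b
    have "0 = g e z (adapted_frame S C K e (Inr b))" using zero[OF basis_of_in[OF ab]] by simp
    also have "\<dots> = (\<Sum>a\<in>UNIV. g_ver S C K G e $ a $ b * ?c z (Inr a))"
      unfolding m(5)[OF z basis_of_in[OF ab]] by (simp add: coef_basis[OF ab] if_distrib cong: if_cong)
    finally show "(\<Sum>a\<in>UNIV. g_ver S C K G e $ b $ a * ?c z (Inr a)) = 0" by (simp add: m(2)[of b])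
  qed
  then have "(\<chi> a. ?c z (Inr a)) = 0" using m(4) invertible_left_inverse matrix_left_invertible_ker by metis
  then have 2: "?c z (Inr a) = 0" for a by (simp add: vec_eq_iff)
  have "?c z k = 0" for k using 1 2 by (cases k) auto
  then show ?thesis using basis_of_expand[OF ab z] by simp
qed

lemma g_eqI:
  assumes e: "e \<in> totalE S" and K: "local_coords S K" "fst e \<in> nbhd K" and vw: "v \<in> gtb S e" "w \<in> gtb S e"
    and eq: "\<And>k. g e v (adapted_frame S C K e k) = g e w (adapted_frame S C K e k)"
  shows "v = w"
proof -
  note ab = adapted_basis[OF K(1) e K(2)]
  have d: "g e (v - w) x = g e v x - g e w x" if "x \<in> gtb S e" for x
    by (rule lin_on_diff[OF g_lin(1)[OF e that] gtb_subspace[OF e] vw])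
  have vw': "v - w \<in> gtb S e" by (rule subspace_diff[OF gtb_subspace[OF e] vw])
  have "g e (v - w) x = 0" if "x \<in> gtb S e" for x
    by (rule lin_on_basis_zero[OF ab g_lin(2)[OF e vw'] _ that]) (simp add: d[OF basis_of_in[OF ab]] eq)
  then have "v - w = 0" by (rule g_nondegenerate[OF e vw'])
  then show ?thesis by simp
qed

lemma gram_matrix:
  assumes K: "local_coords S K" and e: "e \<in> totalE S" "fst e \<in> nbhd K"
  defines "M \<equiv> (\<chi> j k. g e (nat_frame S K e k) (nat_frame S K e j)) :: real ^ ('p + 'r) ^ ('p + 'r)"
  shows "invertible M"
    and "M *v z = (\<chi> j. g e (\<Sum>k\<in>UNIV. z $ k *\<^sub>R nat_frame S K e k) (nat_frame S K e j))"
proof -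
  note nb = nat_frame_basis[OF K e]
  show Mz: "M *v z = (\<chi> j. g e (\<Sum>k\<in>UNIV. z $ k *\<^sub>R nat_frame S K e k) (nat_frame S K e j))" for z
  proof -
    have "g e (\<Sum>k\<in>UNIV. z $ k *\<^sub>R nat_frame S K e k) (nat_frame S K e j) = (\<Sum>k\<in>UNIV. z $ k *\<^sub>R g e (nat_frame S K e k) (nat_frame S K e j))" for j
      by (rule lin_on_sum[OF g_lin(1)[OF e(1)] gtb_subspace[OF e(1)]]) (auto intro: basis_of_in[OF nb])
    then show ?thesis by (simp add: M_def vec_eq_iff matrix_vector_mult_def mult.commute)
  qed
  have "z = 0" if "M *v z = 0" for z
  proof -
    let ?v = "\<Sum>k\<in>UNIV. z $ k *\<^sub>R nat_frame S K e k"
    have v: "?v \<in> gtb S e" by (rule basis_of_sum_in[OF nb])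
    have "g e ?v x = 0" if "x \<in> gtb S e" for x
      by (rule lin_on_basis_zero[OF nb g_lin(2)[OF e(1) v] _ that]) (use \<open>M *v z = 0\<close> Mz[of z] in \<open>simp add: vec_eq_iff\<close>)
    then have "?v = 0" by (rule g_nondegenerate[OF e(1) v])
    then have "z $ k = 0" for k using coef_sum[OF nb, of "\<lambda>k. z $ k" k] by (simp add: coef_zero)
    then show "z = 0" by (simp add: vec_eq_iff)
  qed
  then show "invertible M" using invertible_left_inverse matrix_left_invertible_ker by metis
qed

lemma g_represents:
  assumes e: "e \<in> totalE S" and f: "lin_on (gtb S e) f"
  obtains z where "z \<in> gtb S e" "\<And>v. v \<in> gtb S e \<Longrightarrow> g e z v = (f v :: real)"
proof -
  obtain K where K: "local_coords S K" "fst e \<in> nbhd K" by (rule ex_local_coords)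
  note nb = nat_frame_basis[OF K(1) e K(2)] and gm = gram_matrix[OF K(1) e K(2)]
  let ?M = "(\<chi> j k. g e (nat_frame S K e k) (nat_frame S K e j)) :: real ^ ('p + 'r) ^ ('p + 'r)"
  obtain A where A: "?M ** A = mat 1" using gm(1) by (auto simp: invertible_def)
  let ?y = "(\<chi> j. f (nat_frame S K e j)) :: real ^ ('p + 'r)"
  let ?z = "\<Sum>k\<in>UNIV. (A *v ?y) $ k *\<^sub>R nat_frame S K e k"
  have z: "?z \<in> gtb S e" by (rule basis_of_sum_in[OF nb])
  have "?M *v (A *v ?y) = ?y" using A by (simp add: matrix_vector_mul_assoc)
  then have y: "g e ?z (nat_frame S K e j) = f (nat_frame S K e j)" for j
    unfolding gm(2) by (simp add: vec_eq_iff)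
  have "g e ?z v - f v = 0" if "v \<in> gtb S e" for v
    by (rule lin_on_basis_zero[OF nb lin_on_minus[OF g_lin(2)[OF e z] f] _ that]) (simp add: y)
  then show thesis using z by (intro that) auto
qed

section \<open>The torsion of the given connection\<close>

text \<open>The torsion of lifts. There is no bracket term in \<open>torV\<close> because vertical lifts of
  sections of \<open>E\<close> commute.\<close>

definition torH :: "('n \<Rightarrow> 'f) \<Rightarrow> ('n \<Rightarrow> 'f) \<Rightarrow> 'm \<times> 'b \<Rightarrow> ('m, 'f, 'b) gvec" where
  "torH u v e = nab (hlift u) (hlift v) e - nab (hlift v) (hlift u) e - hlift (bracket S u v) e"

definition torV :: "('m \<Rightarrow> 'b) \<Rightarrow> ('m \<Rightarrow> 'b) \<Rightarrow> 'm \<times> 'b \<Rightarrow> ('m, 'f, 'b) gvec" where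
  "torV s t e = nab (vlift s) (vlift t) e - nab (vlift t) (vlift s) e"

lemma torH_section: "u \<in> sectionsF S \<Longrightarrow> v \<in> sectionsF S \<Longrightarrow> torH u v \<in> gsections S"
  unfolding torH_def[abs_def] by (intro gsec_diff nab_in hlift_section bracket_in)

lemma torV_section: "s \<in> sectionsE \<Longrightarrow> t \<in> sectionsE \<Longrightarrow> torV s t \<in> gsections S"
  unfolding torV_def[abs_def] by (intro gsec_diff nab_in vlift_section)

lemma torH_antisym:
  assumes "u \<in> sectionsF S" "v \<in> sectionsF S" shows "torH v u e = - torH u v e"
proof -
  have b: "bracket S v u = (\<lambda>q. (-1) *\<^sub>R bracket S u v q)" using bracket_antisym[OF assms] by auto
  have "hlift (bracket S v u) = (\<lambda>e. (-1) *\<^sub>R hlift (bracket S u v) e)"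
    unfolding b using hlift_scale[OF F.smooth_fun_const[OF open_UNIV] bracket_in[OF assms], of "-1"] by simp
  then show ?thesis by (simp add: torH_def)
qed

lemma torV_antisym: "torV t s e = - torV s t e"
  by (simp add: torV_def)

lemma torH_add:
  assumes "u \<in> sectionsF S" "u' \<in> sectionsF S" "v \<in> sectionsF S"
  shows "torH (\<lambda>q. u q + u' q) v e = torH u v e + torH u' v e"
proof -
  have b: "bracket S (\<lambda>q. u q + u' q) v = (\<lambda>q. bracket S u v q + bracket S u' v q)"
    using bracket_add(2)[OF assms(3,1,2)] by auto
  show ?thesis unfolding torH_def b
    by (simp add: assms hlift_add nab_add_left nab_add_right hlift_section bracket_in algebra_simps)
qed

lemma torV_add:
  assumes "s \<in> sectionsE" "s' \<in> sectionsE" "t \<in> sectionsE"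
  shows "torV (\<lambda>x. s x + s' x) t e = torV s t e + torV s' t e"
  unfolding torV_def vlift_add[OF assms(1,2)]
  by (simp add: nab_add_left nab_add_right vlift_section[OF assms(1)] vlift_section[OF assms(2)] vlift_section[OF assms(3)] algebra_simps)

text \<open>Both torsions are linear over the functions on the base. For \<open>torH\<close> the derivative terms cancel
  because the derivative along a horizontal lift of a function pulled back from \<open>N\<close> is the anchor
  term in the Leibniz rule of the bracket; for \<open>torV\<close> there is none, as vertical vectors annihilate such
  functions.\<close>

lemma torH_scale:
  assumes f: "smooth_fun (atlasN S) UNIV f" and u: "u \<in> sectionsF S" and v: "v \<in> sectionsF S" and e: "e \<in> totalE S"
  shows "torH (\<lambda>q. f q *\<^sub>R u q) v e = f (hmap S (fst e)) *\<^sub>R torH u v e"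
proof -
  have fE: "smoothE S UNIV (\<lambda>e. f (hmap S (fst e)))"
    using E.smooth_total_pullback[OF open_UNIV smooth_fun_h_UNIV[OF f]] by simp
  have "hlift (bracket S (\<lambda>q. f q *\<^sub>R u q) v) e
      = f (hmap S (fst e)) *\<^sub>R hlift (bracket S u v) e - anchorN S v f (hmap S (fst e)) *\<^sub>R hlift u e"
  proof (rule horizontal_eqI[OF e])
    note H = hlift_horizontal[OF _ e]
    show "hlift (bracket S (\<lambda>q. f q *\<^sub>R u q) v) e \<in> horizontal S C e"
      by (intro H bracket_in sectionsF_scale f u v)
    show "f (hmap S (fst e)) *\<^sub>R hlift (bracket S u v) e - anchorN S v f (hmap S (fst e)) *\<^sub>R hlift u e \<in> horizontal S C e"
      by (intro subspace_diff subspace_scale horizontal_subspace[OF e] H bracket_in u v)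
    show "fst (hlift (bracket S (\<lambda>q. f q *\<^sub>R u q) v) e)
      = fst (f (hmap S (fst e)) *\<^sub>R hlift (bracket S u v) e - anchorN S v f (hmap S (fst e)) *\<^sub>R hlift u e)"
      using bracket_scale_left[OF u v f] by (simp add: H(2) bracket_in sectionsF_scale f u v)
  qed
  then show ?thesis
    using snd_hlift_pullback[OF v e f]
    unfolding torH_def hlift_scale[OF f u] nab_scale_left[OF fE hlift_section[OF u] hlift_section[OF v]]
      nab_scale_right[OF fE hlift_section[OF v] hlift_section[OF u]]
    by (simp add: algebra_simps)
qed

lemma torV_scale:
  assumes f: "smooth_fun (atlasM S) UNIV f" and s: "s \<in> sectionsE" and t: "t \<in> sectionsE" and e: "e \<in> totalE S"
  shows "torV (\<lambda>x. f x *\<^sub>R s x) t e = f (fst e) *\<^sub>R torV s t e"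
proof -
  have fE: "smoothE S UNIV (\<lambda>e. f (fst e))" by (rule E.smooth_total_pullback[OF open_UNIV f])
  show ?thesis
    using snd_vertical_pullback[OF e vlift_vertical[OF t e] f]
    unfolding torV_def vlift_scale[OF s] nab_scale_left[OF fE vlift_section[OF s] vlift_section[OF t]]
      nab_scale_right[OF fE vlift_section[OF t] vlift_section[OF s]]
    by (simp add: algebra_simps)
qed

lemma vlift_zero:
  assumes s: "s \<in> sectionsE" and e: "e \<in> totalE S" and z: "vlift s e = 0" shows "s (fst e) = 0"
proof -
  obtain K where K: "local_coords S K" "fst e \<in> nbhd K" by (rule ex_local_coords)
  note bs = E.bundle_chart_basis[OF local_coords_bundle_chart[OF K(1)] K(2)]
  have sF: "s (fst e) \<in> fibre (bundleE S) (fst e)" using s E.local_section_in[of UNIV s] by simp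
  have "coef (\<lambda>a. sframe K a (fst e)) (s (fst e)) a = 0" for a
    using coef_vertical[OF K(1) e K(2), of "\<lambda>a. coef (\<lambda>a. sframe K a (fst e)) (s (fst e)) a" "Inr a"]
      vvec_eq[OF K(1) e K(2) sF] z e by (simp add: vlift_def coef_zero)
  then show ?thesis using basis_of_expand[OF bs sF] by simp
qed

definition extH :: "'m \<times> 'b \<Rightarrow> ('m, 'f, 'b) gvec \<Rightarrow> 'n \<Rightarrow> 'f" where
  "extH e w = (SOME u. u \<in> sectionsF S \<and> hlift u e = w)"

definition extV :: "'m \<times> 'b \<Rightarrow> ('m, 'f, 'b) gvec \<Rightarrow> 'm \<Rightarrow> 'b" where
  "extV e w = (SOME s. s \<in> sectionsE \<and> vlift s e = w)"

lemma extH: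
  assumes "e \<in> totalE S" "w \<in> horizontal S C e" shows "extH e w \<in> sectionsF S \<and> hlift (extH e w) e = w"
proof -
  obtain u where "u \<in> sectionsF S" "hlift u e = w" by (rule hlift_surj[OF assms])
  then show ?thesis unfolding extH_def using someI[of "\<lambda>u. u \<in> sectionsF S \<and> hlift u e = w" u] by blast
qed

lemma extV:
  assumes "e \<in> totalE S" "w \<in> vertical S e" shows "extV e w \<in> sectionsE \<and> vlift (extV e w) e = w"
proof -
  obtain s where "s \<in> sectionsE" "vlift s e = w" by (rule vlift_surj[OF assms])
  then show ?thesis unfolding extV_def using someI[of "\<lambda>s. s \<in> sectionsE \<and> vlift s e = w" s] by blast
qed

lemma torH_descends:
  assumes e: "e \<in> totalE S" and v: "v \<in> sectionsF S"
  shows "u \<in> sectionsF S \<Longrightarrow> torH (extH e (hlift u e)) v e = torH u v e"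
    and "lin_on (horizontal S C e) (\<lambda>w. torH (extH e w) v e)"
proof -
  have sur: "\<exists>u\<in>sectionsF S. hlift u e = w" if "w \<in> horizontal S C e" for w by (rule hlift_surj[OF e that]) blast
  have comb: "\<exists>r\<in>sectionsF S. hlift r e = hlift s e + c *\<^sub>R hlift t e \<and> torH r v e = torH s v e + c *\<^sub>R torH t v e"
    if st: "s \<in> sectionsF S" "t \<in> sectionsF S" for s t c
  proof (intro bexI conjI)
    have ct: "(\<lambda>q. c *\<^sub>R t q) \<in> sectionsF S" using sectionsF_scale[OF F.smooth_fun_const[OF open_UNIV] st(2)] .
    show "(\<lambda>q. s q + c *\<^sub>R t q) \<in> sectionsF S" by (rule sectionsF_add[OF st(1) ct])
    show "hlift (\<lambda>q. s q + c *\<^sub>R t q) e = hlift s e + c *\<^sub>R hlift t e"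
      using hlift_add[OF st(1) ct] hlift_scale[OF F.smooth_fun_const[OF open_UNIV] st(2), of c] by simp
    show "torH (\<lambda>q. s q + c *\<^sub>R t q) v e = torH s v e + c *\<^sub>R torH t v e"
      using torH_add[OF st(1) ct v] torH_scale[OF F.smooth_fun_const[OF open_UNIV] st(2) v e, of c] by simp
  qed
  have van: "torH s v e = 0" if s: "s \<in> sectionsF S" "hlift s e = 0" for s
  proof (rule F.section_function_linear_vanishes[where \<tau>="\<lambda>u. torH u v e" and p="hmap S (fst e)"])
    show "s (hmap S (fst e)) = 0" using hlift_horizontal(2)[OF s(1) e] s(2) by simp
  qed (use s(1) torH_add torH_scale v e in \<open>simp_all add: sectionsF_iff\<close>)
  note d = descend_to_fibre[where \<Gamma>="sectionsF S" and W="horizontal S C e" and ev="\<lambda>u. hlift u e" and \<tau>="\<lambda>u. torH u v e",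
      OF sur hlift_horizontal(1)[OF _ e] comb van]
  show "u \<in> sectionsF S \<Longrightarrow> torH (extH e (hlift u e)) v e = torH u v e" unfolding extH_def by (rule d(1))
  show "lin_on (horizontal S C e) (\<lambda>w. torH (extH e w) v e)" unfolding extH_def by (rule d(2))
qed

lemma torV_descends:
  assumes e: "e \<in> totalE S" and t: "t \<in> sectionsE"
  shows "s \<in> sectionsE \<Longrightarrow> torV (extV e (vlift s e)) t e = torV s t e"
    and "lin_on (vertical S e) (\<lambda>w. torV (extV e w) t e)"
proof -
  have sur: "\<exists>u\<in>sectionsE. vlift u e = w" if "w \<in> vertical S e" for w by (rule vlift_surj[OF e that]) blast
  have comb: "\<exists>r\<in>sectionsE. vlift r e = vlift s e + c *\<^sub>R vlift s' e \<and> torV r t e = torV s t e + c *\<^sub>R torV s' t e"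
    if st: "s \<in> sectionsE" "s' \<in> sectionsE" for s s' c
  proof (intro bexI conjI)
    have ct: "(\<lambda>x. c *\<^sub>R s' x) \<in> sectionsE"
      using E.local_section_scale[OF open_UNIV E.smooth_fun_const[OF open_UNIV]] st(2) by simp
    show "(\<lambda>q. s q + c *\<^sub>R s' q) \<in> sectionsE" using E.local_section_add[OF open_UNIV] st(1) ct by simp
    show "vlift (\<lambda>q. s q + c *\<^sub>R s' q) e = vlift s e + c *\<^sub>R vlift s' e"
      using vlift_add[OF st(1) ct] vlift_scale[OF st(2), of "\<lambda>_. c"] by simp
    show "torV (\<lambda>q. s q + c *\<^sub>R s' q) t e = torV s t e + c *\<^sub>R torV s' t e"
      using torV_add[OF st(1) ct t] torV_scale[OF E.smooth_fun_const[OF open_UNIV] st(2) t e, of c] by simp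
  qed
  have van: "torV s t e = 0" if s: "s \<in> sectionsE" "vlift s e = 0" for s
    by (rule E.section_function_linear_vanishes[where \<tau>="\<lambda>u. torV u t e" and p="fst e"])
      (use s vlift_zero[OF s(1) e s(2)] torV_add torV_scale t e in simp_all)
  note d = descend_to_fibre[where \<Gamma>=sectionsE and W="vertical S e" and ev="\<lambda>u. vlift u e" and \<tau>="\<lambda>u. torV u t e",
      OF sur vlift_vertical[OF _ e] comb van]
  show "s \<in> sectionsE \<Longrightarrow> torV (extV e (vlift s e)) t e = torV s t e" unfolding extV_def by (rule d(1))
  show "lin_on (vertical S e) (\<lambda>w. torV (extV e w) t e)" unfolding extV_def by (rule d(2))
qed

text \<open>Block diagonal: two horizontal vectors are extended by horizontal lifts and two vertical ones by
  vertical lifts.\<close>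

definition tor :: "'m \<times> 'b \<Rightarrow> ('m, 'f, 'b) gvec \<Rightarrow> ('m, 'f, 'b) gvec \<Rightarrow> ('m, 'f, 'b) gvec" where
  "tor e x y = torH (extH e (hproj e x)) (extH e (hproj e y)) e + torV (extV e (C e x)) (extV e (C e y)) e"

lemma tor_antisym:
  assumes "e \<in> totalE S" "x \<in> gtb S e" "y \<in> gtb S e" shows "tor e y x = - tor e x y"
proof -
  have "extH e (hproj e x) \<in> sectionsF S" "extH e (hproj e y) \<in> sectionsF S"
    using extH[OF assms(1) hproj_horizontal[OF assms(1)]] assms(2,3) by auto
  then show ?thesis unfolding tor_def
    using torH_antisym[of "extH e (hproj e x)" "extH e (hproj e y)" e] torV_antisym[of "extV e (C e y)" "extV e (C e x)" e] by simp
qed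

lemma tor_lin1: assumes e: "e \<in> totalE S" and y: "y \<in> gtb S e" shows "lin_on (gtb S e) (\<lambda>x. tor e x y)"
  unfolding tor_def
proof (rule lin_on_plus)
  show "lin_on (gtb S e) (\<lambda>x. torH (extH e (hproj e x)) (extH e (hproj e y)) e)"
    by (rule lin_on_compose[OF torH_descends(2)[OF e] hproj_lin[OF e] hproj_horizontal[OF e]])
      (use extH[OF e hproj_horizontal[OF e y]] in auto)
  show "lin_on (gtb S e) (\<lambda>x. torV (extV e (C e x)) (extV e (C e y)) e)"
    by (rule lin_on_compose[OF torV_descends(2)[OF e] C_lin[OF e] C_vertical[OF e]])
      (use extV[OF e C_vertical[OF e y]] in auto)
qed

lemma tor_lin2: assumes e: "e \<in> totalE S" and x: "x \<in> gtb S e" shows "lin_on (gtb S e) (\<lambda>y. tor e x y)"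
  by (rule lin_on_congI[OF lin_on_neg[OF tor_lin1[OF e x]] gtb_subspace[OF e]])
    (use tor_antisym[OF e x] in simp)

lemma tor_in: assumes e: "e \<in> totalE S" and x: "x \<in> gtb S e" and y: "y \<in> gtb S e" shows "tor e x y \<in> gtb S e"
proof -
  have "torH (extH e (hproj e x)) (extH e (hproj e y)) \<in> gsections S"
    using extH[OF e hproj_horizontal[OF e]] x y torH_section by blast
  moreover have "torV (extV e (C e x)) (extV e (C e y)) \<in> gsections S"
    using extV[OF e C_vertical[OF e]] x y torV_section by blast
  ultimately show ?thesis using gsec_in e subspace_add[OF gtb_subspace[OF e]] by (simp add: tor_def)
qed

lemma tor_hlift:
  assumes u: "u \<in> sectionsF S" and v: "v \<in> sectionsF S" and e: "e \<in> totalE S"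
  shows "tor e (hlift u e) (hlift v e) = torH u v e"
proof -
  note hu = hlift_horizontal(1)[OF u e] and hv = hlift_horizontal(1)[OF v e]
  have z: "0 \<in> vertical S e" using subspace_0[OF vertical_subspace[OF e]] .
  have xv: "extH e (hlift v e) \<in> sectionsF S" and xu: "extH e (hlift u e) \<in> sectionsF S" using extH[OF e] hu hv by auto
  have "torV (extV e 0) (extV e 0) e = 0"
    using lin_on_zero[OF torV_descends(2)[OF e] z] extV[OF e z] by blast
  moreover have "torH (extH e (hlift u e)) (extH e (hlift v e)) e = torH u v e"
    using torH_descends(1)[OF e xv u] torH_descends(1)[OF e u v] torH_antisym[OF xv u, of e] torH_antisym[OF u v, of e] by simp
  ultimately show ?thesis by (simp add: tor_def hproj_id[OF hu] hproj_id[OF hv] C_horizontal[OF hu] C_horizontal[OF hv])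
qed

lemma tor_vlift:
  assumes s: "s \<in> sectionsE" and t: "t \<in> sectionsE" and e: "e \<in> totalE S"
  shows "tor e (vlift s e) (vlift t e) = torV s t e"
proof -
  note vs = vlift_vertical[OF s e] and vt = vlift_vertical[OF t e]
  have z: "0 \<in> horizontal S C e" using subspace_0[OF horizontal_subspace[OF e]] .
  have xt: "extV e (vlift t e) \<in> sectionsE" using extV[OF e vt] by blast
  have "torH (extH e 0) (extH e 0) e = 0"
    using lin_on_zero[OF torH_descends(2)[OF e] z] extH[OF e z] by blast
  moreover have "torV (extV e (vlift s e)) (extV e (vlift t e)) e = torV s t e"
    using torV_descends(1)[OF e xt s] torV_descends(1)[OF e s t] torV_antisym[of "extV e (vlift t e)" s e] torV_antisym[of t s e] by simp
  ultimately show ?thesis by (simp add: tor_def hproj_vertical[OF e vs] hproj_vertical[OF e vt] C_id[OF e vs] C_id[OF e vt])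
qed

section \<open>The derivative of the metric\<close>

text \<open>The tensor \<open>D0 G\<close>. The direction \<open>x\<close> is extended to an arbitrary section.\<close>

definition Q :: "'m \<times> 'b \<Rightarrow> ('m, 'f, 'b) gvec \<Rightarrow> ('m, 'f, 'b) gvec \<Rightarrow> ('m, 'f, 'b) gvec \<Rightarrow> real" where
  "Q e x y z = D0 (SOME X. X \<in> gsections S \<and> X e = x) G e [] [y, z]"

lemma Q_descends:
  assumes e: "e \<in> totalE S"
  shows "X \<in> gsections S \<Longrightarrow> Q e (X e) y z = D0 X G e [] [y, z]"
    and "lin_on (gtb S e) (\<lambda>x. Q e x y z)"
proof -
  let ?\<tau> = "\<lambda>X. D0 X G e [] [y, z]"
  have sur: "\<exists>X\<in>gsections S. X e = w" if "w \<in> gtb S e" for w by (rule gsec_extends[OF e that]) blast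
  have comb: "\<exists>r\<in>gsections S. r e = X e + c *\<^sub>R Y e \<and> ?\<tau> r = ?\<tau> X + c *\<^sub>R ?\<tau> Y"
    if XY: "X \<in> gsections S" "Y \<in> gsections S" for X Y c
  proof (intro bexI conjI)
    note sm = E.smooth_total_const[OF open_UNIV, of c]
    have cY: "(\<lambda>e. c *\<^sub>R Y e) \<in> gsections S" by (rule gsec_scale[OF sm XY(2)])
    show "(\<lambda>e. X e + c *\<^sub>R Y e) \<in> gsections S" by (rule gsec_add[OF XY(1) cY])
    show "?\<tau> (\<lambda>e. X e + c *\<^sub>R Y e) = ?\<tau> X + c *\<^sub>R ?\<tau> Y"
      using cd_add_left[OF XY(1) cY G_field] cd_scale_left[OF XY(2) sm G_field] by simp
  qed simp
  have van: "?\<tau> X = 0" if X: "X \<in> gsections S" "X e = 0" for X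
    by (rule gsec_function_linear_vanishes[where p=e])
      (use X in \<open>simp_all add: cd_add_left[OF _ _ G_field] cd_scale_left[OF _ _ G_field]\<close>)
  show "Q e (X e) y z = ?\<tau> X" if X: "X \<in> gsections S" unfolding Q_def
  proof (rule descend_to_fibre(1)[where \<Gamma>="gsections S" and W="gtb S e" and ev="\<lambda>X. X e" and \<tau>="?\<tau>"])
    show "\<exists>s\<in>gsections S. s e = w" if "w \<in> gtb S e" for w by (rule sur[OF that])
    show "s e \<in> gtb S e" if "s \<in> gsections S" for s by (rule gsec_in[OF that e])
    show "\<exists>r\<in>gsections S. r e = s e + c *\<^sub>R t e \<and> ?\<tau> r = ?\<tau> s + c *\<^sub>R ?\<tau> t"
      if "s \<in> gsections S" "t \<in> gsections S" for s t c by (rule comb[OF that])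
    show "?\<tau> s = 0" if "s \<in> gsections S" "s e = 0" for s by (rule van[OF that])
  qed (rule X)
  show "lin_on (gtb S e) (\<lambda>x. Q e x y z)" unfolding Q_def
  proof (rule descend_to_fibre(2)[where \<Gamma>="gsections S" and W="gtb S e" and ev="\<lambda>X. X e" and \<tau>="?\<tau>"])
    show "\<exists>s\<in>gsections S. s e = w" if "w \<in> gtb S e" for w by (rule sur[OF that])
    show "s e \<in> gtb S e" if "s \<in> gsections S" for s by (rule gsec_in[OF that e])
    show "\<exists>r\<in>gsections S. r e = s e + c *\<^sub>R t e \<and> ?\<tau> r = ?\<tau> s + c *\<^sub>R ?\<tau> t"
      if "s \<in> gsections S" "t \<in> gsections S" for s t c by (rule comb[OF that])
    show "?\<tau> s = 0" if "s \<in> gsections S" "s e = 0" for s by (rule van[OF that])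
  qed
qed

lemma Q_lin:
  assumes e: "e \<in> totalE S" and x: "x \<in> gtb S e" and y: "y \<in> gtb S e"
  shows "lin_on (gtb S e) (\<lambda>z. Q e x z y)" "lin_on (gtb S e) (\<lambda>z. Q e x y z)"
proof -
  obtain X where X: "X \<in> gsections S" "X e = x" by (rule gsec_extends[OF e x])
  have tf: "tensor_field S 0 2 (D0 X G)" by (rule cd_field[OF X(1) G_field])
  have tf2: "tensor_field S 0 (Suc 1) (D0 X G)" using tf by (simp add: numeral_2_eq_2)
  have "lin_on (gtb S e) (\<lambda>z. D0 X G e [] [z, y])" using tf_Cons_lin[OF tf2 e, of "[y]"] y by simp
  moreover have "lin_on (gtb S e) (\<lambda>z. D0 X G e [] [y, z])"
    using tf_lin_vec[OF tf e, of "[]" "[y, y]" 1] y by (simp add: tensor_args_iff)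
  ultimately show "lin_on (gtb S e) (\<lambda>z. Q e x z y)" "lin_on (gtb S e) (\<lambda>z. Q e x y z)"
    using Q_descends(1)[OF e X(1)] X(2) by simp_all
qed

lemma Q_sections:
  assumes e: "e \<in> totalE S" and XYZ: "X \<in> gsections S" "Y \<in> gsections S" "Z \<in> gsections S"
  shows "Q e (X e) (Y e) (Z e) = snd (X e) (\<lambda>e. g e (Y e) (Z e)) - g e (nab X Y e) (Z e) - g e (Y e) (nab X Z e)"
  using Q_descends(1)[OF e XYZ(1)] cd_metric[OF XYZ e] by simp

lemma Q_sym:
  assumes e: "e \<in> totalE S" and xyz: "x \<in> gtb S e" "y \<in> gtb S e" "z \<in> gtb S e"
  shows "Q e x y z = Q e x z y"
proof -
  obtain X where X: "X \<in> gsections S" "X e = x" by (rule gsec_extends[OF e xyz(1)])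
  obtain Y where Y: "Y \<in> gsections S" "Y e = y" by (rule gsec_extends[OF e xyz(2)])
  obtain Z where Z: "Z \<in> gsections S" "Z e = z" by (rule gsec_extends[OF e xyz(3)])
  have "(\<lambda>e. g e (Y e) (Z e)) = (\<lambda>e. g e (Z e) (Y e))"
  proof
    fix e' show "g e' (Y e') (Z e') = g e' (Z e') (Y e')"
      using g_sym[OF _ gsec_in[OF Y(1)] gsec_in[OF Z(1)]] tf_zero[OF G_field, of e'] by (cases "e' \<in> totalE S") auto
  qed
  then show ?thesis
    using Q_sections[OF e X(1) Y(1) Z(1)] Q_sections[OF e X(1) Z(1) Y(1)] X(2) Y(2) Z(2)
      g_sym[OF e gsec_in[OF nab_in[OF X(1) Y(1)] e] xyz(3)] g_sym[OF e gsec_in[OF nab_in[OF X(1) Z(1)] e] xyz(2)] by simp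
qed

text \<open>Lifts make the function \<open>G(Y, Z)\<close> vanish identically, and the derivatives of the lifts
  stay in the respective subbundles.\<close>

lemma Q_horizontal_vertical:
  assumes e: "e \<in> totalE S" and x: "x \<in> gtb S e" and y: "y \<in> horizontal S C e" and z: "z \<in> vertical S e"
  shows "Q e x y z = 0" "Q e x z y = 0"
proof -
  obtain X where X: "X \<in> gsections S" "X e = x" by (rule gsec_extends[OF e x])
  obtain u where u: "u \<in> sectionsF S" "hlift u e = y" by (rule hlift_surj[OF e y])
  obtain s where s: "s \<in> sectionsE" "vlift s e = z" by (rule vlift_surj[OF e z])
  note hu = hlift_section[OF u(1)] and vs = vlift_section[OF s(1)]
  have "(\<lambda>e. g e (hlift u e) (vlift s e)) = (\<lambda>e. 0)"
  proof
    fix e' show "g e' (hlift u e') (vlift s e') = 0"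
      using g_horizontal_vertical(1)[OF _ hlift_horizontal(1)[OF u(1)] vlift_vertical[OF s(1)]] tf_zero[OF G_field, of e']
      by (cases "e' \<in> totalE S") auto
  qed
  then show "Q e x y z = 0"
    using Q_sections[OF e X(1) hu vs] snd_const[OF e gsec_in[OF X(1) e], of 0]
      g_horizontal_vertical(1)[OF e nab_horizontal[OF X(1) hu hlift_horizontal(1)[OF u(1)] e] z]
      g_horizontal_vertical(1)[OF e y nab_vertical[OF X(1) vs vlift_vertical[OF s(1)] e]] X u s by simp
  then show "Q e x z y = 0" using Q_sym[OF e x horizontal_in[OF y] subsetD[OF vertical_subset[OF e] z]] by simp
qed

section \<open>The difference between the metrical and the given connection\<close>

text \<open>The Koszul expression of the difference tensor between a torsion-free metrical connection and one with metric
  derivative \<open>Q\<close> and torsion \<open>tor\<close>.\<close>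

definition koszul :: "'m \<times> 'b \<Rightarrow> ('m, 'f, 'b) gvec \<Rightarrow> ('m, 'f, 'b) gvec \<Rightarrow> ('m, 'f, 'b) gvec \<Rightarrow> real" where
  "koszul e x y z = Q e x y z + Q e y x z - Q e z x y - g e (tor e x y) z + g e (tor e x z) y + g e (tor e y z) x"

text \<open>Twice the lowered difference tensor: on each of the two subbundles that of the torsion-free metrical
  connection, on the mixed blocks half of \<open>Q\<close>.\<close>

definition diff_form :: "'m \<times> 'b \<Rightarrow> ('m, 'f, 'b) gvec \<Rightarrow> ('m, 'f, 'b) gvec \<Rightarrow> ('m, 'f, 'b) gvec \<Rightarrow> real" where
  "diff_form e x y z =
     koszul e (hproj e x) (hproj e y) (hproj e z) + koszul e (C e x) (C e y) (C e z)
     + Q e (hproj e x) (C e y) (C e z) + Q e (C e x) (hproj e y) (hproj e z)"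

lemma koszul_lin:
  assumes e: "e \<in> totalE S" and v: "v \<in> gtb S e" and w: "w \<in> gtb S e"
  shows "lin_on (gtb S e) (\<lambda>x. koszul e x v w)" "lin_on (gtb S e) (\<lambda>y. koszul e v y w)" "lin_on (gtb S e) (\<lambda>z. koszul e v w z)"
  unfolding koszul_def
  by (intro lin_on_plus lin_on_minus Q_descends(2) Q_lin g_lin e v w tor_in
      lin_on_compose[OF g_lin(1)[OF e] tor_lin1[OF e]] lin_on_compose[OF g_lin(1)[OF e] tor_lin2[OF e]]; assumption)+

lemma diff_form_lin:
  assumes e: "e \<in> totalE S" and v: "v \<in> gtb S e" and w: "w \<in> gtb S e"
  shows "lin_on (gtb S e) (\<lambda>x. diff_form e x v w)" "lin_on (gtb S e) (\<lambda>y. diff_form e v y w)" "lin_on (gtb S e) (\<lambda>z. diff_form e v w z)"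
  unfolding diff_form_def
  by (intro lin_on_plus lin_on_compose[OF koszul_lin(1)[OF e]] lin_on_compose[OF koszul_lin(2)[OF e]] lin_on_compose[OF koszul_lin(3)[OF e]]
      lin_on_compose[OF Q_descends(2)[OF e]] lin_on_compose[OF Q_lin(1)[OF e]] lin_on_compose[OF Q_lin(2)[OF e]]
      hproj_lin C_lin hproj_in C_in e v w; assumption)+

text \<open>Exchanging \<open>y\<close> and \<open>z\<close> reverses the sign of the sum of all terms other than the first.\<close>

lemma koszul_metrical:
  assumes e: "e \<in> totalE S" and xyz: "x \<in> gtb S e" "y \<in> gtb S e" "z \<in> gtb S e"
  shows "koszul e x y z + koszul e x z y = 2 * Q e x y z"
proof -
  have "g e (tor e z y) x = - g e (tor e y z) x"
    using tor_antisym[OF e xyz(2,3)] lin_on_combination[OF g_lin(1)[OF e xyz(1)] gtb_subspace[OF e] subspace_0[OF gtb_subspace[OF e]] tor_in[OF e xyz(2,3)], of "-1"]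
      lin_on_zero[OF g_lin(1)[OF e xyz(1)] subspace_0[OF gtb_subspace[OF e]]] by simp
  then show ?thesis using Q_sym[OF e xyz] by (simp add: koszul_def)
qed

lemma split_hv: "w = hproj e w + C e w"
  by (simp add: hproj_def)

text \<open>Adding the form to its transpose gives the metric derivative, because \<open>Q\<close> has no mixed part.\<close>

lemma diff_form_metrical:
  assumes e: "e \<in> totalE S" and xyz: "x \<in> gtb S e" "y \<in> gtb S e" "z \<in> gtb S e"
  shows "diff_form e x y z + diff_form e x z y = 2 * Q e x y z"
proof -
  note H = hproj_in[OF e] and V = C_in[OF e] and HH = hproj_horizontal[OF e] and VV = C_vertical[OF e]
  have 1: "Q e x y z = Q e x (hproj e y) (hproj e z) + Q e x (C e y) (C e z)"
    if x: "x \<in> gtb S e" for x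
  proof -
    have "Q e x (hproj e y + C e y) (hproj e z + C e z)
        = Q e x (hproj e y) (hproj e z + C e z) + Q e x (C e y) (hproj e z + C e z)"
      using Q_lin(1)[OF e x] H V xyz subspace_add[OF gtb_subspace[OF e]] by (simp add: lin_on_def)
    also have "\<dots> = Q e x (hproj e y) (hproj e z) + Q e x (hproj e y) (C e z) + Q e x (C e y) (hproj e z) + Q e x (C e y) (C e z)"
      using Q_lin(2)[OF e x] H V xyz by (simp add: lin_on_def)
    finally show ?thesis
      using Q_horizontal_vertical[OF e x HH[OF xyz(2)] VV[OF xyz(3)]] Q_horizontal_vertical[OF e x HH[OF xyz(3)] VV[OF xyz(2)]]
      by (simp flip: split_hv)
  qed
  have "Q e (hproj e x + C e x) y z = Q e (hproj e x) y z + Q e (C e x) y z"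
    using Q_descends(2)[OF e] H[OF xyz(1)] V[OF xyz(1)] by (simp add: lin_on_def)
  then have 2: "Q e x y z = Q e (hproj e x) y z + Q e (C e x) y z" by (simp flip: split_hv)
  show ?thesis
    using koszul_metrical[OF e H[OF xyz(1)] H[OF xyz(2)] H[OF xyz(3)]] koszul_metrical[OF e V[OF xyz(1)] V[OF xyz(2)] V[OF xyz(3)]]
      Q_sym[OF e H[OF xyz(1)] V[OF xyz(2)] V[OF xyz(3)]] Q_sym[OF e V[OF xyz(1)] H[OF xyz(2)] H[OF xyz(3)]]
      1[OF H[OF xyz(1)]] 1[OF V[OF xyz(1)]] 2
    by (simp add: diff_form_def)
qed

text \<open>The endomorphisms represented by the form. The value zero outside the fibre is chosen to agree with
  the convention for covectors, see \<open>transpose_covector\<close>.\<close>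

definition Phi :: "'m \<times> 'b \<Rightarrow> ('m, 'f, 'b) gvec \<Rightarrow> ('m, 'f, 'b) gvec \<Rightarrow> ('m, 'f, 'b) gvec" where
  "Phi e x y = (if e \<in> totalE S \<and> y \<in> gtb S e
     then THE z. z \<in> gtb S e \<and> (\<forall>v\<in>gtb S e. 2 * g e z v = diff_form e x y v) else 0)"

lemma g_half_unique:
  assumes e: "e \<in> totalE S" and z: "z \<in> gtb S e" "z' \<in> gtb S e" and eq: "\<And>v. v \<in> gtb S e \<Longrightarrow> 2 * g e z v = 2 * g e z' v"
  shows "z = z'"
proof -
  obtain K where K: "local_coords S K" "fst e \<in> nbhd K" by (rule ex_local_coords)
  show ?thesis using eq adapted_in[OF K(1) e K(2)] by (intro g_eqI[OF e K z]) simp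
qed

lemma Phi_char:
  assumes e: "e \<in> totalE S" and x: "x \<in> gtb S e" and y: "y \<in> gtb S e"
  shows "Phi e x y \<in> gtb S e \<and> (\<forall>v\<in>gtb S e. 2 * g e (Phi e x y) v = diff_form e x y v)"
proof -
  obtain z where z: "z \<in> gtb S e" "\<And>v. v \<in> gtb S e \<Longrightarrow> g e z v = 1 / 2 * diff_form e x y v"
    using g_represents[OF e lin_on_mult_left[OF diff_form_lin(3)[OF e x y]], of "1 / 2"] by blast
  have z2: "2 * g e z v = diff_form e x y v" if "v \<in> gtb S e" for v using z(2)[OF that] by simp
  have "(THE z. z \<in> gtb S e \<and> (\<forall>v\<in>gtb S e. 2 * g e z v = diff_form e x y v)) = z"
  proof (rule the_equality)
    show "z \<in> gtb S e \<and> (\<forall>v\<in>gtb S e. 2 * g e z v = diff_form e x y v)" using z(1) z2 by blast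
    fix z' assume z': "z' \<in> gtb S e \<and> (\<forall>v\<in>gtb S e. 2 * g e z' v = diff_form e x y v)"
    show "z' = z"
    proof (rule g_half_unique[OF e _ z(1)])
      fix v assume "v \<in> gtb S e"
      then show "2 * g e z' v = 2 * g e z v" using z2 z' by metis
    qed (use z' in blast)
  qed
  then have "Phi e x y = z" using e y by (simp only: Phi_def simp_thms if_True)
  then show ?thesis using z(1) z2 by blast
qed

lemma Phi_in: "e \<in> totalE S \<Longrightarrow> x \<in> gtb S e \<Longrightarrow> y \<in> gtb S e \<Longrightarrow> Phi e x y \<in> gtb S e"
  and g_Phi: "e \<in> totalE S \<Longrightarrow> x \<in> gtb S e \<Longrightarrow> y \<in> gtb S e \<Longrightarrow> v \<in> gtb S e \<Longrightarrow> 2 * g e (Phi e x y) v = diff_form e x y v"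
  using Phi_char by blast+

lemma Phi_off: "y \<notin> gtb S e \<Longrightarrow> Phi e x y = 0"
  by (simp add: Phi_def)

lemma Phi_lin:
  assumes e: "e \<in> totalE S" and v: "v \<in> gtb S e"
  shows "lin_on (gtb S e) (\<lambda>x. Phi e x v)" "lin_on (gtb S e) (Phi e v)"
proof -
  note sp = gtb_subspace[OF e]
  note add = subspace_add[OF sp] and scale = subspace_scale[OF sp]
  have gadd: "2 * g e (a + b) w = 2 * g e a w + 2 * g e b w" "2 * g e (c *\<^sub>R a) w = c * (2 * g e a w)"
    if "a \<in> gtb S e" "b \<in> gtb S e" "w \<in> gtb S e" for a b c w
    using g_lin(1)[OF e that(3)] that by (simp_all add: lin_on_def)
  show "lin_on (gtb S e) (\<lambda>x. Phi e x v)" unfolding lin_on_def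
  proof (intro conjI ballI allI)
    fix x y assume x: "x \<in> gtb S e" and y: "y \<in> gtb S e"
    show "Phi e (x + y) v = Phi e x v + Phi e y v"
      by (rule g_half_unique[OF e Phi_in[OF e add[OF x y] v] add[OF Phi_in[OF e x v] Phi_in[OF e y v]]])
        (use g_Phi[OF e add[OF x y] v] g_Phi[OF e x v] g_Phi[OF e y v] gadd(1)[OF Phi_in[OF e x v] Phi_in[OF e y v]]
          diff_form_lin(1)[OF e v] x y in \<open>simp only: lin_on_def\<close>)
  next
    fix c x assume x: "x \<in> gtb S e"
    show "Phi e (c *\<^sub>R x) v = c *\<^sub>R Phi e x v"
      by (rule g_half_unique[OF e Phi_in[OF e scale[OF x] v] scale[OF Phi_in[OF e x v]]])
        (use g_Phi[OF e scale[OF x] v] g_Phi[OF e x v] gadd(2)[OF Phi_in[OF e x v] v]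
          diff_form_lin(1)[OF e v] x in \<open>simp only: lin_on_def real_scaleR_def\<close>)
  qed
  show "lin_on (gtb S e) (Phi e v)" unfolding lin_on_def
  proof (intro conjI ballI allI)
    fix x y assume x: "x \<in> gtb S e" and y: "y \<in> gtb S e"
    show "Phi e v (x + y) = Phi e v x + Phi e v y"
      by (rule g_half_unique[OF e Phi_in[OF e v add[OF x y]] add[OF Phi_in[OF e v x] Phi_in[OF e v y]]])
        (use g_Phi[OF e v add[OF x y]] g_Phi[OF e v x] g_Phi[OF e v y] gadd(1)[OF Phi_in[OF e v x] Phi_in[OF e v y]]
          diff_form_lin(2)[OF e v] x y in \<open>simp only: lin_on_def\<close>)
  next
    fix c x assume x: "x \<in> gtb S e"
    show "Phi e v (c *\<^sub>R x) = c *\<^sub>R Phi e v x"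
      by (rule g_half_unique[OF e Phi_in[OF e v scale[OF x]] scale[OF Phi_in[OF e v x]]])
        (use g_Phi[OF e v scale[OF x]] g_Phi[OF e v x] gadd(2)[OF Phi_in[OF e v x] v]
          diff_form_lin(2)[OF e v] x in \<open>simp only: lin_on_def real_scaleR_def\<close>)
  qed
qed

lemma Phi_metrical:
  assumes e: "e \<in> totalE S" and xyz: "x \<in> gtb S e" "y \<in> gtb S e" "z \<in> gtb S e"
  shows "g e (Phi e x y) z + g e y (Phi e x z) = Q e x y z"
  using g_Phi[OF e xyz] g_Phi[OF e xyz(1,3,2)] diff_form_metrical[OF e xyz] g_sym[OF e xyz(2) Phi_in[OF e xyz(1,3)]] by simp

lemma Q_zero:
  assumes e: "e \<in> totalE S" and xy: "x \<in> gtb S e" "y \<in> gtb S e"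
  shows "Q e 0 x y = 0" "Q e x 0 y = 0" "Q e x y 0 = 0"
  using lin_on_zero[OF Q_descends(2)[OF e]] lin_on_zero[OF Q_lin(1)[OF e xy]] lin_on_zero[OF Q_lin(2)[OF e xy]]
    subspace_0[OF gtb_subspace[OF e]] by auto

lemma koszul_zero:
  assumes e: "e \<in> totalE S" and xy: "x \<in> gtb S e" "y \<in> gtb S e"
  shows "koszul e 0 x y = 0" "koszul e x 0 y = 0" "koszul e x y 0 = 0"
  using lin_on_zero[OF koszul_lin(1)[OF e xy]] lin_on_zero[OF koszul_lin(2)[OF e xy]] lin_on_zero[OF koszul_lin(3)[OF e xy]]
    subspace_0[OF gtb_subspace[OF e]] by auto

text \<open>For \<open>y\<close> horizontal each block that remains contains the horizontal part of the last
  argument, so the vertical part of \<open>Phi e x y\<close> is orthogonal to everything.\<close>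

lemma Phi_horizontal:
  assumes e: "e \<in> totalE S" and x: "x \<in> gtb S e" and y: "y \<in> horizontal S C e"
  shows "Phi e x y \<in> horizontal S C e"
proof -
  note y' = horizontal_in[OF y] and z0 = subspace_0[OF gtb_subspace[OF e]]
  let ?z = "Phi e x y"
  have z: "?z \<in> gtb S e" by (rule Phi_in[OF e x y'])
  have Cz: "C e ?z \<in> gtb S e" by (rule C_in[OF e z])
  have "g e (C e ?z) v = 0" if v: "v \<in> gtb S e" for v
  proof -
    note Cv = C_in[OF e v] and hv = hproj_in[OF e v] and hz = hproj_in[OF e z]
    have "g e (C e ?z) (hproj e v + C e v) = g e (C e ?z) (hproj e v) + g e (C e ?z) (C e v)"
      using g_lin(2)[OF e Cz] hv Cv unfolding lin_on_def by blast
    then have 1: "g e (C e ?z) v = g e (C e ?z) (C e v)"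
      using g_horizontal_vertical(2)[OF e hproj_horizontal[OF e v] C_vertical[OF e z]] by (simp flip: split_hv)
    have "g e (hproj e ?z + C e ?z) (C e v) = g e (hproj e ?z) (C e v) + g e (C e ?z) (C e v)"
      using g_lin(1)[OF e Cv] hz Cz unfolding lin_on_def by blast
    then have 2: "g e ?z (C e v) = g e (C e ?z) (C e v)"
      using g_horizontal_vertical(1)[OF e hproj_horizontal[OF e z] C_vertical[OF e v]] by (simp flip: split_hv)
    have "diff_form e x y (C e v) = 0"
      using koszul_zero[OF e] Q_zero[OF e] hproj_in[OF e x] C_in[OF e x] hproj_in[OF e y'] Cv z0
      by (simp add: diff_form_def hproj_vertical[OF e C_vertical[OF e v]] C_horizontal[OF y] C_id[OF e C_vertical[OF e v]])
    then show ?thesis using g_Phi[OF e x y' Cv] 1 2 by simp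
  qed
  then have "C e ?z = 0" by (rule g_nondegenerate[OF e Cz])
  then show ?thesis using z by (simp add: horizontal_def)
qed

lemma Phi_vertical:
  assumes e: "e \<in> totalE S" and x: "x \<in> gtb S e" and y: "y \<in> vertical S e"
  shows "Phi e x y \<in> vertical S e"
proof -
  note y' = subsetD[OF vertical_subset[OF e] y] and z0 = subspace_0[OF gtb_subspace[OF e]]
  let ?z = "Phi e x y"
  have z: "?z \<in> gtb S e" by (rule Phi_in[OF e x y'])
  have hz: "hproj e ?z \<in> gtb S e" by (rule hproj_in[OF e z])
  have "g e (hproj e ?z) v = 0" if v: "v \<in> gtb S e" for v
  proof -
    note Cv = C_in[OF e v] and hv = hproj_in[OF e v] and Cz = C_in[OF e z]
    have "g e (hproj e ?z) (hproj e v + C e v) = g e (hproj e ?z) (hproj e v) + g e (hproj e ?z) (C e v)"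
      using g_lin(2)[OF e hz] hv Cv unfolding lin_on_def by blast
    then have 1: "g e (hproj e ?z) v = g e (hproj e ?z) (hproj e v)"
      using g_horizontal_vertical(1)[OF e hproj_horizontal[OF e z] C_vertical[OF e v]] by (simp flip: split_hv)
    have "g e (hproj e ?z + C e ?z) (hproj e v) = g e (hproj e ?z) (hproj e v) + g e (C e ?z) (hproj e v)"
      using g_lin(1)[OF e hv] hz Cz unfolding lin_on_def by blast
    then have 2: "g e ?z (hproj e v) = g e (hproj e ?z) (hproj e v)"
      using g_horizontal_vertical(2)[OF e hproj_horizontal[OF e v] C_vertical[OF e z]] by (simp flip: split_hv)
    have "diff_form e x y (hproj e v) = 0"
      using koszul_zero[OF e] Q_zero[OF e] hproj_in[OF e x] C_in[OF e x] C_in[OF e y'] hv z0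
      by (simp add: diff_form_def hproj_vertical[OF e y] hproj_id[OF hproj_horizontal[OF e v]] C_horizontal[OF hproj_horizontal[OF e v]])
    then show ?thesis using g_Phi[OF e x y' hv] 1 2 by simp
  qed
  then have "hproj e ?z = 0" by (rule g_nondegenerate[OF e hz])
  then have "?z = C e ?z" using split_hv[of ?z e] by simp
  then show ?thesis using C_vertical[OF e z] by simp
qed

section \<open>Smoothness of the difference tensor\<close>

lemma g_smooth: "X \<in> gsections S \<Longrightarrow> Y \<in> gsections S \<Longrightarrow> smoothE S UNIV (\<lambda>e. g e (X e) (Y e))"
  by (rule tf_eval_smooth[OF G_field])

lemma Q_smooth:
  assumes "X \<in> gsections S" "Y \<in> gsections S" "Z \<in> gsections S" shows "smoothE S UNIV (\<lambda>e. Q e (X e) (Y e) (Z e))"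
  by (rule E.smooth_total_cong[OF open_UNIV _ tf_eval_smooth[OF cd_field[OF assms(1) G_field] assms(2,3)]])
    (simp add: Q_descends(1) assms)

text \<open>The torsion is defined with a choice of extension at every point, so its smoothness has to come from
  sections that are known to represent it.\<close>

lemma koszul_smooth:
  assumes XYZ: "X \<in> gsections S" "Y \<in> gsections S" "Z \<in> gsections S"
    and T: "T1 \<in> gsections S" "T2 \<in> gsections S" "T3 \<in> gsections S"
    and t: "\<And>e. e \<in> totalE S \<Longrightarrow> tor e (X e) (Y e) = T1 e" "\<And>e. e \<in> totalE S \<Longrightarrow> tor e (X e) (Z e) = T2 e"
      "\<And>e. e \<in> totalE S \<Longrightarrow> tor e (Y e) (Z e) = T3 e"
  shows "smoothE S UNIV (\<lambda>e. koszul e (X e) (Y e) (Z e))"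
proof -
  have "smoothE S UNIV (\<lambda>e. Q e (X e) (Y e) (Z e) + Q e (Y e) (X e) (Z e) - Q e (Z e) (X e) (Y e)
      - g e (T1 e) (Z e) + g e (T2 e) (Y e) + g e (T3 e) (X e))"
    by (intro E.smooth_total_add E.smooth_total_diff Q_smooth g_smooth XYZ T open_UNIV)
  then show ?thesis by (rule E.smooth_total_cong[OF open_UNIV, rotated]) (simp add: koszul_def t)
qed

lemma adapted_coef:
  assumes K: "local_coords S K" and e: "e \<in> totalE S" "fst e \<in> nbhd K" and w: "w \<in> gtb S e"
  shows "coef (adapted_frame S C K e) w k = case_sum (\<lambda>\<alpha>. coef (nat_frame S K e) w (Inl \<alpha>))
    (\<lambda>a. coef (nat_frame S K e) w (Inr a) + (\<Sum>\<alpha>\<in>UNIV. conn_coef S C K a \<alpha> e * coef (nat_frame S K e) w (Inl \<alpha>))) k"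
proof -
  let ?n = "coef (nat_frame S K e) w" and ?\<Gamma> = "\<lambda>a \<alpha>. conn_coef S C K a \<alpha> e"
  have nl: "nat_frame S K e (Inl \<alpha>) = adapted_frame S C K e (Inl \<alpha>) + (\<Sum>a\<in>UNIV. ?\<Gamma> a \<alpha> *\<^sub>R adapted_frame S C K e (Inr a))" for \<alpha>
    by (simp add: adapted_frame.simps)
  have "w = (\<Sum>\<alpha>\<in>UNIV. ?n (Inl \<alpha>) *\<^sub>R nat_frame S K e (Inl \<alpha>)) + (\<Sum>a\<in>UNIV. ?n (Inr a) *\<^sub>R nat_frame S K e (Inr a))"
    using basis_of_expand[OF nat_frame_basis[OF K e] w] by (simp add: sum_UNIV_Plus)
  also have "(\<Sum>\<alpha>\<in>UNIV. ?n (Inl \<alpha>) *\<^sub>R nat_frame S K e (Inl \<alpha>)) = (\<Sum>\<alpha>\<in>UNIV. ?n (Inl \<alpha>) *\<^sub>R adapted_frame S C K e (Inl \<alpha>))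
      + (\<Sum>\<alpha>\<in>UNIV. \<Sum>a\<in>UNIV. (?\<Gamma> a \<alpha> * ?n (Inl \<alpha>)) *\<^sub>R adapted_frame S C K e (Inr a))"
    unfolding nl by (simp add: scaleR_add_right sum.distrib scaleR_sum_right mult.commute)
  also have "(\<Sum>\<alpha>\<in>UNIV. \<Sum>a\<in>UNIV. (?\<Gamma> a \<alpha> * ?n (Inl \<alpha>)) *\<^sub>R adapted_frame S C K e (Inr a))
      = (\<Sum>a\<in>UNIV. (\<Sum>\<alpha>\<in>UNIV. ?\<Gamma> a \<alpha> * ?n (Inl \<alpha>)) *\<^sub>R adapted_frame S C K e (Inr a))"
    by (subst sum.swap) (simp add: scaleR_sum_left)
  finally have "w = (\<Sum>k\<in>UNIV. case_sum (\<lambda>\<alpha>. ?n (Inl \<alpha>)) (\<lambda>a. ?n (Inr a) + (\<Sum>\<alpha>\<in>UNIV. ?\<Gamma> a \<alpha> * ?n (Inl \<alpha>))) k *\<^sub>R adapted_frame S C K e k)"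
    by (simp add: sum_UNIV_Plus scaleR_add_left sum.distrib adapted_frame.simps(2) add_ac)
  from arg_cong[OF this, of "\<lambda>w. coef (adapted_frame S C K e) w k"] show ?thesis
    by (simp only: coef_sum[OF adapted_basis[OF K e]])
qed

lemma adapted_coef_smooth:
  assumes K: "local_coords S K" and X: "X \<in> gsections S"
  shows "smoothE S (nbhd K) (\<lambda>e. coef (adapted_frame S C K e) (X e) k)"
proof -
  note oK = local_coords_open[OF K] and c = gsec_coef[OF X K]
  have "smoothE S (nbhd K) (\<lambda>e. case_sum (\<lambda>\<alpha>. coef (nat_frame S K e) (X e) (Inl \<alpha>))
    (\<lambda>a. coef (nat_frame S K e) (X e) (Inr a) + (\<Sum>\<alpha>\<in>UNIV. conn_coef S C K a \<alpha> e * coef (nat_frame S K e) (X e) (Inl \<alpha>))) k)"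
    using c conn_coef_smooth[OF K] oK
    by (cases k) (auto intro!: E.smooth_total_add E.smooth_total_sum E.smooth_total_mult)
  then show ?thesis
    by (rule E.smooth_total_cong[OF oK, rotated]) (simp add: adapted_coef[OF K] gsec_in[OF X])
qed

definition frame_section :: "('m, 'n, 'f, 'b, 'i, 'p, 'r) coords \<Rightarrow> ('m \<Rightarrow> real) \<Rightarrow> 'p + 'r \<Rightarrow> 'm \<times> 'b \<Rightarrow> ('m, 'f, 'b) gvec" where
  "frame_section K b = case_sum (\<lambda>\<alpha>. hlift (bumpF K b \<alpha>)) (\<lambda>a. vlift (bumpS K b a))"

lemma frame_section_in:
  "local_coords S K \<Longrightarrow> bump_at (atlasM S) (nbhd K) x b \<Longrightarrow> frame_section K b k \<in> gsections S"
  by (cases k) (simp_all only: frame_section_def sum.case hlift_section vlift_section bumpF_section bumpS_section)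

lemma frame_section_eq:
  assumes "local_coords S K" "bump_at (atlasM S) (nbhd K) x b" "e \<in> totalE S" "fst e \<in> nbhd K" "b (fst e) = 1"
  shows "frame_section K b k e = adapted_frame S C K e k"
  using hlift_bumpF[OF assms] vlift_bumpS[OF assms] by (cases k) (auto simp: frame_section_def)

text \<open>On lifts of frame sections at most one block of the form is nonzero, and the torsions in it are
  sections by construction.\<close>

lemma diff_form_frame_smooth:
  assumes K: "local_coords S K" and b: "bump_at (atlasM S) (nbhd K) x b"
  shows "smoothE S UNIV (\<lambda>e. diff_form e (frame_section K b i e) (frame_section K b j e) (frame_section K b k e))"
proof -
  let ?F = "frame_section K b"
  let ?u = "bumpF K b" and ?s = "bumpS K b"
  note u = bumpF_section[OF K b] and s = bumpS_section[OF K b] and Fs = frame_section_in[OF K b]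
  have l: "hproj e (?F (Inl \<alpha>) e) = ?F (Inl \<alpha>) e" "C e (?F (Inl \<alpha>) e) = 0" if "e \<in> totalE S" for e \<alpha>
    using hproj_id[OF hlift_horizontal(1)[OF u that]] C_horizontal[OF hlift_horizontal(1)[OF u that]] by (simp_all add: frame_section_def)
  have r: "hproj e (?F (Inr a) e) = 0" "C e (?F (Inr a) e) = ?F (Inr a) e" if "e \<in> totalE S" for e a
    using hproj_vertical[OF that vlift_vertical[OF s that]] C_id[OF that vlift_vertical[OF s that]] by (simp_all add: frame_section_def)
  have in_gtb: "?F m e \<in> gtb S e" "0 \<in> gtb S e" if "e \<in> totalE S" for e m
    using gsec_in[OF Fs that] subspace_0[OF gtb_subspace[OF that]] by auto
  note z = koszul_zero Q_zero in_gtb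
  have cong: "smoothE S UNIV h \<Longrightarrow> (\<And>e. e \<in> totalE S \<Longrightarrow> h e = diff_form e (?F i e) (?F j e) (?F k e)) \<Longrightarrow> ?thesis" for h
    by (rule E.smooth_total_cong[OF open_UNIV]) auto
  note zero = E.smooth_total_const[OF open_UNIV, where c=0]
  show ?thesis
  proof (cases i; cases j; cases k)
    fix \<alpha> \<beta> \<gamma> assume ijk: "i = Inl \<alpha>" "j = Inl \<beta>" "k = Inl \<gamma>"
    have "smoothE S UNIV (\<lambda>e. koszul e (?F i e) (?F j e) (?F k e))"
      by (rule koszul_smooth[OF Fs Fs Fs torH_section[OF u u, of \<alpha> \<beta>] torH_section[OF u u, of \<alpha> \<gamma>] torH_section[OF u u, of \<beta> \<gamma>]])
        (simp_all add: ijk frame_section_def tor_hlift u)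
    then show ?thesis by (rule cong) (simp add: ijk diff_form_def l z)
  next
    fix \<alpha> \<beta> c assume ijk: "i = Inl \<alpha>" "j = Inl \<beta>" "k = Inr c"
    show ?thesis by (rule cong[OF zero]) (simp add: ijk diff_form_def l r z)
  next
    fix \<alpha> a \<gamma> assume ijk: "i = Inl \<alpha>" "j = Inr a" "k = Inl \<gamma>"
    show ?thesis by (rule cong[OF zero]) (simp add: ijk diff_form_def l r z)
  next
    fix \<alpha> a c assume ijk: "i = Inl \<alpha>" "j = Inr a" "k = Inr c"
    show ?thesis by (rule cong[OF Q_smooth[OF Fs Fs Fs, of i j k]]) (simp add: ijk diff_form_def l r z)
  next
    fix a \<beta> \<gamma> assume ijk: "i = Inr a" "j = Inl \<beta>" "k = Inl \<gamma>"
    show ?thesis by (rule cong[OF Q_smooth[OF Fs Fs Fs, of i j k]]) (simp add: ijk diff_form_def l r z)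
  next
    fix a \<beta> c assume ijk: "i = Inr a" "j = Inl \<beta>" "k = Inr c"
    show ?thesis by (rule cong[OF zero]) (simp add: ijk diff_form_def l r z)
  next
    fix a b' \<gamma> assume ijk: "i = Inr a" "j = Inr b'" "k = Inl \<gamma>"
    show ?thesis by (rule cong[OF zero]) (simp add: ijk diff_form_def l r z)
  next
    fix a b' c assume ijk: "i = Inr a" "j = Inr b'" "k = Inr c"
    have "smoothE S UNIV (\<lambda>e. koszul e (?F i e) (?F j e) (?F k e))"
      by (rule koszul_smooth[OF Fs Fs Fs torV_section[OF s s, of a b'] torV_section[OF s s, of a c] torV_section[OF s s, of b' c]])
        (simp_all add: ijk frame_section_def tor_vlift[OF s s])
    then show ?thesis by (rule cong) (simp add: ijk diff_form_def r z)
  qed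
qed

lemma lin_on_expand:
  fixes b :: "'k::finite \<Rightarrow> 'v::real_vector"
  assumes "basis_of W b" "lin_on W f" "w \<in> W" shows "f w = (\<Sum>k\<in>UNIV. coef b w k * (f (b k) :: real))"
proof -
  have "f (\<Sum>k\<in>UNIV. coef b w k *\<^sub>R b k) = (\<Sum>k\<in>UNIV. coef b w k *\<^sub>R f (b k))"
    by (rule lin_on_sum[OF assms(2) basis_of_subspace[OF assms(1)]]) (auto intro: basis_of_in[OF assms(1)])
  then show ?thesis using basis_of_expand[OF assms(1,3)] by simp
qed

lemma diff_form_smooth:
  assumes X: "X \<in> gsections S" and Y: "Y \<in> gsections S" and Z: "Z \<in> gsections S"
  shows "smoothE S UNIV (\<lambda>e. diff_form e (X e) (Y e) (Z e))"
proof (rule E.smooth_total_locally)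
  fix x
  obtain K where K: "local_coords S K" "x \<in> nbhd K" by (rule ex_local_coords)
  obtain b V where b: "bump_at (atlasM S) (nbhd K) x b" "open V" "x \<in> V" "V \<subseteq> nbhd K" "\<And>y. y \<in> V \<Longrightarrow> b y = 1"
    using coords_bump[OF K] by metis
  let ?F = "frame_section K b"
  let ?c = "\<lambda>X k e. coef (adapted_frame S C K e) (X e) k"
  have c: "smoothE S V (?c X k)" if "X \<in> gsections S" for X k
    by (rule E.smooth_total_subset[OF adapted_coef_smooth[OF K(1) that] b(4)])
  have "smoothE S V (\<lambda>e. \<Sum>i\<in>UNIV. ?c X i e * (\<Sum>j\<in>UNIV. ?c Y j e * (\<Sum>k\<in>UNIV. ?c Z k e * diff_form e (?F i e) (?F j e) (?F k e))))"
    by (intro E.smooth_total_sum E.smooth_total_mult c X Y Z b(2) finite_UNIV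
        E.smooth_total_subset[OF diff_form_frame_smooth[OF K(1) b(1)]] subset_UNIV finite)
  then have "smoothE S V (\<lambda>e. diff_form e (X e) (Y e) (Z e))"
  proof (rule E.smooth_total_cong[OF b(2), rotated])
    fix e assume e: "e \<in> totalE S" "fst e \<in> V"
    then have eK: "fst e \<in> nbhd K" using b(4) by auto
    note ab = adapted_basis[OF K(1) e(1) eK] and xe = gsec_in[OF X e(1)] and ye = gsec_in[OF Y e(1)] and ze = gsec_in[OF Z e(1)]
    have F: "?F k e = adapted_frame S C K e k" for k by (rule frame_section_eq[OF K(1) b(1) e(1) eK b(5)[OF e(2)]])
    show "(\<Sum>i\<in>UNIV. ?c X i e * (\<Sum>j\<in>UNIV. ?c Y j e * (\<Sum>k\<in>UNIV. ?c Z k e * diff_form e (?F i e) (?F j e) (?F k e))))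
        = diff_form e (X e) (Y e) (Z e)"
      unfolding F
      by (simp add: lin_on_expand[OF ab diff_form_lin(1)[OF e(1) ye ze] xe]
          lin_on_expand[OF ab diff_form_lin(2)[OF e(1) basis_of_in[OF ab] ze] ye]
          lin_on_expand[OF ab diff_form_lin(3)[OF e(1) basis_of_in[OF ab] basis_of_in[OF ab]] ze])
  qed
  then show "\<exists>V. open V \<and> x \<in> V \<and> smoothE S V (\<lambda>e. diff_form e (X e) (Y e) (Z e))" using b by blast
qed

text \<open>Near a point the coefficients of \<open>Phi e (X e) (Y e)\<close> solve the linear system whose
  matrix is the Gram matrix of the natural base and whose right-hand side is half the form.\<close>

lemma Phi_section:
  assumes X: "X \<in> gsections S" and Y: "Y \<in> gsections S"
  shows "(\<lambda>e. Phi e (X e) (Y e)) \<in> gsections S"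
proof (rule gsectionI_coords)
  show "Phi e (X e) (Y e) \<in> gtb S e" if "e \<in> totalE S" for e
    using Phi_in[OF that gsec_in[OF X that] gsec_in[OF Y that]] .
  show "Phi e (X e) (Y e) = 0" if "e \<notin> totalE S" for e using that by (simp add: Phi_def)
  fix K :: "('m, 'n, 'f, 'b, 'i, 'p, 'r) coords" and k assume K: "local_coords S K"
  show "smoothE S (nbhd K) (\<lambda>e. coef (nat_frame S K e) (Phi e (X e) (Y e)) k)"
  proof (rule E.smooth_total_locally)
    fix x assume x: "x \<in> nbhd K"
    obtain b V where b: "bump_at (atlasM S) (nbhd K) x b" "open V" "x \<in> V" "V \<subseteq> nbhd K" "\<And>y. y \<in> V \<Longrightarrow> b y = 1"
      using coords_bump[OF K x] by metis
    define M :: "'m \<times> 'b \<Rightarrow> real ^ ('p + 'r) ^ ('p + 'r)" where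
      "M e = (\<chi> j k. g e (nat_frame S K e k) (nat_frame S K e j))" for e
    define v :: "'m \<times> 'b \<Rightarrow> real ^ ('p + 'r)" where "v e = (\<chi> j. 1 / 2 * diff_form e (X e) (Y e) (bumpE K b j e))" for e
    define y :: "'m \<times> 'b \<Rightarrow> real ^ ('p + 'r)" where "y e = (\<chi> k. coef (nat_frame S K e) (Phi e (X e) (Y e)) k)" for e
    have "smoothE S V (\<lambda>e. y e $ k)"
    proof (rule cramer_closed[where U="{e \<in> totalE S. fst e \<in> V}" and M=M and v=v and P="smoothE S V"])
      show "smoothE S V (\<lambda>e. M e $ i $ j)" for i j
        using E.smooth_total_subset[OF tf_smooth[OF G_field K, of "[]" "[j, i]"] b(4)] by (simp add: M_def)
      show "smoothE S V (\<lambda>e. v e $ i)" for i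
        using E.smooth_total_mult[OF b(2) E.smooth_total_const[OF b(2), of "1/2"]
            E.smooth_total_subset[OF diff_form_smooth[OF X Y bumpE_section[OF K b(1), of i]]]] by (simp add: v_def)
      show "invertible (M e) \<and> M e *v y e = v e" if "e \<in> {e \<in> totalE S. fst e \<in> V}" for e
      proof
        have e: "e \<in> totalE S" "fst e \<in> V" "fst e \<in> nbhd K" using that b(4) by auto
        note nb = nat_frame_basis[OF K e(1,3)]
        show "invertible (M e)" unfolding M_def by (rule gram_matrix(1)[OF K e(1,3)])
        have "bumpE K b j e = nat_frame S K e j" for j using e b(5) by (simp add: bumpE_def)
        then show "M e *v y e = v e"
          unfolding M_def gram_matrix(2)[OF K e(1,3)]
          using basis_of_expand[OF nb Phi_in[OF e(1) gsec_in[OF X e(1)] gsec_in[OF Y e(1)]]]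
            g_Phi[OF e(1) gsec_in[OF X e(1)] gsec_in[OF Y e(1)] basis_of_in[OF nb]]
          by (simp add: v_def y_def vec_eq_iff flip: g_Phi[OF e(1) gsec_in[OF X e(1)] gsec_in[OF Y e(1)] basis_of_in[OF nb]])
      qed
      show "smoothE S V g'" if "smoothE S V f" "\<And>e. e \<in> {e \<in> totalE S. fst e \<in> V} \<Longrightarrow> f e = g' e" for f g'
        by (rule E.smooth_total_cong[OF b(2) _ that(1)]) (simp add: that(2))
      show "smoothE S V (\<lambda>e. inverse (f e))" if "smoothE S V f" "\<And>e. e \<in> {e \<in> totalE S. fst e \<in> V} \<Longrightarrow> f e \<noteq> 0" for f
        by (rule E.smooth_total_inverse[OF b(2) that(1)]) (simp add: that(2))
    qed (intro E.smooth_total_const E.smooth_total_add E.smooth_total_mult b(2); assumption)+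
    then show "\<exists>V. open V \<and> x \<in> V \<and> smoothE S V (\<lambda>e. coef (nat_frame S K e) (Phi e (X e) (Y e)) k)"
      using b by (auto simp: y_def)
  qed
qed

end

section \<open>Derivations of the tensor algebra induced by endomorphisms\<close>

lemma sum_lessThan_add: "(\<Sum>i<a + b. f i) = (\<Sum>i<a. f i) + (\<Sum>i<b. f (a + i))" for f :: "nat \<Rightarrow> real"
  by (induction b) (simp_all add: add.assoc)

text \<open>The argument lists of a contracted tensor have a basis vector inserted at position \<open>i\<close>. A derivation
  sums over all positions, and the term of the inserted one has to be separated.\<close>

lemma sum_insert_position:
  fixes f :: "'x list \<Rightarrow> real"
  assumes "i \<le> length xs"
  defines "ins \<equiv> \<lambda>a xs. take i xs @ a # drop i xs"
  shows "(\<Sum>m<Suc (length xs). f ((ins a xs)[m := h (ins a xs ! m)]))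
    = f (ins (h a) xs) + (\<Sum>m<length xs. f (ins a (xs[m := h (xs ! m)])))"
proof -
  define us vs where "us = take i xs" and "vs = drop i xs"
  have xs: "xs = us @ vs" and i: "i = length us" using assms(1) by (auto simp: us_def vs_def)
  have "Suc (length xs) = length us + (1 + length vs)" by (simp add: xs)
  then have "(\<Sum>m<Suc (length xs). f ((ins a xs)[m := h (ins a xs ! m)]))
      = (\<Sum>m<length us. f ((us @ a # vs)[m := h ((us @ a # vs) ! m)])) + f (us @ h a # vs)
        + (\<Sum>m<length vs. f (us @ a # vs[m := h (vs ! m)]))"
    by (simp only: sum_lessThan_add) (simp add: ins_def us_def[symmetric] vs_def[symmetric] nth_append list_update_append)
  moreover have "(\<Sum>m<length xs. f (ins a (xs[m := h (xs ! m)])))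
      = (\<Sum>m<length us. f (us[m := h (us ! m)] @ a # vs)) + (\<Sum>m<length vs. f (us @ a # vs[m := h (vs ! m)]))"
  proof -
    have "length xs = length us + length vs" by (simp add: xs)
    then show ?thesis
      by (simp only: sum_lessThan_add) (simp add: ins_def xs i nth_append list_update_append)
  qed
  moreover have "(\<Sum>m<length us. f ((us @ a # vs)[m := h ((us @ a # vs) ! m)])) = (\<Sum>m<length us. f (us[m := h (us ! m)] @ a # vs))"
    by (intro sum.cong refl) (simp add: nth_append list_update_append)
  ultimately show ?thesis by (simp add: ins_def us_def vs_def)
qed

context gla
begin

definition endo :: "'m \<times> 'b \<Rightarrow> (('m, 'f, 'b) gvec \<Rightarrow> ('m, 'f, 'b) gvec) \<Rightarrow> bool" where
  "endo e A \<longleftrightarrow> lin_on (gtb S e) A \<and> (\<forall>w\<in>gtb S e. A w \<in> gtb S e) \<and> (\<forall>w. w \<notin> gtb S e \<longrightarrow> A w = 0)"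

text \<open>The derivation of the tensor algebra that annihilates functions and is \<open>A\<close> on vectors, hence the
  negative transpose of \<open>A\<close> on covectors. As a covector slot takes covectors, it is the transpose that is
  inserted there, with the positive sign.\<close>

definition act :: "(('m, 'f, 'b) gvec \<Rightarrow> ('m, 'f, 'b) gvec) \<Rightarrow> ('m, 'f, 'b) tensor \<Rightarrow> ('m, 'f, 'b) tensor" where
  "act A T e \<omega>s ws = (if e \<in> totalE S \<and> (\<omega>s, ws) \<in> tensor_args S (length \<omega>s) (length ws) e
     then (\<Sum>m<length \<omega>s. T e (\<omega>s[m := (\<lambda>w. (\<omega>s ! m) (A w))]) ws) - (\<Sum>m<length ws. T e \<omega>s (ws[m := A (ws ! m)])) else 0)"

lemma endo_lin: "endo e A \<Longrightarrow> lin_on (gtb S e) A" and endo_in: "endo e A \<Longrightarrow> w \<in> gtb S e \<Longrightarrow> A w \<in> gtb S e"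
  and endo_off: "endo e A \<Longrightarrow> w \<notin> gtb S e \<Longrightarrow> A w = 0"
  unfolding endo_def by blast+

text \<open>A covector is zero outside the fibre; it remains so under the transpose because an element of
  \<open>endo\<close> is zero there as well.\<close>

lemma transpose_covector:
  assumes e: "e \<in> totalE S" and A: "endo e A" and \<omega>: "\<omega> \<in> covectors S e" shows "(\<lambda>w. \<omega> (A w)) \<in> covectors S e"
  unfolding covectors_def mem_Collect_eq
proof (intro conjI allI impI)
  show "lin_on (gtb S e) (\<lambda>w. \<omega> (A w))" by (rule lin_on_compose[OF covectors_lin[OF \<omega>] endo_lin[OF A] endo_in[OF A]])
  show "\<omega> (A w) = 0" if "w \<notin> gtb S e" for w
    using endo_off[OF A that] lin_on_zero[OF covectors_lin[OF \<omega>] subspace_0[OF gtb_subspace[OF e]]] by simp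
qed

lemma act_valid:
  assumes "e \<in> totalE S" "(\<omega>s, ws) \<in> tensor_args S k l e"
  shows "act A T e \<omega>s ws = (\<Sum>m<k. T e (\<omega>s[m := (\<lambda>w. (\<omega>s ! m) (A w))]) ws) - (\<Sum>m<l. T e \<omega>s (ws[m := A (ws ! m)]))"
  using assms by (simp add: act_def tensor_args_iff)

lemma act_zero:
  assumes T: "\<And>e \<omega>s ws. \<not> (e \<in> totalE S \<and> (\<omega>s, ws) \<in> tensor_args S k l e) \<Longrightarrow> T e \<omega>s ws = 0"
    and n: "\<not> (e \<in> totalE S \<and> (\<omega>s, ws) \<in> tensor_args S k l e)"
  shows "act A T e \<omega>s ws = 0"
proof (cases "e \<in> totalE S \<and> (\<omega>s, ws) \<in> tensor_args S (length \<omega>s) (length ws) e")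
  case True
  then have len: "\<not> (length \<omega>s = k \<and> length ws = l)" using n by (auto simp: tensor_args_iff)
  have "T e \<omega>s' ws' = 0" if "length \<omega>s' = length \<omega>s" "length ws' = length ws" for \<omega>s' ws'
    by (rule T) (use that len in \<open>auto simp: tensor_args_iff\<close>)
  then show ?thesis by (simp add: act_def)
next
  case False
  then show ?thesis unfolding act_def by (rule if_not_P)
qed

lemma tensor_args_update_cov:
  "(\<omega>s, ws) \<in> tensor_args S k l e \<Longrightarrow> \<omega> \<in> covectors S e \<Longrightarrow> (\<omega>s[i := \<omega>], ws) \<in> tensor_args S k l e"
  by (auto simp: tensor_args_iff dest: set_update_subset_insert[THEN subsetD])

lemma tensor_args_update_vec:
  "(\<omega>s, ws) \<in> tensor_args S k l e \<Longrightarrow> w \<in> gtb S e \<Longrightarrow> (\<omega>s, ws[i := w]) \<in> tensor_args S k l e"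
  unfolding tensor_args_iff using set_update_subset_insert[of ws i w] by auto

lemma tensor_args_nth:
  "(\<omega>s, ws) \<in> tensor_args S k l e \<Longrightarrow> i < k \<Longrightarrow> \<omega>s ! i \<in> covectors S e"
  "(\<omega>s, ws) \<in> tensor_args S k l e \<Longrightarrow> j < l \<Longrightarrow> ws ! j \<in> gtb S e"
  unfolding tensor_args_iff by (meson nth_mem subsetD)+

lemma lin_on_sum_functions:
  "finite I \<Longrightarrow> (\<And>i. i \<in> I \<Longrightarrow> lin_on W (f i)) \<Longrightarrow> lin_on W (\<lambda>w. \<Sum>i\<in>I. (f i w :: real))"
  by (induction I rule: finite_induct) (auto simp: lin_on_def algebra_simps)

lemma act_field:
  assumes T: "tensor_field S k l T" and A: "\<And>e. e \<in> totalE S \<Longrightarrow> endo e (A e)"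
    and sm: "\<And>K i j. local_coords S K \<Longrightarrow> smoothE S (nbhd K) (\<lambda>e. coef (nat_frame S K e) (A e (nat_frame S K e j)) i)"
  shows "tensor_field S k l (\<lambda>e. act (A e) T e)"
proof (rule tensor_fieldI)
  show "act (A e) T e \<omega>s ws = 0" if "\<not> (e \<in> totalE S \<and> (\<omega>s, ws) \<in> tensor_args S k l e)" for e \<omega>s ws
    by (rule act_zero[OF tf_zero[OF T] that])
next
  fix e \<omega>s ws i assume e: "e \<in> totalE S" and a: "(\<omega>s, ws) \<in> tensor_args S k l e" and i: "i < k"
  note A' = A[OF e]
  have len: "length \<omega>s = k" using a by (simp add: tensor_args_iff)
  have l1: "lin_on (covectors S e) (\<lambda>\<omega>. T e (\<omega>s[i := \<omega>, m := (\<lambda>w. (\<omega>s[i := \<omega>] ! m) (A e w))]) ws)" if m: "m < k" for m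
  proof (cases "m = i")
    case True
    have "lin_on (covectors S e) (\<lambda>\<omega> w. \<omega> (A e w))" by (auto simp: lin_on_def scaleR_fun_def)
    from lin_on_compose[OF tf_lin_cov[OF T e a i] this transpose_covector[OF e A']]
    show ?thesis using True i len by simp
  next
    case False
    have "(\<omega>s[m := (\<lambda>w. (\<omega>s ! m) (A e w))], ws) \<in> tensor_args S k l e"
      by (rule tensor_args_update_cov[OF a transpose_covector[OF e A' tensor_args_nth(1)[OF a m]]])
    from tf_lin_cov[OF T e this i] show ?thesis using False by (simp add: list_update_swap[of i m])
  qed
  have l2: "lin_on (covectors S e) (\<lambda>\<omega>. T e (\<omega>s[i := \<omega>]) (ws[m := A e (ws ! m)]))" if m: "m < l" for m
    by (rule tf_lin_cov[OF T e tensor_args_update_vec[OF a endo_in[OF A' tensor_args_nth(2)[OF a m]]] i])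
  have "lin_on (covectors S e) (\<lambda>\<omega>. (\<Sum>m<k. T e (\<omega>s[i := \<omega>, m := (\<lambda>w. (\<omega>s[i := \<omega>] ! m) (A e w))]) ws)
      - (\<Sum>m<l. T e (\<omega>s[i := \<omega>]) (ws[m := A e (ws ! m)])))"
    by (intro lin_on_minus lin_on_sum_functions l1 l2) auto
  then show "lin_on (covectors S e) (\<lambda>\<omega>. act (A e) T e (\<omega>s[i := \<omega>]) ws)"
    by (rule lin_on_congI[OF _ covectors_subspace]) (simp add: act_valid[OF e tensor_args_update_cov[OF a]])
next
  fix e \<omega>s ws j assume e: "e \<in> totalE S" and a: "(\<omega>s, ws) \<in> tensor_args S k l e" and j: "j < l"
  note A' = A[OF e]
  have len: "length ws = l" using a by (simp add: tensor_args_iff)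
  have l1: "lin_on (gtb S e) (\<lambda>w. T e \<omega>s (ws[j := w, m := A e (ws[j := w] ! m)]))" if m: "m < l" for m
  proof (cases "m = j")
    case True
    from lin_on_compose[OF tf_lin_vec[OF T e a j] endo_lin[OF A'] endo_in[OF A']]
    show ?thesis using True j len by simp
  next
    case False
    have "(\<omega>s, ws[m := A e (ws ! m)]) \<in> tensor_args S k l e"
      by (rule tensor_args_update_vec[OF a endo_in[OF A' tensor_args_nth(2)[OF a m]]])
    from tf_lin_vec[OF T e this j] show ?thesis using False by (simp add: list_update_swap[of j m])
  qed
  have l2: "lin_on (gtb S e) (\<lambda>w. T e (\<omega>s[m := (\<lambda>w. (\<omega>s ! m) (A e w))]) (ws[j := w]))" if m: "m < k" for m
    by (rule tf_lin_vec[OF T e tensor_args_update_cov[OF a transpose_covector[OF e A' tensor_args_nth(1)[OF a m]]] j])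
  have "lin_on (gtb S e) (\<lambda>w. (\<Sum>m<k. T e (\<omega>s[m := (\<lambda>w. (\<omega>s ! m) (A e w))]) (ws[j := w]))
      - (\<Sum>m<l. T e \<omega>s (ws[j := w, m := A e (ws[j := w] ! m)])))"
    by (intro lin_on_minus lin_on_sum_functions l1 l2) auto
  then show "lin_on (gtb S e) (\<lambda>w. act (A e) T e \<omega>s (ws[j := w]))"
    by (rule lin_on_congI[OF _ gtb_subspace[OF e]]) (simp add: act_valid[OF e tensor_args_update_vec[OF a]])
next
  fix K :: "('m, 'n, 'f, 'b, 'i, 'p, 'r) coords" and As Bs :: "('p + 'r) list"
  assume K: "local_coords S K" and len: "length As = k" "length Bs = l"
  note oK = local_coords_open[OF K]
  let ?d = "\<lambda>e. dual_basis (gtb S e) (nat_frame S K e)" and ?n = "\<lambda>e. nat_frame S K e"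
  let ?c = "\<lambda>i j e. coef (nat_frame S K e) (A e (nat_frame S K e j)) i"
  have "smoothE S (nbhd K) (\<lambda>e. (\<Sum>m<k. \<Sum>i\<in>UNIV. ?c (As ! m) i e * T e (map (?d e) (As[m := i])) (map (?n e) Bs))
      - (\<Sum>m<l. \<Sum>i\<in>UNIV. ?c i (Bs ! m) e * T e (map (?d e) As) (map (?n e) (Bs[m := i]))))"
    using len by (intro E.smooth_total_diff E.smooth_total_sum E.smooth_total_mult oK sm[OF K] tf_smooth[OF T K]) auto
  then show "smoothE S (nbhd K) (\<lambda>e. act (A e) T e (map (?d e) As) (map (?n e) Bs))"
  proof (rule E.smooth_total_cong[OF oK, rotated])
    fix e assume e: "e \<in> totalE S" "fst e \<in> nbhd K"
    note nb = nat_frame_basis[OF K e] and A' = A[OF e(1)]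
    have a: "(map (?d e) As, map (?n e) Bs) \<in> tensor_args S k l e"
      using len dual_basis_covector[OF nb] basis_of_in[OF nb] by (auto simp: tensor_args_iff)
    have t1: "T e ((map (?d e) As)[m := (\<lambda>w. (map (?d e) As ! m) (A e w))]) (map (?n e) Bs)
        = (\<Sum>i\<in>UNIV. ?c (As ! m) i e * T e (map (?d e) (As[m := i])) (map (?n e) Bs))" if m: "m < k" for m
    proof -
      have ex: "(\<lambda>w. ?d e (As ! m) (A e w)) = (\<Sum>i\<in>UNIV. ?c (As ! m) i e *\<^sub>R ?d e i)"
        using covector_expand[OF nb transpose_covector[OF e(1) A' dual_basis_covector[OF nb, of "As ! m"]]]
          endo_in[OF A' basis_of_in[OF nb]] by (simp add: dual_basis_def[of _ _ "As ! m"])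
      have "T e ((map (?d e) As)[m := \<Sum>i\<in>UNIV. ?c (As ! m) i e *\<^sub>R ?d e i]) (map (?n e) Bs)
          = (\<Sum>i\<in>UNIV. ?c (As ! m) i e *\<^sub>R T e ((map (?d e) As)[m := ?d e i]) (map (?n e) Bs))"
        by (rule lin_on_sum[OF tf_lin_cov[OF T e(1) a m] covectors_subspace]) (auto intro: dual_basis_covector[OF nb])
      then show ?thesis using ex m len by (simp add: map_update)
    qed
    have t2: "T e (map (?d e) As) ((map (?n e) Bs)[m := A e (map (?n e) Bs ! m)])
        = (\<Sum>i\<in>UNIV. ?c i (Bs ! m) e * T e (map (?d e) As) (map (?n e) (Bs[m := i])))" if m: "m < l" for m
    proof -
      have "T e (map (?d e) As) ((map (?n e) Bs)[m := \<Sum>i\<in>UNIV. ?c i (Bs ! m) e *\<^sub>R ?n e i])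
          = (\<Sum>i\<in>UNIV. ?c i (Bs ! m) e *\<^sub>R T e (map (?d e) As) ((map (?n e) Bs)[m := ?n e i]))"
        by (rule lin_on_sum[OF tf_lin_vec[OF T e(1) a m] gtb_subspace[OF e(1)]]) (auto intro: basis_of_in[OF nb])
      then show ?thesis
        using m len by (simp add: map_update basis_of_expand[OF nb endo_in[OF A' basis_of_in[OF nb]]])
    qed
    show "(\<Sum>m<k. \<Sum>i\<in>UNIV. ?c (As ! m) i e * T e (map (?d e) (As[m := i])) (map (?n e) Bs))
      - (\<Sum>m<l. \<Sum>i\<in>UNIV. ?c i (Bs ! m) e * T e (map (?d e) As) (map (?n e) (Bs[m := i])))
      = act (A e) T e (map (?d e) As) (map (?n e) Bs)"
      unfolding act_valid[OF e(1) a] by (simp add: t1 t2)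
  qed
qed

lemma act_combination:
  assumes T: "tensor_field S k l T" and e: "e \<in> totalE S" and A: "endo e A" and B: "endo e B"
    and AB: "\<And>w. w \<in> gtb S e \<Longrightarrow> AB w = A w + c *\<^sub>R B w" "endo e AB"
  shows "act AB T e \<omega>s ws = act A T e \<omega>s ws + c * act B T e \<omega>s ws"
proof (cases "(\<omega>s, ws) \<in> tensor_args S k l e")
  case a: True
  have t1: "T e (\<omega>s[m := (\<lambda>w. (\<omega>s ! m) (AB w))]) ws
      = T e (\<omega>s[m := (\<lambda>w. (\<omega>s ! m) (A w))]) ws + c * T e (\<omega>s[m := (\<lambda>w. (\<omega>s ! m) (B w))]) ws" if m: "m < k" for m
  proof -
    note \<omega> = tensor_args_nth(1)[OF a m]
    have eq: "(\<lambda>w. (\<omega>s ! m) (AB w)) = (\<lambda>w. (\<omega>s ! m) (A w)) + c *\<^sub>R (\<lambda>w. (\<omega>s ! m) (B w))"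
    proof
      fix w
      show "(\<omega>s ! m) (AB w) = ((\<lambda>w. (\<omega>s ! m) (A w)) + c *\<^sub>R (\<lambda>w. (\<omega>s ! m) (B w))) w"
      proof (cases "w \<in> gtb S e")
        case True
        show ?thesis
          using lin_on_combination[OF covectors_lin[OF \<omega>] gtb_subspace[OF e] endo_in[OF A True] endo_in[OF B True], of c] AB(1)[OF True]
          by (simp add: scaleR_fun_def)
      next
        case False
        have "(\<omega>s ! m) 0 = 0" by (rule lin_on_zero[OF covectors_lin[OF \<omega>] subspace_0[OF gtb_subspace[OF e]]])
        then show ?thesis using endo_off[OF A False] endo_off[OF B False] endo_off[OF AB(2) False] by (simp add: scaleR_fun_def)
      qed
    qed
    show ?thesis unfolding eq
      using lin_on_combination[OF tf_lin_cov[OF T e a m] covectors_subspace transpose_covector[OF e A \<omega>] transpose_covector[OF e B \<omega>], of c] by simp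
  qed
  have t2: "T e \<omega>s (ws[m := AB (ws ! m)]) = T e \<omega>s (ws[m := A (ws ! m)]) + c * T e \<omega>s (ws[m := B (ws ! m)])" if m: "m < l" for m
    using lin_on_combination[OF tf_lin_vec[OF T e a m] gtb_subspace[OF e] endo_in[OF A] endo_in[OF B], of "ws ! m" "ws ! m" c]
      tensor_args_nth(2)[OF a m] AB(1) by simp
  show ?thesis unfolding act_valid[OF e a] by (simp add: t1 t2 sum.distrib sum_distrib_left algebra_simps)
next
  case False
  have "act A' T e \<omega>s ws = 0" for A'
    by (rule act_zero[where k=k and l=l, OF tf_zero[OF T]]) (simp_all add: False)
  then show ?thesis by simp
qed

lemma act_add: "act A (T + T') e \<omega>s ws = act A T e \<omega>s ws + act A T' e \<omega>s ws"
  by (simp add: act_def sum.distrib)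

lemma act_scalar: "act A (scalar_tensor S f) e \<omega>s ws = 0"
proof (cases "\<omega>s = [] \<and> ws = []")
  case True
  then show ?thesis by (simp add: act_def)
next
  case False
  then have "scalar_tensor S f e (\<omega>s[m := \<omega>]) ws = 0" "scalar_tensor S f e \<omega>s (ws[m := w]) = 0" for m \<omega> w
    by (auto simp: scalar_tensor_def)
  then show ?thesis by (simp add: act_def)
qed

text \<open>Leibniz rule: the slots of the product are those of the two factors.\<close>

lemma act_prod:
  assumes T: "tensor_field S k l T" and T': "tensor_field S k' l' T'" and e: "e \<in> totalE S"
    and a: "(\<omega>s, ws) \<in> tensor_args S (k + k') (l + l') e"
  shows "act A (tensor_prod k l T T') e \<omega>s ws
    = act A T e (take k \<omega>s) (take l ws) * T' e (drop k \<omega>s) (drop l ws) + T e (take k \<omega>s) (take l ws) * act A T' e (drop k \<omega>s) (drop l ws)"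
proof -
  have a1: "(take k \<omega>s, take l ws) \<in> tensor_args S k l e" and a2: "(drop k \<omega>s, drop l ws) \<in> tensor_args S k' l' e"
    using a by (auto simp: tensor_args_iff dest: in_set_takeD in_set_dropD)
  have len: "length \<omega>s = k + k'" "length ws = l + l'" using a by (auto simp: tensor_args_iff)
  have c1: "(\<Sum>m<k + k'. tensor_prod k l T T' e (\<omega>s[m := (\<lambda>w. (\<omega>s ! m) (A w))]) ws)
      = (\<Sum>m<k. T e ((take k \<omega>s)[m := (\<lambda>w. (take k \<omega>s ! m) (A w))]) (take l ws)) * T' e (drop k \<omega>s) (drop l ws)
      + T e (take k \<omega>s) (take l ws) * (\<Sum>m<k'. T' e ((drop k \<omega>s)[m := (\<lambda>w. (drop k \<omega>s ! m) (A w))]) (drop l ws))"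
    unfolding sum_lessThan_add sum_distrib_left sum_distrib_right
    using len by (intro arg_cong2[where f="(+)"] sum.cong refl)
      (simp_all add: tensor_prod_def take_update_swap drop_update_cancel drop_update_swap list_update_beyond)
  have c2: "(\<Sum>m<l + l'. tensor_prod k l T T' e \<omega>s (ws[m := A (ws ! m)]))
      = (\<Sum>m<l. T e (take k \<omega>s) ((take l ws)[m := A (take l ws ! m)])) * T' e (drop k \<omega>s) (drop l ws)
      + T e (take k \<omega>s) (take l ws) * (\<Sum>m<l'. T' e (drop k \<omega>s) ((drop l ws)[m := A (drop l ws ! m)]))"
    unfolding sum_lessThan_add sum_distrib_left sum_distrib_right
    using len by (intro arg_cong2[where f="(+)"] sum.cong refl)
      (simp_all add: tensor_prod_def take_update_swap drop_update_cancel drop_update_swap list_update_beyond)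
  show ?thesis unfolding act_valid[OF e a] act_valid[OF e a1] act_valid[OF e a2] c1 c2 by (simp add: algebra_simps)
qed

lemma contraction_zero:
  assumes T: "\<And>e \<omega>s ws. \<not> (e \<in> totalE S \<and> (\<omega>s, ws) \<in> tensor_args S (Suc k) (Suc l) e) \<Longrightarrow> T e \<omega>s ws = 0"
    and n: "\<not> (e \<in> totalE S \<and> (\<omega>s, ws) \<in> tensor_args S k l e)"
  shows "contraction S i j T e \<omega>s ws = 0"
proof -
  have "T e (take i \<omega>s @ \<omega> # drop i \<omega>s) (take j ws @ w # drop j ws) = 0" for \<omega> w
  proof (rule T, rule notI, elim conjE)
    assume e: "e \<in> totalE S" and a: "(take i \<omega>s @ \<omega> # drop i \<omega>s, take j ws @ w # drop j ws) \<in> tensor_args S (Suc k) (Suc l) e"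
    have s: "set \<omega>s \<subseteq> set (take i \<omega>s @ \<omega> # drop i \<omega>s)" "set ws \<subseteq> set (take j ws @ w # drop j ws)"
      using set_append[of "take i \<omega>s" "drop i \<omega>s"] set_append[of "take j ws" "drop j ws"]
      unfolding append_take_drop_id by simp_all blast+
    have len: "length (take i \<omega>s @ \<omega> # drop i \<omega>s) = Suc (length \<omega>s)" "length (take j ws @ w # drop j ws) = Suc (length ws)"
      by simp_all
    note a' = a[unfolded tensor_args_iff len Suc_inject]
    have "set \<omega>s \<subseteq> covectors S e" "set ws \<subseteq> gtb S e" using a' s order_trans by blast+
    then have "(\<omega>s, ws) \<in> tensor_args S k l e" unfolding tensor_args_iff using a' by blast
    then show False using n e by blast
  qed
  then show ?thesis by (simp add: contraction_def Let_def)
qed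

text \<open>In a contracted pair of slots the two actions of \<open>A\<close> cancel: both are the trace of the tensor against
  the matrix of \<open>A\<close>.\<close>

lemma act_contraction:
  assumes T: "tensor_field S (Suc k) (Suc l) T" and A: "\<And>e. e \<in> totalE S \<Longrightarrow> endo e (A e)" and ij: "i \<le> k" "j \<le> l"
  shows "act (A e) (contraction S i j T) e \<omega>s ws = contraction S i j (\<lambda>e. act (A e) T e) e \<omega>s ws"
proof (cases "e \<in> totalE S \<and> (\<omega>s, ws) \<in> tensor_args S k l e")
  case True
  then have e: "e \<in> totalE S" and a: "(\<omega>s, ws) \<in> tensor_args S k l e" by auto
  note A' = A[OF e]
  obtain b :: "'p + 'r \<Rightarrow> ('m, 'f, 'b) gvec" where b: "basis_of (gtb S e) b"
    and contr: "\<And>i j T \<omega>s ws. contraction S i j T e \<omega>s ws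
       = (\<Sum>k\<in>UNIV. T e (take i \<omega>s @ dual_basis (gtb S e) b k # drop i \<omega>s) (take j ws @ b k # drop j ws))"
    by (rule contraction_basis[OF e]) blast
  let ?d = "dual_basis (gtb S e) b"
  let ?P = "\<lambda>\<omega> \<omega>s. take i \<omega>s @ \<omega> # drop i \<omega>s" and ?R = "\<lambda>w ws. take j ws @ w # drop j ws"
  have len: "length \<omega>s = k" "length ws = l" using a by (auto simp: tensor_args_iff)
  have ins: "(?P \<omega> \<omega>s, ?R w ws) \<in> tensor_args S (Suc k) (Suc l) e" if "\<omega> \<in> covectors S e" "w \<in> gtb S e" for \<omega> w
    using a that by (auto simp: tensor_args_iff dest: in_set_takeD in_set_dropD)
  note dc = dual_basis_covector[OF b] and bi = basis_of_in[OF b]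
  have act_ins: "act (A e) T e (?P (?d n) \<omega>s) (?R (b n) ws)
      = T e (?P (\<lambda>w. ?d n (A e w)) \<omega>s) (?R (b n) ws) - T e (?P (?d n) \<omega>s) (?R (A e (b n)) ws)
        + ((\<Sum>m<k. T e (?P (?d n) (\<omega>s[m := (\<lambda>w. (\<omega>s ! m) (A e w))])) (?R (b n) ws))
          - (\<Sum>m<l. T e (?P (?d n) \<omega>s) (?R (b n) (ws[m := A e (ws ! m)]))))" for n
    unfolding act_valid[OF e ins[OF dc bi]]
    using sum_insert_position[of i \<omega>s "\<lambda>\<omega>s. T e \<omega>s (?R (b n) ws)" "?d n" "\<lambda>\<omega> w. \<omega> (A e w)"]
      sum_insert_position[of j ws "\<lambda>ws. T e (?P (?d n) \<omega>s) ws" "b n" "A e"] ij len by simp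
  have trace: "(\<Sum>n\<in>UNIV. T e (?P (\<lambda>w. ?d n (A e w)) \<omega>s) (?R (b n) ws)) = (\<Sum>n\<in>UNIV. T e (?P (?d n) \<omega>s) (?R (A e (b n)) ws))"
  proof -
    have P: "?P \<omega> \<omega>s = (?P \<omega>' \<omega>s)[i := \<omega>]" for \<omega> \<omega>' using ij len by (simp add: list_update_append)
    have R: "?R w ws = (?R w' ws)[j := w]" for w w' using ij len by (simp add: list_update_append)
    have "T e (?P (\<lambda>w. ?d n (A e w)) \<omega>s) (?R (b n) ws) = (\<Sum>m\<in>UNIV. ?d n (A e (b m)) *\<^sub>R T e (?P (?d m) \<omega>s) (?R (b n) ws))" for n
    proof -
      have "lin_on (covectors S e) (\<lambda>\<omega>. T e ((?P (?d n) \<omega>s)[i := \<omega>]) (?R (b n) ws))"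
        by (rule tf_lin_cov[OF T e ins[OF dc bi]]) (use ij in simp)
      then have "lin_on (covectors S e) (\<lambda>\<omega>. T e (?P \<omega> \<omega>s) (?R (b n) ws))" by (simp only: P[symmetric])
      from lin_on_sum[OF this covectors_subspace finite dc, of "\<lambda>m. ?d n (A e (b m))"]
      show ?thesis using covector_expand[OF b transpose_covector[OF e A' dc[of n]]] by simp
    qed
    then have "(\<Sum>n\<in>UNIV. T e (?P (\<lambda>w. ?d n (A e w)) \<omega>s) (?R (b n) ws))
        = (\<Sum>n\<in>UNIV. \<Sum>m\<in>UNIV. ?d n (A e (b m)) *\<^sub>R T e (?P (?d m) \<omega>s) (?R (b n) ws))" by simp
    also have "\<dots> = (\<Sum>m\<in>UNIV. \<Sum>n\<in>UNIV. ?d n (A e (b m)) *\<^sub>R T e (?P (?d m) \<omega>s) (?R (b n) ws))" by (rule sum.swap)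
    also have "\<dots> = (\<Sum>m\<in>UNIV. T e (?P (?d m) \<omega>s) (?R (A e (b m)) ws))"
    proof (intro sum.cong refl)
      fix m
      have "lin_on (gtb S e) (\<lambda>w. T e (?P (?d m) \<omega>s) ((?R (b m) ws)[j := w]))"
        by (rule tf_lin_vec[OF T e ins[OF dc bi]]) (use ij in simp)
      then have "lin_on (gtb S e) (\<lambda>w. T e (?P (?d m) \<omega>s) (?R w ws))" by (simp only: R[symmetric])
      from lin_on_sum[OF this gtb_subspace[OF e] finite bi, of "\<lambda>n. ?d n (A e (b m))"]
      have "T e (?P (?d m) \<omega>s) (?R (\<Sum>n\<in>UNIV. ?d n (A e (b m)) *\<^sub>R b n) ws) = (\<Sum>n\<in>UNIV. ?d n (A e (b m)) *\<^sub>R T e (?P (?d m) \<omega>s) (?R (b n) ws))" .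
      moreover have "(\<Sum>n\<in>UNIV. ?d n (A e (b m)) *\<^sub>R b n) = A e (b m)"
        using basis_of_expand[OF b endo_in[OF A' bi[of m]]] endo_in[OF A' bi[of m]] by (simp add: dual_basis_def)
      ultimately show "(\<Sum>n\<in>UNIV. ?d n (A e (b m)) *\<^sub>R T e (?P (?d m) \<omega>s) (?R (b n) ws)) = T e (?P (?d m) \<omega>s) (?R (A e (b m)) ws)" by simp
    qed
    finally show ?thesis .
  qed
  have "contraction S i j (\<lambda>e. act (A e) T e) e \<omega>s ws
      = (\<Sum>n\<in>UNIV. (\<Sum>m<k. T e (?P (?d n) (\<omega>s[m := (\<lambda>w. (\<omega>s ! m) (A e w))])) (?R (b n) ws))
          - (\<Sum>m<l. T e (?P (?d n) \<omega>s) (?R (b n) (ws[m := A e (ws ! m)]))))"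
    unfolding contr act_ins by (simp add: sum.distrib sum_subtractf trace)
  also have "\<dots> = act (A e) (contraction S i j T) e \<omega>s ws"
    unfolding act_valid[OF e a] contr sum_subtractf
    by (subst (1 2) sum.swap) simp
  finally show ?thesis by simp
next
  case False
  have 1: "contraction S i j (\<lambda>e. act (A e) T e) e \<omega>s ws = 0"
    by (rule contraction_zero[OF act_zero[OF tf_zero[OF T]] False])
  have 2: "act (A e) (contraction S i j T) e \<omega>s ws = 0"
    by (rule act_zero[OF contraction_zero[OF tf_zero[OF T]] False])
  show ?thesis using 1 2 by simp
qed

end

section \<open>The metrical connection\<close>

context metr
begin

definition Dm :: "('m, 'f, 'b) cov_deriv" where
  "Dm X T = D0 X T + (\<lambda>e. act (Phi e (X e)) T e)"

lemma Phi_endo: assumes "X \<in> gsections S" "e \<in> totalE S" shows "endo e (Phi e (X e))"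
  unfolding endo_def using Phi_lin(2)[OF assms(2) gsec_in[OF assms]] Phi_in[OF assms(2) gsec_in[OF assms]] Phi_off by blast

lemma Phi_matrix_smooth:
  assumes X: "X \<in> gsections S" and K: "local_coords S K"
  shows "smoothE S (nbhd K) (\<lambda>e. coef (nat_frame S K e) (Phi e (X e) (nat_frame S K e j)) i)"
proof (rule E.smooth_total_locally)
  fix x assume x: "x \<in> nbhd K"
  obtain b V where b: "bump_at (atlasM S) (nbhd K) x b" "open V" "x \<in> V" "V \<subseteq> nbhd K" "\<And>y. y \<in> V \<Longrightarrow> b y = 1"
    using coords_bump[OF K x] by metis
  have "smoothE S V (\<lambda>e. coef (nat_frame S K e) (Phi e (X e) (nat_frame S K e j)) i)"
    by (rule E.smooth_total_cong[OF b(2) _ E.smooth_total_subset[OF gsec_coef[OF Phi_section[OF X bumpE_section[OF K b(1), of j]] K, of i] b(4)]])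
      (simp add: bumpE_def b(5))
  then show "\<exists>V. open V \<and> x \<in> V \<and> smoothE S V (\<lambda>e. coef (nat_frame S K e) (Phi e (X e) (nat_frame S K e j)) i)"
    using b by blast
qed

lemma act_Phi_field: "X \<in> gsections S \<Longrightarrow> tensor_field S k l T \<Longrightarrow> tensor_field S k l (\<lambda>e. act (Phi e (X e)) T e)"
  by (rule act_field[OF _ Phi_endo Phi_matrix_smooth])

lemma Dm_field: "X \<in> gsections S \<Longrightarrow> tensor_field S k l T \<Longrightarrow> tensor_field S k l (Dm X T)"
  unfolding Dm_def by (intro tf_add cd_field act_Phi_field)

lemma act_off: "e \<notin> totalE S \<Longrightarrow> act A T e \<omega>s ws = 0"
  by (simp add: act_def)

lemma act_Phi_combination:
  assumes X: "X \<in> gsections S" and Y: "Y \<in> gsections S" and T: "tensor_field S k l T" and Z: "Z \<in> gsections S" "Z e = X e + c *\<^sub>R Y e"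
  shows "act (Phi e (Z e)) T e \<omega>s ws = act (Phi e (X e)) T e \<omega>s ws + c * act (Phi e (Y e)) T e \<omega>s ws"
proof (cases "e \<in> totalE S")
  case True
  show ?thesis
    by (rule act_combination[OF T True Phi_endo[OF X True] Phi_endo[OF Y True] _ Phi_endo[OF Z(1) True]])
      (simp add: Z(2) lin_on_combination[OF Phi_lin(1)[OF True] gtb_subspace[OF True] gsec_in[OF X True] gsec_in[OF Y True]])
qed (simp add: act_off)

lemma Dm_covariant: "covariant_derivative S Dm"
  unfolding covariant_derivative_def
proof (intro conjI ballI allI impI; (elim conjE)?)
  show "tensor_field S k l (Dm X T)" if "X \<in> gsections S" "tensor_field S k l T" for X k l T
    using that by (rule Dm_field)
next
  fix X Y k l T assume X: "X \<in> gsections S" and Y: "Y \<in> gsections S" and T: "tensor_field S k l T"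
  have XY: "X + Y \<in> gsections S" using gsec_add[OF X Y] by (simp add: plus_fun_def)
  have "D0 (X + Y) T = D0 X T + D0 Y T" using cd_add_left[OF X Y T] by (simp add: plus_fun_def)
  then show "Dm (X + Y) T = Dm X T + Dm Y T"
    using act_Phi_combination[OF X Y T XY, where c=1] by (simp add: Dm_def fun_eq_iff)
next
  fix X f k l T assume X: "X \<in> gsections S" and f: "smoothE S UNIV f" and T: "tensor_field S k l T"
  \<comment> \<open>\<open>f X\<close> is at each point the combination of the zero section and \<open>X\<close> with the constant \<open>f e\<close>\<close>
  have z: "act (Phi e 0) T e \<omega>s ws = 0" for e \<omega>s ws
  proof -
    have "act (Phi e 0) T e \<omega>s ws = act (Phi e 0) T e \<omega>s ws + 1 * act (Phi e 0) T e \<omega>s ws"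
      using act_Phi_combination[OF gsec_zero gsec_zero T gsec_zero, where e=e and c=1 and \<omega>s=\<omega>s and ws=ws] by simp
    then show ?thesis by simp
  qed
  have "act (Phi e (f e *\<^sub>R X e)) T e \<omega>s ws = f e * act (Phi e (X e)) T e \<omega>s ws" for e \<omega>s ws
    using act_Phi_combination[OF gsec_zero X T gsec_scale[OF f X], where e=e and c="f e" and \<omega>s=\<omega>s and ws=ws] z by simp
  then show "Dm (\<lambda>e. f e *\<^sub>R X e) T = (\<lambda>e \<omega>s ws. f e * Dm X T e \<omega>s ws)"
    by (simp add: Dm_def fun_eq_iff cd_scale_left[OF X f T] algebra_simps)
next
  fix X k l T T' assume X: "X \<in> gsections S" and T: "tensor_field S k l T" "tensor_field S k l T'"
  show "Dm X (T + T') = Dm X T + Dm X T'"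
    using cd_add[OF X T] by (simp add: Dm_def fun_eq_iff act_add)
next
  fix X f assume X: "X \<in> gsections S" and f: "smoothE S UNIV f"
  show "Dm X (scalar_tensor S f) = scalar_tensor S (\<lambda>e. snd (X e) f)"
    using cd_scalar[OF X f] by (simp add: Dm_def fun_eq_iff act_scalar)
next
  fix X k l k' l' T T' assume X: "X \<in> gsections S" and T: "tensor_field S k l T" and T': "tensor_field S k' l' T'"
  have f1: "tensor_field S (k + k') (l + l') (Dm X (tensor_prod k l T T'))" by (intro Dm_field X tensor_prod_field T T')
  have f2: "tensor_field S (k + k') (l + l') (tensor_prod k l (Dm X T) T' + tensor_prod k l T (Dm X T'))"
    by (intro tf_add tensor_prod_field Dm_field X T T')
  show "Dm X (tensor_prod k l T T') = tensor_prod k l (Dm X T) T' + tensor_prod k l T (Dm X T')"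
  proof (intro ext)
    fix e \<omega>s ws
    show "Dm X (tensor_prod k l T T') e \<omega>s ws = (tensor_prod k l (Dm X T) T' + tensor_prod k l T (Dm X T')) e \<omega>s ws"
    proof (cases "e \<in> totalE S \<and> (\<omega>s, ws) \<in> tensor_args S (k + k') (l + l') e")
      case True
      then show ?thesis using act_prod[OF T T', of e \<omega>s ws] cd_prod[OF X T T']
        by (simp add: Dm_def tensor_prod_def algebra_simps)
    next
      case False
      show ?thesis using tf_zero[OF f1 False] tf_zero[OF f2 False] by simp
    qed
  qed
next
  fix X k l T i j assume X: "X \<in> gsections S" and T: "tensor_field S (Suc k) (Suc l) T" and ij: "i \<le> k" "j \<le> l"
  show "Dm X (contraction S i j T) = contraction S i j (Dm X T)"
    using cd_contraction[OF X T ij] act_contraction[OF T Phi_endo[OF X] ij]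
    by (simp add: Dm_def fun_eq_iff contraction_add)
qed

text \<open>On vector fields the derivation is the endomorphism itself.\<close>

lemma Dm_vector:
  assumes X: "X \<in> gsections S" and Y: "Y \<in> gsections S"
  shows "Dm X (vector_tensor S Y) = vector_tensor S (\<lambda>e. nab X Y e + Phi e (X e) (Y e))"
proof (rule vt_eqI[OF Dm_field[OF X vector_tensor_field[OF Y]]])
  fix e \<omega> assume e: "e \<in> totalE S" and \<omega>: "\<omega> \<in> covectors S e"
  have a: "([\<omega>], []) \<in> tensor_args S 1 0 e" using \<omega> by (simp add: tensor_args_iff)
  have "act (Phi e (X e)) (vector_tensor S Y) e [\<omega>] [] = \<omega> (Phi e (X e) (Y e))"
    unfolding act_valid[OF e a] using vt_apply[OF e transpose_covector[OF e Phi_endo[OF X e] \<omega>], of Y] by simp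
  then show "Dm X (vector_tensor S Y) e [\<omega>] [] = \<omega> (nab X Y e + Phi e (X e) (Y e))"
    using nab_apply[OF X Y e \<omega>] covector_add[OF e \<omega> gsec_in[OF nab_in[OF X Y] e] Phi_in[OF e gsec_in[OF X e] gsec_in[OF Y e]]]
    by (simp add: Dm_def)
qed

lemma Dm_section: "X \<in> gsections S \<Longrightarrow> Y \<in> gsections S \<Longrightarrow> (\<lambda>e. nab X Y e + Phi e (X e) (Y e)) \<in> gsections S"
  by (intro gsec_add nab_in Phi_section)

lemma Dm_distinguished: "distinguished_connection S C Dm"
  unfolding distinguished_connection_def
proof (intro conjI Dm_covariant)
  show "preserves S Dm (horizontal S C)" unfolding preserves_def
  proof (intro ballI impI)
    fix X Y assume X: "X \<in> gsections S" and Y: "Y \<in> gsections S" and h: "\<forall>e\<in>totalE S. Y e \<in> horizontal S C e"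
    have "nab X Y e + Phi e (X e) (Y e) \<in> horizontal S C e" if e: "e \<in> totalE S" for e
      by (intro subspace_add horizontal_subspace[OF e] nab_horizontal[OF X Y _ e] Phi_horizontal[OF e gsec_in[OF X e]] bspec[OF h] e)
    then show "\<exists>Z\<in>gsections S. (\<forall>e\<in>totalE S. Z e \<in> horizontal S C e) \<and> Dm X (vector_tensor S Y) = vector_tensor S Z"
      using Dm_vector[OF X Y] Dm_section[OF X Y] by (intro bexI[of _ "\<lambda>e. nab X Y e + Phi e (X e) (Y e)"] conjI ballI)
  qed
  show "preserves S Dm (vertical S)" unfolding preserves_def
  proof (intro ballI impI)
    fix X Y assume X: "X \<in> gsections S" and Y: "Y \<in> gsections S" and v: "\<forall>e\<in>totalE S. Y e \<in> vertical S e"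
    have "nab X Y e + Phi e (X e) (Y e) \<in> vertical S e" if e: "e \<in> totalE S" for e
      by (intro subspace_add vertical_subspace[OF e] nab_vertical[OF X Y _ e] Phi_vertical[OF e gsec_in[OF X e]] bspec[OF v] e)
    then show "\<exists>Z\<in>gsections S. (\<forall>e\<in>totalE S. Z e \<in> vertical S e) \<and> Dm X (vector_tensor S Y) = vector_tensor S Z"
      using Dm_vector[OF X Y] Dm_section[OF X Y] by (intro bexI[of _ "\<lambda>e. nab X Y e + Phi e (X e) (Y e)"] conjI ballI)
  qed
qed

lemma Dm_metrical: assumes X: "X \<in> gsections S" shows "Dm X G = 0"
proof (intro ext)
  fix e \<omega>s ws
  show "Dm X G e \<omega>s ws = 0 e \<omega>s ws"
  proof (cases "e \<in> totalE S \<and> (\<omega>s, ws) \<in> tensor_args S 0 2 e")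
    case True
    then have e: "e \<in> totalE S" and a: "(\<omega>s, ws) \<in> tensor_args S 0 2 e" by auto
    obtain y z where yz: "\<omega>s = []" "ws = [y, z]" "y \<in> gtb S e" "z \<in> gtb S e"
      using a by (auto simp: tensor_args_iff numeral_2_eq_2 length_Suc_conv)
    have "Dm X G e [] [y, z] = Q e (X e) y z - (g e (Phi e (X e) y) z + g e y (Phi e (X e) z))"
      using Q_descends(1)[OF e X, of y z] act_valid[OF e a, of "Phi e (X e)" G] yz by (simp add: Dm_def numeral_2_eq_2)
    then show ?thesis using Phi_metrical[OF e gsec_in[OF X e] yz(3,4)] yz by simp
  next
    case False
    then show ?thesis using tf_zero[OF Dm_field[OF X G_field] False] by simp
  qed
qed

end

section \<open>The components of the metrical connection\<close>

context gla
begin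

text \<open>As for covariant derivatives: a section vanishing near the point is its own product with a function
  that vanishes at the point, and the Leibniz rule leaves nothing.\<close>

lemma bracket_local_left:
  assumes u: "u \<in> sectionsF S" "u' \<in> sectionsF S" and v: "v \<in> sectionsF S"
    and V: "open V" "q \<in> V" "\<And>y. y \<in> V \<Longrightarrow> u y = u' y"
  shows "bracket S u v q = bracket S u' v q"
proof -
  obtain b where b: "bump_at (atlasN S) V q b" by (rule F.ex_bump[OF V(1,2)])
  define f where "f y = 1 + (-1) * b y" for y
  have f: "smooth_fun (atlasN S) UNIV f" unfolding f_def
    by (intro F.smooth_fun_add F.smooth_fun_mult F.smooth_fun_const bump_at_smooth[OF b] open_UNIV)
  define w where "w y = u y + (-1) *\<^sub>R u' y" for y
  have w: "w \<in> sectionsF S" unfolding w_def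
    by (intro sectionsF_add sectionsF_scale[OF F.smooth_fun_const[OF open_UNIV]] u)
  have fw: "(\<lambda>y. f y *\<^sub>R w y) = w"
  proof
    fix y show "f y *\<^sub>R w y = w y"
      using bump_at_eq_0[OF b, of y] V(3)[of y] by (cases "y \<in> V") (auto simp: f_def w_def)
  qed
  have "bracket S w v q = f q *\<^sub>R bracket S w v q - anchorN S v f q *\<^sub>R w q"
    using bracket_scale_left[OF w v f, of q] unfolding fw .
  then have "bracket S w v q = 0" using bump_at_eq_1[OF b] V by (simp add: f_def w_def)
  moreover have "(\<lambda>y. w y + u' y) = u" by (auto simp: w_def)
  ultimately show ?thesis using bracket_add(2)[OF v w u(2), of q] by simp
qed

lemma bracket_local:
  assumes u: "u \<in> sectionsF S" "u' \<in> sectionsF S" and v: "v \<in> sectionsF S" "v' \<in> sectionsF S"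
    and V: "open V" "q \<in> V" "\<And>y. y \<in> V \<Longrightarrow> u y = u' y" "\<And>y. y \<in> V \<Longrightarrow> v y = v' y"
  shows "bracket S u v q = bracket S u' v' q"
  using bracket_local_left[OF u v(1) V(1-3)] bracket_local_left[OF v u(2) V(1,2,4)]
    bracket_antisym[OF u(2) v(1), of q] bracket_antisym[OF u(2) v(2), of q] by simp

text \<open>The definite description behind \<open>struct_fun\<close> has exactly one solution: any two
  admissible pairs of extensions have the same bracket at the point, and cut-off frames provide such a
  pair.\<close>

lemma struct_fun_bracket:
  assumes K: "local_coords S K" and b: "bump_at (atlasM S) (nbhd K) x b" and x: "x \<in> nbhd K"
  shows "bracket S (bumpF K b \<alpha>) (bumpF K b \<beta>) (hmap S x) = (\<Sum>\<theta>\<in>UNIV. struct_fun S K \<theta> \<alpha> \<beta> x *\<^sub>R tframe K \<theta> (hmap S x))"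
proof -
  let ?B = "bracket S (bumpF K b \<alpha>) (bumpF K b \<beta>) (hmap S x)" and ?t = "\<lambda>\<theta>. tframe K \<theta> (hmap S x)"
  note bF = basisF[OF K x] and s = bumpF_section[OF K b]
  obtain V where V: "open V" "x \<in> V" "V \<subseteq> nbhd K" "\<And>y. y \<in> V \<Longrightarrow> b y = 1" by (rule bump_at_plateau[OF b]) blast
  have hV: "open (hmap S ` V)" "hmap S x \<in> hmap S ` V" "\<And>q \<alpha>. q \<in> hmap S ` V \<Longrightarrow> bumpF K b \<alpha> q = tframe K \<alpha> q"
    using continuous_h(2)[OF V(1)] V by (auto simp: bumpF_eq)
  define P where "P c \<longleftrightarrow> (\<forall>u\<in>sectionsF S. \<forall>v\<in>sectionsF S. \<forall>V.
     open V \<and> hmap S x \<in> V \<and> (\<forall>q\<in>V. u q = tframe K \<alpha> q \<and> v q = tframe K \<beta> q) \<longrightarrow>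
     bracket S u v (hmap S x) = (\<Sum>\<theta>\<in>UNIV. (c $ \<theta>) *\<^sub>R tframe K \<theta> (hmap S x)))" for c :: "real ^ 'p"
  let ?c = "\<chi> \<theta>. coef ?t ?B \<theta>"
  have Bc: "?B = (\<Sum>\<theta>\<in>UNIV. (?c $ \<theta>) *\<^sub>R ?t \<theta>)"
    using basis_of_expand[OF bF sectionsF_in[OF bracket_in[OF s s]]] by simp
  have "P ?c" unfolding P_def
  proof (intro ballI allI impI, elim conjE)
    fix u v W assume u: "u \<in> sectionsF S" and v: "v \<in> sectionsF S" and W: "open W" "hmap S x \<in> W"
      "\<forall>q\<in>W. u q = tframe K \<alpha> q \<and> v q = tframe K \<beta> q"
    have "bracket S u v (hmap S x) = ?B"
      by (rule bracket_local[OF u s v s, of "W \<inter> hmap S ` V"]) (use W hV in auto)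
    then show "bracket S u v (hmap S x) = (\<Sum>\<theta>\<in>UNIV. (?c $ \<theta>) *\<^sub>R ?t \<theta>)" using Bc by simp
  qed
  moreover have "c = ?c" if "P c" for c
  proof -
    have "?B = (\<Sum>\<theta>\<in>UNIV. (c $ \<theta>) *\<^sub>R ?t \<theta>)"
      using that[unfolded P_def, rule_format, OF s s, of "hmap S ` V" \<alpha> \<beta>] hV by auto
    then show ?thesis using coef_sum[OF bF, of "\<lambda>\<theta>. c $ \<theta>"] by (simp add: vec_eq_iff)
  qed
  ultimately have "(THE c. P c) = ?c" by (rule the_equality)
  then have "struct_fun S K \<theta> \<alpha> \<beta> x = ?c $ \<theta>" for \<theta> by (simp add: struct_fun_def P_def)
  then show ?thesis using Bc by simp
qed

end

lemma (in gcon) snd_adapted: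
  assumes K: "local_coords S K" and e: "e \<in> totalE S" "fst e \<in> nbhd K" and f: "smoothE S UNIV f"
    and V: "open V" "fst e \<in> V" "\<And>e'. e' \<in> totalE S \<Longrightarrow> fst e' \<in> V \<Longrightarrow> f e' = f' e'"
  shows "snd (adapted_frame S C K e k) f = adapted_deriv S C K k f' e"
proof -
  have pd: "partial_deriv K w f e = partial_deriv K w f' e" for w
    unfolding partial_deriv_eq
    by (rule E.bundle_deriv_cong[OF local_coords_bundle_chart[OF K] V(1,2) e(2) V(3)])
  show ?thesis
    using f by (cases k) (simp_all add: adapted_frame.simps nat_frame.simps pd snd_sum sum_apply scaleR_fun_def)
qed

text \<open>The inverse metric in the component formulas disappears when the vector is paired with the frame.\<close>

lemma pair_raised:
  fixes A :: "real ^ 'k::finite ^ 'k"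
  assumes "invertible A" "\<And>i j. A $ i $ j = A $ j $ i"
  shows "(\<Sum>i\<in>UNIV. (\<Sum>j\<in>UNIV. matrix_inv A $ i $ j * k j) * A $ i $ l) = k l"
proof -
  have "A ** matrix_inv A = mat 1 \<and> matrix_inv A ** A = mat 1"
    unfolding matrix_inv_def by (rule someI_ex) (use assms(1) in \<open>simp add: invertible_def\<close>)
  then have "A *v (matrix_inv A *v (\<chi> j. k j)) = (\<chi> j. k j)"
    by (simp add: matrix_vector_mul_assoc)
  then have "(A *v (matrix_inv A *v (\<chi> j. k j))) $ l = k l" by simp
  moreover have "(A *v (matrix_inv A *v (\<chi> j. k j))) $ l = (\<Sum>i\<in>UNIV. A $ l $ i * (\<Sum>j\<in>UNIV. matrix_inv A $ i $ j * k j))"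
    by (simp add: matrix_vector_mult_def)
  ultimately show ?thesis using assms(2)[of l] by (simp add: mult.commute)
qed

context metr
begin

lemma nab_local_frames:
  assumes K: "local_coords S K" and b: "bump_at (atlasM S) (nbhd K) (fst e) b" and e: "e \<in> totalE S" "fst e \<in> nbhd K"
    and X: "X \<in> gsections S" and Y: "Y \<in> gsections S" and V: "open V" "fst e \<in> V"
      "\<forall>e'\<in>totalE S. fst e' \<in> V \<longrightarrow> X e' = adapted_frame S C K e' i \<and> Y e' = adapted_frame S C K e' j"
  shows "nab X Y e = nab (frame_section K b i) (frame_section K b j) e"
proof -
  note Fs = frame_section_in[OF K b]
  obtain W where W: "open W" "fst e \<in> W" "W \<subseteq> nbhd K" "\<And>y. y \<in> W \<Longrightarrow> b y = 1" by (rule bump_at_plateau[OF b]) blast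
  have F: "frame_section K b k e' = adapted_frame S C K e' k" if "e' \<in> totalE S" "fst e' \<in> W" for k e'
    using frame_section_eq[OF K b that(1)] W that(2) by blast
  have "nab X Y e = nab (frame_section K b i) Y e"
    by (rule nab_cong_point[OF X Fs Y]) (use V(2,3) e(1) F[OF e(1) W(2)] in simp)
  also have "\<dots> = nab (frame_section K b i) (frame_section K b j) e"
  proof (rule nab_local[OF Fs Y Fs _ _ _ e(1)])
    show "open (V \<inter> W)" "fst e \<in> V \<inter> W" using V W by auto
    show "Y e' = frame_section K b j e'" if "e' \<in> totalE S" "fst e' \<in> V \<inter> W" for e'
      using V(3) F[OF that(1)] that by simp
  qed
  finally show ?thesis .
qed

text \<open>The relation \<open>local_cov\<close> speaks of all global extensions of the frame, in particular of
  the lifted cut-off frames.\<close>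

lemma local_cov_given:
  assumes K: "local_coords S K" and b: "bump_at (atlasM S) (nbhd K) (fst e) b" and e: "e \<in> totalE S" "fst e \<in> nbhd K"
    and w: "w \<in> gtb S e" and lc: "local_cov S D0 (\<lambda>e. adapted_frame S C K e i) (\<lambda>e. adapted_frame S C K e j) e w"
  shows "nab (frame_section K b i) (frame_section K b j) e = w"
proof -
  note Fs = frame_section_in[OF K b]
  obtain W where W: "open W" "fst e \<in> W" "W \<subseteq> nbhd K" "\<And>y. y \<in> W \<Longrightarrow> b y = 1" by (rule bump_at_plateau[OF b]) blast
  have F: "frame_section K b k e' = adapted_frame S C K e' k" if "e' \<in> totalE S" "fst e' \<in> W" for k e'
    using frame_section_eq[OF K b that(1)] W that(2) by blast
  have "\<forall>e'\<in>totalE S. fst e' \<in> W \<longrightarrow> frame_section K b i e' = adapted_frame S C K e' i \<and> frame_section K b j e' = adapted_frame S C K e' j"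
    using F by blast
  then have "\<forall>\<omega>\<in>covectors S e. D0 (frame_section K b i) (vector_tensor S (frame_section K b j)) e [\<omega>] [] = \<omega> w"
    using bspec[OF bspec[OF lc[unfolded local_cov_def] Fs] Fs] W(1,2) by blast
  then show ?thesis
    using covectors_separate[OF e(1) gsec_in[OF nab_in[OF Fs Fs] e(1)] w] nab_apply[OF Fs Fs e(1)] by simp
qed

lemma local_cov_metrical:
  assumes K: "local_coords S K" and b: "bump_at (atlasM S) (nbhd K) (fst e) b" and e: "e \<in> totalE S" "fst e \<in> nbhd K"
    and w: "nab (frame_section K b i) (frame_section K b j) e + Phi e (adapted_frame S C K e i) (adapted_frame S C K e j) = w"
  shows "local_cov S Dm (\<lambda>e. adapted_frame S C K e i) (\<lambda>e. adapted_frame S C K e j) e w"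
  unfolding local_cov_def
proof (intro ballI allI impI, elim conjE)
  fix X Y V \<omega> assume X: "X \<in> gsections S" and Y: "Y \<in> gsections S" and \<omega>: "\<omega> \<in> covectors S e"
    and V: "open V" "fst e \<in> V" "\<forall>e'\<in>totalE S. fst e' \<in> V \<longrightarrow> X e' = adapted_frame S C K e' i \<and> Y e' = adapted_frame S C K e' j"
  have "nab X Y e + Phi e (X e) (Y e) = w"
    using nab_local_frames[OF K b e X Y V] w V(2,3) e(1) by simp
  then show "Dm X (vector_tensor S Y) e [\<omega>] [] = \<omega> w"
    unfolding Dm_vector[OF X Y] by (simp add: vt_apply[OF e(1) \<omega>])
qed

context
  fixes K :: "('m, 'n, 'f, 'b, 'i, 'p, 'r) coords" and e :: "'m \<times> 'b" and b :: "'m \<Rightarrow> real"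
  assumes K: "local_coords S K" and e: "e \<in> totalE S" "fst e \<in> nbhd K" and b: "bump_at (atlasM S) (nbhd K) (fst e) b"
begin

abbreviation (input) "Fr \<equiv> adapted_frame S C K e"
abbreviation (input) "Nab i j \<equiv> nab (frame_section K b i) (frame_section K b j) e"

lemma frame_at: "frame_section K b k e = Fr k"
  by (rule frame_section_eq[OF K b e bump_at_eq_1[OF b]])

lemma Fr_in: "Fr k \<in> gtb S e"
  by (rule adapted_in[OF K e])

lemma Nab_in: "Nab i j \<in> gtb S e"
  by (rule gsec_in[OF nab_in[OF frame_section_in[OF K b] frame_section_in[OF K b]] e(1)])

lemma Q_frame:
  assumes f: "\<And>e'. e' \<in> totalE S \<Longrightarrow> fst e' \<in> nbhd K \<Longrightarrow> f e' = g e' (adapted_frame S C K e' j) (adapted_frame S C K e' k)"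
  shows "Q e (Fr i) (Fr j) (Fr k) = adapted_deriv S C K i f e - g e (Nab i j) (Fr k) - g e (Nab i k) (Fr j)"
proof -
  note Fs = frame_section_in[OF K b]
  obtain W where W: "open W" "fst e \<in> W" "W \<subseteq> nbhd K" "\<And>y. y \<in> W \<Longrightarrow> b y = 1" by (rule bump_at_plateau[OF b]) blast
  have "snd (Fr i) (\<lambda>e. g e (frame_section K b j e) (frame_section K b k e)) = adapted_deriv S C K i f e"
  proof (rule snd_adapted[OF K e g_smooth[OF Fs Fs] W(1,2)])
    fix e' assume e': "e' \<in> totalE S" "fst e' \<in> W"
    then show "g e' (frame_section K b j e') (frame_section K b k e') = f e'"
      using f[OF e'(1)] frame_section_eq[OF K b e'(1)] W by auto
  qed
  then show ?thesis
    using Q_sections[OF e(1) Fs Fs Fs, of i j k] g_sym[OF e(1) Fr_in Nab_in] by (simp add: frame_at)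
qed

lemma frame_horizontal: "Fr (Inl \<alpha>) \<in> horizontal S C e" and frame_vertical: "Fr (Inr a) \<in> vertical S e"
  by (rule adapted_Inl_horizontal(1)[OF K e], rule adapted_Inr_vertical[OF K e])

lemma hproj_frame: "hproj e (Fr (Inl \<alpha>)) = Fr (Inl \<alpha>)" "C e (Fr (Inl \<alpha>)) = 0"
  "hproj e (Fr (Inr a)) = 0" "C e (Fr (Inr a)) = Fr (Inr a)"
  using hproj_id[OF frame_horizontal] C_horizontal[OF frame_horizontal] hproj_vertical[OF e(1) frame_vertical] C_id[OF e(1) frame_vertical]
  by auto

lemma diff_form_frame:
  "diff_form e (Fr (Inl \<alpha>)) (Fr (Inl \<beta>)) (Fr (Inl \<gamma>)) = koszul e (Fr (Inl \<alpha>)) (Fr (Inl \<beta>)) (Fr (Inl \<gamma>))"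
  "diff_form e (Fr (Inr a)) (Fr (Inr c)) (Fr (Inr d)) = koszul e (Fr (Inr a)) (Fr (Inr c)) (Fr (Inr d))"
  "diff_form e (Fr (Inl \<alpha>)) (Fr (Inr c)) (Fr (Inr d)) = Q e (Fr (Inl \<alpha>)) (Fr (Inr c)) (Fr (Inr d))"
  "diff_form e (Fr (Inr a)) (Fr (Inl \<beta>)) (Fr (Inl \<gamma>)) = Q e (Fr (Inr a)) (Fr (Inl \<beta>)) (Fr (Inl \<gamma>))"
  using koszul_zero[OF e(1)] Q_zero[OF e(1)] Fr_in subspace_0[OF gtb_subspace[OF e(1)]]
  by (simp_all add: diff_form_def hproj_frame)

lemma Nab_horizontal: "Nab i (Inl \<beta>) \<in> horizontal S C e"
  using nab_horizontal[OF frame_section_in[OF K b] frame_section_in[OF K b] _ e(1), of "Inl \<beta>" i]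
    hlift_horizontal(1)[OF bumpF_section[OF K b]] by (simp add: frame_section_def)

lemma Nab_vertical: "Nab i (Inr c) \<in> vertical S e"
  using nab_vertical[OF frame_section_in[OF K b] frame_section_in[OF K b] _ e(1), of "Inr c" i]
    vlift_vertical[OF bumpS_section[OF K b]] by (simp add: frame_section_def)

lemma tor_frame:
  "tor e (Fr (Inl \<alpha>)) (Fr (Inl \<beta>)) = Nab (Inl \<alpha>) (Inl \<beta>) - Nab (Inl \<beta>) (Inl \<alpha>) - (\<Sum>\<theta>\<in>UNIV. struct_fun S K \<theta> \<alpha> \<beta> (fst e) *\<^sub>R Fr (Inl \<theta>))"
  "tor e (Fr (Inr a)) (Fr (Inr c)) = Nab (Inr a) (Inr c) - Nab (Inr c) (Inr a)"
proof -
  note u = bumpF_section[OF K b] and s = bumpS_section[OF K b]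
  have "hlift (bracket S (bumpF K b \<alpha>) (bumpF K b \<beta>)) e = (\<Sum>\<theta>\<in>UNIV. struct_fun S K \<theta> \<alpha> \<beta> (fst e) *\<^sub>R Fr (Inl \<theta>))"
    using hlift_expand[OF bracket_in[OF u u] K e, of \<alpha> \<beta>] struct_fun_bracket[OF K b e(2), of \<alpha> \<beta>]
      coef_sum[OF basisF[OF K e(2)]] by simp
  then show "tor e (Fr (Inl \<alpha>)) (Fr (Inl \<beta>)) = Nab (Inl \<alpha>) (Inl \<beta>) - Nab (Inl \<beta>) (Inl \<alpha>) - (\<Sum>\<theta>\<in>UNIV. struct_fun S K \<theta> \<alpha> \<beta> (fst e) *\<^sub>R Fr (Inl \<theta>))"
    using tor_hlift[OF u u e(1), of \<alpha> \<beta>] frame_at[of "Inl \<alpha>"] frame_at[of "Inl \<beta>"] by (simp add: torH_def frame_section_def)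
  show "tor e (Fr (Inr a)) (Fr (Inr c)) = Nab (Inr a) (Inr c) - Nab (Inr c) (Inr a)"
    using tor_vlift[OF s s e(1), of a c] frame_at[of "Inr a"] frame_at[of "Inr c"] by (simp add: torV_def frame_section_def)
qed

lemma g_sum_frame: "g e (\<Sum>\<theta>\<in>UNIV. c \<theta> *\<^sub>R Fr (h \<theta>)) (Fr k) = (\<Sum>\<theta>\<in>UNIV. c \<theta> * g e (Fr (h \<theta>)) (Fr k))" for h :: "'k::finite \<Rightarrow> 'p + 'r"
  using lin_on_sum[OF g_lin(1)[OF e(1) Fr_in] gtb_subspace[OF e(1)], where I=UNIV and w="\<lambda>\<theta>. Fr (h \<theta>)" and c=c] Fr_in by simp

lemma g_diff: "v \<in> gtb S e \<Longrightarrow> w \<in> gtb S e \<Longrightarrow> g e (v - w) (Fr k) = g e v (Fr k) - g e w (Fr k)"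
  by (rule lin_on_diff[OF g_lin(1)[OF e(1) Fr_in] gtb_subspace[OF e(1)]])

lemma g_plus: "v \<in> gtb S e \<Longrightarrow> w \<in> gtb S e \<Longrightarrow> g e (v + w) (Fr k) = g e v (Fr k) + g e w (Fr k)"
  using g_lin(1)[OF e(1) Fr_in] by (simp add: lin_on_def)

lemma g_frames: "g e (Fr (Inl \<alpha>)) (Fr (Inl \<beta>)) = g_hor S C K G e $ \<alpha> $ \<beta>" "g e (Fr (Inr a)) (Fr (Inr c)) = g_ver S C K G e $ a $ c"
  by (simp_all add: g_hor_def g_ver_def)

lemma g_frames_sym:
  assumes "e' \<in> totalE S" "fst e' \<in> nbhd K"
  shows "g e' (adapted_frame S C K e' i) (adapted_frame S C K e' j) = g e' (adapted_frame S C K e' j) (adapted_frame S C K e' i)"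
  by (rule g_sym[OF assms(1) adapted_in[OF K assms] adapted_in[OF K assms]])

text \<open>Paired with the frame, the derivatives of \<open>D0\<close> contained in \<open>Q\<close> and in the
  torsion cancel against \<open>Nab\<close>, and the derivatives of the components of the metric and
  the structure functions remain. The vertical case is the same without structure functions.\<close>

lemma H_hor_component:
  "Nab (Inl \<gamma>) (Inl \<beta>) + Phi e (Fr (Inl \<gamma>)) (Fr (Inl \<beta>)) = (\<Sum>\<alpha>\<in>UNIV. H_hor S C K G \<alpha> \<beta> \<gamma> e *\<^sub>R Fr (Inl \<alpha>))"
  (is "?v = ?w")
proof (rule g_eqI[OF e(1) K e(2)])
  note P = Phi_in[OF e(1) Fr_in Fr_in] and sub = gtb_subspace[OF e(1)]
  show "?v \<in> gtb S e" by (intro subspace_add sub Nab_in P)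
  show "?w \<in> gtb S e" by (intro subspace_sum subspace_scale sub Fr_in)
  fix k
  show "g e ?v (Fr k) = g e ?w (Fr k)"
  proof (cases k)
    case (Inr c)
    have "?v \<in> horizontal S C e"
      by (intro subspace_add horizontal_subspace[OF e(1)] Nab_horizontal Phi_horizontal[OF e(1) Fr_in frame_horizontal])
    moreover have "?w \<in> horizontal S C e" by (intro subspace_sum subspace_scale horizontal_subspace[OF e(1)] frame_horizontal)
    ultimately show ?thesis using g_horizontal_vertical(1)[OF e(1) _ frame_vertical] Inr by simp
  next
    case (Inl \<epsilon>)
    let ?L = "\<lambda>\<theta> \<mu> \<nu>. struct_fun S K \<theta> \<mu> \<nu> (fst e)" and ?g = "\<lambda>\<mu> \<nu> e. g_hor S C K G e $ \<mu> $ \<nu>"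
    let ?D = "\<lambda>\<mu>. adapted_deriv S C K (Inl \<mu>)"
    define \<kappa> where "\<kappa> \<epsilon> = ?D \<gamma> (?g \<epsilon> \<beta>) e + ?D \<beta> (?g \<epsilon> \<gamma>) e - ?D \<epsilon> (?g \<beta> \<gamma>) e
            + (\<Sum>\<theta>\<in>UNIV. ?g \<theta> \<epsilon> e * ?L \<theta> \<gamma> \<beta>) - (\<Sum>\<theta>\<in>UNIV. ?g \<beta> \<theta> e * ?L \<theta> \<gamma> \<epsilon>)
            - (\<Sum>\<theta>\<in>UNIV. ?g \<theta> \<gamma> e * ?L \<theta> \<beta> \<epsilon>)" for \<epsilon>
    note m = metric_coords[OF K e]
    have q: "Q e (Fr (Inl \<mu>)) (Fr (Inl \<nu>)) (Fr (Inl \<rho>)) = ?D \<mu> (?g \<rho> \<nu>) e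
        - g e (Nab (Inl \<mu>) (Inl \<nu>)) (Fr (Inl \<rho>)) - g e (Nab (Inl \<mu>) (Inl \<rho>)) (Fr (Inl \<nu>))" for \<mu> \<nu> \<rho>
      by (rule Q_frame) (simp add: g_hor_def g_frames_sym)
    have t: "g e (tor e (Fr (Inl \<mu>)) (Fr (Inl \<nu>))) (Fr (Inl \<rho>)) = g e (Nab (Inl \<mu>) (Inl \<nu>)) (Fr (Inl \<rho>))
        - g e (Nab (Inl \<nu>) (Inl \<mu>)) (Fr (Inl \<rho>)) - (\<Sum>\<theta>\<in>UNIV. ?L \<theta> \<mu> \<nu> * ?g \<theta> \<rho> e)" for \<mu> \<nu> \<rho>
      unfolding tor_frame
      by (simp add: g_diff g_sum_frame g_frames Nab_in Fr_in subspace_diff[OF sub] subspace_sum[OF sub] subspace_scale[OF sub])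
    have "2 * g e ?v (Fr k) = 2 * g e (Nab (Inl \<gamma>) (Inl \<beta>)) (Fr k) + koszul e (Fr (Inl \<gamma>)) (Fr (Inl \<beta>)) (Fr (Inl \<epsilon>))"
      using g_Phi[OF e(1) Fr_in Fr_in Fr_in, of "Inl \<gamma>" "Inl \<beta>" k] g_plus[OF Nab_in P] diff_form_frame(1) Inl by simp
    also have "\<dots> = \<kappa> \<epsilon>"
      unfolding koszul_def q t \<kappa>_def Inl
      by (simp add: m(1)[of \<beta>] mult.commute)
    finally have v: "2 * g e ?v (Fr k) = \<kappa> \<epsilon>" .
    have "g e ?w (Fr k) = (\<Sum>\<alpha>\<in>UNIV. H_hor S C K G \<alpha> \<beta> \<gamma> e * g_hor S C K G e $ \<alpha> $ \<epsilon>)"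
      by (simp add: Inl g_sum_frame g_frames)
    also have "\<dots> = 1 / 2 * (\<Sum>\<alpha>\<in>UNIV. (\<Sum>\<epsilon>\<in>UNIV. matrix_inv (g_hor S C K G e) $ \<alpha> $ \<epsilon> * \<kappa> \<epsilon>) * g_hor S C K G e $ \<alpha> $ \<epsilon>)"
      unfolding sum_distrib_left by (simp add: H_hor_def Let_def \<kappa>_def)
    also have "\<dots> = 1 / 2 * \<kappa> \<epsilon>" unfolding pair_raised[OF m(3) m(1)] ..
    finally show ?thesis using v by simp
  qed
qed

lemma V_ver_component:
  "Nab (Inr c) (Inr b') + Phi e (Fr (Inr c)) (Fr (Inr b')) = (\<Sum>a\<in>UNIV. V_ver S C K G a b' c e *\<^sub>R Fr (Inr a))"
  (is "?v = ?w")
proof (rule g_eqI[OF e(1) K e(2)])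
  note P = Phi_in[OF e(1) Fr_in Fr_in] and sub = gtb_subspace[OF e(1)]
  show "?v \<in> gtb S e" by (intro subspace_add sub Nab_in P)
  show "?w \<in> gtb S e" by (intro subspace_sum subspace_scale sub Fr_in)
  fix k
  show "g e ?v (Fr k) = g e ?w (Fr k)"
  proof (cases k)
    case (Inl \<alpha>)
    have "?v \<in> vertical S e"
      by (intro subspace_add vertical_subspace[OF e(1)] Nab_vertical Phi_vertical[OF e(1) Fr_in frame_vertical])
    moreover have "?w \<in> vertical S e" by (intro subspace_sum subspace_scale vertical_subspace[OF e(1)] frame_vertical)
    ultimately show ?thesis using g_horizontal_vertical(2)[OF e(1) frame_horizontal] Inl by simp
  next
    case (Inr d)
    let ?g = "\<lambda>a b e. g_ver S C K G e $ a $ b" and ?D = "\<lambda>a. adapted_deriv S C K (Inr a)"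
    define \<kappa> where "\<kappa> d = ?D c (?g d b') e + ?D b' (?g d c) e - ?D d (?g b' c) e" for d
    note m = metric_coords[OF K e]
    have q: "Q e (Fr (Inr x)) (Fr (Inr y)) (Fr (Inr z)) = ?D x (?g z y) e
        - g e (Nab (Inr x) (Inr y)) (Fr (Inr z)) - g e (Nab (Inr x) (Inr z)) (Fr (Inr y))" for x y z
      by (rule Q_frame) (simp add: g_ver_def g_frames_sym)
    have t: "g e (tor e (Fr (Inr x)) (Fr (Inr y))) (Fr (Inr z)) = g e (Nab (Inr x) (Inr y)) (Fr (Inr z))
        - g e (Nab (Inr y) (Inr x)) (Fr (Inr z))" for x y z
      unfolding tor_frame by (rule g_diff[OF Nab_in Nab_in])
    have "2 * g e ?v (Fr k) = 2 * g e (Nab (Inr c) (Inr b')) (Fr k) + koszul e (Fr (Inr c)) (Fr (Inr b')) (Fr (Inr d))"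
      using g_Phi[OF e(1) Fr_in Fr_in Fr_in, of "Inr c" "Inr b'" k] g_plus[OF Nab_in P] diff_form_frame(2) Inr by simp
    also have "\<dots> = \<kappa> d" unfolding koszul_def q t \<kappa>_def Inr by simp
    finally have v: "2 * g e ?v (Fr k) = \<kappa> d" .
    have "g e ?w (Fr k) = (\<Sum>a\<in>UNIV. V_ver S C K G a b' c e * g_ver S C K G e $ a $ d)"
      by (simp add: Inr g_sum_frame g_frames)
    also have "\<dots> = 1 / 2 * (\<Sum>a\<in>UNIV. (\<Sum>d\<in>UNIV. matrix_inv (g_ver S C K G e) $ a $ d * \<kappa> d) * g_ver S C K G e $ a $ d)"
      unfolding sum_distrib_left by (simp add: V_ver_def Let_def \<kappa>_def)
    also have "\<dots> = 1 / 2 * \<kappa> d" unfolding pair_raised[OF m(4) m(2)] ..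
    finally show ?thesis using v by simp
  qed
qed

text \<open>In the mixed blocks \<open>Phi\<close> contributes half the metric derivative, written with the
  coefficients of \<open>D0\<close>.\<close>

lemma H_ver_component:
  assumes N: "\<And>c. Nab (Inl \<gamma>) (Inr c) = (\<Sum>a\<in>UNIV. Hv0 a c \<gamma> e *\<^sub>R Fr (Inr a))"
  shows "Nab (Inl \<gamma>) (Inr b') + Phi e (Fr (Inl \<gamma>)) (Fr (Inr b')) = (\<Sum>a\<in>UNIV. H_ver S C K G Hv0 a b' \<gamma> e *\<^sub>R Fr (Inr a))"
  (is "?v = ?w")
proof (rule g_eqI[OF e(1) K e(2)])
  note P = Phi_in[OF e(1) Fr_in Fr_in] and sub = gtb_subspace[OF e(1)]
  show "?v \<in> gtb S e" by (intro subspace_add sub Nab_in P)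
  show "?w \<in> gtb S e" by (intro subspace_sum subspace_scale sub Fr_in)
  fix k
  show "g e ?v (Fr k) = g e ?w (Fr k)"
  proof (cases k)
    case (Inl \<alpha>)
    have "?v \<in> vertical S e"
      by (intro subspace_add vertical_subspace[OF e(1)] Nab_vertical Phi_vertical[OF e(1) Fr_in frame_vertical])
    moreover have "?w \<in> vertical S e" by (intro subspace_sum subspace_scale vertical_subspace[OF e(1)] frame_vertical)
    ultimately show ?thesis using g_horizontal_vertical(2)[OF e(1) frame_horizontal] Inl by simp
  next
    case (Inr d)
    let ?g = "\<lambda>a b e. g_ver S C K G e $ a $ b"
    define \<kappa> where "\<kappa> c = adapted_deriv S C K (Inl \<gamma>) (?g b' c) e
                 - (\<Sum>d\<in>UNIV. Hv0 d b' \<gamma> e * ?g d c e) - (\<Sum>d\<in>UNIV. Hv0 d c \<gamma> e * ?g b' d e)" for c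
    note m = metric_coords[OF K e]
    have n: "g e (Nab (Inl \<gamma>) (Inr x)) (Fr (Inr y)) = (\<Sum>a\<in>UNIV. Hv0 a x \<gamma> e * ?g a y e)" for x y
      unfolding N by (simp add: g_sum_frame g_frames)
    have "Q e (Fr (Inl \<gamma>)) (Fr (Inr b')) (Fr (Inr d)) = adapted_deriv S C K (Inl \<gamma>) (?g b' d) e
        - g e (Nab (Inl \<gamma>) (Inr b')) (Fr (Inr d)) - g e (Nab (Inl \<gamma>) (Inr d)) (Fr (Inr b'))"
      by (rule Q_frame) (simp add: g_ver_def)
    then have q: "Q e (Fr (Inl \<gamma>)) (Fr (Inr b')) (Fr (Inr d)) = \<kappa> d"
      unfolding n \<kappa>_def by (simp add: m(2)[of b'])
    have v: "g e ?v (Fr k) = (\<Sum>a\<in>UNIV. Hv0 a b' \<gamma> e * ?g a d e) + 1 / 2 * \<kappa> d"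
      using g_Phi[OF e(1) Fr_in Fr_in Fr_in, of "Inl \<gamma>" "Inr b'" k] g_plus[OF Nab_in P] diff_form_frame(3) Inr n[of b' d] q by simp
    have "g e ?w (Fr k) = (\<Sum>a\<in>UNIV. H_ver S C K G Hv0 a b' \<gamma> e * ?g a d e)"
      by (simp add: Inr g_sum_frame g_frames)
    also have "\<dots> = (\<Sum>a\<in>UNIV. Hv0 a b' \<gamma> e * ?g a d e)
        + 1 / 2 * (\<Sum>a\<in>UNIV. (\<Sum>c\<in>UNIV. matrix_inv (g_ver S C K G e) $ a $ c * \<kappa> c) * g_ver S C K G e $ a $ d)"
      unfolding sum_distrib_left by (simp add: H_ver_def Let_def \<kappa>_def distrib_right sum.distrib)
    also have "\<dots> = (\<Sum>a\<in>UNIV. Hv0 a b' \<gamma> e * ?g a d e) + 1 / 2 * \<kappa> d" unfolding pair_raised[OF m(4) m(2)] ..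
    finally show ?thesis using v by simp
  qed
qed

lemma V_hor_component:
  assumes N: "\<And>\<beta>. Nab (Inr c) (Inl \<beta>) = (\<Sum>\<alpha>\<in>UNIV. Vh0 \<alpha> \<beta> c e *\<^sub>R Fr (Inl \<alpha>))"
  shows "Nab (Inr c) (Inl \<beta>) + Phi e (Fr (Inr c)) (Fr (Inl \<beta>)) = (\<Sum>\<alpha>\<in>UNIV. V_hor S C K G Vh0 \<alpha> \<beta> c e *\<^sub>R Fr (Inl \<alpha>))"
  (is "?v = ?w")
proof (rule g_eqI[OF e(1) K e(2)])
  note P = Phi_in[OF e(1) Fr_in Fr_in] and sub = gtb_subspace[OF e(1)]
  show "?v \<in> gtb S e" by (intro subspace_add sub Nab_in P)
  show "?w \<in> gtb S e" by (intro subspace_sum subspace_scale sub Fr_in)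
  fix k
  show "g e ?v (Fr k) = g e ?w (Fr k)"
  proof (cases k)
    case (Inr a)
    have "?v \<in> horizontal S C e"
      by (intro subspace_add horizontal_subspace[OF e(1)] Nab_horizontal Phi_horizontal[OF e(1) Fr_in frame_horizontal])
    moreover have "?w \<in> horizontal S C e" by (intro subspace_sum subspace_scale horizontal_subspace[OF e(1)] frame_horizontal)
    ultimately show ?thesis using g_horizontal_vertical(1)[OF e(1) _ frame_vertical] Inr by simp
  next
    case (Inl \<epsilon>)
    let ?g = "\<lambda>\<mu> \<nu> e. g_hor S C K G e $ \<mu> $ \<nu>"
    define \<kappa> where "\<kappa> \<epsilon> = adapted_deriv S C K (Inr c) (?g \<beta> \<epsilon>) e
                 - (\<Sum>\<theta>\<in>UNIV. Vh0 \<theta> \<beta> c e * ?g \<theta> \<epsilon> e) - (\<Sum>\<theta>\<in>UNIV. Vh0 \<theta> \<epsilon> c e * ?g \<beta> \<theta> e)" for \<epsilon>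
    note m = metric_coords[OF K e]
    have n: "g e (Nab (Inr c) (Inl \<mu>)) (Fr (Inl \<nu>)) = (\<Sum>\<theta>\<in>UNIV. Vh0 \<theta> \<mu> c e * ?g \<theta> \<nu> e)" for \<mu> \<nu>
      unfolding N by (simp add: g_sum_frame g_frames)
    have "Q e (Fr (Inr c)) (Fr (Inl \<beta>)) (Fr (Inl \<epsilon>)) = adapted_deriv S C K (Inr c) (?g \<beta> \<epsilon>) e
        - g e (Nab (Inr c) (Inl \<beta>)) (Fr (Inl \<epsilon>)) - g e (Nab (Inr c) (Inl \<epsilon>)) (Fr (Inl \<beta>))"
      by (rule Q_frame) (simp add: g_hor_def)
    then have q: "Q e (Fr (Inr c)) (Fr (Inl \<beta>)) (Fr (Inl \<epsilon>)) = \<kappa> \<epsilon>"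
      unfolding n \<kappa>_def by (simp add: m(1)[of \<beta>])
    have v: "g e ?v (Fr k) = (\<Sum>\<theta>\<in>UNIV. Vh0 \<theta> \<beta> c e * ?g \<theta> \<epsilon> e) + 1 / 2 * \<kappa> \<epsilon>"
      using g_Phi[OF e(1) Fr_in Fr_in Fr_in, of "Inr c" "Inl \<beta>" k] g_plus[OF Nab_in P] diff_form_frame(4) Inl n[of \<beta> \<epsilon>] q by simp
    have "g e ?w (Fr k) = (\<Sum>\<alpha>\<in>UNIV. V_hor S C K G Vh0 \<alpha> \<beta> c e * ?g \<alpha> \<epsilon> e)"
      by (simp add: Inl g_sum_frame g_frames)
    also have "\<dots> = (\<Sum>\<theta>\<in>UNIV. Vh0 \<theta> \<beta> c e * ?g \<theta> \<epsilon> e)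
        + 1 / 2 * (\<Sum>\<alpha>\<in>UNIV. (\<Sum>\<epsilon>\<in>UNIV. matrix_inv (g_hor S C K G e) $ \<alpha> $ \<epsilon> * \<kappa> \<epsilon>) * g_hor S C K G e $ \<alpha> $ \<epsilon>)"
      unfolding sum_distrib_left by (simp add: V_hor_def Let_def \<kappa>_def distrib_right sum.distrib)
    also have "\<dots> = (\<Sum>\<theta>\<in>UNIV. Vh0 \<theta> \<beta> c e * ?g \<theta> \<epsilon> e) + 1 / 2 * \<kappa> \<epsilon>" unfolding pair_raised[OF m(3) m(1)] ..
    finally show ?thesis using v by simp
  qed
qed

end

lemma Dm_components:
  assumes K: "local_coords S K" and c0: "components_in S C K D0 Hh0 Hv0 Vh0 Vv0"
  shows "components_in S C K Dm (H_hor S C K G) (H_ver S C K G Hv0) (V_hor S C K G Vh0) (V_ver S C K G)"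
  unfolding components_in_def Let_def
proof (intro ballI impI)
  fix e assume e: "e \<in> totalE S" "fst e \<in> nbhd K"
  obtain b where b: "bump_at (atlasM S) (nbhd K) (fst e) b" by (rule E.ex_bump[OF local_coords_open[OF K] e(2)])
  note sub = gtb_subspace[OF e(1)] and F = adapted_in[OF K e]
  note c = bspec[OF c0[unfolded components_in_def Let_def] e(1), rule_format, OF e(2)]
  have Hv: "nab (frame_section K b (Inl \<gamma>)) (frame_section K b (Inr b')) e = (\<Sum>a\<in>UNIV. Hv0 a b' \<gamma> e *\<^sub>R adapted_frame S C K e (Inr a))" for b' \<gamma>
    by (rule local_cov_given[OF K b e]) (use c in \<open>blast intro: subspace_sum subspace_scale sub F\<close>)+
  have Vh: "nab (frame_section K b (Inr d)) (frame_section K b (Inl \<beta>)) e = (\<Sum>\<alpha>\<in>UNIV. Vh0 \<alpha> \<beta> d e *\<^sub>R adapted_frame S C K e (Inl \<alpha>))" for \<beta> d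
    by (rule local_cov_given[OF K b e]) (use c in \<open>blast intro: subspace_sum subspace_scale sub F\<close>)+
  note lc = local_cov_metrical[OF K b e]
  show "(\<forall>\<beta> \<gamma>. local_cov S Dm (\<lambda>e. adapted_frame S C K e (Inl \<gamma>)) (\<lambda>e. adapted_frame S C K e (Inl \<beta>)) e
          (\<Sum>\<alpha>\<in>UNIV. H_hor S C K G \<alpha> \<beta> \<gamma> e *\<^sub>R adapted_frame S C K e (Inl \<alpha>))) \<and>
        (\<forall>b \<gamma>. local_cov S Dm (\<lambda>e. adapted_frame S C K e (Inl \<gamma>)) (\<lambda>e. adapted_frame S C K e (Inr b)) e
          (\<Sum>a\<in>UNIV. H_ver S C K G Hv0 a b \<gamma> e *\<^sub>R adapted_frame S C K e (Inr a))) \<and>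
        (\<forall>\<beta> c. local_cov S Dm (\<lambda>e. adapted_frame S C K e (Inr c)) (\<lambda>e. adapted_frame S C K e (Inl \<beta>)) e
          (\<Sum>\<alpha>\<in>UNIV. V_hor S C K G Vh0 \<alpha> \<beta> c e *\<^sub>R adapted_frame S C K e (Inl \<alpha>))) \<and>
        (\<forall>b c. local_cov S Dm (\<lambda>e. adapted_frame S C K e (Inr c)) (\<lambda>e. adapted_frame S C K e (Inr b)) e
          (\<Sum>a\<in>UNIV. V_ver S C K G a b c e *\<^sub>R adapted_frame S C K e (Inr a)))"
    by (intro conjI allI lc H_hor_component[OF K e b] V_ver_component[OF K e b] H_ver_component[where ?Hv0.0=Hv0, OF K e b Hv] V_hor_component[where ?Vh0.0=Vh0, OF K e b Vh])
qed

end

theorem theorem5p1: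
  fixes S :: "('m::{t2_space,second_countable_topology}, 'n::{t2_space,second_countable_topology},
               'f::real_vector, 'b::real_vector, 'i::finite, 'p::finite, 'r::finite) gla_data"
    and C :: "('m, 'f, 'b) gconn"
    and D0 :: "('m, 'f, 'b) cov_deriv"
    and G :: "('m, 'f, 'b) tensor"
  assumes "generalized_Lie_algebroid S"
    and "vector_bundle (atlasM S) (bundleE S)"
    and "gconnection S C"
    and "distinguished_connection S C D0"
    and "pseudometrical S C G"
  shows "\<exists>D. distinguished_connection S C D \<and>
           (\<forall>K Hh0 Hv0 Vh0 Vv0. local_coords S K \<and> components_in S C K D0 Hh0 Hv0 Vh0 Vv0 \<longrightarrow>
              components_in S C K D (H_hor S C K G) (H_ver S C K G Hv0)
                                    (V_hor S C K G Vh0) (V_ver S C K G)) \<and>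
           (\<forall>X\<in>gsections S. D X G = 0)"
proof -
  interpret metr S C D0 G
    using assms by unfold_locales
  show ?thesis
    using Dm_distinguished Dm_components Dm_metrical by blast
qed

end
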